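(* Let $1<q<2$ and let $\Omega\subset\mathbb{R}^N$ be an open set with finite measure. Set \[ \mathcal{A}(\Omega)=\Big\{(f,\phi)\in L^1_{\rm loc}(\Omega)\times L^2_{\rm loc}(\Omega;\mathbb{R}^N)\, :\, -\mathrm{div}\, \phi+f\ge 1 \mbox{ in }\Omega\Big\}. \] Then \[ \frac{1}{\lambda_1(\Omega;q)}=(q-1)^{(q-1)\frac{2}{q}}\inf_{(f,\phi)\in \mathcal{A}(\Omega)} \Big\|G_q(f,\phi)\Big\|_{L^\frac{2}{2-q}(\Omega)}^\frac{2}{q}. \] Moreover, if $w\in W^{1,2}_0(\Omega)$ denotes the unique positive solution of \[ \max_{\varphi\in W^{1,2}_0(\Omega)}\left\{\frac{2}{q}\,\int_\Omega |\varphi|^q\,dx-\int_\Omega |\nabla \varphi|^2\,dx\right\}, \] then the pair $(f_0,\phi_0)$ defined by \[ \phi_0=\frac{\nabla w}{w^{q-1}}\qquad \mbox{ and }\qquad f_0=-(q-1)\,\frac{|\nabla w|^2}{w^{q}} \] is a minimizer for the infimum \[ \inf_{(f,\phi)\in \mathcal{A}(\Omega)} \Big\|G_q(f,\phi)\Big\|_{L^\frac{2}{2-q}(\Omega)}^\frac{2}{q}. \]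
   Context: $W^{1,2}_0(\Omega)$ is the closure of $C^\infty_0(\Omega)$ in the Sobolev norm $\|\varphi\|_{L^2(\Omega)}+\|\nabla\varphi\|_{L^2(\Omega;\mathbb{R}^N)}$. For $1\le q\le 2$ and $\Omega$ open with finite measure, the generalized principal frequency is \[ \lambda_1(\Omega;q)=\min_{\varphi\in W^{1,2}_0(\Omega)\setminus\{0\}} \frac{\int_\Omega |\nabla \varphi|^2\,dx}{\left(\int_\Omega |\varphi|^q\,dx\right)^{2/q}}. \] For $1<q\le 2$, the function $G_q:\mathbb{R}\times\mathbb{R}^N\to[0,+\infty]$ is defined by $G_q(s,\xi)=\dfrac{|\xi|^q}{|s|^{q-1}}$ if $s<0$ and $\xi\in\mathbb{R}^N$; $G_q(0,0)=0$; and $G_q(s,\xi)=+\infty$ otherwise. The norm $\|G_q(f,\phi)\|_{L^{2/(2-q)}(\Omega)}$ may take the value $+\infty$. The condition $-\mathrm{div}\,\phi+f\ge 1$ in $\Omega$ is understood in the distributional sense: \[ \int_\Omega \big[\langle \nabla \psi,\phi\rangle+f\,\psi\big]\,dx\ge \int_\Omega \psi\,dx\qquad \mbox{for every } \psi\in C^1_0(\Omega) \mbox{ with } \psi\ge 0, \] where $C^1_0(\Omega)$ denotes the $C^1$ functions with compact support in $\Omega$. *)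

theory Defs
  imports "HOL-Analysis.Analysis"
begin

section \<open>Lebesgue spaces\<close>

text \<open>Powers with positive real exponent on \<open>[0,\<infinity>]\<close>, with \<open>\<infinity>\<close> raised to \<open>p\<close> equal to \<open>\<infinity>\<close>.\<close>

definition ennpowr :: "ennreal \<Rightarrow> real \<Rightarrow> ennreal" where
  "ennpowr x p = (if x = \<infinity> then \<infinity> else ennreal (enn2real x powr p))"

definition eLp_norm :: "'a measure \<Rightarrow> real \<Rightarrow> ('a \<Rightarrow> ennreal) \<Rightarrow> ennreal" where
  "eLp_norm M p F = ennpowr (\<integral>\<^sup>+ x. ennpowr (F x) p \<partial>M) (1 / p)"

definition Lp_space ::
    "'a::euclidean_space set \<Rightarrow> real \<Rightarrow> ('a \<Rightarrow> 'b::euclidean_space) set" where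
  "Lp_space \<Omega> p = {u. u \<in> borel_measurable (lebesgue_on \<Omega>) \<and>
     eLp_norm (lebesgue_on \<Omega>) p (\<lambda>x. ennreal (norm (u x))) < \<infinity>}"

definition Lp_loc ::
    "'a::euclidean_space set \<Rightarrow> real \<Rightarrow> ('a \<Rightarrow> 'b::euclidean_space) set" where
  "Lp_loc \<Omega> p = {u. u \<in> borel_measurable (lebesgue_on \<Omega>) \<and>
     (\<forall>K. compact K \<and> K \<subseteq> \<Omega> \<longrightarrow> u \<in> Lp_space K p)}"

section \<open>Test functions\<close>

definition grad :: "('a::euclidean_space \<Rightarrow> real) \<Rightarrow> 'a \<Rightarrow> 'a" where
  "grad \<psi> x = (\<Sum>i\<in>Basis. frechet_derivative \<psi> (at x) i *\<^sub>R i)"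

primrec Ck :: "nat \<Rightarrow> ('a::euclidean_space \<Rightarrow> real) \<Rightarrow> bool" where
  "Ck 0 \<psi> \<longleftrightarrow> continuous_on UNIV \<psi>"
| "Ck (Suc k) \<psi> \<longleftrightarrow> (\<forall>x. \<psi> differentiable at x) \<and>
     (\<forall>i\<in>Basis. Ck k (\<lambda>x. frechet_derivative \<psi> (at x) i))"

text \<open>Functions with compact support in \<open>\<Omega>\<close> are identified with their extensions by zero to the
  whole space.\<close>

definition compact_support_in :: "'a::euclidean_space set \<Rightarrow> ('a \<Rightarrow> real) \<Rightarrow> bool" where
  "compact_support_in \<Omega> \<psi> \<longleftrightarrow>
     compact (closure {x. \<psi> x \<noteq> 0}) \<and> closure {x. \<psi> x \<noteq> 0} \<subseteq> \<Omega>"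

definition C1_0 :: "'a::euclidean_space set \<Rightarrow> ('a \<Rightarrow> real) set" where
  "C1_0 \<Omega> = {\<psi>. Ck 1 \<psi> \<and> compact_support_in \<Omega> \<psi>}"

definition Cinf_0 :: "'a::euclidean_space set \<Rightarrow> ('a \<Rightarrow> real) set" where
  "Cinf_0 \<Omega> = {\<psi>. (\<forall>k. Ck k \<psi>) \<and> compact_support_in \<Omega> \<psi>}"

section \<open>The Sobolev space and the principal frequency\<close>

definition is_weak_gradient ::
    "'a::euclidean_space set \<Rightarrow> ('a \<Rightarrow> real) \<Rightarrow> ('a \<Rightarrow> 'a) \<Rightarrow> bool" where
  "is_weak_gradient \<Omega> u g \<longleftrightarrow> u \<in> Lp_loc \<Omega> 1 \<and> g \<in> Lp_loc \<Omega> 1 \<and>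
     (\<forall>\<psi>\<in>Cinf_0 \<Omega>. (LINT x|lebesgue_on \<Omega>. u x *\<^sub>R grad \<psi> x)
        = - (LINT x|lebesgue_on \<Omega>. \<psi> x *\<^sub>R g x))"

text \<open>A representative of the weak gradient, which is unique only up to null sets.\<close>

definition weak_gradient :: "'a::euclidean_space set \<Rightarrow> ('a \<Rightarrow> real) \<Rightarrow> 'a \<Rightarrow> 'a" where
  "weak_gradient \<Omega> u = (SOME g. is_weak_gradient \<Omega> u g)"

definition W12 :: "'a::euclidean_space set \<Rightarrow> ('a \<Rightarrow> real) set" where
  "W12 \<Omega> = {u. u \<in> Lp_space \<Omega> 2 \<and> (\<exists>g. is_weak_gradient \<Omega> u g) \<and>
     weak_gradient \<Omega> u \<in> Lp_space \<Omega> 2}"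

text \<open>Elements are functions rather than classes modulo almost everywhere equality, and their
  values outside \<open>\<Omega>\<close> are irrelevant.\<close>

definition W12_0 :: "'a::euclidean_space set \<Rightarrow> ('a \<Rightarrow> real) set" where
  "W12_0 \<Omega> = {u \<in> W12 \<Omega>. \<forall>\<epsilon>>0. \<exists>\<psi>\<in>Cinf_0 \<Omega>.
     eLp_norm (lebesgue_on \<Omega>) 2 (\<lambda>x. ennreal (norm (u x - \<psi> x))) +
     eLp_norm (lebesgue_on \<Omega>) 2 (\<lambda>x. ennreal (norm (weak_gradient \<Omega> u x - grad \<psi> x))) < \<epsilon>}"

text \<open>For empty \<open>\<Omega>\<close> there are no competitors and the value is \<open>\<infinity>\<close>.\<close>

definition principal_frequency :: "'a::euclidean_space set \<Rightarrow> real \<Rightarrow> ennreal" where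
  "principal_frequency \<Omega> q =
     (INF \<phi>\<in>{\<phi> \<in> W12_0 \<Omega>. \<not> (AE x in lebesgue_on \<Omega>. \<phi> x = 0)}.
        (\<integral>\<^sup>+ x. ennreal ((norm (weak_gradient \<Omega> \<phi> x))\<^sup>2) \<partial>lebesgue_on \<Omega>) /
        ennpowr (\<integral>\<^sup>+ x. ennreal (\<bar>\<phi> x\<bar> powr q) \<partial>lebesgue_on \<Omega>) (2 / q))"

definition is_positive_maximizer ::
    "'a::euclidean_space set \<Rightarrow> real \<Rightarrow> ('a \<Rightarrow> real) \<Rightarrow> bool" where
  "is_positive_maximizer \<Omega> q w \<longleftrightarrow>
     is_arg_max
       (\<lambda>\<phi>. 2 / q * (LINT x|lebesgue_on \<Omega>. \<bar>\<phi> x\<bar> powr q)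
            - (LINT x|lebesgue_on \<Omega>. (norm (weak_gradient \<Omega> \<phi> x))\<^sup>2))
       (\<lambda>\<phi>. \<phi> \<in> W12_0 \<Omega>) w \<and>
     (AE x in lebesgue_on \<Omega>. w x > 0)"

section \<open>The dual problem\<close>

definition G :: "real \<Rightarrow> real \<Rightarrow> 'a::euclidean_space \<Rightarrow> ennreal" where
  "G q s \<xi> = (if s < 0 then ennreal (norm \<xi> powr q / \<bar>s\<bar> powr (q - 1))
              else if s = 0 \<and> \<xi> = 0 then 0 else \<infinity>)"

text \<open>The inequality \<open>- div \<phi> + f \<ge> 1\<close> in the sense of distributions.\<close>

definition dist_ineq ::
    "'a::euclidean_space set \<Rightarrow> ('a \<Rightarrow> real) \<Rightarrow> ('a \<Rightarrow> 'a) \<Rightarrow> bool" where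
  "dist_ineq \<Omega> f \<phi> \<longleftrightarrow> (\<forall>\<psi>\<in>C1_0 \<Omega>. (\<forall>x. \<psi> x \<ge> 0) \<longrightarrow>
     (LINT x|lebesgue_on \<Omega>. grad \<psi> x \<bullet> \<phi> x + f x * \<psi> x) \<ge> (LINT x|lebesgue_on \<Omega>. \<psi> x))"

definition admissible ::
    "'a::euclidean_space set \<Rightarrow> (('a \<Rightarrow> real) \<times> ('a \<Rightarrow> 'a)) set" where
  "admissible \<Omega> = {(f, \<phi>). f \<in> Lp_loc \<Omega> 1 \<and> \<phi> \<in> Lp_loc \<Omega> 2 \<and> dist_ineq \<Omega> f \<phi>}"

definition dual_functional ::
    "'a::euclidean_space set \<Rightarrow> real \<Rightarrow> ('a \<Rightarrow> real) \<times> ('a \<Rightarrow> 'a) \<Rightarrow> ennreal" where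
  "dual_functional \<Omega> q = (\<lambda>(f, \<phi>).
     ennpowr (eLp_norm (lebesgue_on \<Omega>) (2 / (2 - q)) (\<lambda>x. G q (f x) (\<phi> x))) (2 / q))"

end

theory Submission
  imports Defs "HOL-Real_Asymp.Real_Asymp"
begin

text \<open>
  Write \<open>p = q - 1\<close>. Everything rests on one computation. Suppose that \<open>U > 0\<close> and
  \<open>- \<Delta> U = U\<^sup>p\<close>, and put \<open>\<phi> = \<nabla>U / U\<^sup>p\<close> and \<open>f = - p |\<nabla>U|\<^sup>2 / U\<^sup>q\<close>. By the quotient rule
  \<open>- div \<phi> + f = 1\<close>, and \<open>G\<^sub>q(f, \<phi>)\<close> is the constant \<open>p\<^bsup>-p\<^esup>\<close> times \<open>|\<nabla>U|\<^bsup>2-q\<^esup>\<close>, so that the dual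
  functional of this pair, multiplied by the constant of the theorem, is a power of the Dirichlet
  energy: it equals \<open>(\<integral>|\<nabla>U|\<^sup>2)\<^bsup>(2-q)/q\<^esup>\<close>.

  \<^emph>\<open>Weak duality\<close> (\<open>weak_duality\<close>). Test the constraint of an arbitrary admissible pair with
  \<open>|\<psi>|\<^sup>q\<close>, which is of class \<open>C\<^sup>1\<close> as \<open>q > 1\<close>. Young's inequality absorbs the term with \<open>f\<close> and leaves
  \<open>\<integral>|\<psi>|\<^sup>q \<le> p\<^sup>p \<integral>|\<nabla>\<psi>|\<^sup>q G\<^sub>q(f, \<phi>)\<close>; Hoelder's inequality with exponents \<open>2/q\<close> and \<open>2/(2-q)\<close>
  then bounds the Rayleigh quotient from below. Density of the test functions gives \<open>1/\<lambda>\<^sub>1\<close> as a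
  lower bound of the dual problem.

  \<^emph>\<open>No gap\<close> (\<open>no_duality_gap\<close>). For \<open>\<delta> > 0\<close> the regularised equation \<open>- \<Delta> u = (u + \<delta>)\<^sup>p\<close> has a solution
  \<open>u \<ge> 0\<close> with zero trace, obtained by monotone iteration from zero
  (\<open>regularised_solution_exists\<close>). The iterates increase by the weak maximum principle and are
  bounded because the right-hand side grows sublinearly, and an increasing bounded sequence of
  nonnegative functions converges in \<open>L\<^sup>2\<close>. The computation above applies to \<open>U = u + \<delta>\<close>. Testing
  the equation with \<open>u\<close> shows that the energy \<open>X\<close> satisfies \<open>X \<le> \<integral>u\<^sup>q + O(\<delta>\<^sup>p)\<surd>X\<close>, where
  \<open>\<integral>u\<^sup>q\<close> is controlled by \<open>X\<close> through \<open>\<lambda>\<^sub>1\<close>. As \<open>\<delta>\<close> tends to zero the values of these pairs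
  therefore come down to \<open>1/\<lambda>\<^sub>1\<close>.

  \<^emph>\<open>The maximiser.\<close> A positive maximiser \<open>w\<close> solves the equation with \<open>\<delta> = 0\<close>
  (\<open>maximizer_weak_solution\<close>), hence yields the pair of the theorem, and \<open>w\<close> itself is a competitor for
  \<open>\<lambda>\<^sub>1\<close>, which bounds the value of its pair by \<open>1/\<lambda>\<^sub>1\<close> (\<open>maximizer_energy\<close>).

  The quotient rule is justified for both kinds of solutions at once, in the locale
  \<open>singular_solution\<close>. The equation is tested with \<open>\<psi> (U + \<epsilon>)\<^bsup>-p\<^esup>\<close>; the choice \<open>\<psi> = \<eta>\<^sup>2\<close> bounds
  \<open>\<integral> \<eta>\<^sup>2 |\<nabla>U|\<^sup>2 (U + \<epsilon>)\<^bsup>-q\<^esup>\<close> uniformly in \<open>\<epsilon>\<close>, and this local bound makes the pair locally integrable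
  and dominates the passage to the limit \<open>\<epsilon> \<rightarrow> 0\<close>.

  The rest supplies the function spaces: completeness of \<open>L\<^sup>2\<close>, smooth bumps and mollification, the
  uniqueness of weak gradients, and the Poincare inequality on open sets of finite measure.
\<close>

section \<open>Square-integrable functions\<close>

definition square_integrable :: "'a measure \<Rightarrow> ('a \<Rightarrow> 'b::euclidean_space) \<Rightarrow> bool" where
  "square_integrable M f \<longleftrightarrow> f \<in> borel_measurable M \<and> integrable M (\<lambda>x. (norm (f x))\<^sup>2)"

abbreviation L2sq :: "'a measure \<Rightarrow> ('a \<Rightarrow> 'b::euclidean_space) \<Rightarrow> real" where
  "L2sq M f \<equiv> LINT x|M. (norm (f x))\<^sup>2"

lemma square_integrable_measurable [measurable_dest]:
  "square_integrable M f \<Longrightarrow> f \<in> borel_measurable M"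
  by (simp add: square_integrable_def)

lemma square_integrable_zero [simp]: "square_integrable M (\<lambda>x. 0)"
  by (simp add: square_integrable_def)

lemma square_integrable_bound:
  fixes f :: "'a \<Rightarrow> 'b::euclidean_space"
  assumes "f \<in> borel_measurable M" "integrable M g" "AE x in M. (norm (f x))\<^sup>2 \<le> g x"
  shows "square_integrable M f"
  unfolding square_integrable_def
proof (intro conjI)
  show "integrable M (\<lambda>x. (norm (f x))\<^sup>2)"
    using assms by (intro Bochner_Integration.integrable_bound[OF assms(2)]) auto
qed (use assms in auto)

lemma norm_add_sq_le:
  fixes a b :: "'b::real_normed_vector"
  shows "(norm (a + b))\<^sup>2 \<le> 2 * (norm a)\<^sup>2 + 2 * (norm b)\<^sup>2"
proof -
  have "(norm (a + b))\<^sup>2 \<le> (norm a + norm b)\<^sup>2"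
    by (intro power_mono norm_triangle_ineq) auto
  also have "\<dots> \<le> 2 * (norm a)\<^sup>2 + 2 * (norm b)\<^sup>2"
    using sum_squares_bound[of "norm a" "norm b"] by (simp add: power2_sum)
  finally show ?thesis .
qed

lemma square_integrable_add:
  assumes "square_integrable M f" "square_integrable M g"
  shows "square_integrable M (\<lambda>x. f x + g x)"
  using assms
  by (intro square_integrable_bound[where g = "\<lambda>x. 2 * (norm (f x))\<^sup>2 + 2 * (norm (g x))\<^sup>2"])
    (auto simp: square_integrable_def norm_add_sq_le)

lemma square_integrable_scaleR:
  assumes "square_integrable M f"
  shows "square_integrable M (\<lambda>x. c *\<^sub>R f x)"
  using assms by (auto simp: square_integrable_def power_mult_distrib)

lemma square_integrable_diff:
  assumes "square_integrable M f" "square_integrable M g"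
  shows "square_integrable M (\<lambda>x. f x - g x)"
  using square_integrable_add[OF assms(1) square_integrable_scaleR[OF assms(2), of "-1"]] by simp

lemma square_integrable_norm:
  "square_integrable M f \<Longrightarrow> square_integrable M (\<lambda>x. norm (f x))"
  by (auto simp: square_integrable_def)

lemma square_integrable_bounded_mult:
  fixes f :: "'a \<Rightarrow> 'b::euclidean_space"
  assumes "square_integrable M f" "c \<in> borel_measurable M" "AE x in M. \<bar>c x\<bar> \<le> B"
  shows "square_integrable M (\<lambda>x. c x *\<^sub>R f x)"
proof (rule square_integrable_bound)
  show "integrable M (\<lambda>x. B\<^sup>2 * (norm (f x))\<^sup>2)"
    using assms by (auto simp: square_integrable_def)
  show "AE x in M. (norm (c x *\<^sub>R f x))\<^sup>2 \<le> B\<^sup>2 * (norm (f x))\<^sup>2"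
    using assms(3)
  proof eventually_elim
    case (elim x)
    then have "\<bar>c x\<bar>\<^sup>2 \<le> B\<^sup>2" by (intro power_mono) auto
    then show ?case by (simp add: power_mult_distrib mult_right_mono)
  qed
qed (use assms in measurable)

lemma (in finite_measure) square_integrable_const: "square_integrable M (\<lambda>x. c)"
  by (simp add: square_integrable_def)

lemma integrable_inner:
  fixes f g :: "'a \<Rightarrow> 'b::euclidean_space"
  assumes "square_integrable M f" "square_integrable M g"
  shows "integrable M (\<lambda>x. f x \<bullet> g x)"
proof (rule Bochner_Integration.integrable_bound[where f = "\<lambda>x. (norm (f x))\<^sup>2 + (norm (g x))\<^sup>2"])
  show "integrable M (\<lambda>x. (norm (f x))\<^sup>2 + (norm (g x))\<^sup>2)"
    using assms by (auto simp: square_integrable_def)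
  have "\<bar>f x \<bullet> g x\<bar> \<le> (norm (f x))\<^sup>2 + (norm (g x))\<^sup>2" for x
    using Cauchy_Schwarz_ineq2[of "f x" "g x"] sum_squares_bound[of "norm (f x)" "norm (g x)"]
      zero_le_power2[of "norm (f x)"] zero_le_power2[of "norm (g x)"] by linarith
  then show "AE x in M. norm (f x \<bullet> g x) \<le> norm ((norm (f x))\<^sup>2 + (norm (g x))\<^sup>2)"
    by auto
qed (use assms in measurable)

lemma integrable_mult_square:
  fixes f g :: "'a \<Rightarrow> real"
  assumes "square_integrable M f" "square_integrable M g"
  shows "integrable M (\<lambda>x. f x * g x)"
  using integrable_inner[OF assms] by simp

lemma (in finite_measure) square_integrable_integrable:
  fixes f :: "'a \<Rightarrow> 'b::euclidean_space"
  assumes "square_integrable M f" shows "integrable M f"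
  using integrable_mult_square[OF square_integrable_norm[OF assms] square_integrable_const[of 1]] assms
  by (simp add: integrable_norm_iff square_integrable_measurable)

lemma L2sq_nonneg [simp]: "0 \<le> L2sq M f"
  by (intro integral_nonneg_AE) auto

lemma L2sq_scaleR: "L2sq M (\<lambda>x. c *\<^sub>R f x) = c\<^sup>2 * L2sq M f"
  by (simp add: power_mult_distrib)

lemma L2sq_expand:
  fixes f g :: "'a \<Rightarrow> 'b::euclidean_space"
  assumes "square_integrable M f" "square_integrable M g"
  shows "L2sq M (\<lambda>x. f x + t *\<^sub>R g x) = L2sq M f + 2 * t * (LINT x|M. f x \<bullet> g x) + t\<^sup>2 * L2sq M g"
proof -
  have eq: "(norm (f x + t *\<^sub>R g x))\<^sup>2 = (norm (f x))\<^sup>2 + 2 * t * (f x \<bullet> g x) + t\<^sup>2 * (norm (g x))\<^sup>2" for x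
    by (simp add: power2_norm_eq_inner inner_add inner_commute algebra_simps)
      (simp add: power2_eq_square)
  show ?thesis
    unfolding eq using assms integrable_inner[OF assms] by (simp add: square_integrable_def)
qed

text \<open>Besides the Cauchy--Schwarz inequality this yields all Euler--Lagrange equations below: with
  \<open>A = 0\<close> it says that a quadratic polynomial with minimum at zero has no linear term.\<close>

lemma quadratic_nonneg_discriminant:
  fixes A B C :: real
  assumes "\<And>t. 0 \<le> A + 2 * t * B + t\<^sup>2 * C"
  shows "B\<^sup>2 \<le> A * C"
proof (cases "C = 0")
  case True
  have "B = 0"
  proof (rule ccontr)
    assume "B \<noteq> 0"
    then have "2 * (- (A + 1) / (2 * B)) * B = - (A + 1)" by simp
    with assms[of "- (A + 1) / (2 * B)"] True show False by simp
  qed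
  then show ?thesis using True by simp
next
  case False
  have "C > 0"
  proof (rule ccontr)
    assume "\<not> C > 0"
    with False have "C < 0" by simp
    have 1: "0 \<le> A + t\<^sup>2 * C" for t using assms[of t] assms[of "-t"] by simp
    have "0 \<le> A" using 1[of 0] by simp
    have "(sqrt ((A + 1) / - C))\<^sup>2 = (A + 1) / - C" using \<open>0 \<le> A\<close> \<open>C < 0\<close>
      by (intro real_sqrt_pow2 divide_nonneg_pos) auto
    with 1[of "sqrt ((A + 1) / - C)"] \<open>C < 0\<close> show False by simp
  qed
  have "0 \<le> (A + 2 * (- B / C) * B + (- B / C)\<^sup>2 * C) * C"
    using assms[of "- B / C"] \<open>C > 0\<close> by simp
  also have "\<dots> = A * C - B\<^sup>2" using \<open>C > 0\<close> by (simp add: field_simps power2_eq_square)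
  finally show ?thesis by simp
qed

lemma L2_Cauchy_Schwarz:
  fixes f g :: "'a \<Rightarrow> 'b::euclidean_space"
  assumes "square_integrable M f" "square_integrable M g"
  shows "(LINT x|M. f x \<bullet> g x)\<^sup>2 \<le> L2sq M f * L2sq M g"
proof (rule quadratic_nonneg_discriminant)
  fix t :: real
  show "0 \<le> L2sq M f + 2 * t * (LINT x|M. f x \<bullet> g x) + t\<^sup>2 * L2sq M g"
    unfolding L2sq_expand[OF assms, symmetric] by simp
qed

lemma L2sq_add_le:
  fixes f g :: "'a \<Rightarrow> 'b::euclidean_space"
  assumes "square_integrable M f" "square_integrable M g"
  shows "L2sq M (\<lambda>x. f x + g x) \<le> 2 * L2sq M f + 2 * L2sq M g"
proof -
  have "L2sq M (\<lambda>x. f x + g x) \<le> (LINT x|M. 2 * (norm (f x))\<^sup>2 + 2 * (norm (g x))\<^sup>2)"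
    using assms square_integrable_add[OF assms]
    by (intro integral_mono) (auto simp: square_integrable_def norm_add_sq_le)
  also have "\<dots> = 2 * L2sq M f + 2 * L2sq M g"
    using assms by (simp add: square_integrable_def)
  finally show ?thesis .
qed

lemma L2sq_mono:
  fixes f :: "'a \<Rightarrow> 'b::euclidean_space" and g :: "'a \<Rightarrow> 'c::euclidean_space"
  assumes "square_integrable M f" "square_integrable M g" "AE x in M. norm (f x) \<le> norm (g x)"
  shows "L2sq M f \<le> L2sq M g"
  using assms by (intro integral_mono_AE) (auto simp: square_integrable_def power_mono)

lemma L2sq_minus_commute:
  fixes f g :: "'a \<Rightarrow> 'b::euclidean_space"
  shows "L2sq M (\<lambda>x. f x - g x) = L2sq M (\<lambda>x. g x - f x)"
  by (simp add: norm_minus_commute)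

lemma L2sq_diff_triangle:
  fixes f g h :: "'a \<Rightarrow> 'b::euclidean_space"
  assumes "square_integrable M f" "square_integrable M g" "square_integrable M h"
  shows "L2sq M (\<lambda>x. f x - h x) \<le> 2 * L2sq M (\<lambda>x. f x - g x) + 2 * L2sq M (\<lambda>x. g x - h x)"
  using L2sq_add_le[OF square_integrable_diff[OF assms(1,2)] square_integrable_diff[OF assms(2,3)]]
  by simp

lemma L2sq_eq_0_AE:
  assumes "square_integrable M f" "L2sq M f = 0"
  shows "AE x in M. f x = 0"
  using assms integral_nonneg_eq_0_iff_AE[of M "\<lambda>x. (norm (f x))\<^sup>2"]
  by (auto simp: square_integrable_def)

subsection \<open>Convergence and completeness\<close>

lemma L2_inner_tendsto:
  fixes f g :: "nat \<Rightarrow> 'a \<Rightarrow> 'b::euclidean_space"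
  assumes f: "\<And>n. square_integrable M (f n)" "square_integrable M f0"
    and g: "\<And>n. square_integrable M (g n)" "square_integrable M g0"
    and lim: "(\<lambda>n. L2sq M (\<lambda>x. f n x - f0 x)) \<longlonglongrightarrow> 0" "(\<lambda>n. L2sq M (\<lambda>x. g n x - g0 x)) \<longlonglongrightarrow> 0"
  shows "(\<lambda>n. LINT x|M. f n x \<bullet> g n x) \<longlonglongrightarrow> (LINT x|M. f0 x \<bullet> g0 x)"
proof -
  have null: "(\<lambda>n. LINT x|M. a n x \<bullet> b n x) \<longlonglongrightarrow> 0"
    if "\<And>n. square_integrable M (a n)" "\<And>n. square_integrable M (b n)"
      "(\<lambda>n. L2sq M (a n) * L2sq M (b n)) \<longlonglongrightarrow> 0" for a b :: "nat \<Rightarrow> 'a \<Rightarrow> 'b"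
  proof -
    have "(\<lambda>n. (LINT x|M. a n x \<bullet> b n x)\<^sup>2) \<longlonglongrightarrow> 0"
      by (rule tendsto_sandwich[OF _ _ tendsto_const that(3)])
        (auto intro!: always_eventually L2_Cauchy_Schwarz that)
    then show ?thesis by (simp add: power_tendsto_0_iff)
  qed
  have "(LINT x|M. f n x \<bullet> g n x) = (LINT x|M. f0 x \<bullet> g0 x) + (LINT x|M. (f n x - f0 x) \<bullet> (g n x - g0 x))
      + (LINT x|M. (f n x - f0 x) \<bullet> g0 x) + (LINT x|M. f0 x \<bullet> (g n x - g0 x))" for n
  proof -
    have "(LINT x|M. f n x \<bullet> g n x) = (LINT x|M. f0 x \<bullet> g0 x + (f n x - f0 x) \<bullet> (g n x - g0 x)
        + (f n x - f0 x) \<bullet> g0 x + f0 x \<bullet> (g n x - g0 x))"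
      by (intro Bochner_Integration.integral_cong) (auto simp: inner_diff_left inner_diff_right)
    also have "\<dots> = (LINT x|M. f0 x \<bullet> g0 x) + (LINT x|M. (f n x - f0 x) \<bullet> (g n x - g0 x))
      + (LINT x|M. (f n x - f0 x) \<bullet> g0 x) + (LINT x|M. f0 x \<bullet> (g n x - g0 x))"
      using f(1)[of n] f(2) g(1)[of n] g(2)
      by (simp add: integrable_inner square_integrable_diff)
    finally show ?thesis .
  qed
  moreover have "(\<lambda>n. (LINT x|M. f0 x \<bullet> g0 x) + (LINT x|M. (f n x - f0 x) \<bullet> (g n x - g0 x))
      + (LINT x|M. (f n x - f0 x) \<bullet> g0 x) + (LINT x|M. f0 x \<bullet> (g n x - g0 x)))
      \<longlonglongrightarrow> (LINT x|M. f0 x \<bullet> g0 x) + 0 + 0 + 0"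
  proof (intro tendsto_add tendsto_const null square_integrable_diff f g)
    show "(\<lambda>n. L2sq M (\<lambda>x. f n x - f0 x) * L2sq M (\<lambda>x. g n x - g0 x)) \<longlonglongrightarrow> 0"
      using tendsto_mult[OF lim] by simp
    show "(\<lambda>n. L2sq M (\<lambda>x. f n x - f0 x) * L2sq M g0) \<longlonglongrightarrow> 0"
      using tendsto_mult_right[OF lim(1), of "L2sq M g0"] by simp
    show "(\<lambda>n. L2sq M f0 * L2sq M (\<lambda>x. g n x - g0 x)) \<longlonglongrightarrow> 0"
      using tendsto_mult_left[OF lim(2), of "L2sq M f0"] by simp
  qed
  ultimately show ?thesis by simp
qed

lemma L2sq_tendsto:
  fixes f :: "nat \<Rightarrow> 'a \<Rightarrow> 'b::euclidean_space"
  assumes "\<And>n. square_integrable M (f n)" "square_integrable M f0"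
    and "(\<lambda>n. L2sq M (\<lambda>x. f n x - f0 x)) \<longlonglongrightarrow> 0"
  shows "(\<lambda>n. L2sq M (f n)) \<longlonglongrightarrow> L2sq M f0"
  using L2_inner_tendsto[OF assms(1,2) assms(1,2) assms(3,3)] by (simp add: power2_norm_eq_inner)

text \<open>The convergence of a subsequence almost everywhere is what makes Fatou's lemma and dominated
  convergence available for limits in the mean square.\<close>

lemma L2_tendsto_AE_subseq:
  fixes f :: "nat \<Rightarrow> 'a \<Rightarrow> 'b::euclidean_space"
  assumes f: "\<And>n. square_integrable M (f n)" "square_integrable M f0"
    and lim: "(\<lambda>n. L2sq M (\<lambda>x. f n x - f0 x)) \<longlonglongrightarrow> 0"
  obtains r :: "nat \<Rightarrow> nat" where "strict_mono r" "AE x in M. (\<lambda>n. f (r n) x) \<longlonglongrightarrow> f0 x"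
proof -
  have "(\<lambda>n. L2sq M (\<lambda>x. f n x - f0 x)) \<longlonglongrightarrow> 0" using lim .
  then have "\<exists>r::nat\<Rightarrow>nat. strict_mono r \<and> (AE x in M. (\<lambda>n. (norm (f (r n) x - f0 x))\<^sup>2) \<longlonglongrightarrow> 0)"
    using square_integrable_diff[OF f] unfolding square_integrable_def
    by (intro tendsto_L1_AE_subseq) auto
  then obtain r :: "nat \<Rightarrow> nat" where r: "strict_mono r" "AE x in M. (\<lambda>n. (norm (f (r n) x - f0 x))\<^sup>2) \<longlonglongrightarrow> 0"
    by blast
  have "AE x in M. (\<lambda>n. f (r n) x) \<longlonglongrightarrow> f0 x"
    using r(2)
  proof eventually_elim
    case (elim x)
    then have "(\<lambda>n. norm (f (r n) x - f0 x)) \<longlonglongrightarrow> 0" by (simp add: power_tendsto_0_iff)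
    then show ?case by (simp add: tendsto_norm_zero_iff LIM_zero_iff)
  qed
  with r(1) show ?thesis using that by blast
qed

definition L2_Cauchy :: "'a measure \<Rightarrow> (nat \<Rightarrow> 'a \<Rightarrow> 'b::euclidean_space) \<Rightarrow> bool" where
  "L2_Cauchy M f \<longleftrightarrow> (\<forall>e>0. \<exists>N. \<forall>i\<ge>N. \<forall>j\<ge>N. L2sq M (\<lambda>x. f i x - f j x) \<le> e)"

lemma L2_CauchyD:
  "L2_Cauchy M f \<Longrightarrow> e > 0 \<Longrightarrow> \<exists>N. \<forall>i\<ge>N. \<forall>j\<ge>N. L2sq M (\<lambda>x. f i x - f j x) \<le> e"
  by (simp add: L2_Cauchy_def)

text \<open>A Cauchy sequence in the mean square is Cauchy in \<open>L\<^sup>1\<close>, as the measure is finite, so a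
  subsequence converges almost everywhere; Fatou's lemma identifies its limit as the limit in the
  mean square.\<close>

lemma (in finite_measure) L2_complete:
  fixes f :: "nat \<Rightarrow> 'a \<Rightarrow> 'b::euclidean_space"
  assumes f: "\<And>n. square_integrable M (f n)" and C: "L2_Cauchy M f"
  shows "\<exists>f0. square_integrable M f0 \<and> (\<lambda>n. L2sq M (\<lambda>x. f n x - f0 x)) \<longlonglongrightarrow> 0"
proof -
  have f_meas[measurable]: "f n \<in> borel_measurable M" for n
    using f by (simp add: square_integrable_def)
  have L1: "\<exists>N. \<forall>i\<ge>N. \<forall>j\<ge>N. (LINT x|M. norm (f i x - f j x)) < e" if "e > 0" for e
  proof -
    define m where "m = measure M (space M) + 1"
    have m: "m > 0" by (simp add: m_def add_nonneg_pos)
    obtain N where N: "\<And>i j. i \<ge> N \<Longrightarrow> j \<ge> N \<Longrightarrow> L2sq M (\<lambda>x. f i x - f j x) \<le> e\<^sup>2 / (2 * m)"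
      using L2_CauchyD[OF C, of "e\<^sup>2 / (2 * m)"] \<open>e > 0\<close> m by auto
    have "(LINT x|M. norm (f i x - f j x)) < e" if "i \<ge> N" "j \<ge> N" for i j
    proof -
      have "(LINT x|M. norm (f i x - f j x) \<bullet> 1)\<^sup>2 \<le> L2sq M (\<lambda>x. norm (f i x - f j x)) * L2sq M (\<lambda>x. 1::real)"
        by (intro L2_Cauchy_Schwarz square_integrable_norm square_integrable_diff f square_integrable_const)
      also have "\<dots> \<le> (e\<^sup>2 / (2 * m)) * m"
        using N[OF that] m by (intro mult_mono) (auto simp: m_def)
      also have "\<dots> < e\<^sup>2" using m \<open>e > 0\<close> by simp
      finally have "(LINT x|M. norm (f i x - f j x))\<^sup>2 < e\<^sup>2" by simp
      then show ?thesis by (rule power2_less_imp_less) (use \<open>e > 0\<close> in simp)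
    qed
    then show ?thesis by blast
  qed
  have int: "integrable M (f n)" for n using f by (rule square_integrable_integrable)
  obtain r where r: "strict_mono r" "AE x in M. Cauchy (\<lambda>i. f (r i) x)"
    using cauchy_L1_AE_cauchy_subseq[OF int L1] by blast
  define f0 where "f0 = (\<lambda>x. lim (\<lambda>i. f (r i) x))"
  have f0_meas[measurable]: "f0 \<in> borel_measurable M"
    unfolding f0_def by (intro borel_measurable_lim_metric) measurable
  have conv: "AE x in M. (\<lambda>i. f (r i) x) \<longlonglongrightarrow> f0 x"
    using r(2) unfolding f0_def by eventually_elim (use Cauchy_convergent convergent_LIMSEQ_iff in blast)
  \<comment> \<open>Fatou's lemma turns the Cauchy bound into a bound for the distance to the pointwise limit.\<close>
  have fatou: "(\<integral>\<^sup>+x. ennreal ((norm (f n x - f0 x))\<^sup>2) \<partial>M) \<le> ennreal e"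
    if N: "\<And>i j. i \<ge> N \<Longrightarrow> j \<ge> N \<Longrightarrow> L2sq M (\<lambda>x. f i x - f j x) \<le> e" and "n \<ge> N" for n N e
  proof -
    have "(\<integral>\<^sup>+x. ennreal ((norm (f n x - f0 x))\<^sup>2) \<partial>M)
        = (\<integral>\<^sup>+x. liminf (\<lambda>i. ennreal ((norm (f n x - f (r i) x))\<^sup>2)) \<partial>M)"
    proof (rule nn_integral_cong_AE)
      show "AE x in M. ennreal ((norm (f n x - f0 x))\<^sup>2) = liminf (\<lambda>i. ennreal ((norm (f n x - f (r i) x))\<^sup>2))"
        using conv
      proof eventually_elim
        case (elim x)
        have "(\<lambda>i. ennreal ((norm (f n x - f (r i) x))\<^sup>2)) \<longlonglongrightarrow> ennreal ((norm (f n x - f0 x))\<^sup>2)"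
          by (intro tendsto_ennrealI tendsto_intros elim)
        then show ?case by (rule lim_imp_Liminf[OF trivial_limit_sequentially, symmetric])
      qed
    qed
    also have "\<dots> \<le> liminf (\<lambda>i. \<integral>\<^sup>+x. ennreal ((norm (f n x - f (r i) x))\<^sup>2) \<partial>M)"
      by (intro nn_integral_liminf) measurable
    also have "\<dots> \<le> liminf (\<lambda>i. ennreal e)"
    proof (rule Liminf_mono)
      show "\<forall>\<^sub>F i in sequentially. (\<integral>\<^sup>+x. ennreal ((norm (f n x - f (r i) x))\<^sup>2) \<partial>M) \<le> ennreal e"
        using eventually_ge_at_top[of N]
      proof eventually_elim
        case (elim i)
        have "r i \<ge> N" using seq_suble[OF r(1), of i] elim by simp
        have "(\<integral>\<^sup>+x. ennreal ((norm (f n x - f (r i) x))\<^sup>2) \<partial>M) = ennreal (L2sq M (\<lambda>x. f n x - f (r i) x))"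
          using square_integrable_diff[OF f[of n] f[of "r i"]]
          by (intro nn_integral_eq_integral) (auto simp: square_integrable_def)
        then show ?case using N[OF \<open>n \<ge> N\<close> \<open>r i \<ge> N\<close>] by (simp add: ennreal_leI)
      qed
    qed
    also have "\<dots> = ennreal e" by (simp add: Liminf_const)
    finally show ?thesis .
  qed
  have bound: "integrable M (\<lambda>x. (norm (f n x - f0 x))\<^sup>2) \<and> L2sq M (\<lambda>x. f n x - f0 x) \<le> e"
    if N: "\<And>i j. i \<ge> N \<Longrightarrow> j \<ge> N \<Longrightarrow> L2sq M (\<lambda>x. f i x - f j x) \<le> e" and "n \<ge> N" and e: "e > 0" for n N e
  proof -
    have *: "(\<integral>\<^sup>+x. ennreal ((norm (f n x - f0 x))\<^sup>2) \<partial>M) \<le> ennreal e"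
      using fatou[OF N \<open>n \<ge> N\<close>] by blast
    have int: "integrable M (\<lambda>x. (norm (f n x - f0 x))\<^sup>2)"
      using * by (intro integrableI_bounded) (auto simp: top_unique less_top[symmetric])
    moreover have "L2sq M (\<lambda>x. f n x - f0 x) \<le> e"
      using * nn_integral_eq_integral[OF int] e by simp
    ultimately show ?thesis by blast
  qed
  obtain N where N: "\<And>i j. i \<ge> N \<Longrightarrow> j \<ge> N \<Longrightarrow> L2sq M (\<lambda>x. f i x - f j x) \<le> 1"
    using L2_CauchyD[OF C, of 1] by auto
  have "integrable M (\<lambda>x. (norm (f N x - f0 x))\<^sup>2)" using bound[OF N, of N] by auto
  then have "square_integrable M (\<lambda>x. f N x - f0 x)"
    using f[of N] by (auto simp: square_integrable_def)
  from square_integrable_diff[OF f[of N] this] have f0: "square_integrable M f0" by simp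
  have "(\<lambda>n. L2sq M (\<lambda>x. f n x - f0 x)) \<longlonglongrightarrow> 0"
  proof (rule LIMSEQ_I)
    fix e :: real assume "e > 0"
    then obtain N where N: "\<And>i j. i \<ge> N \<Longrightarrow> j \<ge> N \<Longrightarrow> L2sq M (\<lambda>x. f i x - f j x) \<le> e / 2"
      using L2_CauchyD[OF C, of "e / 2"] by auto
    have "norm (L2sq M (\<lambda>x. f n x - f0 x) - 0) < e" if "n \<ge> N" for n
      using bound[OF N that] \<open>e > 0\<close> by simp
    then show "\<exists>N. \<forall>n\<ge>N. norm (L2sq M (\<lambda>x. f n x - f0 x) - 0) < e" by blast
  qed
  with f0 show ?thesis by blast
qed

lemma L2_Cauchy_dominated:
  fixes f :: "nat \<Rightarrow> 'a \<Rightarrow> 'b::euclidean_space"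
  assumes "L2_Cauchy M f" "\<And>i j. L2sq M (\<lambda>x. g i x - g j x) \<le> C * L2sq M (\<lambda>x. f i x - f j x)" "C \<ge> 0"
  shows "L2_Cauchy M (g :: nat \<Rightarrow> 'a \<Rightarrow> 'c::euclidean_space)"
  unfolding L2_Cauchy_def
proof (intro allI impI)
  fix e :: real assume "e > 0"
  then obtain N where N: "\<And>i j. i \<ge> N \<Longrightarrow> j \<ge> N \<Longrightarrow> L2sq M (\<lambda>x. f i x - f j x) \<le> e / (C + 1)"
    using L2_CauchyD[OF assms(1), of "e / (C + 1)"] assms(3) by auto
  have "L2sq M (\<lambda>x. g i x - g j x) \<le> e" if "i \<ge> N" "j \<ge> N" for i j
  proof -
    have "L2sq M (\<lambda>x. g i x - g j x) \<le> C * (e / (C + 1))"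
      using assms(2)[of i j] N[OF that] assms(3) by (meson mult_left_mono order_trans)
    also have "\<dots> \<le> e" using assms(3) \<open>e > 0\<close> by (simp add: field_simps)
    finally show ?thesis .
  qed
  then show "\<exists>N. \<forall>i\<ge>N. \<forall>j\<ge>N. L2sq M (\<lambda>x. g i x - g j x) \<le> e" by blast
qed

section \<open>Continuously differentiable functions\<close>

(* Unfolding Ck 1 into partial derivatives would hide the total derivative that is used below. *)
declare Ck.simps [simp del]

lemma grad_unique:
  assumes "(\<psi> has_derivative (\<lambda>h. d \<bullet> h)) (at x)"
  shows "grad \<psi> x = d"
proof -
  have "frechet_derivative \<psi> (at x) = (\<lambda>h. d \<bullet> h)"
    using frechet_derivative_at[OF assms] by simp
  then show ?thesis by (simp add: grad_def euclidean_representation)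
qed

lemma has_derivative_grad:
  fixes \<psi> :: "'a::euclidean_space \<Rightarrow> real"
  assumes "\<psi> differentiable (at x)"
  shows "(\<psi> has_derivative (\<lambda>h. grad \<psi> x \<bullet> h)) (at x)"
proof -
  have lin: "linear (frechet_derivative \<psi> (at x))"
    by (rule linear_frechet_derivative[OF assms])
  have "frechet_derivative \<psi> (at x) h = grad \<psi> x \<bullet> h" for h
  proof -
    have "frechet_derivative \<psi> (at x) h = frechet_derivative \<psi> (at x) (\<Sum>i\<in>Basis. (h \<bullet> i) *\<^sub>R i)"
      by (simp add: euclidean_representation)
    also have "\<dots> = (\<Sum>i\<in>Basis. (h \<bullet> i) * frechet_derivative \<psi> (at x) i)"
      by (simp add: linear_sum[OF lin] linear_scale[OF lin])
    also have "\<dots> = grad \<psi> x \<bullet> h"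
      unfolding grad_def inner_sum_left
      by (intro sum.cong) (auto simp: inner_commute)
    finally show ?thesis .
  qed
  then have "frechet_derivative \<psi> (at x) = (\<lambda>h. grad \<psi> x \<bullet> h)" by auto
  then show ?thesis using assms by (metis frechet_derivative_works)
qed

lemma grad_inner_Basis: "i \<in> Basis \<Longrightarrow> grad \<psi> x \<bullet> i = frechet_derivative \<psi> (at x) i"
  by (simp add: grad_def inner_sum_left inner_Basis if_distrib cong: if_cong)

lemma Ck_Suc_iff:
  fixes \<psi> :: "'a::euclidean_space \<Rightarrow> real"
  shows "Ck (Suc k) \<psi> \<longleftrightarrow> (\<forall>x. (\<psi> has_derivative (\<lambda>h. grad \<psi> x \<bullet> h)) (at x)) \<and>
    (\<forall>i\<in>Basis. Ck k (\<lambda>x. grad \<psi> x \<bullet> i))"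
proof -
  have "\<psi> differentiable (at x) \<longleftrightarrow> (\<psi> has_derivative (\<lambda>h. grad \<psi> x \<bullet> h)) (at x)" for x
    using has_derivative_grad[of \<psi> x] unfolding differentiable_def by blast
  then show ?thesis unfolding Ck.simps by (simp add: grad_inner_Basis)
qed

text \<open>Here the partial derivatives are traded for the total derivative and a continuous gradient field,
  the form in which the chain and product rules apply.\<close>

lemma Ck_1_iff:
  fixes \<psi> :: "'a::euclidean_space \<Rightarrow> real"
  shows "Ck 1 \<psi> \<longleftrightarrow> (\<forall>x. (\<psi> has_derivative (\<lambda>h. grad \<psi> x \<bullet> h)) (at x)) \<and> continuous_on UNIV (grad \<psi>)"
  unfolding One_nat_def Ck_Suc_iff Ck.simps(1) continuous_on_componentwise[of UNIV "grad \<psi>"] ..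

lemma Ck_1I:
  fixes \<psi> :: "'a::euclidean_space \<Rightarrow> real"
  assumes "\<And>x. (\<psi> has_derivative (\<lambda>h. D x \<bullet> h)) (at x)" "continuous_on UNIV D"
  shows "Ck 1 \<psi>" "grad \<psi> = D"
proof -
  show "grad \<psi> = D" using grad_unique[OF assms(1)] by auto
  then show "Ck 1 \<psi>" using assms unfolding Ck_1_iff by simp
qed

lemma Ck_1D:
  fixes \<psi> :: "'a::euclidean_space \<Rightarrow> real"
  assumes "Ck 1 \<psi>"
  shows "(\<psi> has_derivative (\<lambda>h. grad \<psi> x \<bullet> h)) (at x)" "continuous_on UNIV (grad \<psi>)"
    "continuous_on UNIV \<psi>"
proof -
  show *: "(\<psi> has_derivative (\<lambda>h. grad \<psi> x \<bullet> h)) (at x)" for x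
    using assms unfolding Ck_1_iff by blast
  show "continuous_on UNIV (grad \<psi>)" using assms unfolding Ck_1_iff by blast
  show "continuous_on UNIV \<psi>"
    using has_derivative_continuous[OF *] by (simp add: continuous_on_eq_continuous_at)
qed

lemma Ck_1_mult:
  fixes f g :: "'a::euclidean_space \<Rightarrow> real"
  assumes "Ck 1 f" "Ck 1 g"
  shows "Ck 1 (\<lambda>x. f x * g x)" "grad (\<lambda>x. f x * g x) = (\<lambda>x. g x *\<^sub>R grad f x + f x *\<^sub>R grad g x)"
proof -
  have "((\<lambda>x. f x * g x) has_derivative (\<lambda>h. (g x *\<^sub>R grad f x + f x *\<^sub>R grad g x) \<bullet> h)) (at x)" for x
    by (rule has_derivative_eq_rhs[OF has_derivative_mult[OF Ck_1D(1)[OF assms(1)] Ck_1D(1)[OF assms(2)]]])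
      (auto simp: fun_eq_iff inner_add_left)
  moreover have "continuous_on UNIV (\<lambda>x. g x *\<^sub>R grad f x + f x *\<^sub>R grad g x)"
    by (intro continuous_intros Ck_1D assms)
  ultimately show "Ck 1 (\<lambda>x. f x * g x)" "grad (\<lambda>x. f x * g x) = (\<lambda>x. g x *\<^sub>R grad f x + f x *\<^sub>R grad g x)"
    by (rule Ck_1I)+
qed

lemma Ck_1_compose:
  fixes f :: "'a::euclidean_space \<Rightarrow> real"
  assumes "Ck 1 f" "\<And>s. (h has_real_derivative h' s) (at s)" "continuous_on UNIV h'"
  shows "Ck 1 (\<lambda>x. h (f x))" "grad (\<lambda>x. h (f x)) = (\<lambda>x. h' (f x) *\<^sub>R grad f x)"
proof -
  have "((\<lambda>x. h (f x)) has_derivative (\<lambda>k. (h' (f x) *\<^sub>R grad f x) \<bullet> k)) (at x)" for x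
    using has_derivative_compose[OF Ck_1D(1)[OF assms(1), of x], of h "(*) (h' (f x))"] assms(2)[of "f x"]
    by (simp add: has_field_derivative_def)
  moreover have "continuous_on UNIV (\<lambda>x. h' (f x) *\<^sub>R grad f x)"
    by (intro continuous_on_scaleR continuous_on_compose2[OF assms(3) Ck_1D(3)[OF assms(1)]]
        Ck_1D(2) assms) auto
  ultimately show "Ck 1 (\<lambda>x. h (f x))" "grad (\<lambda>x. h (f x)) = (\<lambda>x. h' (f x) *\<^sub>R grad f x)"
    by (rule Ck_1I)+
qed

abbreviation support :: "('a::euclidean_space \<Rightarrow> real) \<Rightarrow> 'a set" where
  "support \<psi> \<equiv> closure {x. \<psi> x \<noteq> 0}"

lemma outside_support: "x \<notin> support \<psi> \<Longrightarrow> \<psi> x = 0"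
  using closure_subset[of "{x. \<psi> x \<noteq> 0}"] by blast

lemma grad_outside_support:
  assumes "x \<notin> support \<psi>"
  shows "grad \<psi> x = 0"
proof (rule grad_unique)
  have "(\<psi> has_derivative (\<lambda>h. 0)) (at x)"
  proof (rule has_derivative_transform_within_open[of "\<lambda>x. 0" _ _ _ "- support \<psi>"])
    show "open (- support \<psi>)" by (intro open_Compl closed_closure)
    show "x \<in> - support \<psi>" using assms by blast
    show "0 = \<psi> y" if "y \<in> - support \<psi>" for y using outside_support[of y \<psi>] that by simp
  qed (rule has_derivative_const)
  then show "(\<psi> has_derivative (\<lambda>h. 0 \<bullet> h)) (at x)" by simp
qed

lemma C1_0_support:
  assumes "\<psi> \<in> C1_0 \<Omega>"
  shows "compact (support \<psi>)" "support \<psi> \<subseteq> \<Omega>"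
  using assms by (auto simp: C1_0_def compact_support_in_def)

lemma C1_0I:
  fixes \<psi> :: "'a::euclidean_space \<Rightarrow> real"
  assumes "Ck 1 \<psi>" "compact K" "K \<subseteq> \<Omega>" "\<And>x. x \<notin> K \<Longrightarrow> \<psi> x = 0"
  shows "\<psi> \<in> C1_0 \<Omega>"
proof -
  have "closure {x. \<psi> x \<noteq> 0} \<subseteq> K"
    using assms by (intro closure_minimal compact_imp_closed) auto
  then show ?thesis
    using assms compact_closure bounded_subset[of K "{x. \<psi> x \<noteq> 0}"] closure_subset[of "{x. \<psi> x \<noteq> 0}"]
    by (auto simp: C1_0_def compact_support_in_def compact_imp_bounded)
qed

lemma Cinf_0I:
  fixes \<psi> :: "'a::euclidean_space \<Rightarrow> real"
  assumes "\<And>k. Ck k \<psi>" "compact K" "K \<subseteq> \<Omega>" "\<And>x. x \<notin> K \<Longrightarrow> \<psi> x = 0"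
  shows "\<psi> \<in> Cinf_0 \<Omega>"
  using C1_0I[OF assms(1)[of 1] assms(2-4)] assms(1) by (auto simp: C1_0_def Cinf_0_def)

lemma C1_0_mono: "\<Omega> \<subseteq> \<Omega>' \<Longrightarrow> C1_0 \<Omega> \<subseteq> C1_0 \<Omega>'"
  by (auto simp: C1_0_def compact_support_in_def)

lemma Cinf_0_subset_C1_0: "Cinf_0 \<Omega> \<subseteq> C1_0 \<Omega>"
  by (auto simp: C1_0_def Cinf_0_def)

lemma C1_0_Ck: "\<psi> \<in> C1_0 \<Omega> \<Longrightarrow> Ck 1 \<psi>"
  by (simp add: C1_0_def)

lemma C1_0_mult:
  assumes "f \<in> C1_0 \<Omega>" "Ck 1 g"
  shows "(\<lambda>x. f x * g x) \<in> C1_0 \<Omega>"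
proof -
  note K = C1_0_support[OF assms(1)]
  show ?thesis
    by (rule C1_0I[OF Ck_1_mult(1)[OF C1_0_Ck[OF assms(1)] assms(2)] K]) (drule outside_support, simp)
qed

lemma C1_0_compose:
  assumes "f \<in> C1_0 \<Omega>" "\<And>s. (h has_real_derivative h' s) (at s)" "continuous_on UNIV h'" "h 0 = 0"
  shows "(\<lambda>x. h (f x)) \<in> C1_0 \<Omega>"
proof -
  note K = C1_0_support[OF assms(1)]
  show ?thesis
    by (rule C1_0I[OF Ck_1_compose(1)[OF C1_0_Ck[OF assms(1)] assms(2,3)] K])
      (drule outside_support, simp add: assms(4))
qed

lemma continuous_compact_support_bounded:
  fixes f :: "'a::euclidean_space \<Rightarrow> 'b::real_normed_vector"
  assumes "continuous_on UNIV f" "compact K" "\<And>x. x \<notin> K \<Longrightarrow> f x = 0"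
  shows "\<exists>B>0. \<forall>x. norm (f x) \<le> B"
proof -
  have "bounded (f ` K)"
    using assms by (intro compact_imp_bounded compact_continuous_image) (auto intro: continuous_on_subset)
  then obtain B where "B > 0" and B: "\<forall>x\<in>K. norm (f x) \<le> B"
    by (auto simp: bounded_pos)
  moreover have "norm (f x) \<le> B" for x
    using B assms(3)[of x] \<open>B > 0\<close> by (cases "x \<in> K") auto
  ultimately show ?thesis by blast
qed

lemma continuous_compact_support_integrable:
  fixes f :: "'a::euclidean_space \<Rightarrow> 'b::euclidean_space"
  assumes "continuous_on UNIV f" "compact K" "\<And>x. x \<notin> K \<Longrightarrow> f x = 0"
  shows "integrable lborel f"
proof -
  have "integrable lborel (\<lambda>x. indicator K x *\<^sub>R f x)"
    using assms by (intro borel_integrable_compact) (auto intro: continuous_on_subset)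
  also have "(\<lambda>x. indicator K x *\<^sub>R f x) = f"
    using assms(3) by (auto simp: fun_eq_iff indicator_def)
  finally show ?thesis .
qed

lemma continuous_compact_support_uniformly_continuous:
  fixes f :: "'a::euclidean_space \<Rightarrow> 'b::real_normed_vector"
  assumes "continuous_on UNIV f" "compact K" "\<And>x. x \<notin> K \<Longrightarrow> f x = 0" "e > 0"
  shows "\<exists>d>0. \<forall>x y. norm (x - y) < d \<longrightarrow> norm (f x - f y) < e"
proof -
  obtain R where R: "\<forall>x\<in>K. norm x \<le> R"
    using compact_imp_bounded[OF assms(2)] unfolding bounded_iff by blast
  have "uniformly_continuous_on (cball 0 (R + 1)) f"
    using assms(1) by (intro compact_uniformly_continuous continuous_on_subset[OF assms(1)]) auto
  then obtain d where d: "d > 0"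
    "\<forall>x\<in>cball 0 (R+1). \<forall>y\<in>cball 0 (R+1). dist y x < d \<longrightarrow> dist (f y) (f x) < e"
    unfolding uniformly_continuous_on_def using \<open>e > 0\<close> by blast
  have "norm (f x - f y) < e" if "norm (x - y) < min d 1" for x y
  proof (cases "norm x \<le> R + 1 \<and> norm y \<le> R + 1")
    case True then show ?thesis using d(2)[rule_format, of y x] that by (simp add: dist_norm)
  next
    case False
    then have "\<not> norm x \<le> R" "\<not> norm y \<le> R"
      using that norm_triangle_ineq2[of x y] norm_triangle_ineq2[of y x] by (auto simp: norm_minus_commute)
    then have "f x = 0" "f y = 0" using R assms(3) by blast+
    then show ?thesis using \<open>e > 0\<close> by simp
  qed
  then show ?thesis using d(1) by (intro exI[of _ "min d 1"]) simp
qed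

subsection \<open>Translation invariance and integration by parts\<close>

lemma lborel_integral_translate:
  fixes f :: "'a::euclidean_space \<Rightarrow> 'b::euclidean_space"
  assumes "f \<in> borel_measurable borel"
  shows "(LINT x|lborel. f (c + x)) = (LINT x|lborel. f x)"
proof -
  have "(LINT x|lborel. f x) = (LINT x|distr lborel borel ((+) c). f x)"
    by (simp add: lborel_distr_plus)
  also have "\<dots> = (LINT x|lborel. f (c + x))"
    using assms by (intro integral_distr) auto
  finally show ?thesis by simp
qed

lemma nn_integral_lborel_translate:
  fixes f :: "'a::euclidean_space \<Rightarrow> ennreal"
  assumes "f \<in> borel_measurable borel"
  shows "(\<integral>\<^sup>+x. f (c + x) \<partial>lborel) = (\<integral>\<^sup>+x. f x \<partial>lborel)"
proof -
  have "(\<integral>\<^sup>+x. f x \<partial>lborel) = (\<integral>\<^sup>+x. f x \<partial>distr lborel borel ((+) c))"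
    by (simp add: lborel_distr_plus)
  also have "\<dots> = (\<integral>\<^sup>+x. f (c + x) \<partial>lborel)"
    using assms by (intro nn_integral_distr) auto
  finally show ?thesis by simp
qed

text \<open>A difference quotient has integral zero because Lebesgue measure is translation invariant, and
  the difference quotients of a \<open>C\<^sup>1\<close> function with compact support are dominated by a multiple of
  the indicator of a compact set.\<close>

lemma integral_grad_eq_0:
  fixes \<psi> :: "'a::euclidean_space \<Rightarrow> real"
  assumes "\<psi> \<in> C1_0 UNIV"
  shows "(LINT x|lborel. grad \<psi> x) = 0"
proof -
  define K where "K = support \<psi>"
  have K: "compact K" "\<And>x. x \<notin> K \<Longrightarrow> \<psi> x = 0" "\<And>x. x \<notin> K \<Longrightarrow> grad \<psi> x = 0"
    using C1_0_support[OF assms] outside_support[of _ \<psi>] grad_outside_support[of _ \<psi>] unfolding K_def by blast+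
  note C = Ck_1D[OF C1_0_Ck[OF assms]]
  have \<psi>_meas[measurable]: "\<psi> \<in> borel_measurable borel" and g_meas[measurable]: "grad \<psi> \<in> borel_measurable borel"
    using C by (auto intro: borel_measurable_continuous_onI)
  have int: "integrable lborel (grad \<psi>)" "integrable lborel \<psi>"
    using continuous_compact_support_integrable[OF C(2) K(1,3)]
      continuous_compact_support_integrable[OF C(3) K(1,2)] by auto
  obtain L where L: "L > 0" "\<forall>x. norm (grad \<psi> x) \<le> L"
    using continuous_compact_support_bounded[OF C(2) K(1,3)] by blast
  have lip: "\<bar>\<psi> x - \<psi> y\<bar> \<le> L * norm (x - y)" for x y
  proof -
    have "norm (\<psi> x - \<psi> y) \<le> L * norm (x - y)"
    proof (rule differentiable_bound[OF convex_UNIV, of \<psi> "\<lambda>x h. grad \<psi> x \<bullet> h"])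
      show "onorm ((\<bullet>) (grad \<psi> x)) \<le> L" for x
      proof (rule onorm_le)
        fix h
        have "norm (grad \<psi> x \<bullet> h) \<le> norm (grad \<psi> x) * norm h"
          using Cauchy_Schwarz_ineq2 by simp
        also have "\<dots> \<le> L * norm h" by (intro mult_right_mono L(2)[rule_format]) auto
        finally show "norm (grad \<psi> x \<bullet> h) \<le> L * norm h" .
      qed
    qed (use C in auto)
    then show ?thesis by simp
  qed
  have "(LINT x|lborel. grad \<psi> x \<bullet> e) = 0" for e
  proof -
    define K1 where "K1 = {x + y | x y. x \<in> K \<and> y \<in> cball 0 (norm e)}"
    have K1: "compact K1" unfolding K1_def by (intro compact_sums K compact_cball)
    have notK1: "\<psi> (x + t *\<^sub>R e) = 0" if "x \<notin> K1" "\<bar>t\<bar> \<le> 1" for x t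
    proof (rule K(2), rule notI)
      assume "x + t *\<^sub>R e \<in> K"
      moreover have "- t *\<^sub>R e \<in> cball 0 (norm e)"
        using that(2) by (simp add: mult_left_le_one_le)
      moreover have "x = (x + t *\<^sub>R e) + (- t *\<^sub>R e)" by simp
      ultimately have "x \<in> K1" unfolding K1_def by blast
      with that show False by simp
    qed
    let ?F = "\<lambda>n x. real (Suc n) * (\<psi> (x + (1 / real (Suc n)) *\<^sub>R e) - \<psi> x)"
    have "(\<lambda>n. LINT x|lborel. ?F n x) \<longlonglongrightarrow> (LINT x|lborel. grad \<psi> x \<bullet> e)"
    proof (rule integral_dominated_convergence[where w = "\<lambda>x. (L * norm e) *\<^sub>R indicator K1 x"])
      show "(\<lambda>x. grad \<psi> x \<bullet> e) \<in> borel_measurable lborel" by simp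
      show "?F n \<in> borel_measurable lborel" for n by simp
      show "integrable lborel (\<lambda>x. (L * norm e) *\<^sub>R indicat_real K1 x)"
        using emeasure_bounded_finite[OF compact_imp_bounded[OF K1]] compact_imp_closed[OF K1]
        by (intro integrable_scaleR_right integrable_real_indicator) auto
      show "AE x in lborel. (\<lambda>n. ?F n x) \<longlonglongrightarrow> grad \<psi> x \<bullet> e"
      proof (intro AE_I2)
        fix x
        have "((\<lambda>t. \<psi> (x + t *\<^sub>R e)) has_derivative (\<lambda>t. grad \<psi> x \<bullet> (t *\<^sub>R e))) (at 0)"
          by (rule has_derivative_compose[where f = "\<lambda>t. x + t *\<^sub>R e"])
            (use C(1)[of x] in \<open>auto intro!: derivative_eq_intros\<close>)
        then have "((\<lambda>t. \<psi> (x + t *\<^sub>R e)) has_real_derivative (grad \<psi> x \<bullet> e)) (at 0)"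
          by (simp add: has_field_derivative_def mult_commute_abs)
        then have lim: "((\<lambda>t. (\<psi> (x + t *\<^sub>R e) - \<psi> x) / t) \<longlongrightarrow> grad \<psi> x \<bullet> e) (at 0)"
          by (simp add: has_field_derivative_iff)
        have "filterlim (\<lambda>n. 1 / real (Suc n)) (at 0) sequentially"
          using LIMSEQ_Suc[OF lim_1_over_n] by (auto simp: filterlim_at)
        from filterlim_compose[OF lim this]
        show "(\<lambda>n. ?F n x) \<longlonglongrightarrow> grad \<psi> x \<bullet> e" by (simp add: mult.commute)
      qed
      show "AE x in lborel. norm (?F n x) \<le> (L * norm e) *\<^sub>R indicat_real K1 x" for n
      proof (intro AE_I2)
        fix x
        show "norm (?F n x) \<le> (L * norm e) *\<^sub>R indicat_real K1 x"
        proof (cases "x \<in> K1")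
          case True
          have "norm (?F n x) = real (Suc n) * \<bar>\<psi> (x + (1 / real (Suc n)) *\<^sub>R e) - \<psi> x\<bar>"
            by (simp only: real_norm_def abs_mult abs_of_nat)
          also have "\<dots> \<le> real (Suc n) * (L * norm ((1 / real (Suc n)) *\<^sub>R e))"
            using lip[of "x + (1 / real (Suc n)) *\<^sub>R e" x] by (intro mult_left_mono) auto
          also have "\<dots> = L * norm e" by simp
          finally show ?thesis using True by simp
        next
          case False
          then have "\<psi> (x + (1 / real (Suc n)) *\<^sub>R e) = 0" "\<psi> x = 0"
            using notK1[of x "1 / real (Suc n)"] notK1[of x 0] by auto
          then show ?thesis using L(1) by simp
        qed
      qed
    qed
    moreover have "(LINT x|lborel. ?F n x) = 0" for n
    proof -
      have i: "integrable lborel (\<lambda>x. \<psi> (x + (1 / real (Suc n)) *\<^sub>R e))"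
      proof -
        have "integrable (distr lborel borel ((+) ((1 / real (Suc n)) *\<^sub>R e))) \<psi>"
          using int by (simp add: lborel_distr_plus)
        then show ?thesis by (simp add: integrable_distr_eq add.commute)
      qed
      have "(LINT x|lborel. ?F n x) = real (Suc n) * ((LINT x|lborel. \<psi> (x + (1 / real (Suc n)) *\<^sub>R e)) - (LINT x|lborel. \<psi> x))"
        using i int by simp
      also have "(LINT x|lborel. \<psi> (x + (1 / real (Suc n)) *\<^sub>R e)) = (LINT x|lborel. \<psi> x)"
        using lborel_integral_translate[of \<psi> "(1 / real (Suc n)) *\<^sub>R e"] by (simp add: add.commute)
      finally show ?thesis by simp
    qed
    ultimately show ?thesis by (simp add: LIMSEQ_const_iff)
  qed
  then have "(LINT x|lborel. grad \<psi> x) \<bullet> e = 0" for e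
    using int by (simp add: integral_inner_left)
  then show ?thesis by (metis inner_eq_zero_iff)
qed

lemma integration_by_parts:
  fixes \<psi> \<eta> :: "'a::euclidean_space \<Rightarrow> real"
  assumes "\<psi> \<in> C1_0 UNIV" "Ck 1 \<eta>"
  shows "(LINT x|lborel. \<psi> x *\<^sub>R grad \<eta> x) = - (LINT x|lborel. \<eta> x *\<^sub>R grad \<psi> x)"
proof -
  define K where "K = support \<psi>"
  have K: "compact K" "\<And>x. x \<notin> K \<Longrightarrow> \<psi> x = 0" "\<And>x. x \<notin> K \<Longrightarrow> grad \<psi> x = 0"
    using C1_0_support[OF assms(1)] outside_support[of _ \<psi>] grad_outside_support[of _ \<psi>] unfolding K_def by blast+
  note C = Ck_1D[OF C1_0_Ck[OF assms(1)]] Ck_1D[OF assms(2)]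
  have i: "integrable lborel (\<lambda>x. \<psi> x *\<^sub>R grad \<eta> x)" "integrable lborel (\<lambda>x. \<eta> x *\<^sub>R grad \<psi> x)"
    using K by (auto intro!: continuous_compact_support_integrable[of _ K] continuous_intros C)
  have "0 = (LINT x|lborel. \<eta> x *\<^sub>R grad \<psi> x + \<psi> x *\<^sub>R grad \<eta> x)"
    using integral_grad_eq_0[OF C1_0_mult[OF assms]] Ck_1_mult(2)[OF C1_0_Ck[OF assms(1)] assms(2)] by simp
  also have "\<dots> = (LINT x|lborel. \<eta> x *\<^sub>R grad \<psi> x) + (LINT x|lborel. \<psi> x *\<^sub>R grad \<eta> x)"
    using i by simp
  finally show ?thesis by (simp add: eq_neg_iff_add_eq_0 add.commute)
qed

section \<open>Smooth bump functions\<close>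

definition flat_exp :: "nat \<Rightarrow> real \<Rightarrow> real" where
  "flat_exp j t = (if t > 0 then exp (- 1 / t) / t ^ j else 0)"

text \<open>The family is closed under differentiation, also at zero, where each member vanishes faster
  than any power.\<close>

lemma flat_exp_deriv:
  "(flat_exp j has_real_derivative (flat_exp (j + 2) t - real j * flat_exp (j + 1) t)) (at t)"
proof -
  consider "t > 0" | "t < 0" | "t = 0" by linarith
  then show ?thesis
  proof cases
    case 1
    have "((\<lambda>t. exp (- 1 / t) / t ^ j) has_real_derivative (flat_exp (j + 2) t - real j * flat_exp (j + 1) t)) (at t)"
    proof (rule DERIV_cong[OF DERIV_divide])
      show "((\<lambda>t. exp (- 1 / t)) has_real_derivative exp (- 1 / t) / t\<^sup>2) (at t)"
        using 1 by (auto intro!: derivative_eq_intros simp: power2_eq_square)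
      show "((\<lambda>t. t ^ j) has_real_derivative real j * t ^ (j - 1)) (at t)"
        by (auto intro!: derivative_eq_intros)
      show "t ^ j \<noteq> 0" using 1 by simp
      show "(exp (- 1 / t) / t\<^sup>2 * t ^ j - exp (- 1 / t) * (real j * t ^ (j - 1))) / (t ^ j * t ^ j)
          = flat_exp (j + 2) t - real j * flat_exp (j + 1) t"
        using 1 by (cases j) (simp_all add: flat_exp_def field_simps power2_eq_square)
    qed
    then show ?thesis
      by (rule has_field_derivative_transform_within_open[of _ _ _ "{0<..}"])
        (use 1 in \<open>auto simp: flat_exp_def\<close>)
  next
    case 2
    have "((\<lambda>t. 0) has_real_derivative (flat_exp (j + 2) t - real j * flat_exp (j + 1) t)) (at t)"
      using 2 by (auto simp: flat_exp_def)
    then show ?thesis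
      by (rule has_field_derivative_transform_within_open[of _ _ _ "{..<0}"])
        (use 2 in \<open>auto simp: flat_exp_def\<close>)
  next
    case 3
    have "((\<lambda>t. flat_exp j t / t) \<longlongrightarrow> 0) (at_left 0)"
      by (rule tendsto_eventually) (auto simp: eventually_at_left_field flat_exp_def intro!: exI[of _ "-1"])
    moreover have "((\<lambda>t. flat_exp j t / t) \<longlongrightarrow> 0) (at_right 0)"
    proof -
      have "((\<lambda>s::real. s ^ Suc j / exp s) \<longlongrightarrow> 0) at_top" by (rule tendsto_power_div_exp_0)
      from filterlim_compose[OF this filterlim_inverse_at_top_right]
      have "((\<lambda>t::real. inverse t ^ Suc j / exp (inverse t)) \<longlongrightarrow> 0) (at_right 0)" .
      then show ?thesis
        by (rule Lim_transform_eventually)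
          (auto simp: eventually_at_right_field flat_exp_def exp_minus field_simps intro!: exI[of _ 1])
    qed
    ultimately have "((\<lambda>t. flat_exp j t / t) \<longlongrightarrow> 0) (at 0)"
      by (simp add: filterlim_split_at)
    then show ?thesis
      using 3 by (simp add: has_field_derivative_iff flat_exp_def)
  qed
qed

text \<open>An algebra of functions that contains a bump for every ball and is closed under partial
  derivatives; the closure property makes all its members smooth by induction on the order.\<close>

inductive bump_algebra :: "('a::euclidean_space \<Rightarrow> real) \<Rightarrow> bool" where
  flat: "bump_algebra (\<lambda>x. flat_exp j (r\<^sup>2 - (norm (x - c))\<^sup>2))"
| const: "bump_algebra (\<lambda>x. a)"
| coordinate: "bump_algebra (\<lambda>x. x \<bullet> i)"
| add: "bump_algebra f \<Longrightarrow> bump_algebra g \<Longrightarrow> bump_algebra (\<lambda>x. f x + g x)"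
| mult: "bump_algebra f \<Longrightarrow> bump_algebra g \<Longrightarrow> bump_algebra (\<lambda>x. f x * g x)"
| exp: "bump_algebra f \<Longrightarrow> bump_algebra (\<lambda>x. exp (f x))"

lemma bump_algebra_grad:
  fixes f :: "'a::euclidean_space \<Rightarrow> real"
  assumes "bump_algebra f"
  shows "(\<forall>x. (f has_derivative (\<lambda>h. grad f x \<bullet> h)) (at x)) \<and> (\<forall>i. bump_algebra (\<lambda>x. grad f x \<bullet> i))"
proof -
  have "\<exists>D. (\<forall>x. (f has_derivative (\<lambda>h. D x \<bullet> h)) (at x)) \<and> (\<forall>i. bump_algebra (\<lambda>x. D x \<bullet> i))"
    using assms
  proof induction
    case (flat j r c)
    let ?d = "\<lambda>t. flat_exp (j + 2) t - real j * flat_exp (j + 1) t"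
    let ?t = "\<lambda>x. r\<^sup>2 - (norm (x - c))\<^sup>2"
    let ?D = "\<lambda>x. (?d (?t x) * (-2)) *\<^sub>R (x - c)"
    have "((\<lambda>x. flat_exp j (?t x)) has_derivative (\<lambda>h. ?D x \<bullet> h)) (at x)" for x
    proof -
      have "(?t has_derivative (\<lambda>h. - 2 * ((x - c) \<bullet> h))) (at x)"
        unfolding power2_norm_eq_inner
        by (auto intro!: derivative_eq_intros simp: inner_commute)
      moreover have "(flat_exp j has_derivative (\<lambda>h. ?d (?t x) * h)) (at (?t x))"
        using flat_exp_deriv[of j "?t x"] unfolding has_field_derivative_def .
      ultimately have "((\<lambda>x. flat_exp j (?t x)) has_derivative (\<lambda>h. ?d (?t x) * (- 2 * ((x - c) \<bullet> h)))) (at x)"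
        by (rule has_derivative_compose)
      then show ?thesis unfolding inner_scaleR_left mult.assoc .
    qed
    moreover have "bump_algebra (\<lambda>x. ?D x \<bullet> i)" for i
    proof -
      have "bump_algebra (\<lambda>x. ((flat_exp (j + 2) (?t x) + (- real j) * flat_exp (j + 1) (?t x)) * (-2)) * (x \<bullet> i + (- (c \<bullet> i))))"
        by (intro bump_algebra.intros)
      then show ?thesis by (simp add: inner_diff_left)
    qed
    ultimately show ?case by (intro exI[of _ ?D]) blast
  next
    case (const a)
    show ?case by (rule exI[of _ "\<lambda>x. 0"]) (auto intro: bump_algebra.const)
  next
    case (coordinate i)
    show ?case
      by (rule exI[of _ "\<lambda>x. i"])
        (auto intro!: bump_algebra.const derivative_eq_intros simp: inner_commute)
  next
    case (add f g)
    then obtain D E where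
      "\<forall>x. (f has_derivative (\<lambda>h. D x \<bullet> h)) (at x)" "\<forall>i. bump_algebra (\<lambda>x. D x \<bullet> i)"
      "\<forall>x. (g has_derivative (\<lambda>h. E x \<bullet> h)) (at x)" "\<forall>i. bump_algebra (\<lambda>x. E x \<bullet> i)" by blast
    then show ?case
      by (intro exI[of _ "\<lambda>x. D x + E x"])
        (auto simp: inner_add_left intro!: bump_algebra.add has_derivative_add)
  next
    case (mult f g)
    then obtain D E where DE:
      "\<And>x. (f has_derivative (\<lambda>h. D x \<bullet> h)) (at x)" "\<And>i. bump_algebra (\<lambda>x. D x \<bullet> i)"
      "\<And>x. (g has_derivative (\<lambda>h. E x \<bullet> h)) (at x)" "\<And>i. bump_algebra (\<lambda>x. E x \<bullet> i)" by blast
    let ?D = "\<lambda>x. g x *\<^sub>R D x + f x *\<^sub>R E x"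
    have "((\<lambda>x. f x * g x) has_derivative (\<lambda>h. ?D x \<bullet> h)) (at x)" for x
      by (rule has_derivative_eq_rhs[OF has_derivative_mult[OF DE(1) DE(3)]])
        (auto simp: fun_eq_iff inner_add_left)
    moreover have "bump_algebra (\<lambda>x. ?D x \<bullet> i)" for i
      by (simp add: inner_add_left) (intro bump_algebra.add bump_algebra.mult mult.hyps DE)
    ultimately show ?case by (intro exI[of _ ?D]) blast
  next
    case (exp f)
    then obtain D where D:
      "\<And>x. (f has_derivative (\<lambda>h. D x \<bullet> h)) (at x)" "\<And>i. bump_algebra (\<lambda>x. D x \<bullet> i)" by blast
    let ?D = "\<lambda>x. exp (f x) *\<^sub>R D x"
    have "((\<lambda>x. exp (f x)) has_derivative (\<lambda>h. ?D x \<bullet> h)) (at x)" for x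
      by (rule has_derivative_eq_rhs[OF has_derivative_exp[OF D(1)]]) (auto simp: fun_eq_iff)
    moreover have "bump_algebra (\<lambda>x. ?D x \<bullet> i)" for i
      by simp (intro bump_algebra.exp bump_algebra.mult exp.hyps D)
    ultimately show ?case by (intro exI[of _ ?D]) blast
  qed
  then obtain D where D: "\<And>x. (f has_derivative (\<lambda>h. D x \<bullet> h)) (at x)" "\<And>i. bump_algebra (\<lambda>x. D x \<bullet> i)"
    by blast
  have "grad f = D" using grad_unique[OF D(1)] by auto
  then show ?thesis using D by simp
qed

lemma bump_algebra_Ck: "bump_algebra f \<Longrightarrow> Ck k f"
proof (induction k arbitrary: f)
  case 0
  have "isCont f x" for x
    using bump_algebra_grad[OF 0] has_derivative_continuous by blast
  then show ?case by (simp add: Ck.simps continuous_on_eq_continuous_at)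
next
  case (Suc k)
  then show ?case using bump_algebra_grad[of f] unfolding Ck_Suc_iff by blast
qed

definition bump :: "'a::euclidean_space \<Rightarrow> real \<Rightarrow> 'a \<Rightarrow> real" where
  "bump c r x = flat_exp 0 (r\<^sup>2 - (norm (x - c))\<^sup>2)"

lemma bump_algebra_bump: "bump_algebra (bump c r)"
  unfolding bump_def[abs_def] by (rule bump_algebra.flat)

lemma bump_nonneg: "0 \<le> bump c r x"
  by (simp add: bump_def flat_exp_def)

lemma bump_pos_iff: "r > 0 \<Longrightarrow> 0 < bump c r x \<longleftrightarrow> x \<in> ball c r"
  using power_mono_iff[of r "norm (x - c)" 2]
  by (simp add: bump_def flat_exp_def dist_norm norm_minus_commute not_le[symmetric])

lemma bump_eq_0_iff: "r > 0 \<Longrightarrow> bump c r x = 0 \<longleftrightarrow> x \<notin> ball c r"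
  using bump_pos_iff[of r c x] bump_nonneg[of c r x] by linarith

lemma bump_multiple_Cinf_0:
  assumes "bump_algebra f" "r > 0" "cball c r \<subseteq> \<Omega>" "\<And>x. x \<notin> ball c r \<Longrightarrow> f x = 0"
  shows "f \<in> Cinf_0 \<Omega>"
  using assms by (intro Cinf_0I[OF bump_algebra_Ck, of f "cball c r"]) auto

lemma bump_algebra_sum:
  "finite I \<Longrightarrow> (\<And>i. i \<in> I \<Longrightarrow> bump_algebra (f i)) \<Longrightarrow> bump_algebra (\<lambda>x. \<Sum>i\<in>I. f i x)"
  by (induction I rule: finite_induct) (auto intro: bump_algebra.intros)

text \<open>A sum of bumps over a finite cover is positive on the compact set; dividing by its minimum there
  makes it at least one.\<close>

lemma cutoff_exists:
  fixes K :: "'a::euclidean_space set"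
  assumes "compact K" "open \<Omega>" "K \<subseteq> \<Omega>"
  shows "\<exists>\<eta>\<in>Cinf_0 \<Omega>. (\<forall>x. 0 \<le> \<eta> x) \<and> (\<forall>x\<in>K. 1 \<le> \<eta> x)"
proof -
  obtain r where r: "r > 0" "(\<Union>x\<in>K. cball x r) \<subseteq> \<Omega>"
    using compact_subset_open_imp_cball_epsilon_subset[OF assms] by blast
  have "K \<subseteq> (\<Union>x\<in>K. ball x r)" using r(1) by auto
  then obtain I where I: "I \<subseteq> K" "finite I" "K \<subseteq> (\<Union>x\<in>I. ball x r)"
    using compactE_image[OF assms(1), of K "\<lambda>x. ball x r"] by (metis open_ball)
  define f where "f x = (\<Sum>c\<in>I. bump c r x)" for x
  have f_alg: "bump_algebra f" unfolding f_def[abs_def]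
    by (intro bump_algebra_sum I bump_algebra_bump)
  have f_nonneg: "f x \<ge> 0" for x unfolding f_def by (intro sum_nonneg bump_nonneg)
  have f_pos: "f x > 0" if "x \<in> K" for x
  proof -
    have "x \<in> (\<Union>x\<in>I. ball x r)" using I(3) that by (rule subsetD)
    then obtain c where c: "c \<in> I" "x \<in> ball c r" by (rule UN_E)
    have "0 < bump c r x" using c r(1) by (simp add: bump_pos_iff del: mem_ball)
    also have "\<dots> \<le> f x" unfolding f_def
      by (rule member_le_sum) (auto simp: c I bump_nonneg)
    finally show ?thesis .
  qed
  have cont: "continuous_on K f"
    using bump_algebra_Ck[OF f_alg, of 0] continuous_on_subset unfolding Ck.simps by blast
  obtain m where m: "m > 0" "\<And>x. x \<in> K \<Longrightarrow> m \<le> f x"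
  proof (cases "K = {}")
    case True then show ?thesis using that[of 1] by auto
  next
    case False
    then obtain x0 where x0: "x0 \<in> K" "\<forall>y\<in>K. f x0 \<le> f y"
      using continuous_attains_inf[OF assms(1) _ cont] by blast
    then show ?thesis using that[of "f x0"] f_pos by auto
  qed
  have "(\<lambda>x. (1 / m) * f x) \<in> Cinf_0 \<Omega>"
  proof (rule Cinf_0I)
    show "Ck k (\<lambda>x. (1 / m) * f x)" for k
      by (intro bump_algebra_Ck bump_algebra.mult bump_algebra.const f_alg)
    show "compact (\<Union>c\<in>I. cball c r)" using I by (intro compact_UN) auto
    show "(\<Union>c\<in>I. cball c r) \<subseteq> \<Omega>" using r(2) I(1) by blast
    show "1 / m * f x = 0" if "x \<notin> (\<Union>c\<in>I. cball c r)" for x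
      using that r(1) unfolding f_def by (auto simp: bump_eq_0_iff intro!: sum.neutral)
  qed
  moreover have "(\<forall>x. 0 \<le> (1 / m) * f x) \<and> (\<forall>x\<in>K. 1 \<le> (1 / m) * f x)"
    using m f_nonneg by (auto simp: field_simps)
  ultimately show ?thesis by (intro bexI[of _ "\<lambda>x. (1 / m) * f x"])
qed

section \<open>Mollification\<close>

text \<open>The kernel is evaluated at \<open>y - x\<close>, so that translations are the only substitutions in the
  integrals; for the radial kernels below this is the usual convolution.\<close>

definition mollify :: "('a::euclidean_space \<Rightarrow> real) \<Rightarrow> ('a \<Rightarrow> real) \<Rightarrow> 'a \<Rightarrow> real" where
  "mollify g \<rho> x = (LINT y|lborel. g y * \<rho> (y - x))"

lemma Ck_1_linear_approximation:
  fixes \<rho> :: "'a::euclidean_space \<Rightarrow> real"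
  assumes "Ck 1 \<rho>" and "\<And>x y. norm (x - y) < d \<Longrightarrow> norm (grad \<rho> x - grad \<rho> y) < e"
    and "norm k < d"
  shows "\<bar>\<rho> (z + k) - \<rho> z - grad \<rho> z \<bullet> k\<bar> \<le> e * norm k"
proof -
  have "norm (\<rho> (z + k) - \<rho> z - grad \<rho> z \<bullet> ((z + k) - z)) \<le> norm ((z + k) - z) * e"
  proof (rule differentiable_bound_linearization[where S = "ball z d" and f' = "\<lambda>x h. grad \<rho> x \<bullet> h"
        and f = \<rho> and a = z and b = "z + k" and ?x0.0 = z and B = e])
    show "z + t *\<^sub>R (z + k - z) \<in> ball z d" if "t \<in> {0..1}" for t
    proof -
      have "\<bar>t\<bar> * norm k \<le> 1 * norm k" using that by (intro mult_right_mono) auto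
      then show ?thesis using assms(3) by (simp add: dist_norm)
    qed
    show "(\<rho> has_derivative (\<bullet>) (grad \<rho> x)) (at x within ball z d)" for x
      using Ck_1D(1)[OF assms(1), of x] by (rule has_derivative_at_withinI)
    show "onorm ((\<bullet>) (grad \<rho> x) - (\<bullet>) (grad \<rho> z)) \<le> e" if "x \<in> ball z d" for x
    proof (rule onorm_le)
      fix h
      have "norm (((\<bullet>) (grad \<rho> x) - (\<bullet>) (grad \<rho> z)) h) = \<bar>(grad \<rho> x - grad \<rho> z) \<bullet> h\<bar>"
        by (simp add: inner_diff_left)
      also have "\<dots> \<le> norm (grad \<rho> x - grad \<rho> z) * norm h" by (rule Cauchy_Schwarz_ineq2)
      also have "\<dots> \<le> e * norm h"
        using assms(2)[of x z] that by (intro mult_right_mono) (auto simp: dist_norm norm_minus_commute less_imp_le)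
      finally show "norm (((\<bullet>) (grad \<rho> x) - (\<bullet>) (grad \<rho> z)) h) \<le> e * norm h" .
    qed
    show "z \<in> ball z d" using le_less_trans[OF norm_ge_zero assms(3)] by simp
  qed
  then show ?thesis by (simp add: mult.commute)
qed

lemma continuous_compact_support_translate_integrable:
  fixes g :: "'a::euclidean_space \<Rightarrow> real" and \<rho> :: "'a \<Rightarrow> 'b::euclidean_space"
  assumes "g \<in> C1_0 UNIV" "continuous_on UNIV \<rho>"
  shows "integrable lborel (\<lambda>y. g y *\<^sub>R \<rho> (y - x))"
proof (rule continuous_compact_support_integrable)
  show "continuous_on UNIV (\<lambda>y. g y *\<^sub>R \<rho> (y - x))"
    using Ck_1D(3)[OF C1_0_Ck[OF assms(1)]] 
    by (intro continuous_on_scaleR continuous_on_compose2[OF assms(2)] continuous_intros) auto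
  show "compact (support g)" using C1_0_support[OF assms(1)] by blast
  show "g y *\<^sub>R \<rho> (y - x) = 0" if "y \<notin> support g" for y
    using outside_support[OF that] by simp
qed

text \<open>The linear approximation of the kernel is uniform because its gradient is uniformly continuous,
  so the difference quotients converge under the integral.\<close>

lemma mollify_has_derivative:
  fixes g \<rho> :: "'a::euclidean_space \<Rightarrow> real"
  assumes g: "g \<in> C1_0 UNIV" and \<rho>: "\<rho> \<in> C1_0 UNIV"
  shows "(mollify g \<rho> has_derivative (\<lambda>h. (- (LINT y|lborel. g y *\<^sub>R grad \<rho> (y - x))) \<bullet> h)) (at x)"
proof -
  note C\<rho> = Ck_1D[OF C1_0_Ck[OF \<rho>]] and Cg = Ck_1D[OF C1_0_Ck[OF g]]
  note int1 = continuous_compact_support_translate_integrable[OF g C\<rho>(3), simplified]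
  note int2 = continuous_compact_support_translate_integrable[OF g C\<rho>(2)]
  let ?V = "LINT y|lborel. g y *\<^sub>R grad \<rho> (y - x)"
  have intg: "integrable lborel (\<lambda>y. \<bar>g y\<bar>)"
    using continuous_compact_support_integrable[OF Cg(3) C1_0_support(1)[OF g] outside_support[of _ g]]
    by (rule integrable_abs)
  define G where "G = (LINT y|lborel. \<bar>g y\<bar>) + 1"
  have G: "G > 0" unfolding G_def by (intro add_nonneg_pos integral_nonneg_AE) auto
  show ?thesis
    unfolding has_derivative_at_alt
  proof (intro conjI allI impI)
    show "bounded_linear ((\<bullet>) (- ?V))" by (rule bounded_linear_inner_right)
    fix e :: real assume e: "e > 0"
    obtain d where d: "d > 0" "\<forall>u v. norm (u - v) < d \<longrightarrow> norm (grad \<rho> u - grad \<rho> v) < e / G"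
      using continuous_compact_support_uniformly_continuous[OF C\<rho>(2) C1_0_support(1)[OF \<rho>]
          grad_outside_support, of "e / G"] e G by auto
    have "norm (mollify g \<rho> y - mollify g \<rho> x - (- ?V) \<bullet> (y - x)) \<le> e * norm (y - x)"
      if "norm (y - x) < d" for y
    proof -
      have "mollify g \<rho> y - mollify g \<rho> x - (- ?V) \<bullet> (y - x)
          = (LINT z|lborel. g z * \<rho> (z - y) - g z * \<rho> (z - x) - (g z *\<^sub>R grad \<rho> (z - x)) \<bullet> (x - y))"
      proof -
        have "(LINT z|lborel. g z * \<rho> (z - y) - g z * \<rho> (z - x) - (g z *\<^sub>R grad \<rho> (z - x)) \<bullet> (x - y))
            = (LINT z|lborel. g z * \<rho> (z - y)) - (LINT z|lborel. g z * \<rho> (z - x))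
              - (LINT z|lborel. (g z *\<^sub>R grad \<rho> (z - x)) \<bullet> (x - y))"
          using int1[of y] int1[of x] integrable_inner_left[OF int2[of x], of "x - y"]
          by (simp only: Bochner_Integration.integral_diff Bochner_Integration.integrable_diff)
        also have "(LINT z|lborel. (g z *\<^sub>R grad \<rho> (z - x)) \<bullet> (x - y)) = ?V \<bullet> (x - y)"
          by (rule integral_inner_left) (rule int2)
        finally show ?thesis by (simp add: mollify_def inner_diff_right)
      qed
      also have "norm \<dots> \<le> (LINT z|lborel. (e / G * norm (y - x)) * \<bar>g z\<bar>)"
      proof (rule Bochner_Integration.integral_norm_bound_integral)
        show "integrable lborel (\<lambda>z. g z * \<rho> (z - y) - g z * \<rho> (z - x) - (g z *\<^sub>R grad \<rho> (z - x)) \<bullet> (x - y))"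
          using int1[of y] int1[of x] integrable_inner_left[OF int2[of x], of "x - y"]
          by (simp only: Bochner_Integration.integrable_diff)
        show "integrable lborel (\<lambda>z. (e / G * norm (y - x)) * \<bar>g z\<bar>)" using intg by auto
        fix z
        have "\<bar>\<rho> ((z - x) + (x - y)) - \<rho> (z - x) - grad \<rho> (z - x) \<bullet> (x - y)\<bar> \<le> e / G * norm (x - y)"
          using d that by (intro Ck_1_linear_approximation[OF C1_0_Ck[OF \<rho>], of d]) (auto simp: norm_minus_commute)
        then have "\<bar>g z\<bar> * \<bar>\<rho> (z - y) - \<rho> (z - x) - grad \<rho> (z - x) \<bullet> (x - y)\<bar> \<le> \<bar>g z\<bar> * (e / G * norm (x - y))"
          by (intro mult_left_mono) auto
        then show "norm (g z * \<rho> (z - y) - g z * \<rho> (z - x) - (g z *\<^sub>R grad \<rho> (z - x)) \<bullet> (x - y))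
            \<le> (e / G * norm (y - x)) * \<bar>g z\<bar>"
          by (simp add: abs_mult[symmetric] right_diff_distrib norm_minus_commute mult.commute mult.left_commute)
      qed
      also have "\<dots> = e * norm (y - x) * ((LINT z|lborel. \<bar>g z\<bar>) / G)" by simp
      also have "\<dots> \<le> e * norm (y - x) * 1"
        using G e by (intro mult_left_mono) (auto simp: G_def)
      finally show ?thesis by simp
    qed
    then show "\<exists>d>0. \<forall>y. norm (y - x) < d \<longrightarrow> norm (mollify g \<rho> y - mollify g \<rho> x - (- ?V) \<bullet> (y - x)) \<le> e * norm (y - x)"
      using d(1) by blast
  qed
qed

text \<open>Integration by parts moves the derivative from the kernel to the mollified function. Mollifying
  thus commutes with the gradient, and one convergence argument covers functions and gradients.\<close>

lemma grad_mollify: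
  fixes g \<rho> :: "'a::euclidean_space \<Rightarrow> real"
  assumes g: "g \<in> C1_0 UNIV" and \<rho>: "\<rho> \<in> C1_0 UNIV"
  shows "grad (mollify g \<rho>) x = (LINT y|lborel. \<rho> (y - x) *\<^sub>R grad g y)"
proof -
  have "((\<lambda>y. \<rho> (y - x)) has_derivative (\<lambda>h. grad \<rho> (y - x) \<bullet> h)) (at y)" for y
    by (rule has_derivative_compose[of "\<lambda>y. y - x" "\<lambda>h. h" _ _ \<rho>])
      (auto intro!: derivative_eq_intros Ck_1D(1)[OF C1_0_Ck[OF \<rho>]])
  moreover have "continuous_on UNIV (\<lambda>y. grad \<rho> (y - x))"
    using Ck_1D(2)[OF C1_0_Ck[OF \<rho>]] by (rule continuous_on_compose2) (auto intro: continuous_intros)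
  ultimately have *: "Ck 1 (\<lambda>y. \<rho> (y - x))" "grad (\<lambda>y. \<rho> (y - x)) = (\<lambda>y. grad \<rho> (y - x))"
    by (rule Ck_1I)+
  have "grad (mollify g \<rho>) x = - (LINT y|lborel. g y *\<^sub>R grad \<rho> (y - x))"
    by (rule grad_unique[OF mollify_has_derivative[OF assms]])
  also have "\<dots> = (LINT y|lborel. \<rho> (y - x) *\<^sub>R grad g y)"
    using integration_by_parts[OF g *(1)] *(2) by simp
  finally show ?thesis .
qed

lemma Cinf_0_partial:
  assumes "\<rho> \<in> Cinf_0 \<Omega>" "i \<in> Basis"
  shows "(\<lambda>x. - (grad \<rho> x \<bullet> i)) \<in> Cinf_0 \<Omega>"
proof (rule Cinf_0I)
  have neg: "Ck k f \<Longrightarrow> Ck k (\<lambda>x. - f x)" for k and f :: "'a \<Rightarrow> real"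
  proof (induction k arbitrary: f)
    case 0 then show ?case by (simp add: Ck.simps continuous_on_minus)
  next
    case (Suc k)
    have d: "((\<lambda>x. - f x) has_derivative (\<lambda>h. (- grad f x) \<bullet> h)) (at x)" for x
      using Suc.prems has_derivative_minus[of f] unfolding Ck_Suc_iff inner_minus_left by blast
    then have g: "grad (\<lambda>x. - f x) x = - grad f x" for x by (rule grad_unique)
    have "Ck k (\<lambda>x. - grad f x \<bullet> i)" if "i \<in> Basis" for i
      using Suc that unfolding Ck_Suc_iff inner_minus_left by blast
    then show ?case using d unfolding Ck_Suc_iff g by blast
  qed
  show "Ck k (\<lambda>x. - (grad \<rho> x \<bullet> i))" for k
  proof (rule neg)
    have "Ck (Suc k) \<rho>" using assms(1) by (simp add: Cinf_0_def)
    then show "Ck k (\<lambda>x. grad \<rho> x \<bullet> i)" using assms(2) unfolding Ck_Suc_iff by blast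
  qed
  show "compact (support \<rho>)" "support \<rho> \<subseteq> \<Omega>"
    using assms(1) C1_0_support Cinf_0_subset_C1_0 by blast+
  show "- (grad \<rho> x \<bullet> i) = 0" if "x \<notin> support \<rho>" for x
    using grad_outside_support[OF that] by simp
qed

text \<open>Each partial derivative is again a mollification, with a partial derivative of the kernel as the
  new kernel.\<close>

lemma mollify_Ck:
  fixes g \<rho> :: "'a::euclidean_space \<Rightarrow> real"
  assumes g: "g \<in> C1_0 UNIV"
  shows "\<rho> \<in> Cinf_0 UNIV \<Longrightarrow> Ck k (mollify g \<rho>)"
proof (induction k arbitrary: \<rho>)
  case 0
  then have "\<rho> \<in> C1_0 UNIV" using Cinf_0_subset_C1_0 by blast
  then show ?case using has_derivative_continuous[OF mollify_has_derivative[OF g]]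
    by (simp add: Ck.simps continuous_on_eq_continuous_at)
next
  case (Suc k)
  then have \<rho>: "\<rho> \<in> C1_0 UNIV" using Cinf_0_subset_C1_0 by blast
  note int = continuous_compact_support_translate_integrable[OF g Ck_1D(2)[OF C1_0_Ck[OF \<rho>]]]
  have gr: "grad (mollify g \<rho>) x = - (LINT y|lborel. g y *\<^sub>R grad \<rho> (y - x))" for x
    by (rule grad_unique[OF mollify_has_derivative[OF g \<rho>]])
  have "(\<lambda>x. grad (mollify g \<rho>) x \<bullet> i) = mollify g (\<lambda>x. - (grad \<rho> x \<bullet> i))" for i
    unfolding gr mollify_def using int by (auto simp: fun_eq_iff integral_inner_left[symmetric])
  then show ?case
    using mollify_has_derivative[OF g \<rho>] Suc.IH[OF Cinf_0_partial[OF Suc.prems]]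
    unfolding Ck_Suc_iff gr by presburger
qed

lemma mollify_error:
  fixes f :: "'a::euclidean_space \<Rightarrow> 'b::euclidean_space"
  assumes \<rho>: "\<And>x. \<rho> x \<ge> 0" "integrable lborel \<rho>" "(LINT x|lborel. \<rho> x) = 1" "\<And>x. norm x \<ge> r \<Longrightarrow> \<rho> x = 0"
    and f: "integrable lborel (\<lambda>y. \<rho> (y - x) *\<^sub>R f y)"
    and e: "\<And>y. norm (y - x) < r \<Longrightarrow> norm (f y - f x) \<le> e"
  shows "norm ((LINT y|lborel. \<rho> (y - x) *\<^sub>R f y) - f x) \<le> e"
proof -
  have meas: "\<rho> \<in> borel_measurable borel" using \<rho>(2) by simp
  have one: "(LINT y|lborel. \<rho> (y - x)) = 1"
    using lborel_integral_translate[OF meas, of "- x"] \<rho>(3) by simp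
  have int: "integrable lborel (\<lambda>y. \<rho> (y - x))"
    using one not_integrable_integral_eq by fastforce
  have "(LINT y|lborel. \<rho> (y - x) *\<^sub>R f y) - f x = (LINT y|lborel. \<rho> (y - x) *\<^sub>R (f y - f x))"
    using f int one by (simp add: scaleR_diff_right)
  also have "norm \<dots> \<le> (LINT y|lborel. \<rho> (y - x) * e)"
  proof (rule Bochner_Integration.integral_norm_bound_integral)
    show "integrable lborel (\<lambda>y. \<rho> (y - x) *\<^sub>R (f y - f x))" using f int by (simp add: scaleR_diff_right)
    show "integrable lborel (\<lambda>y. \<rho> (y - x) * e)" using int by simp
    show "norm (\<rho> (y - x) *\<^sub>R (f y - f x)) \<le> \<rho> (y - x) * e" for y
    proof (cases "norm (y - x) < r")
      case True
      then show ?thesis using e[OF True] \<rho>(1)[of "y - x"] by (simp add: mult_left_mono)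
    next
      case False
      then show ?thesis using \<rho>(4)[of "y - x"] by simp
    qed
  qed
  also have "\<dots> = e" using one int by simp
  finally show ?thesis .
qed

lemma mollifier_exists:
  assumes "r > 0"
  shows "\<exists>\<rho>::'a::euclidean_space \<Rightarrow> real. \<rho> \<in> Cinf_0 UNIV \<and> (\<forall>x. \<rho> x \<ge> 0) \<and> integrable lborel \<rho> \<and>
    (LINT x|lborel. \<rho> x) = 1 \<and> (\<forall>x. norm x \<ge> r \<longrightarrow> \<rho> x = 0)"
proof -
  let ?b = "bump (0::'a) r"
  have b: "?b \<in> Cinf_0 UNIV"
    by (intro bump_multiple_Cinf_0[OF bump_algebra_bump, of r 0]) (use assms in \<open>simp_all add: bump_eq_0_iff\<close>)
  have cont: "continuous_on UNIV ?b" using bump_algebra_Ck[OF bump_algebra_bump, of 0] by (simp add: Ck.simps)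
  have int: "integrable lborel ?b"
    by (rule continuous_compact_support_integrable[OF cont compact_cball[of 0 r]])
      (use assms in \<open>simp add: bump_eq_0_iff\<close>)
  define I where "I = (LINT x|lborel. ?b x)"
  have "I \<noteq> 0"
  proof
    assume "I = 0"
    then have "AE x in lborel. ?b x = 0"
      using integral_nonneg_eq_0_iff_AE[OF int] bump_nonneg by (auto simp: I_def)
    then have "AE x in lborel. x \<notin> ball (0::'a) r" by (simp only: bump_eq_0_iff[OF assms])
    then have "emeasure lborel (ball (0::'a) r) = 0"
      by (subst (asm) AE_iff_measurable[OF _ refl]) (auto simp: ball_def)
    then have "measure lborel (ball (0::'a) r) = 0" by (simp add: measure_def)
    then show False using assms by simp
  qed
  moreover have "I \<ge> 0" unfolding I_def by (intro integral_nonneg_AE) (auto simp: bump_nonneg)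
  ultimately have I: "I > 0" by simp
  show ?thesis
  proof (intro exI[of _ "\<lambda>x. (1 / I) * ?b x"] conjI allI impI)
    show "(\<lambda>x. (1 / I) * ?b x) \<in> Cinf_0 UNIV"
      by (intro bump_multiple_Cinf_0[of _ r 0] bump_algebra.mult bump_algebra.const bump_algebra_bump)
        (use assms in \<open>simp_all add: bump_eq_0_iff\<close>)
    show "(1 / I) * ?b x \<ge> 0" for x using I by (simp add: bump_nonneg)
    show "integrable lborel (\<lambda>x. (1 / I) * ?b x)" using int by simp
    show "(LINT x|lborel. (1 / I) * ?b x) = 1" using I by (simp add: I_def)
    show "(1 / I) * ?b x = 0" if "norm x \<ge> r" for x using that assms by (simp add: bump_eq_0_iff)
  qed
qed

text \<open>The constraint of the dual problem is tested with \<open>C\<^sup>1\<close> functions, whereas the Sobolev space is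
  generated by smooth ones; this lemma passes from one class to the other.\<close>

lemma C1_0_uniform_approximation:
  fixes \<psi> :: "'a::euclidean_space \<Rightarrow> real"
  assumes "open \<Omega>" "\<psi> \<in> C1_0 \<Omega>" "e > 0"
  shows "\<exists>\<phi>\<in>Cinf_0 \<Omega>. (\<forall>x. \<bar>\<phi> x - \<psi> x\<bar> \<le> e) \<and> (\<forall>x. norm (grad \<phi> x - grad \<psi> x) \<le> e)"
proof -
  note C = Ck_1D[OF C1_0_Ck[OF assms(2)]] and S = C1_0_support[OF assms(2)]
  have \<psi>: "\<psi> \<in> C1_0 UNIV" using assms(2) C1_0_mono[of \<Omega> UNIV] by blast
  obtain r1 where r1: "r1 > 0" "(\<Union>x\<in>support \<psi>. cball x r1) \<subseteq> \<Omega>"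
    using compact_subset_open_imp_cball_epsilon_subset[OF S(1) assms(1) S(2)] by blast
  obtain r2 where r2: "r2 > 0" "\<forall>x y. norm (x - y) < r2 \<longrightarrow> norm (\<psi> x - \<psi> y) < e"
    using continuous_compact_support_uniformly_continuous[OF C(3) S(1) outside_support[of _ \<psi>] assms(3)] by blast
  obtain r3 where r3: "r3 > 0" "\<forall>x y. norm (x - y) < r3 \<longrightarrow> norm (grad \<psi> x - grad \<psi> y) < e"
    using continuous_compact_support_uniformly_continuous[OF C(2) S(1) grad_outside_support[of _ \<psi>] assms(3)] by blast
  define r where "r = min r1 (min r2 r3)"
  have r: "r > 0" "r \<le> r1" "r \<le> r2" "r \<le> r3" using r1 r2 r3 by (auto simp: r_def)
  obtain \<rho> :: "'a \<Rightarrow> real" where \<rho>: "\<rho> \<in> Cinf_0 UNIV" "\<And>x. \<rho> x \<ge> 0" "integrable lborel \<rho>"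
    "(LINT x|lborel. \<rho> x) = 1" "\<And>x. norm x \<ge> r \<Longrightarrow> \<rho> x = 0"
    using mollifier_exists[OF r(1)] by blast
  have \<rho>1: "\<rho> \<in> C1_0 UNIV" using \<rho>(1) Cinf_0_subset_C1_0 by blast
  note C\<rho> = Ck_1D[OF C1_0_Ck[OF \<rho>1]]
  have meas: "\<rho> \<in> borel_measurable borel" using \<rho>(3) by simp
  have "mollify \<psi> \<rho> \<in> Cinf_0 \<Omega>"
  proof (rule Cinf_0I[OF mollify_Ck[OF \<psi> \<rho>(1)]])
    define K where "K = {x + y | x y. x \<in> support \<psi> \<and> y \<in> cball 0 r}"
    show "compact K" unfolding K_def by (intro compact_sums S compact_cball)
    show "K \<subseteq> \<Omega>"
    proof
      fix z assume "z \<in> K"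
      then obtain x y where xy: "z = x + y" "x \<in> support \<psi>" "norm y \<le> r" by (auto simp: K_def)
      then have "z \<in> cball x r1" using r(2) by (simp add: dist_norm)
      then show "z \<in> \<Omega>" using r1(2) xy(2) by blast
    qed
    show "mollify \<psi> \<rho> x = 0" if "x \<notin> K" for x
    proof -
      have z: "\<psi> y * \<rho> (y - x) = 0" for y
      proof (cases "y \<in> support \<psi>")
        case True
        have "norm (y - x) \<ge> r"
        proof (rule ccontr)
          assume "\<not> norm (y - x) \<ge> r"
          then have "x - y \<in> cball 0 r" by (simp add: norm_minus_commute)
          moreover have "x = y + (x - y)" by simp
          ultimately have "x \<in> K" unfolding K_def using True by blast
          with that show False by simp
        qed
        then show ?thesis using \<rho>(5) by simp
      next
        case False
        then show ?thesis using outside_support[of y \<psi>] by simp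
      qed
      show ?thesis unfolding mollify_def z by simp
    qed
  qed
  moreover have "\<bar>mollify \<psi> \<rho> x - \<psi> x\<bar> \<le> e" for x
  proof -
    have "norm ((LINT y|lborel. \<rho> (y - x) *\<^sub>R \<psi> y) - \<psi> x) \<le> e"
    proof (rule mollify_error[OF \<rho>(2-5)])
      show "integrable lborel (\<lambda>y. \<rho> (y - x) *\<^sub>R \<psi> y)"
        using continuous_compact_support_translate_integrable[OF \<psi> C\<rho>(3), of x] by (simp add: mult.commute)
      show "norm (\<psi> y - \<psi> x) \<le> e" if "norm (y - x) < r" for y
        using r2(2)[rule_format, of y x] that r by simp
    qed auto
    then show ?thesis by (simp add: mollify_def mult.commute)
  qed
  moreover have "norm (grad (mollify \<psi> \<rho>) x - grad \<psi> x) \<le> e" for x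
    unfolding grad_mollify[OF \<psi> \<rho>1]
  proof (rule mollify_error[OF \<rho>(2-5)])
    show "integrable lborel (\<lambda>y. \<rho> (y - x) *\<^sub>R grad \<psi> y)"
    proof (rule continuous_compact_support_integrable[OF _ S(1)])
      show "continuous_on UNIV (\<lambda>y. \<rho> (y - x) *\<^sub>R grad \<psi> y)"
        by (intro continuous_on_scaleR continuous_on_compose2[OF C\<rho>(3)] C continuous_intros) auto
      show "\<rho> (y - x) *\<^sub>R grad \<psi> y = 0" if "y \<notin> support \<psi>" for y
        using grad_outside_support[OF that] by simp
    qed
    show "norm (grad \<psi> y - grad \<psi> x) \<le> e" if "norm (y - x) < r" for y
      using r3(2)[rule_format, of y x] that r by simp
  qed auto
  ultimately show ?thesis by blast
qed

section \<open>Test functions and Lebesgue measure on an open set\<close>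

lemma lebesgue_on_integral_eq:
  fixes f :: "'a::euclidean_space \<Rightarrow> 'b::euclidean_space"
  assumes "\<Omega> \<in> sets lebesgue" "f \<in> borel_measurable borel" "\<And>x. x \<notin> \<Omega> \<Longrightarrow> f x = 0"
  shows "(LINT x|lebesgue_on \<Omega>. f x) = (LINT x|lborel. f x)"
    and "integrable (lebesgue_on \<Omega>) f \<longleftrightarrow> integrable lborel f"
proof -
  have *: "(\<lambda>x. indicator \<Omega> x *\<^sub>R f x) = f" using assms(3) by (auto simp: indicator_def fun_eq_iff)
  have **: "f \<in> lborel \<rightarrow>\<^sub>M borel" using assms(2) by simp
  show "(LINT x|lebesgue_on \<Omega>. f x) = (LINT x|lborel. f x)"
    using assms(1) integral_completion[OF **] by (simp add: integral_restrict_space * del: integral_completion)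
  show "integrable (lebesgue_on \<Omega>) f \<longleftrightarrow> integrable lborel f"
    using assms(1) integrable_completion[OF **] by (simp add: integrable_restrict_space * del: integrable_completion)
qed

lemma borel_measurable_lebesgue_on:
  fixes f :: "'a::euclidean_space \<Rightarrow> 'b::euclidean_space"
  assumes "f \<in> borel_measurable borel"
  shows "f \<in> borel_measurable (lebesgue_on \<Omega>)"
  using assms by (intro measurable_restrict_space1 measurable_completion) simp

lemma C1_0_measurable:
  fixes \<psi> :: "'a::euclidean_space \<Rightarrow> real"
  assumes "\<psi> \<in> C1_0 \<Omega>"
  shows "\<psi> \<in> borel_measurable (lebesgue_on S)" "grad \<psi> \<in> borel_measurable (lebesgue_on S)"
    "\<psi> \<in> borel_measurable borel" "grad \<psi> \<in> borel_measurable borel"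
  using Ck_1D(2,3)[OF C1_0_Ck[OF assms]]
  by (auto intro: borel_measurable_lebesgue_on borel_measurable_continuous_onI)

lemma C1_0_bounded:
  fixes \<psi> :: "'a::euclidean_space \<Rightarrow> real"
  assumes "\<psi> \<in> C1_0 \<Omega>"
  shows "\<exists>B>0. \<forall>x. \<bar>\<psi> x\<bar> \<le> B \<and> norm (grad \<psi> x) \<le> B"
proof -
  obtain B1 where B1: "B1 > 0" "\<forall>x. norm (\<psi> x) \<le> B1"
    using continuous_compact_support_bounded[OF Ck_1D(3)[OF C1_0_Ck[OF assms]] C1_0_support(1)[OF assms]
        outside_support[of _ \<psi>]] by blast
  obtain B2 where B2: "B2 > 0" "\<forall>x. norm (grad \<psi> x) \<le> B2"
    using continuous_compact_support_bounded[OF Ck_1D(2)[OF C1_0_Ck[OF assms]] C1_0_support(1)[OF assms]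
        grad_outside_support[of _ \<psi>]] by blast
  have "\<bar>\<psi> x\<bar> \<le> max B1 B2 \<and> norm (grad \<psi> x) \<le> max B1 B2" for x
    using B1(2)[rule_format, of x] B2(2)[rule_format, of x] by auto
  then show ?thesis using B1(1) by (intro exI[of _ "max B1 B2"]) auto
qed

lemma continuous_compact_support_square_integrable:
  fixes F :: "'a::euclidean_space \<Rightarrow> 'b::euclidean_space"
  assumes "open \<Omega>" "compact K" "K \<subseteq> \<Omega>" "continuous_on UNIV F" "\<And>x. x \<notin> K \<Longrightarrow> F x = 0"
  shows "square_integrable (lebesgue_on \<Omega>) F"
proof -
  have m: "\<Omega> \<in> sets lebesgue" using assms(1) by auto
  have [measurable]: "F \<in> borel_measurable borel"
    using assms(4) by (rule borel_measurable_continuous_onI)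
  have int: "integrable lborel (\<lambda>x. (norm (F x))\<^sup>2)"
  proof (rule continuous_compact_support_integrable[OF _ assms(2)])
    show "continuous_on UNIV (\<lambda>x. (norm (F x))\<^sup>2)"
      by (intro continuous_on_power continuous_on_norm assms)
    show "(norm (F x))\<^sup>2 = 0" if "x \<notin> K" for x using assms(5)[OF that] by simp
  qed
  have "integrable (lebesgue_on \<Omega>) (\<lambda>x. (norm (F x))\<^sup>2)"
  proof (subst lebesgue_on_integral_eq(2)[OF m])
    show "(norm (F x))\<^sup>2 = 0" if "x \<notin> \<Omega>" for x using assms(3) assms(5)[of x] that by auto
  qed (use int in measurable)
  moreover have "F \<in> borel_measurable (lebesgue_on \<Omega>)"
    by (rule borel_measurable_lebesgue_on) measurable
  ultimately show ?thesis by (simp add: square_integrable_def)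
qed

lemma C1_0_square_integrable:
  fixes \<psi> :: "'a::euclidean_space \<Rightarrow> real"
  assumes "open \<Omega>" "\<psi> \<in> C1_0 \<Omega>"
  shows "square_integrable (lebesgue_on \<Omega>) \<psi>" "square_integrable (lebesgue_on \<Omega>) (grad \<psi>)"
proof -
  note C = Ck_1D[OF C1_0_Ck[OF assms(2)]] and S = C1_0_support[OF assms(2)]
  show "square_integrable (lebesgue_on \<Omega>) \<psi>"
    by (rule continuous_compact_support_square_integrable[OF assms(1) S C(3) outside_support[of _ \<psi>]])
  show "square_integrable (lebesgue_on \<Omega>) (grad \<psi>)"
    by (rule continuous_compact_support_square_integrable[OF assms(1) S C(2) grad_outside_support[of _ \<psi>]])
qed

lemma integration_by_parts_lebesgue_on:
  fixes \<psi> \<eta> :: "'a::euclidean_space \<Rightarrow> real"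
  assumes "open \<Omega>" "\<psi> \<in> C1_0 \<Omega>" "\<eta> \<in> C1_0 \<Omega>"
  shows "(LINT x|lebesgue_on \<Omega>. \<psi> x *\<^sub>R grad \<eta> x) = - (LINT x|lebesgue_on \<Omega>. \<eta> x *\<^sub>R grad \<psi> x)"
proof -
  have m: "\<Omega> \<in> sets lebesgue" using assms(1) by auto
  have z: "\<psi> x = 0" "\<eta> x = 0" if "x \<notin> \<Omega>" for x
    using that C1_0_support(2)[OF assms(2)] C1_0_support(2)[OF assms(3)]
      outside_support[of x \<psi>] outside_support[of x \<eta>] by auto
  note [measurable] = C1_0_measurable(3,4)[OF assms(2)] C1_0_measurable(3,4)[OF assms(3)]
  have "(LINT x|lebesgue_on \<Omega>. \<psi> x *\<^sub>R grad \<eta> x) = (LINT x|lborel. \<psi> x *\<^sub>R grad \<eta> x)"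
    by (rule lebesgue_on_integral_eq[OF m]) (auto simp: z)
  also have "\<dots> = - (LINT x|lborel. \<eta> x *\<^sub>R grad \<psi> x)"
    using assms C1_0_mono[of \<Omega> UNIV] by (intro integration_by_parts C1_0_Ck[OF assms(3)]) auto
  also have "(LINT x|lborel. \<eta> x *\<^sub>R grad \<psi> x) = (LINT x|lebesgue_on \<Omega>. \<eta> x *\<^sub>R grad \<psi> x)"
    by (rule lebesgue_on_integral_eq[OF m, symmetric]) (auto simp: z)
  finally show ?thesis .
qed

section \<open>The fundamental lemma of the calculus of variations\<close>

text \<open>The sets on which a member of the bump algebra is positive form an intersection-stable generator
  of the Borel sets: intersections correspond to products, and all balls occur.\<close>

lemma integral_zero_if_zero_on_bump_sets:
  fixes B :: "'a::euclidean_space set"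
  assumes B: "B \<in> sets borel"
    and int: "integrable lborel (f :: 'a \<Rightarrow> real)"
    and zero: "\<And>b. bump_algebra b \<Longrightarrow> (\<And>x. 0 \<le> b x) \<Longrightarrow> set_lebesgue_integral lborel {x. 0 < b x} f = 0"
  shows "set_lebesgue_integral lborel B f = 0"
proof -
  define E where "E = {{x::'a. 0 < b x} | b. bump_algebra b \<and> (\<forall>x. 0 \<le> b x)}"
  have "Int_stable E"
  proof (rule Int_stableI)
    fix X Y assume "X \<in> E" "Y \<in> E"
    then obtain b c where "X = {x. 0 < b x}" "Y = {x. 0 < c x}" "bump_algebra b" "bump_algebra c"
      "\<forall>x. 0 \<le> b x" "\<forall>x. 0 \<le> c x" unfolding E_def by blast
    moreover have "0 < b x * c x \<longleftrightarrow> 0 < b x \<and> 0 < c x" for x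
    proof -
      have "\<not> b x < 0" "\<not> c x < 0" using calculation(5,6) by (auto simp: not_less)
      then show ?thesis by (simp add: zero_less_mult_iff)
    qed
    then have "X \<inter> Y = {x. 0 < b x * c x}"
      using calculation(1,2) by auto
    moreover have "bump_algebra (\<lambda>x. b x * c x)" "\<forall>x. 0 \<le> b x * c x"
      using calculation(3-6) by (auto intro: bump_algebra.mult)
    ultimately show "X \<inter> Y \<in> E"
      unfolding E_def mem_Collect_eq by (intro exI[of _ "\<lambda>x. b x * c x"] conjI)
  qed
  have E_open: "open X" if X: "X \<in> E" for X
  proof -
    obtain b where b: "X = {x. 0 < b x}" "bump_algebra b" using X unfolding E_def by blast
    have "continuous_on UNIV b" using bump_algebra_Ck[OF b(2), of 0] by (simp add: Ck.simps)
    then show ?thesis unfolding b(1) by (intro open_Collect_less) auto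
  qed
  have ball_E: "ball c r \<in> E" for c r
  proof (cases "r > 0")
    case True
    then have "ball c r = {x. 0 < bump c r x}" using bump_pos_iff[OF True, of c] by blast
    then show ?thesis unfolding E_def using bump_algebra_bump[of c r] bump_nonneg[of c r] by blast
  next
    case False
    then have "ball c r = {x. 0 < (0::real)}" by auto
    then show ?thesis unfolding E_def mem_Collect_eq
      by (intro exI[of _ "\<lambda>x. 0"] conjI allI bump_algebra.const) auto
  qed
  have gen: "sets (borel :: 'a measure) = sigma_sets UNIV E"
  proof -
    have "(borel :: 'a measure) = sigma UNIV ((\<lambda>X. X) ` E)"
    proof (rule borel_eq_sigmaI1[OF borel_def])
      show "X \<in> sets borel" if "X \<in> E" for X using E_open[OF that] by auto
      fix U :: "'a set" assume "U \<in> Collect open"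
      then have U: "open U" by simp
      define F where "F = {ball c r | c r. ball c r \<subseteq> U}"
      have F_open: "open S" if "S \<in> F" for S using that unfolding F_def by auto
      have "\<exists>F'. F' \<subseteq> F \<and> countable F' \<and> \<Union> F' = \<Union> F"
        by (rule Lindelof[of F, OF F_open]) auto
      then obtain F' where F': "F' \<subseteq> F" "countable F'" "\<Union> F' = \<Union> F" by blast
      have "\<Union> F = U"
      proof
        show "U \<subseteq> \<Union> F"
        proof
          fix x assume "x \<in> U"
          then obtain e where "e > 0" "ball x e \<subseteq> U" using U open_contains_ball by blast
          then show "x \<in> \<Union> F" unfolding F_def using centre_in_ball[of x e] by blast
        qed
      qed (auto simp: F_def)
      with F' have "U = \<Union> F'" by simp
      also have "\<dots> \<in> sets (sigma UNIV ((\<lambda>X. X) ` E))"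
        using F' ball_E unfolding F_def by (intro sets.countable_Union) auto
      finally show "U \<in> sets (sigma UNIV ((\<lambda>X. X) ` E))" .
    qed
    then have "sets (borel :: 'a measure) = sets (sigma UNIV E)" by simp
    then show ?thesis by simp
  qed
  have total: "(LINT x|lborel. f x) = 0"
    using zero[of "\<lambda>x. 1"] bump_algebra.const[of 1] by (simp add: set_lebesgue_integral_def)
  from B have "B \<in> sigma_sets UNIV E" unfolding gen .
  with \<open>Int_stable E\<close> subset_UNIV[of E, folded Pow_UNIV] show ?thesis
  proof (induction rule: sigma_sets_induct_disjoint)
    case (basic A)
    then show ?case using zero unfolding E_def by blast
  next
    case empty
    then show ?case by (simp add: set_lebesgue_integral_def)
  next
    case (compl A)
    have A: "A \<in> sets borel" using compl gen by simp
    have "set_lebesgue_integral lborel (UNIV - A) f = (LINT x|lborel. f x) - set_lebesgue_integral lborel A f"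
    proof -
      have "integrable lborel (\<lambda>x. indicator A x *\<^sub>R f x)" using int A by (intro integrable_mult_indicator) auto
      then have "(LINT x|lborel. f x - indicator A x *\<^sub>R f x) = (LINT x|lborel. f x) - set_lebesgue_integral lborel A f"
        using int by (simp add: set_lebesgue_integral_def)
      moreover have "(\<lambda>x. f x - indicator A x *\<^sub>R f x) = (\<lambda>x. indicator (UNIV - A) x *\<^sub>R f x)"
        by (auto simp: fun_eq_iff indicator_def)
      ultimately show ?thesis by (simp add: set_lebesgue_integral_def)
    qed
    then show ?case using compl total by simp
  next
    case (union A)
    have A: "A i \<in> sets borel" for i using union gen by auto
    have "set_integrable lborel (\<Union>i. A i) f"
      unfolding set_integrable_def using int A by (intro integrable_mult_indicator) auto
    then have "set_lebesgue_integral lborel (\<Union>i. A i) f = (\<Sum>i. set_lebesgue_integral lborel (A i) f)"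
      using union A by (intro lebesgue_integral_countable_add) (auto simp: disjoint_family_on_def)
    then show ?case using union by simp
  qed
qed

text \<open>Test functions approximate the indicator of every set of the generator within the ball, so the
  integral over each such set vanishes, and then over each Borel set.\<close>

lemma fundamental_lemma_ball:
  fixes G :: "'a::euclidean_space \<Rightarrow> real"
  assumes "open \<Omega>" "r > 0" "cball c r \<subseteq> \<Omega>"
    and int: "integrable lebesgue (\<lambda>x. indicator (ball c r) x * G x)"
    and zero: "\<And>\<psi>. \<psi> \<in> Cinf_0 \<Omega> \<Longrightarrow> (\<And>x. x \<notin> ball c r \<Longrightarrow> \<psi> x = 0) \<Longrightarrow> (LINT x|lebesgue. \<psi> x * G x) = 0"
  shows "AE x in lborel. x \<in> ball c r \<longrightarrow> G x = 0"
proof -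
  let ?G = "\<lambda>x. indicator (ball c r) x * G x"
  obtain G' where G'[measurable]: "G' \<in> borel_measurable lborel" and eq: "AE x in lborel. ?G x = G' x"
    using completion_ex_borel_measurable_real[OF borel_measurable_integrable[OF int]] by blast
  have [measurable]: "G' \<in> borel_measurable borel" "ball c r \<in> sets borel" using G' by auto
  have eq': "AE x in lebesgue. ?G x = G' x" using eq by (simp add: AE_completion_iff)
  have int': "integrable lborel G'"
  proof -
    have "integrable lebesgue G'"
      by (rule integrable_cong_AE_imp[OF int measurable_completion[OF G'] eq'])
    then show ?thesis using integrable_completion[OF G'] by simp
  qed
  have "AE x in lborel. G' x = 0"
  proof (rule sigma_finite_measure.density_zero[OF sigma_finite_lborel int'])
    fix A :: "'a set" assume "A \<in> sets lborel"
    then have "A \<in> sets borel" by simp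
    then show "set_lebesgue_integral lborel A G' = 0"
    proof (rule integral_zero_if_zero_on_bump_sets[OF _ int'])
      fix b :: "'a \<Rightarrow> real" assume b: "bump_algebra b" "\<And>x. 0 \<le> b x"
      \<comment> \<open>These test functions increase to the indicator of the part of the ball where \<open>b\<close> is positive.\<close>
      let ?\<psi> = "\<lambda>n x. (1 + (- 1) * exp (- real n * b x)) * (1 + (- 1) * exp (- real n * bump c r x))"
      have b_meas[measurable]: "b \<in> borel_measurable borel" 
        using bump_algebra_Ck[OF b(1), of 0] by (simp add: Ck.simps borel_measurable_continuous_onI)
      have bump_meas[measurable]: "bump c r \<in> borel_measurable borel" 
        using bump_algebra_Ck[OF bump_algebra_bump, of 0 c r]
        by (intro borel_measurable_continuous_onI) (simp add: Ck.simps)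
      have \<psi>: "?\<psi> n \<in> Cinf_0 \<Omega>" for n
        by (intro bump_multiple_Cinf_0[OF _ assms(2,3)] bump_algebra.intros b bump_algebra_bump)
          (use assms(2) in \<open>simp add: bump_eq_0_iff\<close>)
      have \<psi>0: "?\<psi> n x = 0" if "x \<notin> ball c r" for n x
        using that assms(2) by (simp add: bump_eq_0_iff)
      have bound: "\<bar>?\<psi> n x\<bar> \<le> 1" for n x
      proof -
        have "exp (- real n * b x) \<le> 1" "exp (- real n * bump c r x) \<le> 1"
          using b(2)[of x] bump_nonneg[of c r x] by auto
        then show ?thesis by (auto simp: abs_mult intro!: mult_le_one)
      qed
      have "(\<lambda>n. LINT x|lborel. ?\<psi> n x * G' x) \<longlonglongrightarrow> (LINT x|lborel. indicator {x. 0 < b x} x * (indicator (ball c r) x * G' x))"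
      proof (rule integral_dominated_convergence[where w = "\<lambda>x. \<bar>G' x\<bar>"])
        show "integrable lborel (\<lambda>x. \<bar>G' x\<bar>)" using int' by simp
        show "AE x in lborel. norm (?\<psi> n x * G' x) \<le> \<bar>G' x\<bar>" for n
          using bound[of n] by (auto simp: abs_mult intro!: mult_left_le_one_le)
        have lim: "(\<lambda>n. 1 + (- 1) * exp (- real n * t)) \<longlonglongrightarrow> (if 0 < t then 1 else 0)" if "0 \<le> t" for t :: real
        proof (cases "t = 0")
          case False
          then have "t > 0" using that by simp
          then have "(\<lambda>n. exp (- real n * t)) \<longlonglongrightarrow> 0"
            by (intro filterlim_compose[OF exp_at_bot]) real_asymp
          from tendsto_add[OF tendsto_const[of 1] tendsto_mult[OF tendsto_const[of "-1"] this]]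
          show ?thesis using \<open>t > 0\<close> by simp
        qed simp
        show "AE x in lborel. (\<lambda>n. ?\<psi> n x * G' x) \<longlonglongrightarrow> indicator {x. 0 < b x} x * (indicator (ball c r) x * G' x)"
        proof (intro AE_I2)
          fix x
          have "(\<lambda>n. ?\<psi> n x * G' x) \<longlonglongrightarrow> (if 0 < b x then 1 else 0) * (if 0 < bump c r x then 1 else 0) * G' x"
            by (intro tendsto_mult lim b bump_nonneg tendsto_const)
          moreover have "(if 0 < b x then 1 else 0) * (if 0 < bump c r x then 1 else 0) * G' x
              = indicator {x. 0 < b x} x * (indicator (ball c r) x * G' x)"
            unfolding bump_pos_iff[OF assms(2)] by (simp add: indicator_def)
          ultimately show "(\<lambda>n. ?\<psi> n x * G' x) \<longlonglongrightarrow> indicator {x. 0 < b x} x * (indicator (ball c r) x * G' x)"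
            by (simp only:)
        qed
      qed measurable
      moreover have "(LINT x|lborel. ?\<psi> n x * G' x) = 0" for n
      proof -
        have "(LINT x|lborel. ?\<psi> n x * G' x) = (LINT x|lebesgue. ?\<psi> n x * G' x)"
          by (intro integral_completion[symmetric]) measurable
        also have "\<dots> = (LINT x|lebesgue. ?\<psi> n x * G x)"
        proof (rule integral_cong_AE)
          show "AE x in lebesgue. ?\<psi> n x * G' x = ?\<psi> n x * G x"
            using eq'
          proof eventually_elim
            case (elim x)
            then show ?case using \<psi>0[of x n] by (cases "x \<in> ball c r") auto
          qed
          show "(\<lambda>x. ?\<psi> n x * G' x) \<in> borel_measurable lebesgue" by (intro measurable_completion) measurable
          have "(\<lambda>x. ?\<psi> n x * G x) = (\<lambda>x. ?\<psi> n x * ?G x)"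
            using \<psi>0[of _ n] by (auto simp: fun_eq_iff indicator_def)
          moreover have "?\<psi> n \<in> borel_measurable lebesgue" by (intro measurable_completion) measurable
          ultimately show "(\<lambda>x. ?\<psi> n x * G x) \<in> borel_measurable lebesgue"
            using borel_measurable_times[OF _ borel_measurable_integrable[OF int]] by simp
        qed
        also have "\<dots> = 0" by (rule zero[OF \<psi> \<psi>0])
        finally show ?thesis .
      qed
      ultimately have "(LINT x|lborel. indicator {x. 0 < b x} x * (indicator (ball c r) x * G' x)) = 0"
        by (simp add: LIMSEQ_const_iff)
      also have "(LINT x|lborel. indicator {x. 0 < b x} x * (indicator (ball c r) x * G' x)) = (LINT x|lborel. indicator {x. 0 < b x} x * G' x)"
        by (rule integral_cong_AE) (use eq in \<open>auto elim!: eventually_mono simp: indicator_def split: if_splits\<close>)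
      finally show "set_lebesgue_integral lborel {x. 0 < b x} G' = 0" by (simp add: set_lebesgue_integral_def)
    qed
  qed
  with eq show ?thesis by eventually_elim (auto simp: indicator_def)
qed

lemma fundamental_lemma:
  fixes G :: "'a::euclidean_space \<Rightarrow> real"
  assumes "open \<Omega>"
    and int: "\<And>K. compact K \<Longrightarrow> K \<subseteq> \<Omega> \<Longrightarrow> integrable (lebesgue_on K) G"
    and zero: "\<And>\<psi>. \<psi> \<in> Cinf_0 \<Omega> \<Longrightarrow> (LINT x|lebesgue_on \<Omega>. \<psi> x * G x) = 0"
  shows "AE x in lebesgue_on \<Omega>. G x = 0"
proof -
  define F where "F = {ball c r | c r. r > 0 \<and> cball c r \<subseteq> \<Omega>}"
  have UF: "\<Union> F = \<Omega>"
  proof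
    show "\<Omega> \<subseteq> \<Union> F"
    proof
      fix x assume "x \<in> \<Omega>"
      then obtain r where "r > 0" "cball x r \<subseteq> \<Omega>" using assms(1) open_contains_cball by blast
      then show "x \<in> \<Union> F" unfolding F_def using centre_in_ball[of x r] by blast
    qed
    show "\<Union> F \<subseteq> \<Omega>" unfolding F_def using ball_subset_cball by blast
  qed
  have F_open: "open S" if "S \<in> F" for S using that unfolding F_def by auto
  have "\<exists>F'. F' \<subseteq> F \<and> countable F' \<and> \<Union> F' = \<Union> F"
    by (rule Lindelof[of F, OF F_open]) auto
  then obtain F' where F': "F' \<subseteq> F" "countable F'" "\<Union> F' = \<Union> F" by blast
  have "AE x in lborel. x \<in> B \<longrightarrow> G x = 0" if "B \<in> F'" for B
  proof -
    have "B \<in> F" using that F'(1) by blast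
    then obtain c r where B: "B = ball c r" "r > 0" "cball c r \<subseteq> \<Omega>" unfolding F_def by blast
    have "integrable (lebesgue_on (cball c r)) G" using int[of "cball c r"] B by simp
    then have "integrable lebesgue (\<lambda>x. indicator (cball c r) x *\<^sub>R G x)"
      by (subst (asm) integrable_restrict_space) auto
    then have "integrable lebesgue (\<lambda>x. indicator (ball c r) x *\<^sub>R (indicator (cball c r) x *\<^sub>R G x))"
      by (rule integrable_mult_indicator[rotated]) auto
    also have "(\<lambda>x. indicator (ball c r) x *\<^sub>R (indicator (cball c r) x *\<^sub>R G x)) = (\<lambda>x. indicator (ball c r) x * G x)"
      by (auto simp: fun_eq_iff indicator_def)
    finally have 1: "integrable lebesgue (\<lambda>x. indicator (ball c r) x * G x)" .
    have 2: "(LINT x|lebesgue. \<psi> x * G x) = 0"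
      if "\<psi> \<in> Cinf_0 \<Omega>" and z: "\<And>x. x \<notin> ball c r \<Longrightarrow> \<psi> x = 0" for \<psi>
    proof -
      have "\<psi> x = 0" if "x \<notin> \<Omega>" for x using z[of x] B(3) that ball_subset_cball[of c r] by blast
      then have "(\<lambda>x. indicator \<Omega> x *\<^sub>R (\<psi> x * G x)) = (\<lambda>x. \<psi> x * G x)"
        by (auto simp: fun_eq_iff indicator_def)
      then show ?thesis using zero[OF that(1)] assms(1) by (simp add: integral_restrict_space)
    qed
    show ?thesis using fundamental_lemma_ball[OF assms(1) B(2,3) 1 2] B(1) by blast
  qed
  then have "AE x in lborel. \<forall>B\<in>F'. x \<in> B \<longrightarrow> G x = 0"
    using F'(2) by (subst AE_ball_countable) auto
  then have "AE x in lborel. x \<in> \<Omega> \<longrightarrow> G x = 0"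
    by eventually_elim (use F'(3) UF in blast)
  then have "AE x in lebesgue. x \<in> \<Omega> \<longrightarrow> G x = 0" by (simp add: AE_completion_iff)
  then show ?thesis using assms(1) by (simp add: AE_restrict_space_iff)
qed

section \<open>The Poincare inequality on sets of finite measure\<close>

text \<open>The fundamental theorem of calculus on the segment from \<open>x\<close> to \<open>x + h\<close>, followed by Jensen's
  inequality for the square on the unit interval.\<close>

lemma translation_difference_pointwise:
  fixes \<psi> :: "'a::euclidean_space \<Rightarrow> real"
  assumes "Ck 1 \<psi>"
  shows "ennreal ((\<psi> (x + h) - \<psi> x)\<^sup>2)
    \<le> (\<integral>\<^sup>+t. ennreal ((norm h)\<^sup>2) * (ennreal ((norm (grad \<psi> (x + t *\<^sub>R h)))\<^sup>2) * indicator {0..1} t) \<partial>lborel)"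
proof -
  note C = Ck_1D[OF assms]
  define a where "a t = grad \<psi> (x + t *\<^sub>R h) \<bullet> h" for t :: real
  define c where "c = \<psi> (x + h) - \<psi> x"
  have cont: "continuous_on UNIV a" unfolding a_def
    by (intro continuous_on_inner continuous_on_compose2[OF C(2)] continuous_intros) auto
  have "(LINT t|lborel. indicator {0..1} t *\<^sub>R a t) = \<psi> (x + 1 *\<^sub>R h) - \<psi> (x + 0 *\<^sub>R h)"
  proof (rule integral_FTC_Icc)
    show "continuous_on {0..1} a" using cont by (rule continuous_on_subset) simp
    fix t :: real
    have "((\<lambda>t. \<psi> (x + t *\<^sub>R h)) has_derivative (\<lambda>s. grad \<psi> (x + t *\<^sub>R h) \<bullet> (s *\<^sub>R h))) (at t)"
      by (rule has_derivative_compose[where f = "\<lambda>t. x + t *\<^sub>R h"])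
        (auto intro!: derivative_eq_intros C(1))
    then have "((\<lambda>t. \<psi> (x + t *\<^sub>R h)) has_vector_derivative a t) (at t)"
      by (simp add: has_vector_derivative_def a_def)
    then show "((\<lambda>t. \<psi> (x + t *\<^sub>R h)) has_vector_derivative a t) (at t within {0..1})"
      by (rule has_vector_derivative_at_within)
  qed simp
  then have ftc: "(LINT t|lborel. indicator {0..1} t *\<^sub>R a t) = c" by (simp add: c_def)
  have int: "integrable lborel (\<lambda>t. indicator {0..1} t *\<^sub>R f t)" if "continuous_on UNIV f" for f :: "real \<Rightarrow> real"
    using that by (intro borel_integrable_compact continuous_on_subset[OF that]) auto
  note i1 = int[OF cont] and i2 = int[of "\<lambda>t. (a t)\<^sup>2", OF continuous_on_power[OF cont]]
  have i3: "integrable lborel (\<lambda>t. indicator {0..1::real} t *\<^sub>R (1::real))" by (rule int) simp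
  have "0 \<le> (LINT t|lborel. indicator {0..1} t *\<^sub>R (a t - c)\<^sup>2)"
    by (intro integral_nonneg_AE) auto
  also have "\<dots> = (LINT t|lborel. indicator {0..1} t *\<^sub>R (a t)\<^sup>2 - 2 * c * (indicator {0..1} t *\<^sub>R a t) + c\<^sup>2 * (indicator {0..1} t *\<^sub>R 1))"
    by (intro Bochner_Integration.integral_cong) (auto simp: power2_eq_square algebra_simps)
  also have "\<dots> = (LINT t|lborel. indicator {0..1} t *\<^sub>R (a t)\<^sup>2) - 2 * c * (LINT t|lborel. indicator {0..1} t *\<^sub>R a t)
      + c\<^sup>2 * (LINT t|lborel. indicator {0..1::real} t *\<^sub>R (1::real))"
    using i1 i2 i3 by (subst Bochner_Integration.integral_add Bochner_Integration.integral_diff; simp)+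
  also have "\<dots> = (LINT t|lborel. indicator {0..1} t *\<^sub>R (a t)\<^sup>2) - c\<^sup>2"
    unfolding ftc by (simp add: power2_eq_square)
  finally have "ennreal (c\<^sup>2) \<le> ennreal (LINT t|lborel. indicator {0..1} t *\<^sub>R (a t)\<^sup>2)"
    by (intro ennreal_leI) simp
  also have "\<dots> = (\<integral>\<^sup>+t. ennreal (indicator {0..1} t *\<^sub>R (a t)\<^sup>2) \<partial>lborel)"
    by (intro nn_integral_eq_integral[symmetric] i2) auto
  also have "\<dots> \<le> (\<integral>\<^sup>+t. ennreal ((norm h)\<^sup>2) * (ennreal ((norm (grad \<psi> (x + t *\<^sub>R h)))\<^sup>2) * indicator {0..1} t) \<partial>lborel)"
  proof (intro nn_integral_mono)
    fix t :: real
    have "(a t)\<^sup>2 \<le> (norm (grad \<psi> (x + t *\<^sub>R h)) * norm h)\<^sup>2"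
      using Cauchy_Schwarz_ineq2[of "grad \<psi> (x + t *\<^sub>R h)" h]
      by (intro power2_le_iff_abs_le[THEN iffD2]) (auto simp: a_def)
    then show "ennreal (indicator {0..1} t *\<^sub>R (a t)\<^sup>2)
        \<le> ennreal ((norm h)\<^sup>2) * (ennreal ((norm (grad \<psi> (x + t *\<^sub>R h)))\<^sup>2) * indicator {0..1} t)"
      by (auto simp: indicator_def ennreal_mult[symmetric] power_mult_distrib mult.commute intro!: ennreal_leI)
  qed
  finally show ?thesis by (simp add: c_def)
qed

lemma translation_difference_bound:
  fixes \<psi> :: "'a::euclidean_space \<Rightarrow> real"
  assumes "Ck 1 \<psi>"
  shows "(\<integral>\<^sup>+x. ennreal ((\<psi> (x + h) - \<psi> x)\<^sup>2) \<partial>lborel)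
    \<le> ennreal ((norm h)\<^sup>2) * (\<integral>\<^sup>+x. ennreal ((norm (grad \<psi> x))\<^sup>2) \<partial>lborel)"
proof -
  have [measurable]: "grad \<psi> \<in> borel_measurable borel"
    using Ck_1D(2)[OF assms] by (rule borel_measurable_continuous_onI)
  let ?F = "\<lambda>x (t::real). ennreal ((norm h)\<^sup>2) * (ennreal ((norm (grad \<psi> (x + t *\<^sub>R h)))\<^sup>2) * indicator {0..1} t)"
  have "(\<integral>\<^sup>+x. ennreal ((\<psi> (x + h) - \<psi> x)\<^sup>2) \<partial>lborel) \<le> (\<integral>\<^sup>+x. (\<integral>\<^sup>+t. ?F x t \<partial>lborel) \<partial>lborel)"
    by (intro nn_integral_mono translation_difference_pointwise assms)
  also have "\<dots> = (\<integral>\<^sup>+t. (\<integral>\<^sup>+x. ?F x t \<partial>lborel) \<partial>lborel)"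
    by (rule lborel_pair.Fubini'[symmetric]) measurable
  also have "\<dots> = (\<integral>\<^sup>+t. ennreal ((norm h)\<^sup>2) * (\<integral>\<^sup>+x. ennreal ((norm (grad \<psi> x))\<^sup>2) \<partial>lborel) * indicator {0..1::real} t \<partial>lborel)"
  proof (intro nn_integral_cong)
    fix t :: real
    have "(\<integral>\<^sup>+x. ennreal ((norm (grad \<psi> (x + t *\<^sub>R h)))\<^sup>2) \<partial>lborel) = (\<integral>\<^sup>+x. ennreal ((norm (grad \<psi> x))\<^sup>2) \<partial>lborel)"
      using nn_integral_lborel_translate[of "\<lambda>x. ennreal ((norm (grad \<psi> x))\<^sup>2)" "t *\<^sub>R h"]
      by (simp add: add.commute)
    then show "(\<integral>\<^sup>+x. ?F x t \<partial>lborel)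
      = ennreal ((norm h)\<^sup>2) * (\<integral>\<^sup>+x. ennreal ((norm (grad \<psi> x))\<^sup>2) \<partial>lborel) * indicator {0..1} t"
      by (simp add: nn_integral_cmult nn_integral_multc mult.assoc)
  qed
  also have "\<dots> = ennreal ((norm h)\<^sup>2) * (\<integral>\<^sup>+x. ennreal ((norm (grad \<psi> x))\<^sup>2) \<partial>lborel)"
    by (simp add: nn_integral_cmult)
  finally show ?thesis .
qed

lemma large_ball_exists:
  "\<exists>R>0. m \<le> measure lborel (ball (0::'a::euclidean_space) R)"
proof -
  let ?v = "unit_ball_vol (real DIM('a))"
  have v: "?v > 0" by (rule unit_ball_vol_pos) simp
  define R where "R = max 1 (m / ?v)"
  have R: "R \<ge> 1" "m / ?v \<le> R" by (auto simp: R_def)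
  have "m \<le> ?v * R" using R(2) v by (simp add: field_simps)
  also have "R = R ^ 1" by simp
  also have "\<dots> \<le> R ^ DIM('a)" using R(1) by (intro power_increasing) (auto simp: Suc_le_eq)
  finally have "m \<le> ?v * R ^ DIM('a)" using v by (simp add: mult_left_mono)
  moreover have "measure lborel (ball (0::'a) R) = ?v * R ^ DIM('a)"
    using content_ball[of R "0::'a"] R(1) by simp
  ultimately show ?thesis using R(1) by (intro exI[of _ R]) auto
qed

text \<open>Take a ball \<open>B\<close> around zero of more than twice the measure of \<open>\<Omega>\<close>. If \<open>x + h\<close> lies outside
  \<open>\<Omega>\<close> then \<open>\<psi>(x)\<^sup>2 = (\<psi>(x + h) - \<psi>(x))\<^sup>2\<close>, and for each \<open>x\<close> this holds for all \<open>h\<close> in \<open>B\<close> but a set of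
  at most half the measure of \<open>B\<close>. Integrating over \<open>h\<close> in \<open>B\<close> and over \<open>x\<close> bounds the norm of
  \<open>\<psi>\<close> by those of its translation differences, hence by the norm of its gradient.\<close>

lemma poincare_inequality:
  fixes \<Omega> :: "'a::euclidean_space set"
  assumes "open \<Omega>" "emeasure lebesgue \<Omega> < \<infinity>"
  shows "\<exists>P>0. \<forall>\<psi>\<in>C1_0 \<Omega>. L2sq (lebesgue_on \<Omega>) \<psi> \<le> P * L2sq (lebesgue_on \<Omega>) (grad \<psi>)"
proof -
  define m where "m = measure lborel \<Omega>"
  have \<Omega>_sets[measurable]: "\<Omega> \<in> sets borel" using assms(1) by simp
  have \<Omega>_m: "emeasure lborel \<Omega> = ennreal m"
    using assms(2) unfolding m_def by (intro emeasure_eq_ennreal_measure) auto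
  obtain R where R: "R > 0" "2 * m + 1 \<le> measure lborel (ball (0::'a) R)"
    using large_ball_exists by blast
  define B where "B = ball (0::'a) R"
  define b where "b = measure lborel B"
  have b: "2 * m + 1 \<le> b" using R(2) by (simp add: b_def B_def)
  have m: "m \<ge> 0" by (simp add: m_def)
  have B_m: "emeasure lborel B = ennreal b"
    unfolding b_def B_def using emeasure_bounded_finite[OF bounded_ball, of "0::'a" R]
    by (intro emeasure_eq_ennreal_measure) simp
  have B_sets[measurable]: "B \<in> sets borel" by (simp add: B_def)
  have "L2sq (lebesgue_on \<Omega>) \<psi> \<le> (2 * R\<^sup>2) * L2sq (lebesgue_on \<Omega>) (grad \<psi>)" if \<psi>: "\<psi> \<in> C1_0 \<Omega>" for \<psi>
  proof -
    note S = C1_0_support[OF \<psi>]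
    note [measurable] = C1_0_measurable(3,4)[OF \<psi>]
    have z: "\<psi> x = 0" "grad \<psi> x = 0" if "x \<notin> \<Omega>" for x
      using that S(2) outside_support[of x \<psi>] grad_outside_support[of x \<psi>] by auto
    have nn: "(\<integral>\<^sup>+x. ennreal ((norm (f x))\<^sup>2) \<partial>lborel) = ennreal (L2sq (lebesgue_on \<Omega>) f)"
      if "square_integrable (lebesgue_on \<Omega>) f" "\<And>x. x \<notin> \<Omega> \<Longrightarrow> f x = 0" "f \<in> borel_measurable borel"
      for f :: "'a \<Rightarrow> 'c::euclidean_space"
    proof -
      have \<Omega>: "\<Omega> \<in> sets lebesgue" using assms(1) by auto
      have [measurable]: "f \<in> borel_measurable borel" by fact
      note eq = lebesgue_on_integral_eq[OF \<Omega>, of "\<lambda>x. (norm (f x))\<^sup>2"]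
      have "integrable lborel (\<lambda>x. (norm (f x))\<^sup>2)"
        using that eq(2) by (simp add: square_integrable_def)
      then have "(\<integral>\<^sup>+x. ennreal ((norm (f x))\<^sup>2) \<partial>lborel) = ennreal (LINT x|lborel. (norm (f x))\<^sup>2)"
        by (intro nn_integral_eq_integral) auto
      then show ?thesis using eq(1) that(2) by simp
    qed
    define A where "A = L2sq (lebesgue_on \<Omega>) \<psi>"
    define D where "D = L2sq (lebesgue_on \<Omega>) (grad \<psi>)"
    have AD: "A \<ge> 0" "D \<ge> 0" by (simp_all add: A_def D_def)
    have A: "(\<integral>\<^sup>+x. ennreal ((\<psi> x)\<^sup>2) \<partial>lborel) = ennreal A"
      using nn[OF C1_0_square_integrable(1)[OF assms(1) \<psi>] z(1)] by (simp add: A_def)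
    have D: "(\<integral>\<^sup>+x. ennreal ((norm (grad \<psi> x))\<^sup>2) \<partial>lborel) = ennreal D"
      using nn[OF C1_0_square_integrable(2)[OF assms(1) \<psi>] z(2)] by (simp add: D_def)
    \<comment> \<open>Most translates of a point of \<open>\<Omega>\<close> by vectors of the large ball leave \<open>\<Omega>\<close>, and there \<open>\<psi>\<close> vanishes.\<close>
    have "ennreal b * ennreal A = (\<integral>\<^sup>+x. \<integral>\<^sup>+h. ennreal ((\<psi> x)\<^sup>2) * indicator B h \<partial>lborel \<partial>lborel)"
      by (simp add: nn_integral_cmult nn_integral_multc A B_m mult.commute)
    also have "\<dots> \<le> (\<integral>\<^sup>+x. \<integral>\<^sup>+h. ennreal ((\<psi> (x + h) - \<psi> x)\<^sup>2) * indicator B h + ennreal ((\<psi> x)\<^sup>2) * indicator \<Omega> (x + h) \<partial>lborel \<partial>lborel)"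
      by (intro nn_integral_mono) (auto simp: indicator_def z)
    also have "\<dots> = (\<integral>\<^sup>+x. \<integral>\<^sup>+h. ennreal ((\<psi> (x + h) - \<psi> x)\<^sup>2) * indicator B h \<partial>lborel \<partial>lborel)
        + (\<integral>\<^sup>+x. \<integral>\<^sup>+h. ennreal ((\<psi> x)\<^sup>2) * indicator \<Omega> (x + h) \<partial>lborel \<partial>lborel)"
      by (subst nn_integral_add[symmetric]) (auto intro!: nn_integral_cong nn_integral_add)
    also have "(\<integral>\<^sup>+x. \<integral>\<^sup>+h. ennreal ((\<psi> x)\<^sup>2) * indicator \<Omega> (x + h) \<partial>lborel \<partial>lborel) = ennreal A * ennreal m"
    proof -
      have "(\<integral>\<^sup>+h. indicator \<Omega> (x + h) \<partial>lborel) = ennreal m" for x :: 'a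
        using nn_integral_lborel_translate[of "indicator \<Omega>" x] \<Omega>_m by simp
      then show ?thesis by (simp add: nn_integral_cmult nn_integral_multc A)
    qed
    also have "(\<integral>\<^sup>+x. \<integral>\<^sup>+h. ennreal ((\<psi> (x + h) - \<psi> x)\<^sup>2) * indicator B h \<partial>lborel \<partial>lborel)
        = (\<integral>\<^sup>+h. \<integral>\<^sup>+x. ennreal ((\<psi> (x + h) - \<psi> x)\<^sup>2) * indicator B h \<partial>lborel \<partial>lborel)"
      by (rule lborel_pair.Fubini'[symmetric]) measurable
    also have "\<dots> \<le> (\<integral>\<^sup>+h. ennreal (R\<^sup>2 * D) * indicator B h \<partial>lborel)"
    proof (intro nn_integral_mono)
      fix h :: 'a
      have "(\<integral>\<^sup>+x. ennreal ((\<psi> (x + h) - \<psi> x)\<^sup>2) \<partial>lborel) \<le> ennreal (R\<^sup>2 * D)" if "h \<in> B"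
      proof -
        have "(\<integral>\<^sup>+x. ennreal ((\<psi> (x + h) - \<psi> x)\<^sup>2) \<partial>lborel) \<le> ennreal ((norm h)\<^sup>2) * ennreal D"
          using translation_difference_bound[OF C1_0_Ck[OF \<psi>], of h] D by simp
        also have "\<dots> \<le> ennreal (R\<^sup>2) * ennreal D"
          using that by (intro mult_right_mono ennreal_leI power_mono) (auto simp: B_def)
        finally show ?thesis using AD by (simp add: ennreal_mult)
      qed
      then show "(\<integral>\<^sup>+x. ennreal ((\<psi> (x + h) - \<psi> x)\<^sup>2) * indicator B h \<partial>lborel) \<le> ennreal (R\<^sup>2 * D) * indicator B h"
        by (auto simp: indicator_def)
    qed
    also have "\<dots> = ennreal (R\<^sup>2 * D) * ennreal b"
      by (simp add: nn_integral_cmult B_m)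
    finally have "ennreal (b * A) \<le> ennreal (R\<^sup>2 * D * b + A * m)"
      using AD b m by (simp add: ennreal_mult ennreal_plus)
    then have "b * A \<le> R\<^sup>2 * D * b + A * m"
      using AD b m by (subst (asm) ennreal_le_iff) auto
    also have "A * m \<le> A * (b / 2)" using b AD by (intro mult_left_mono) auto
    finally have "b * A \<le> b * (2 * R\<^sup>2 * D)" by (simp add: field_simps)
    then have "A \<le> 2 * R\<^sup>2 * D" using b m by (subst (asm) mult_le_cancel_left_pos) auto
    then show ?thesis by (simp add: A_def D_def)
  qed
  then show ?thesis using R(1) by (intro exI[of _ "2 * R\<^sup>2"]) auto
qed

section \<open>The Sobolev space with zero trace\<close>

text \<open>The closure of the graph of the gradient on test functions. Carrying the gradient along as a
  second component keeps the chosen representative of the weak gradient out of all limit arguments.\<close>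

definition zero_trace :: "'a::euclidean_space set \<Rightarrow> ('a \<Rightarrow> real) \<Rightarrow> ('a \<Rightarrow> 'a) \<Rightarrow> bool" where
  "zero_trace \<Omega> u g \<longleftrightarrow> square_integrable (lebesgue_on \<Omega>) u \<and> square_integrable (lebesgue_on \<Omega>) g \<and>
     (\<forall>\<epsilon>>0. \<exists>\<psi>\<in>Cinf_0 \<Omega>. L2sq (lebesgue_on \<Omega>) (\<lambda>x. u x - \<psi> x) \<le> \<epsilon> \<and>
       L2sq (lebesgue_on \<Omega>) (\<lambda>x. g x - grad \<psi> x) \<le> \<epsilon>)"

lemma zero_trace_square_integrable:
  assumes "zero_trace \<Omega> u g"
  shows "square_integrable (lebesgue_on \<Omega>) u" "square_integrable (lebesgue_on \<Omega>) g"
  using assms by (auto simp: zero_trace_def)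

lemma Cinf_0_square_integrable:
  assumes "open \<Omega>" "\<psi> \<in> Cinf_0 \<Omega>"
  shows "square_integrable (lebesgue_on \<Omega>) \<psi>" "square_integrable (lebesgue_on \<Omega>) (grad \<psi>)"
  using C1_0_square_integrable[OF assms(1)] assms(2) Cinf_0_subset_C1_0 by blast+

lemma zero_trace_closed:
  assumes "open \<Omega>" "square_integrable (lebesgue_on \<Omega>) u" "square_integrable (lebesgue_on \<Omega>) g"
    and "\<And>\<epsilon>. \<epsilon> > 0 \<Longrightarrow> \<exists>v k. zero_trace \<Omega> v k \<and> L2sq (lebesgue_on \<Omega>) (\<lambda>x. u x - v x) \<le> \<epsilon> \<and>
       L2sq (lebesgue_on \<Omega>) (\<lambda>x. g x - k x) \<le> \<epsilon>"
  shows "zero_trace \<Omega> u g"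
  unfolding zero_trace_def
proof (intro conjI allI impI assms)
  fix \<epsilon> :: real assume "\<epsilon> > 0"
  then obtain v k where vk: "zero_trace \<Omega> v k" "L2sq (lebesgue_on \<Omega>) (\<lambda>x. u x - v x) \<le> \<epsilon> / 4"
    "L2sq (lebesgue_on \<Omega>) (\<lambda>x. g x - k x) \<le> \<epsilon> / 4"
    using assms(4)[of "\<epsilon> / 4"] by auto
  then obtain \<psi> where \<psi>: "\<psi> \<in> Cinf_0 \<Omega>" "L2sq (lebesgue_on \<Omega>) (\<lambda>x. v x - \<psi> x) \<le> \<epsilon> / 4"
    "L2sq (lebesgue_on \<Omega>) (\<lambda>x. k x - grad \<psi> x) \<le> \<epsilon> / 4"
    using \<open>\<epsilon> > 0\<close> unfolding zero_trace_def by (meson divide_pos_pos zero_less_numeral)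
  note si = zero_trace_square_integrable[OF vk(1)] Cinf_0_square_integrable[OF assms(1) \<psi>(1)]
  have "L2sq (lebesgue_on \<Omega>) (\<lambda>x. u x - \<psi> x) \<le> \<epsilon>"
    using L2sq_diff_triangle[OF assms(2) si(1,3)] vk \<psi> by simp
  moreover have "L2sq (lebesgue_on \<Omega>) (\<lambda>x. g x - grad \<psi> x) \<le> \<epsilon>"
    using L2sq_diff_triangle[OF assms(3) si(2,4)] vk \<psi> by simp
  ultimately show "\<exists>\<psi>\<in>Cinf_0 \<Omega>. L2sq (lebesgue_on \<Omega>) (\<lambda>x. u x - \<psi> x) \<le> \<epsilon> \<and>
       L2sq (lebesgue_on \<Omega>) (\<lambda>x. g x - grad \<psi> x) \<le> \<epsilon>"
    using \<psi>(1) by blast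
qed

lemma zero_trace_limit:
  assumes "open \<Omega>" "square_integrable (lebesgue_on \<Omega>) u" "square_integrable (lebesgue_on \<Omega>) g"
    and "\<And>n. zero_trace \<Omega> (v n) (k n)"
    and "(\<lambda>n. L2sq (lebesgue_on \<Omega>) (\<lambda>x. v n x - u x)) \<longlonglongrightarrow> 0"
    and "(\<lambda>n. L2sq (lebesgue_on \<Omega>) (\<lambda>x. k n x - g x)) \<longlonglongrightarrow> 0"
  shows "zero_trace \<Omega> u g"
proof (rule zero_trace_closed[OF assms(1-3)])
  fix \<epsilon> :: real assume "\<epsilon> > 0"
  then have "\<forall>\<^sub>F n in sequentially. L2sq (lebesgue_on \<Omega>) (\<lambda>x. v n x - u x) < \<epsilon>"
    "\<forall>\<^sub>F n in sequentially. L2sq (lebesgue_on \<Omega>) (\<lambda>x. k n x - g x) < \<epsilon>"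
    using order_tendstoD(2)[OF assms(5)] order_tendstoD(2)[OF assms(6)] by auto
  then have "\<forall>\<^sub>F n in sequentially. L2sq (lebesgue_on \<Omega>) (\<lambda>x. v n x - u x) < \<epsilon> \<and>
      L2sq (lebesgue_on \<Omega>) (\<lambda>x. k n x - g x) < \<epsilon>"
    by (rule eventually_conj)
  then obtain n where "L2sq (lebesgue_on \<Omega>) (\<lambda>x. v n x - u x) < \<epsilon>" "L2sq (lebesgue_on \<Omega>) (\<lambda>x. k n x - g x) < \<epsilon>"
    by (auto simp: eventually_sequentially)
  then show "\<exists>v k. zero_trace \<Omega> v k \<and> L2sq (lebesgue_on \<Omega>) (\<lambda>x. u x - v x) \<le> \<epsilon> \<and>
       L2sq (lebesgue_on \<Omega>) (\<lambda>x. g x - k x) \<le> \<epsilon>"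
    using assms(4)[of n] L2sq_minus_commute[of "lebesgue_on \<Omega>" u "v n"] L2sq_minus_commute[of "lebesgue_on \<Omega>" g "k n"]
    by (intro exI[of _ "v n"] exI[of _ "k n"]) auto
qed

lemma zero_trace_approximation:
  assumes "open \<Omega>" "zero_trace \<Omega> u g"
  shows "\<exists>\<psi>. (\<forall>n. \<psi> n \<in> Cinf_0 \<Omega>) \<and> (\<lambda>n. L2sq (lebesgue_on \<Omega>) (\<lambda>x. \<psi> n x - u x)) \<longlonglongrightarrow> 0 \<and>
    (\<lambda>n. L2sq (lebesgue_on \<Omega>) (\<lambda>x. grad (\<psi> n) x - g x)) \<longlonglongrightarrow> 0 \<and>
    (AE x in lebesgue_on \<Omega>. (\<lambda>n. \<psi> n x) \<longlonglongrightarrow> u x)"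
proof -
  note si = zero_trace_square_integrable[OF assms(2)]
  have "\<forall>n. \<exists>\<psi>. \<psi> \<in> Cinf_0 \<Omega> \<and> L2sq (lebesgue_on \<Omega>) (\<lambda>x. u x - \<psi> x) \<le> 1 / real (Suc n) \<and>
       L2sq (lebesgue_on \<Omega>) (\<lambda>x. g x - grad \<psi> x) \<le> 1 / real (Suc n)"
  proof
    fix n
    have "0 < 1 / real (Suc n)" by simp
    then show "\<exists>\<psi>. \<psi> \<in> Cinf_0 \<Omega> \<and> L2sq (lebesgue_on \<Omega>) (\<lambda>x. u x - \<psi> x) \<le> 1 / real (Suc n) \<and>
       L2sq (lebesgue_on \<Omega>) (\<lambda>x. g x - grad \<psi> x) \<le> 1 / real (Suc n)"
      using assms(2) unfolding zero_trace_def by blast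
  qed
  then obtain \<psi> where \<psi>: "\<And>n. \<psi> n \<in> Cinf_0 \<Omega>"
    "\<And>n. L2sq (lebesgue_on \<Omega>) (\<lambda>x. u x - \<psi> n x) \<le> 1 / real (Suc n)"
    "\<And>n. L2sq (lebesgue_on \<Omega>) (\<lambda>x. g x - grad (\<psi> n) x) \<le> 1 / real (Suc n)"
    unfolding choice_iff by blast
  have lim: "(\<lambda>n. 1 / real (Suc n)) \<longlonglongrightarrow> 0" using LIMSEQ_Suc[OF lim_1_over_n] by simp
  have b: "L2sq (lebesgue_on \<Omega>) (\<lambda>x. \<psi> n x - u x) \<le> 1 / real (Suc n)"
    "L2sq (lebesgue_on \<Omega>) (\<lambda>x. grad (\<psi> n) x - g x) \<le> 1 / real (Suc n)" for n
    using \<psi>(2,3)[of n] by (simp_all only: L2sq_minus_commute[of _ "\<psi> n" u] L2sq_minus_commute[of _ "grad (\<psi> n)" g])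
  have 1: "(\<lambda>n. L2sq (lebesgue_on \<Omega>) (\<lambda>x. \<psi> n x - u x)) \<longlonglongrightarrow> 0"
    by (rule tendsto_sandwich[OF _ _ tendsto_const lim]) (intro always_eventually allI L2sq_nonneg b(1))+
  have 2: "(\<lambda>n. L2sq (lebesgue_on \<Omega>) (\<lambda>x. grad (\<psi> n) x - g x)) \<longlonglongrightarrow> 0"
    by (rule tendsto_sandwich[OF _ _ tendsto_const lim]) (intro always_eventually allI L2sq_nonneg b(2))+
  obtain r :: "nat \<Rightarrow> nat" where r: "strict_mono r" "AE x in lebesgue_on \<Omega>. (\<lambda>n. \<psi> (r n) x) \<longlonglongrightarrow> u x"
    using L2_tendsto_AE_subseq[OF Cinf_0_square_integrable(1)[OF assms(1) \<psi>(1)] si(1) 1] by blast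
  show ?thesis
    using \<psi>(1) LIMSEQ_subseq_LIMSEQ[OF 1 r(1)] LIMSEQ_subseq_LIMSEQ[OF 2 r(1)] r(2)
    by (intro exI[of _ "\<lambda>n. \<psi> (r n)"]) (auto simp: o_def)
qed

lemma C1_0_zero_trace:
  assumes "open \<Omega>" "emeasure lebesgue \<Omega> < \<infinity>" "\<psi> \<in> C1_0 \<Omega>"
  shows "zero_trace \<Omega> \<psi> (grad \<psi>)"
  unfolding zero_trace_def
proof (intro conjI allI impI C1_0_square_integrable assms)
  fix \<epsilon> :: real assume \<epsilon>: "\<epsilon> > 0"
  interpret finite_measure "lebesgue_on \<Omega>"
    using assms(1,2) by (intro finite_measure_lebesgue_on fmeasurableI) auto
  define m where "m = measure (lebesgue_on \<Omega>) (space (lebesgue_on \<Omega>)) + 1"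
  have m: "m > 0" unfolding m_def by (simp add: add_nonneg_pos)
  obtain \<phi> where \<phi>: "\<phi> \<in> Cinf_0 \<Omega>" "\<forall>x. \<bar>\<phi> x - \<psi> x\<bar> \<le> sqrt (\<epsilon> / m)" "\<forall>x. norm (grad \<phi> x - grad \<psi> x) \<le> sqrt (\<epsilon> / m)"
    using C1_0_uniform_approximation[OF assms(1,3), of "sqrt (\<epsilon> / m)"] \<epsilon> m by auto
  have bound: "L2sq (lebesgue_on \<Omega>) f \<le> \<epsilon>"
    if "square_integrable (lebesgue_on \<Omega>) f" "\<And>x. norm (f x) \<le> sqrt (\<epsilon> / m)" for f :: "'a \<Rightarrow> 'c::euclidean_space"
  proof -
    have "L2sq (lebesgue_on \<Omega>) f \<le> L2sq (lebesgue_on \<Omega>) (\<lambda>x. sqrt (\<epsilon> / m))"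
      using that \<epsilon> m by (intro L2sq_mono square_integrable_const) auto
    also have "\<dots> = (m - 1) * (\<epsilon> / m)" using \<epsilon> m by (simp add: m_def)
    also have "\<dots> \<le> m * (\<epsilon> / m)" using \<epsilon> m by (intro mult_right_mono) auto
    finally show ?thesis using m by simp
  qed
  show "\<exists>\<phi>\<in>Cinf_0 \<Omega>. L2sq (lebesgue_on \<Omega>) (\<lambda>x. \<psi> x - \<phi> x) \<le> \<epsilon> \<and>
       L2sq (lebesgue_on \<Omega>) (\<lambda>x. grad \<psi> x - grad \<phi> x) \<le> \<epsilon>"
    using \<phi> by (intro bexI[of _ \<phi>] conjI bound square_integrable_diff C1_0_square_integrable
        Cinf_0_square_integrable assms) (auto simp: norm_minus_commute abs_minus_commute)
qed

lemma Cinf_0_zero_trace: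
  assumes "\<psi> \<in> Cinf_0 \<Omega>" "open \<Omega>"
  shows "zero_trace \<Omega> \<psi> (grad \<psi>)"
  unfolding zero_trace_def using Cinf_0_square_integrable[OF assms(2,1)] assms(1)
  by (auto intro!: bexI[of _ \<psi>])

subsection \<open>Comparison with the definition by weak gradients\<close>

lemma eLp_norm_2:
  "eLp_norm M 2 (\<lambda>x. ennreal (norm (f x))) = ennpowr (\<integral>\<^sup>+x. ennreal ((norm (f x))\<^sup>2) \<partial>M) (1 / 2)"
  by (simp add: eLp_norm_def ennpowr_def)

lemma eLp_norm_2_eq:
  assumes "square_integrable M f"
  shows "eLp_norm M 2 (\<lambda>x. ennreal (norm (f x))) = ennreal (sqrt (L2sq M f))"
proof -
  have "(\<integral>\<^sup>+x. ennreal ((norm (f x))\<^sup>2) \<partial>M) = ennreal (L2sq M f)"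
    using assms by (intro nn_integral_eq_integral) (auto simp: square_integrable_def)
  then show ?thesis by (simp add: eLp_norm_2 ennpowr_def powr_half_sqrt)
qed

lemma square_integrable_iff_eLp_norm:
  "square_integrable M f \<longleftrightarrow> f \<in> borel_measurable M \<and> eLp_norm M 2 (\<lambda>x. ennreal (norm (f x))) < \<infinity>"
proof
  assume f: "f \<in> borel_measurable M \<and> eLp_norm M 2 (\<lambda>x. ennreal (norm (f x))) < \<infinity>"
  then have [measurable]: "f \<in> borel_measurable M" by blast
  have "(\<integral>\<^sup>+x. ennreal ((norm (f x))\<^sup>2) \<partial>M) < \<infinity>"
    using f by (auto simp: eLp_norm_2 ennpowr_def top_unique less_top split: if_splits)
  then have "integrable M (\<lambda>x. (norm (f x))\<^sup>2)"
    by (intro integrableI_bounded) auto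
  then show "square_integrable M f" by (simp add: square_integrable_def)
qed (auto simp: eLp_norm_2_eq square_integrable_measurable)

lemma Lp_space_2_iff: "u \<in> Lp_space \<Omega> 2 \<longleftrightarrow> square_integrable (lebesgue_on \<Omega>) u"
  by (simp add: Lp_space_def square_integrable_iff_eLp_norm)

lemma integrable_lebesgue_on_subset:
  fixes f :: "'a::euclidean_space \<Rightarrow> 'b::euclidean_space"
  assumes "integrable (lebesgue_on S) f" "T \<in> sets lebesgue" "S \<in> sets lebesgue" "T \<subseteq> S"
  shows "integrable (lebesgue_on T) f"
proof -
  have "integrable lebesgue (\<lambda>x. indicator S x *\<^sub>R f x)"
    using assms by (simp add: integrable_restrict_space)
  then have "integrable lebesgue (\<lambda>x. indicator T x *\<^sub>R (indicator S x *\<^sub>R f x))"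
    by (rule integrable_mult_indicator[OF assms(2)])
  also have "(\<lambda>x. indicator T x *\<^sub>R (indicator S x *\<^sub>R f x)) = (\<lambda>x. indicator T x *\<^sub>R f x)"
    using assms(4) by (auto simp: fun_eq_iff indicator_def)
  finally show ?thesis using assms by (simp add: integrable_restrict_space)
qed

lemma Lp_space_1_iff: "u \<in> Lp_space K 1 \<longleftrightarrow> integrable (lebesgue_on K) u"
proof -
  have "eLp_norm (lebesgue_on K) 1 (\<lambda>x. ennreal (norm (u x))) = (\<integral>\<^sup>+x. ennreal (norm (u x)) \<partial>lebesgue_on K)"
    by (auto simp: eLp_norm_def ennpowr_def ennreal_enn2real_if)
  then show ?thesis by (simp add: Lp_space_def integrable_iff_bounded)
qed

lemma integrable_Lp_loc_1:
  fixes u :: "'a::euclidean_space \<Rightarrow> 'b::euclidean_space"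
  assumes "open \<Omega>" "u \<in> borel_measurable (lebesgue_on \<Omega>)"
    and "\<And>K. compact K \<Longrightarrow> K \<subseteq> \<Omega> \<Longrightarrow> integrable (lebesgue_on K) u"
  shows "u \<in> Lp_loc \<Omega> 1"
  using assms by (auto simp: Lp_loc_def Lp_space_1_iff)

lemma test_function_times_locally_integrable:
  fixes v :: "'a::euclidean_space \<Rightarrow> 'b::euclidean_space"
  assumes "open \<Omega>" "\<psi> \<in> C1_0 \<Omega>" "v \<in> Lp_loc \<Omega> 1"
  shows "integrable (lebesgue_on \<Omega>) (\<lambda>x. \<psi> x *\<^sub>R v x)"
proof -
  define K where "K = support \<psi>"
  have K: "compact K" "K \<subseteq> \<Omega>" using C1_0_support[OF assms(2)] by (auto simp: K_def)
  have K_sets: "K \<in> sets lebesgue" using K(1) by (simp add: compact_imp_closed)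
  have \<Omega>_sets: "\<Omega> \<in> sets lebesgue" using assms(1) by simp
  obtain B where B: "B > 0" "\<forall>x. \<bar>\<psi> x\<bar> \<le> B \<and> norm (grad \<psi> x) \<le> B" using C1_0_bounded[OF assms(2)] by blast
  have "integrable (lebesgue_on K) v"
    using assms(3) K by (auto simp: Lp_loc_def Lp_space_1_iff)
  then have int: "integrable lebesgue (\<lambda>x. indicator K x *\<^sub>R v x)"
    using K_sets by (simp add: integrable_restrict_space)
  have "integrable lebesgue (\<lambda>x. \<psi> x *\<^sub>R (indicator K x *\<^sub>R v x))"
  proof (rule Bochner_Integration.integrable_bound)
    show "integrable lebesgue (\<lambda>x. B *\<^sub>R (indicator K x *\<^sub>R v x))" using int by (rule integrable_scaleR_right)
    have "\<psi> \<in> borel_measurable lebesgue" using C1_0_measurable(1)[OF assms(2), of UNIV] by (simp add: lebesgue_on_UNIV_eq)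
    then show "(\<lambda>x. \<psi> x *\<^sub>R (indicator K x *\<^sub>R v x)) \<in> borel_measurable lebesgue"
      by (rule borel_measurable_scaleR[OF _ borel_measurable_integrable[OF int]])
    show "AE x in lebesgue. norm (\<psi> x *\<^sub>R (indicator K x *\<^sub>R v x)) \<le> norm (B *\<^sub>R (indicator K x *\<^sub>R v x))"
    proof (rule AE_I2)
      fix x
      have "\<bar>\<psi> x\<bar> * norm (indicat_real K x *\<^sub>R v x) \<le> \<bar>B\<bar> * norm (indicat_real K x *\<^sub>R v x)"
        using B by (intro mult_right_mono) auto
      then show "norm (\<psi> x *\<^sub>R (indicator K x *\<^sub>R v x)) \<le> norm (B *\<^sub>R (indicator K x *\<^sub>R v x))"
        by (simp only: norm_scaleR)
    qed
  qed
  also have "(\<lambda>x. \<psi> x *\<^sub>R (indicator K x *\<^sub>R v x)) = (\<lambda>x. indicator \<Omega> x *\<^sub>R (\<psi> x *\<^sub>R v x))"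
  proof
    fix x
    have "\<psi> x = 0" if "x \<notin> K" using outside_support[of x \<psi>] that by (simp add: K_def)
    then show "\<psi> x *\<^sub>R (indicator K x *\<^sub>R v x) = indicator \<Omega> x *\<^sub>R (\<psi> x *\<^sub>R v x)"
      using K(2) by (cases "x \<in> K") (auto simp: indicator_def)
  qed
  finally show ?thesis using \<Omega>_sets by (simp add: integrable_restrict_space)
qed

lemma finite_measure_lebesgue_on_open:
  fixes \<Omega> :: "'a::euclidean_space set"
  assumes "open \<Omega>" "emeasure lebesgue \<Omega> < \<infinity>"
  shows "finite_measure (lebesgue_on \<Omega>)"
  using assms by (intro finite_measure_lebesgue_on fmeasurableI) auto

lemma square_integrable_Lp_loc_1:
  fixes u :: "'a::euclidean_space \<Rightarrow> 'b::euclidean_space"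
  assumes "open \<Omega>" "emeasure lebesgue \<Omega> < \<infinity>" "square_integrable (lebesgue_on \<Omega>) u"
  shows "u \<in> Lp_loc \<Omega> 1"
proof (rule integrable_Lp_loc_1[OF assms(1) square_integrable_measurable[OF assms(3)]])
  have "integrable (lebesgue_on \<Omega>) u"
    by (rule finite_measure.square_integrable_integrable[OF finite_measure_lebesgue_on_open[OF assms(1,2)] assms(3)])
  then show "integrable (lebesgue_on K) u" if "compact K" "K \<subseteq> \<Omega>" for K
    using that assms(1) by (rule_tac integrable_lebesgue_on_subset[of \<Omega>]) (auto simp: compact_imp_closed)
qed

lemma zero_trace_is_weak_gradient:
  fixes u :: "'a::euclidean_space \<Rightarrow> real"
  assumes "open \<Omega>" "emeasure lebesgue \<Omega> < \<infinity>" "zero_trace \<Omega> u g"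
  shows "is_weak_gradient \<Omega> u g"
proof -
  note si = zero_trace_square_integrable[OF assms(3)]
  have "(LINT x|lebesgue_on \<Omega>. u x *\<^sub>R grad \<eta> x) = - (LINT x|lebesgue_on \<Omega>. \<eta> x *\<^sub>R g x)"
    if \<eta>: "\<eta> \<in> Cinf_0 \<Omega>" for \<eta>
  proof -
    have \<eta>1: "\<eta> \<in> C1_0 \<Omega>" using \<eta> Cinf_0_subset_C1_0 by blast
    note si_\<eta> = C1_0_square_integrable[OF assms(1) \<eta>1]
    obtain \<psi> where \<psi>: "\<And>n. \<psi> n \<in> Cinf_0 \<Omega>" "(\<lambda>n. L2sq (lebesgue_on \<Omega>) (\<lambda>x. \<psi> n x - u x)) \<longlonglongrightarrow> 0"
      "(\<lambda>n. L2sq (lebesgue_on \<Omega>) (\<lambda>x. grad (\<psi> n) x - g x)) \<longlonglongrightarrow> 0"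
      using zero_trace_approximation[OF assms(1,3)] by blast
    have si_\<psi>: "square_integrable (lebesgue_on \<Omega>) (\<psi> n)" "square_integrable (lebesgue_on \<Omega>) (grad (\<psi> n))" for n
      using Cinf_0_square_integrable[OF assms(1) \<psi>(1)] by blast+
    have scale: "square_integrable (lebesgue_on \<Omega>) (\<lambda>x. a x *\<^sub>R e)"
      if "square_integrable (lebesgue_on \<Omega>) a" for a :: "'a \<Rightarrow> real" and e :: 'a
      using that by (auto simp: square_integrable_def power_mult_distrib)
    have inner: "square_integrable (lebesgue_on \<Omega>) (\<lambda>x. a x \<bullet> e)"
      if a: "square_integrable (lebesgue_on \<Omega>) a" for a :: "'a \<Rightarrow> 'a" and e :: 'a
    proof (rule square_integrable_bound)
      show "(\<lambda>x. a x \<bullet> e) \<in> borel_measurable (lebesgue_on \<Omega>)" using a by measurable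
      show "integrable (lebesgue_on \<Omega>) (\<lambda>x. (norm e)\<^sup>2 * (norm (a x))\<^sup>2)"
        using a by (simp add: square_integrable_def)
      show "AE x in lebesgue_on \<Omega>. (norm (a x \<bullet> e))\<^sup>2 \<le> (norm e)\<^sup>2 * (norm (a x))\<^sup>2"
      proof (rule AE_I2)
        fix x
        have "\<bar>a x \<bullet> e\<bar>\<^sup>2 \<le> (norm (a x) * norm e)\<^sup>2"
          by (intro power_mono Cauchy_Schwarz_ineq2) simp
        then show "(norm (a x \<bullet> e))\<^sup>2 \<le> (norm e)\<^sup>2 * (norm (a x))\<^sup>2"
          by (simp add: power_mult_distrib mult.commute)
      qed
    qed
    have prod: "integrable (lebesgue_on \<Omega>) (\<lambda>x. a x *\<^sub>R b x)"
      if "square_integrable (lebesgue_on \<Omega>) a" "square_integrable (lebesgue_on \<Omega>) b"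
      for a :: "'a \<Rightarrow> real" and b :: "'a \<Rightarrow> 'a"
    proof (rule Bochner_Integration.integrable_bound)
      show "integrable (lebesgue_on \<Omega>) (\<lambda>x. a x * norm (b x))"
        by (intro integrable_mult_square square_integrable_norm that)
    qed (use that in \<open>auto intro: square_integrable_measurable\<close>)
    have "(LINT x|lebesgue_on \<Omega>. u x *\<^sub>R grad \<eta> x) \<bullet> e = (- (LINT x|lebesgue_on \<Omega>. \<eta> x *\<^sub>R g x)) \<bullet> e" for e
    proof -
      have lim1: "(\<lambda>n. LINT x|lebesgue_on \<Omega>. \<psi> n x \<bullet> (grad \<eta> x \<bullet> e)) \<longlonglongrightarrow> (LINT x|lebesgue_on \<Omega>. u x \<bullet> (grad \<eta> x \<bullet> e))"
        by (rule L2_inner_tendsto[OF si_\<psi>(1) si(1) inner inner \<psi>(2)]) (simp_all add: si_\<eta>)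
      have lim2: "(LINT x|lebesgue_on \<Omega>. \<psi> n x \<bullet> (grad \<eta> x \<bullet> e)) = - (LINT x|lebesgue_on \<Omega>. grad (\<psi> n) x \<bullet> (\<eta> x *\<^sub>R e))" for n
      proof -
        have "(LINT x|lebesgue_on \<Omega>. \<psi> n x \<bullet> (grad \<eta> x \<bullet> e)) = (LINT x|lebesgue_on \<Omega>. \<psi> n x *\<^sub>R grad \<eta> x) \<bullet> e"
          using prod[OF si_\<psi>(1) si_\<eta>(2)] by (subst integral_inner_left[symmetric]) auto
        also have "(LINT x|lebesgue_on \<Omega>. \<psi> n x *\<^sub>R grad \<eta> x) = - (LINT x|lebesgue_on \<Omega>. \<eta> x *\<^sub>R grad (\<psi> n) x)"
          using \<psi>(1) Cinf_0_subset_C1_0 by (intro integration_by_parts_lebesgue_on assms \<eta>1) blast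
        also have "\<dots> \<bullet> e = - (LINT x|lebesgue_on \<Omega>. grad (\<psi> n) x \<bullet> (\<eta> x *\<^sub>R e))"
          using prod[OF si_\<eta>(1) si_\<psi>(2)] unfolding inner_minus_left by (subst integral_inner_left[symmetric]) auto
        finally show ?thesis .
      qed
      have lim3: "(\<lambda>n. LINT x|lebesgue_on \<Omega>. grad (\<psi> n) x \<bullet> (\<eta> x *\<^sub>R e)) \<longlonglongrightarrow> (LINT x|lebesgue_on \<Omega>. g x \<bullet> (\<eta> x *\<^sub>R e))"
        by (rule L2_inner_tendsto[OF si_\<psi>(2) si(2) scale scale \<psi>(3)]) (simp_all add: si_\<eta>)
      have "(LINT x|lebesgue_on \<Omega>. u x \<bullet> (grad \<eta> x \<bullet> e)) = - (LINT x|lebesgue_on \<Omega>. g x \<bullet> (\<eta> x *\<^sub>R e))"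
        using lim1 tendsto_minus[OF lim3] unfolding lim2 by (rule LIMSEQ_unique)
      moreover have "(LINT x|lebesgue_on \<Omega>. u x \<bullet> (grad \<eta> x \<bullet> e)) = (LINT x|lebesgue_on \<Omega>. u x *\<^sub>R grad \<eta> x) \<bullet> e"
        using prod[OF si(1) si_\<eta>(2)] by (subst integral_inner_left[symmetric]) auto
      moreover have "(LINT x|lebesgue_on \<Omega>. g x \<bullet> (\<eta> x *\<^sub>R e)) = (LINT x|lebesgue_on \<Omega>. \<eta> x *\<^sub>R g x) \<bullet> e"
        using prod[OF si_\<eta>(1) si(2)] by (subst integral_inner_left[symmetric]) auto
      ultimately show ?thesis by simp
    qed
    then show ?thesis by (rule vector_eq_rdot[THEN iffD1, rule_format])
  qed
  then show ?thesis
    unfolding is_weak_gradient_def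
    using square_integrable_Lp_loc_1[OF assms(1,2) si(1)] square_integrable_Lp_loc_1[OF assms(1,2) si(2)]
    by blast
qed

text \<open>Both candidates have the same integral against every test function, so the fundamental lemma
  applies to each component of their difference.\<close>

lemma weak_gradient_unique:
  fixes u :: "'a::euclidean_space \<Rightarrow> real"
  assumes "open \<Omega>" "is_weak_gradient \<Omega> u g" "is_weak_gradient \<Omega> u k"
  shows "AE x in lebesgue_on \<Omega>. g x = k x"
proof -
  have "AE x in lebesgue_on \<Omega>. (g x - k x) \<bullet> i = 0" for i
  proof (rule fundamental_lemma[OF assms(1)])
    show "integrable (lebesgue_on K) (\<lambda>x. (g x - k x) \<bullet> i)" if "compact K" "K \<subseteq> \<Omega>" for K
      using assms that by (auto simp: is_weak_gradient_def Lp_loc_def Lp_space_1_iff)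
    fix \<psi> :: "'a \<Rightarrow> real" assume \<psi>: "\<psi> \<in> Cinf_0 \<Omega>"
    then have \<psi>1: "\<psi> \<in> C1_0 \<Omega>" using Cinf_0_subset_C1_0 by blast
    have int: "integrable (lebesgue_on \<Omega>) (\<lambda>x. \<psi> x *\<^sub>R g x)" "integrable (lebesgue_on \<Omega>) (\<lambda>x. \<psi> x *\<^sub>R k x)"
      using test_function_times_locally_integrable[OF assms(1) \<psi>1] assms(2,3) by (auto simp: is_weak_gradient_def)
    have "(LINT x|lebesgue_on \<Omega>. u x *\<^sub>R grad \<psi> x) = - (LINT x|lebesgue_on \<Omega>. \<psi> x *\<^sub>R g x)"
      "(LINT x|lebesgue_on \<Omega>. u x *\<^sub>R grad \<psi> x) = - (LINT x|lebesgue_on \<Omega>. \<psi> x *\<^sub>R k x)"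
      using assms(2,3) \<psi> unfolding is_weak_gradient_def by blast+
    then have "(LINT x|lebesgue_on \<Omega>. \<psi> x *\<^sub>R g x) = (LINT x|lebesgue_on \<Omega>. \<psi> x *\<^sub>R k x)"
      by simp
    then have "0 = ((LINT x|lebesgue_on \<Omega>. \<psi> x *\<^sub>R g x - \<psi> x *\<^sub>R k x)) \<bullet> i"
      using int by simp
    also have "\<dots> = (LINT x|lebesgue_on \<Omega>. (\<psi> x *\<^sub>R g x - \<psi> x *\<^sub>R k x) \<bullet> i)"
      using int by (intro integral_inner_left[symmetric]) auto
    also have "\<dots> = (LINT x|lebesgue_on \<Omega>. \<psi> x * ((g x - k x) \<bullet> i))"
      by (simp add: inner_diff_left right_diff_distrib)
    finally show "(LINT x|lebesgue_on \<Omega>. \<psi> x * ((g x - k x) \<bullet> i)) = 0" by simp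
  qed
  then have "AE x in lebesgue_on \<Omega>. \<forall>i\<in>Basis. (g x - k x) \<bullet> i = 0"
    by (intro AE_finite_allI) auto
  then show ?thesis
    by eventually_elim (rule euclidean_eqI, simp add: inner_diff_left)
qed

text \<open>By uniqueness the representative picked by the choice operator agrees almost everywhere with any
  limit of gradients of test functions.\<close>

lemma zero_trace_weak_gradient:
  assumes "open \<Omega>" "emeasure lebesgue \<Omega> < \<infinity>" "zero_trace \<Omega> u g"
  shows "AE x in lebesgue_on \<Omega>. weak_gradient \<Omega> u x = g x" "is_weak_gradient \<Omega> u (weak_gradient \<Omega> u)"
proof -
  have g: "is_weak_gradient \<Omega> u g" by (rule zero_trace_is_weak_gradient[OF assms])
  then show w: "is_weak_gradient \<Omega> u (weak_gradient \<Omega> u)"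
    unfolding weak_gradient_def by (rule someI[of "is_weak_gradient \<Omega> u"])
  show "AE x in lebesgue_on \<Omega>. weak_gradient \<Omega> u x = g x"
    by (rule weak_gradient_unique[OF assms(1) w g])
qed

lemma square_integrable_cong_AE:
  assumes "square_integrable M f" "AE x in M. f x = g x" "g \<in> borel_measurable M"
  shows "square_integrable M g"
  using assms(2) assms
  by (intro square_integrable_bound[of g M "\<lambda>x. (norm (f x))\<^sup>2"]) (auto simp: square_integrable_def elim!: eventually_mono)

lemma L2sq_cong_AE:
  assumes "AE x in M. f x = g x" "f \<in> borel_measurable M" "g \<in> borel_measurable M"
  shows "L2sq M f = L2sq M g"
  using assms by (intro integral_cong_AE) (auto elim!: eventually_mono)

lemma W12_0_imp_zero_trace:
  assumes "open \<Omega>" "u \<in> W12_0 \<Omega>"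
  shows "zero_trace \<Omega> u (weak_gradient \<Omega> u)"
proof -
  let ?M = "lebesgue_on \<Omega>"
  have si: "square_integrable ?M u" "square_integrable ?M (weak_gradient \<Omega> u)"
    using assms(2) by (auto simp: W12_0_def W12_def Lp_space_2_iff)
  show ?thesis
    unfolding zero_trace_def
  proof (intro conjI allI impI si)
    fix \<epsilon> :: real assume \<epsilon>: "\<epsilon> > 0"
    then have "ennreal (sqrt \<epsilon>) > 0" by simp
    then obtain \<psi> where \<psi>: "\<psi> \<in> Cinf_0 \<Omega>" "eLp_norm ?M 2 (\<lambda>x. ennreal (norm (u x - \<psi> x))) +
     eLp_norm ?M 2 (\<lambda>x. ennreal (norm (weak_gradient \<Omega> u x - grad \<psi> x))) < ennreal (sqrt \<epsilon>)"
      using assms(2) unfolding W12_0_def by blast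
    note si_\<psi> = Cinf_0_square_integrable[OF assms(1) \<psi>(1)]
    have "ennreal (sqrt (L2sq ?M (\<lambda>x. u x - \<psi> x)) + sqrt (L2sq ?M (\<lambda>x. weak_gradient \<Omega> u x - grad \<psi> x))) < ennreal (sqrt \<epsilon>)"
      using \<psi>(2) eLp_norm_2_eq[OF square_integrable_diff[OF si(1) si_\<psi>(1)]]
        eLp_norm_2_eq[OF square_integrable_diff[OF si(2) si_\<psi>(2)]] by (simp add: ennreal_plus)
    then have *: "sqrt (L2sq ?M (\<lambda>x. u x - \<psi> x)) + sqrt (L2sq ?M (\<lambda>x. weak_gradient \<Omega> u x - grad \<psi> x)) < sqrt \<epsilon>"
      by (subst (asm) ennreal_less_iff) auto
    have "0 \<le> sqrt (L2sq ?M (\<lambda>x. u x - \<psi> x))" "0 \<le> sqrt (L2sq ?M (\<lambda>x. weak_gradient \<Omega> u x - grad \<psi> x))"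
      by simp_all
    with * have "sqrt (L2sq ?M (\<lambda>x. u x - \<psi> x)) \<le> sqrt \<epsilon>" "sqrt (L2sq ?M (\<lambda>x. weak_gradient \<Omega> u x - grad \<psi> x)) \<le> sqrt \<epsilon>"
      by linarith+
    then show "\<exists>\<psi>\<in>Cinf_0 \<Omega>. L2sq ?M (\<lambda>x. u x - \<psi> x) \<le> \<epsilon> \<and> L2sq ?M (\<lambda>x. weak_gradient \<Omega> u x - grad \<psi> x) \<le> \<epsilon>"
      using \<psi>(1) by (intro bexI[of _ \<psi>]) (auto simp only: real_sqrt_le_iff)
  qed
qed

lemma zero_trace_imp_W12_0:
  assumes "open \<Omega>" "emeasure lebesgue \<Omega> < \<infinity>" "zero_trace \<Omega> u g"
  shows "u \<in> W12_0 \<Omega>"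
proof -
  let ?M = "lebesgue_on \<Omega>"
  note si = zero_trace_square_integrable[OF assms(3)]
  note wg = zero_trace_weak_gradient[OF assms]
  have w_meas: "weak_gradient \<Omega> u \<in> borel_measurable ?M"
    using wg(2) by (simp add: is_weak_gradient_def Lp_loc_def)
  have siw: "square_integrable ?M (weak_gradient \<Omega> u)"
    by (rule square_integrable_cong_AE[OF si(2) _ w_meas]) (use wg(1) in \<open>auto elim!: eventually_mono\<close>)
  have "u \<in> W12 \<Omega>"
    unfolding W12_def using si siw wg(2) by (auto simp: Lp_space_2_iff)
  moreover have "\<exists>\<psi>\<in>Cinf_0 \<Omega>. eLp_norm ?M 2 (\<lambda>x. ennreal (norm (u x - \<psi> x))) +
     eLp_norm ?M 2 (\<lambda>x. ennreal (norm (weak_gradient \<Omega> u x - grad \<psi> x))) < \<epsilon>" if \<epsilon>: "\<epsilon> > 0" for \<epsilon>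
  proof -
    obtain r where r: "r > 0" "ennreal r < \<epsilon>"
    proof (cases \<epsilon>)
      case (real t)
      then show ?thesis using \<epsilon> that[of "t / 2"] by (auto simp: ennreal_less_iff)
    next
      case top
      then show ?thesis using that[of 1] by simp
    qed
    have "(r / 2)\<^sup>2 > 0" using r by simp
    then obtain \<psi> where \<psi>: "\<psi> \<in> Cinf_0 \<Omega>" "L2sq ?M (\<lambda>x. u x - \<psi> x) \<le> (r / 2)\<^sup>2" "L2sq ?M (\<lambda>x. g x - grad \<psi> x) \<le> (r / 2)\<^sup>2"
      using assms(3) unfolding zero_trace_def by blast
    note si_\<psi> = Cinf_0_square_integrable[OF assms(1) \<psi>(1)]
    have eq: "L2sq ?M (\<lambda>x. weak_gradient \<Omega> u x - grad \<psi> x) = L2sq ?M (\<lambda>x. g x - grad \<psi> x)"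
    proof (rule L2sq_cong_AE)
      show "AE x in ?M. weak_gradient \<Omega> u x - grad \<psi> x = g x - grad \<psi> x"
        using wg(1) by eventually_elim simp
    qed (use w_meas si si_\<psi> in \<open>auto intro: square_integrable_measurable\<close>)
    have "sqrt (L2sq ?M (\<lambda>x. u x - \<psi> x)) \<le> r / 2" "sqrt (L2sq ?M (\<lambda>x. weak_gradient \<Omega> u x - grad \<psi> x)) \<le> r / 2"
      unfolding eq by (rule real_le_lsqrt; use \<psi>(2,3) r(1) in simp)+
    then have "ennreal (sqrt (L2sq ?M (\<lambda>x. u x - \<psi> x)) + sqrt (L2sq ?M (\<lambda>x. weak_gradient \<Omega> u x - grad \<psi> x))) \<le> ennreal r"
      by (intro ennreal_leI) linarith
    then have "eLp_norm ?M 2 (\<lambda>x. ennreal (norm (u x - \<psi> x))) +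
      eLp_norm ?M 2 (\<lambda>x. ennreal (norm (weak_gradient \<Omega> u x - grad \<psi> x))) \<le> ennreal r"
      using eLp_norm_2_eq[OF square_integrable_diff[OF si(1) si_\<psi>(1)]]
        eLp_norm_2_eq[OF square_integrable_diff[OF siw si_\<psi>(2)]] by (simp add: ennreal_plus)
    then show ?thesis using r(2) \<psi>(1) by (meson le_less_trans)
  qed
  ultimately show ?thesis unfolding W12_0_def by blast
qed

section \<open>Weak solutions of the Poisson equation\<close>

lemma Ck_add_scaled:
  fixes f g :: "'a::euclidean_space \<Rightarrow> real"
  shows "Ck k f \<Longrightarrow> Ck k g \<Longrightarrow> Ck k (\<lambda>x. f x + c * g x)"
proof (induction k arbitrary: f g)
  case 0
  then show ?case by (auto simp: Ck.simps intro!: continuous_intros)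
next
  case (Suc k)
  have f: "(f has_derivative (\<lambda>h. grad f x \<bullet> h)) (at x)" and g: "(g has_derivative (\<lambda>h. grad g x \<bullet> h)) (at x)" for x
    using Suc.prems unfolding Ck_Suc_iff by blast+
  have d: "((\<lambda>x. f x + c * g x) has_derivative (\<lambda>h. (grad f x + c *\<^sub>R grad g x) \<bullet> h)) (at x)" for x
    by (rule has_derivative_eq_rhs[OF has_derivative_add[OF f has_derivative_mult_right[OF g]]])
      (auto simp: inner_add_left)
  then have gr: "grad (\<lambda>x. f x + c * g x) x = grad f x + c *\<^sub>R grad g x" for x by (rule grad_unique)
  have "Ck k (\<lambda>x. (grad f x + c *\<^sub>R grad g x) \<bullet> i)" if "i \<in> Basis" for i
    using Suc.IH[of "\<lambda>x. grad f x \<bullet> i" "\<lambda>x. grad g x \<bullet> i"] Suc.prems that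
    unfolding Ck_Suc_iff inner_add_left inner_scaleR_left by blast
  then show ?case using d unfolding Ck_Suc_iff gr by blast
qed

lemma Cinf_0_add_scaled:
  fixes f g :: "'a::euclidean_space \<Rightarrow> real"
  assumes "f \<in> Cinf_0 \<Omega>" "g \<in> Cinf_0 \<Omega>"
  shows "(\<lambda>x. f x + c * g x) \<in> Cinf_0 \<Omega>" "grad (\<lambda>x. f x + c * g x) x = grad f x + c *\<^sub>R grad g x"
proof -
  have C: "Ck k f" "Ck k g" for k using assms by (auto simp: Cinf_0_def)
  have S: "f \<in> C1_0 \<Omega>" "g \<in> C1_0 \<Omega>" using assms Cinf_0_subset_C1_0 by blast+
  show "(\<lambda>x. f x + c * g x) \<in> Cinf_0 \<Omega>"
  proof (rule Cinf_0I)
    show "Ck k (\<lambda>x. f x + c * g x)" for k by (intro Ck_add_scaled C)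
    show "compact (support f \<union> support g)" "support f \<union> support g \<subseteq> \<Omega>"
      using C1_0_support[OF S(1)] C1_0_support[OF S(2)] by auto
    show "f x + c * g x = 0" if "x \<notin> support f \<union> support g" for x
      using that outside_support[of x f] outside_support[of x g] by simp
  qed
  show "grad (\<lambda>x. f x + c * g x) x = grad f x + c *\<^sub>R grad g x"
  proof (rule grad_unique)
    show "((\<lambda>x. f x + c * g x) has_derivative (\<lambda>h. (grad f x + c *\<^sub>R grad g x) \<bullet> h)) (at x)"
      by (rule has_derivative_eq_rhs[OF has_derivative_add[OF Ck_1D(1)[OF C(1)]
            has_derivative_mult_right[OF Ck_1D(1)[OF C(2)]]]]) (auto simp: inner_add_left)
  qed
qed

lemma square_integrable_add_scaled:
  fixes f g :: "'a \<Rightarrow> 'b::euclidean_space"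
  assumes "square_integrable M f" "square_integrable M g"
  shows "square_integrable M (\<lambda>x. f x + c *\<^sub>R g x)"
  by (intro square_integrable_add square_integrable_scaleR assms)

lemma zero_trace_add_scaled:
  fixes u v :: "'a::euclidean_space \<Rightarrow> real"
  assumes "open \<Omega>" "zero_trace \<Omega> u g" "zero_trace \<Omega> v k"
  shows "zero_trace \<Omega> (\<lambda>x. u x + c * v x) (\<lambda>x. g x + c *\<^sub>R k x)"
proof -
  let ?M = "lebesgue_on \<Omega>"
  note si = zero_trace_square_integrable[OF assms(2)] zero_trace_square_integrable[OF assms(3)]
  obtain \<psi> where \<psi>: "\<And>n. \<psi> n \<in> Cinf_0 \<Omega>" "(\<lambda>n. L2sq ?M (\<lambda>x. \<psi> n x - u x)) \<longlonglongrightarrow> 0"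
    "(\<lambda>n. L2sq ?M (\<lambda>x. grad (\<psi> n) x - g x)) \<longlonglongrightarrow> 0"
    using zero_trace_approximation[OF assms(1,2)] by blast
  obtain \<phi> where \<phi>: "\<And>n. \<phi> n \<in> Cinf_0 \<Omega>" "(\<lambda>n. L2sq ?M (\<lambda>x. \<phi> n x - v x)) \<longlonglongrightarrow> 0"
    "(\<lambda>n. L2sq ?M (\<lambda>x. grad (\<phi> n) x - k x)) \<longlonglongrightarrow> 0"
    using zero_trace_approximation[OF assms(1,3)] by blast
  note si\<psi> = Cinf_0_square_integrable[OF assms(1) \<psi>(1)] and si\<phi> = Cinf_0_square_integrable[OF assms(1) \<phi>(1)]
  have conv: "(\<lambda>n. L2sq ?M (\<lambda>x. (a n x + c *\<^sub>R b n x) - (a0 x + c *\<^sub>R b0 x))) \<longlonglongrightarrow> 0"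
    if si: "\<And>n. square_integrable ?M (a n)" "\<And>n. square_integrable ?M (b n)" "square_integrable ?M a0" "square_integrable ?M b0"
      and lim: "(\<lambda>n. L2sq ?M (\<lambda>x. a n x - a0 x)) \<longlonglongrightarrow> 0" "(\<lambda>n. L2sq ?M (\<lambda>x. b n x - b0 x)) \<longlonglongrightarrow> 0"
    for a b :: "nat \<Rightarrow> 'a \<Rightarrow> 'c::euclidean_space" and a0 b0
  proof (rule tendsto_sandwich[OF _ _ tendsto_const])
    show "(\<lambda>n. 2 * L2sq ?M (\<lambda>x. a n x - a0 x) + 2 * (c\<^sup>2 * L2sq ?M (\<lambda>x. b n x - b0 x))) \<longlonglongrightarrow> 0"
      by (rule tendsto_eq_intros lim refl)+ simp
    have "L2sq ?M (\<lambda>x. (a n x + c *\<^sub>R b n x) - (a0 x + c *\<^sub>R b0 x))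
        \<le> 2 * L2sq ?M (\<lambda>x. a n x - a0 x) + 2 * (c\<^sup>2 * L2sq ?M (\<lambda>x. b n x - b0 x))" for n
    proof -
      have eq: "(a n x + c *\<^sub>R b n x) - (a0 x + c *\<^sub>R b0 x) = (a n x - a0 x) + c *\<^sub>R (b n x - b0 x)" for x
        by (simp add: scaleR_diff_right)
      show ?thesis
        unfolding eq using L2sq_add_le[OF square_integrable_diff[OF si(1,3)] square_integrable_scaleR[OF square_integrable_diff[OF si(2,4)], of c], of n n]
        by (simp only: L2sq_scaleR)
    qed
    then show "\<forall>\<^sub>F n in sequentially. L2sq ?M (\<lambda>x. (a n x + c *\<^sub>R b n x) - (a0 x + c *\<^sub>R b0 x))
        \<le> 2 * L2sq ?M (\<lambda>x. a n x - a0 x) + 2 * (c\<^sup>2 * L2sq ?M (\<lambda>x. b n x - b0 x))"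
      by (intro always_eventually allI)
  qed (intro always_eventually allI L2sq_nonneg)
  show ?thesis
  proof (rule zero_trace_limit[OF assms(1)])
    show "zero_trace \<Omega> (\<lambda>x. \<psi> n x + c * \<phi> n x) (\<lambda>x. grad (\<psi> n) x + c *\<^sub>R grad (\<phi> n) x)" for n
      using Cinf_0_zero_trace[OF Cinf_0_add_scaled(1)[OF \<psi>(1) \<phi>(1)] assms(1), of n c n]
      unfolding Cinf_0_add_scaled(2)[OF \<psi>(1) \<phi>(1), abs_def] .
    show "(\<lambda>n. L2sq ?M (\<lambda>x. \<psi> n x + c * \<phi> n x - (u x + c * v x))) \<longlonglongrightarrow> 0"
      using conv[OF si\<psi>(1) si\<phi>(1) si(1,3) \<psi>(2) \<phi>(2)] by simp
    show "(\<lambda>n. L2sq ?M (\<lambda>x. grad (\<psi> n) x + c *\<^sub>R grad (\<phi> n) x - (g x + c *\<^sub>R k x))) \<longlonglongrightarrow> 0"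
      by (rule conv[OF si\<psi>(2) si\<phi>(2) si(2,4) \<psi>(3) \<phi>(3)])
  qed (use square_integrable_add_scaled[OF si(1,3), of c] square_integrable_add_scaled[OF si(2,4), of c] in simp_all)
qed

lemma zero_trace_zero:
  assumes "open \<Omega>"
  shows "zero_trace \<Omega> (\<lambda>x. 0) (\<lambda>x. 0)"
proof -
  have 0: "(\<lambda>x. 0) \<in> Cinf_0 \<Omega>"
    by (rule Cinf_0I[OF bump_algebra_Ck[OF bump_algebra.const] compact_empty]) auto
  have "grad (\<lambda>x::'a. 0) = (\<lambda>x. 0)" by (auto simp: fun_eq_iff intro!: grad_unique)
  then show ?thesis using Cinf_0_zero_trace[OF 0 assms] by simp
qed

lemma zero_trace_diff:
  fixes u v :: "'a::euclidean_space \<Rightarrow> real"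
  assumes "open \<Omega>" "zero_trace \<Omega> u g" "zero_trace \<Omega> v k"
  shows "zero_trace \<Omega> (\<lambda>x. u x - v x) (\<lambda>x. g x - k x)"
  using zero_trace_add_scaled[OF assms, of "-1"] by simp

definition poincare_constant :: "'a::euclidean_space set \<Rightarrow> real \<Rightarrow> bool" where
  "poincare_constant \<Omega> P \<longleftrightarrow> P > 0 \<and>
    (\<forall>u g. zero_trace \<Omega> u g \<longrightarrow> L2sq (lebesgue_on \<Omega>) u \<le> P * L2sq (lebesgue_on \<Omega>) g)"

lemma poincare_constant_exists:
  fixes \<Omega> :: "'a::euclidean_space set"
  assumes "open \<Omega>" "emeasure lebesgue \<Omega> < \<infinity>"
  shows "\<exists>P. poincare_constant \<Omega> P"
proof -
  let ?M = "lebesgue_on \<Omega>"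
  obtain P where P: "P > 0" "\<forall>\<psi>\<in>C1_0 \<Omega>. L2sq ?M \<psi> \<le> P * L2sq ?M (grad \<psi>)"
    using poincare_inequality[OF assms] by blast
  have "L2sq ?M u \<le> P * L2sq ?M g" if ug: "zero_trace \<Omega> u g" for u g
  proof -
    note si = zero_trace_square_integrable[OF ug]
    obtain \<psi> where \<psi>: "\<And>n. \<psi> n \<in> Cinf_0 \<Omega>" "(\<lambda>n. L2sq ?M (\<lambda>x. \<psi> n x - u x)) \<longlonglongrightarrow> 0"
      "(\<lambda>n. L2sq ?M (\<lambda>x. grad (\<psi> n) x - g x)) \<longlonglongrightarrow> 0"
      using zero_trace_approximation[OF assms(1) ug] by blast
    note si\<psi> = Cinf_0_square_integrable[OF assms(1) \<psi>(1)]
    show ?thesis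
    proof (rule LIMSEQ_le)
      show "(\<lambda>n. L2sq ?M (\<psi> n)) \<longlonglongrightarrow> L2sq ?M u" by (rule L2sq_tendsto[OF si\<psi>(1) si(1) \<psi>(2)])
      show "(\<lambda>n. P * L2sq ?M (grad (\<psi> n))) \<longlonglongrightarrow> P * L2sq ?M g"
        by (intro tendsto_mult_left L2sq_tendsto[OF si\<psi>(2) si(2) \<psi>(3)])
      show "\<exists>N. \<forall>n\<ge>N. L2sq ?M (\<psi> n) \<le> P * L2sq ?M (grad (\<psi> n))"
        using P(2) \<psi>(1) Cinf_0_subset_C1_0 by blast
    qed
  qed
  then show ?thesis using P(1) unfolding poincare_constant_def by blast
qed

definition weak_solution ::
    "'a::euclidean_space set \<Rightarrow> ('a \<Rightarrow> real) \<Rightarrow> ('a \<Rightarrow> real) \<Rightarrow> ('a \<Rightarrow> 'a) \<Rightarrow> bool" where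
  "weak_solution \<Omega> h u g \<longleftrightarrow> zero_trace \<Omega> u g \<and>
    (\<forall>v k. zero_trace \<Omega> v k \<longrightarrow> (LINT x|lebesgue_on \<Omega>. g x \<bullet> k x) = (LINT x|lebesgue_on \<Omega>. h x * v x))"

lemma weak_solutionI:
  fixes u :: "'a::euclidean_space \<Rightarrow> real"
  assumes "open \<Omega>" "zero_trace \<Omega> u g" "square_integrable (lebesgue_on \<Omega>) h"
    and eq: "\<And>\<eta>. \<eta> \<in> Cinf_0 \<Omega> \<Longrightarrow> (LINT x|lebesgue_on \<Omega>. g x \<bullet> grad \<eta> x) = (LINT x|lebesgue_on \<Omega>. h x * \<eta> x)"
  shows "weak_solution \<Omega> h u g"
  unfolding weak_solution_def
proof (intro conjI allI impI assms)
  let ?M = "lebesgue_on \<Omega>"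
  fix v k assume vk: "zero_trace \<Omega> v k"
  note si = zero_trace_square_integrable[OF assms(2)] zero_trace_square_integrable[OF vk]
  obtain \<psi> where \<psi>: "\<And>n. \<psi> n \<in> Cinf_0 \<Omega>" "(\<lambda>n. L2sq ?M (\<lambda>x. \<psi> n x - v x)) \<longlonglongrightarrow> 0"
    "(\<lambda>n. L2sq ?M (\<lambda>x. grad (\<psi> n) x - k x)) \<longlonglongrightarrow> 0"
    using zero_trace_approximation[OF assms(1) vk] by blast
  note si\<psi> = Cinf_0_square_integrable[OF assms(1) \<psi>(1)]
  have "(\<lambda>n. LINT x|?M. g x \<bullet> grad (\<psi> n) x) \<longlonglongrightarrow> (LINT x|?M. g x \<bullet> k x)"
    by (rule L2_inner_tendsto[OF si(2,2) si\<psi>(2) si(4) _ \<psi>(3)]) simp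
  moreover have "(\<lambda>n. LINT x|?M. h x \<bullet> \<psi> n x) \<longlonglongrightarrow> (LINT x|?M. h x \<bullet> v x)"
    by (rule L2_inner_tendsto[OF assms(3,3) si\<psi>(1) si(3) _ \<psi>(2)]) simp
  ultimately show "(LINT x|?M. g x \<bullet> k x) = (LINT x|?M. h x * v x)"
    using eq[OF \<psi>(1)] LIMSEQ_unique by simp
qed

lemma weak_solution_energy:
  assumes "weak_solution \<Omega> h u g"
  shows "L2sq (lebesgue_on \<Omega>) g = (LINT x|lebesgue_on \<Omega>. h x * u x)"
  using assms by (auto simp: weak_solution_def power2_norm_eq_inner)

lemma weak_solution_diff:
  fixes u v :: "'a::euclidean_space \<Rightarrow> real"
  assumes "open \<Omega>" "weak_solution \<Omega> h u g" "weak_solution \<Omega> l v k"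
    and "square_integrable (lebesgue_on \<Omega>) h" "square_integrable (lebesgue_on \<Omega>) l"
  shows "weak_solution \<Omega> (\<lambda>x. h x - l x) (\<lambda>x. u x - v x) (\<lambda>x. g x - k x)"
  unfolding weak_solution_def
proof (intro conjI allI impI)
  have zt: "zero_trace \<Omega> u g" "zero_trace \<Omega> v k" using assms by (auto simp: weak_solution_def)
  then show "zero_trace \<Omega> (\<lambda>x. u x - v x) (\<lambda>x. g x - k x)" by (rule zero_trace_diff[OF assms(1)])
  fix a b assume ab: "zero_trace \<Omega> a b"
  note si = zero_trace_square_integrable[OF ab] zero_trace_square_integrable(2)[OF zt(1)] zero_trace_square_integrable(2)[OF zt(2)]
  have "(LINT x|lebesgue_on \<Omega>. (g x - k x) \<bullet> b x) = (LINT x|lebesgue_on \<Omega>. g x \<bullet> b x) - (LINT x|lebesgue_on \<Omega>. k x \<bullet> b x)"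
    using si by (simp add: inner_diff_left integrable_inner)
  also have "\<dots> = (LINT x|lebesgue_on \<Omega>. h x * a x) - (LINT x|lebesgue_on \<Omega>. l x * a x)"
    using assms(2,3) ab by (simp add: weak_solution_def)
  also have "\<dots> = (LINT x|lebesgue_on \<Omega>. (h x - l x) * a x)"
    using si assms(4,5) by (simp add: left_diff_distrib integrable_mult_square)
  finally show "(LINT x|lebesgue_on \<Omega>. (g x - k x) \<bullet> b x) = (LINT x|lebesgue_on \<Omega>. (h x - l x) * a x)" .
qed

text \<open>Stability of the solution with respect to the right-hand side. Applied to differences of
  solutions, it turns the convergence of right-hand sides into that of gradients.\<close>

lemma weak_solution_energy_bound:
  assumes "poincare_constant \<Omega> P" "weak_solution \<Omega> h u g" "square_integrable (lebesgue_on \<Omega>) h"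
  shows "L2sq (lebesgue_on \<Omega>) g \<le> P * L2sq (lebesgue_on \<Omega>) h"
proof -
  let ?M = "lebesgue_on \<Omega>"
  have zt: "zero_trace \<Omega> u g" using assms(2) by (simp add: weak_solution_def)
  note si = zero_trace_square_integrable[OF zt]
  have P: "P > 0" "L2sq ?M u \<le> P * L2sq ?M g" using assms(1) zt by (auto simp: poincare_constant_def)
  have "(L2sq ?M g)\<^sup>2 \<le> L2sq ?M h * L2sq ?M u"
    using L2_Cauchy_Schwarz[OF assms(3) si(1)] weak_solution_energy[OF assms(2)] by simp
  also have "\<dots> \<le> L2sq ?M h * (P * L2sq ?M g)" by (intro mult_left_mono P L2sq_nonneg)
  finally have "L2sq ?M g * L2sq ?M g \<le> (P * L2sq ?M h) * L2sq ?M g" by (simp add: power2_eq_square mult_ac)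
  moreover have "0 \<le> P * L2sq ?M h" using P by simp
  ultimately show ?thesis
    using L2sq_nonneg[of ?M g] by (cases "L2sq ?M g = 0") (auto simp: mult_le_cancel_right)
qed

text \<open>Direct method: a minimising sequence of the quadratic functional is Cauchy by the parallelogram
  law.\<close>

lemma weak_solution_exists:
  fixes \<Omega> :: "'a::euclidean_space set"
  assumes "open \<Omega>" "emeasure lebesgue \<Omega> < \<infinity>" "square_integrable (lebesgue_on \<Omega>) h"
  shows "\<exists>u g. weak_solution \<Omega> h u g"
proof -
  let ?M = "lebesgue_on \<Omega>"
  interpret finite_measure ?M by (rule finite_measure_lebesgue_on_open[OF assms(1,2)])
  obtain P where P: "P > 0" "\<And>u g. zero_trace \<Omega> u g \<Longrightarrow> L2sq ?M u \<le> P * L2sq ?M g"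
    using poincare_constant_exists[OF assms(1,2)] unfolding poincare_constant_def by blast
  define Q where "Q u g = L2sq ?M g - 2 * (LINT x|?M. h x * u x)" for u and g :: "'a \<Rightarrow> 'a"
  define S where "S = {Q u g | u g. zero_trace \<Omega> u g}"
  have lower: "- (P * L2sq ?M h) \<le> Q u g" if ug: "zero_trace \<Omega> u g" for u g
  proof -
    note si = zero_trace_square_integrable[OF ug]
    define b where "b = (LINT x|?M. h x * u x)"
    have "b\<^sup>2 \<le> L2sq ?M h * L2sq ?M u"
      using L2_Cauchy_Schwarz[OF assms(3) si(1)] by (simp add: b_def)
    also have "\<dots> \<le> L2sq ?M h * (P * L2sq ?M g)" by (intro mult_left_mono P ug L2sq_nonneg)
    finally have "b\<^sup>2 \<le> (P * L2sq ?M h) * L2sq ?M g" by (simp add: mult_ac)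
    also have "\<dots> \<le> ((P * L2sq ?M h + L2sq ?M g) / 2)\<^sup>2"
      using zero_le_power2[of "P * L2sq ?M h - L2sq ?M g"] by (simp add: power2_eq_square field_simps)
    finally have "b \<le> (P * L2sq ?M h + L2sq ?M g) / 2"
      by (rule power2_le_imp_le) (use P(1) in \<open>auto intro!: add_nonneg_nonneg\<close>)
    then show ?thesis by (simp add: Q_def b_def)
  qed
  have S_bdd: "bdd_below S" unfolding S_def using lower by (auto intro!: bdd_belowI)
  have S_ne: "S \<noteq> {}" unfolding S_def using zero_trace_zero[OF assms(1)] by blast
  define m where "m = Inf S"
  have m_le: "m \<le> Q u g" if "zero_trace \<Omega> u g" for u g
    unfolding m_def using that by (intro cInf_lower S_bdd) (auto simp: S_def)
  have "\<exists>u g. zero_trace \<Omega> u g \<and> Q u g < m + 1 / real (Suc n)" for n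
  proof -
    have "Inf S < m + 1 / real (Suc n)" by (simp add: m_def)
    then obtain s where "s \<in> S" "s < m + 1 / real (Suc n)" using cInf_lessD[OF S_ne] by blast
    then show ?thesis unfolding S_def by blast
  qed
  then obtain u g where ug: "\<And>n. zero_trace \<Omega> (u n) (g n)" "\<And>n. Q (u n) (g n) < m + 1 / real (Suc n)"
    by metis
  note si = zero_trace_square_integrable[OF ug(1)]
  have g_diff: "L2sq ?M (\<lambda>x. g i x - g j x) \<le> 2 / real (Suc i) + 2 / real (Suc j)" for i j
  proof -
    let ?mu = "\<lambda>x. u i x + (1 / 2) * (u j x - u i x)" and ?mg = "\<lambda>x. g i x + (1 / 2) *\<^sub>R (g j x - g i x)"
    have mid: "zero_trace \<Omega> ?mu ?mg"
      by (intro zero_trace_add_scaled zero_trace_diff assms ug)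
    have sid: "square_integrable ?M (\<lambda>x. g j x - g i x)" "square_integrable ?M (\<lambda>x. u j x - u i x)"
      by (intro square_integrable_diff si)+
    have g_mid: "L2sq ?M ?mg = L2sq ?M (g i) + 2 * (1/2) * (LINT x|?M. g i x \<bullet> (g j x - g i x)) + (1/2)\<^sup>2 * L2sq ?M (\<lambda>x. g j x - g i x)"
      by (rule L2sq_expand[OF si(2) sid(1)])
    have g_end: "L2sq ?M (g j) = L2sq ?M (g i) + 2 * 1 * (LINT x|?M. g i x \<bullet> (g j x - g i x)) + 1\<^sup>2 * L2sq ?M (\<lambda>x. g j x - g i x)"
      using L2sq_expand[OF si(2) sid(1), of i 1] by simp
    have lin: "(LINT x|?M. h x * ?mu x) = (1/2) * (LINT x|?M. h x * u i x) + (1/2) * (LINT x|?M. h x * u j x)"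
    proof -
      have "(LINT x|?M. h x * ?mu x) = (LINT x|?M. (1/2) * (h x * u i x) + (1/2) * (h x * u j x))"
        by (intro Bochner_Integration.integral_cong) (auto simp: field_simps)
      then show ?thesis using integrable_mult_square[OF assms(3) si(1)] by simp
    qed
    have "m \<le> Q ?mu ?mg" by (rule m_le[OF mid])
    then have "4 * m \<le> 2 * Q (u i) (g i) + 2 * Q (u j) (g j) - L2sq ?M (\<lambda>x. g j x - g i x)"
      unfolding Q_def g_mid lin g_end by (simp add: power2_eq_square field_simps)
    then have "L2sq ?M (\<lambda>x. g j x - g i x) \<le> 2 * (1 / real (Suc i)) + 2 * (1 / real (Suc j))"
      using ug(2)[of i] ug(2)[of j] by linarith
    then show ?thesis by (simp add: norm_minus_commute)
  qed
  have "L2_Cauchy ?M g"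
    unfolding L2_Cauchy_def
  proof (intro allI impI)
    fix e :: real assume "e > 0"
    then obtain N where N: "4 / e < real N" using reals_Archimedean2 by blast
    have "L2sq ?M (\<lambda>x. g i x - g j x) \<le> e" if "i \<ge> N" "j \<ge> N" for i j
    proof -
      have bd: "2 / real (Suc n) \<le> e / 2" if "n \<ge> N" for n
      proof -
        have "4 / e \<le> real (Suc n)" using N that by simp
        then show ?thesis using \<open>e > 0\<close> by (simp add: field_simps)
      qed
      show ?thesis using g_diff[of i j] bd[OF that(1)] bd[OF that(2)] by linarith
    qed
    then show "\<exists>N. \<forall>i\<ge>N. \<forall>j\<ge>N. L2sq ?M (\<lambda>x. g i x - g j x) \<le> e" by blast
  qed
  moreover have "L2_Cauchy ?M u"
    by (rule L2_Cauchy_dominated[OF \<open>L2_Cauchy ?M g\<close>, of _ P])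
      (use P zero_trace_diff[OF assms(1) ug(1) ug(1)] in auto)
  ultimately obtain u0 g0 where lim: "square_integrable ?M u0" "(\<lambda>n. L2sq ?M (\<lambda>x. u n x - u0 x)) \<longlonglongrightarrow> 0"
    "square_integrable ?M g0" "(\<lambda>n. L2sq ?M (\<lambda>x. g n x - g0 x)) \<longlonglongrightarrow> 0"
    using L2_complete[OF si(1), of "\<lambda>n. n"] L2_complete[OF si(2), of "\<lambda>n. n"] by blast
  have zt0: "zero_trace \<Omega> u0 g0"
    by (rule zero_trace_limit[OF assms(1) lim(1,3) ug(1) lim(2,4)])
  have Q_lim: "(\<lambda>n. Q (u n) (g n)) \<longlonglongrightarrow> Q u0 g0"
  proof -
    have "(\<lambda>n. LINT x|?M. h x \<bullet> u n x) \<longlonglongrightarrow> (LINT x|?M. h x \<bullet> u0 x)"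
      by (rule L2_inner_tendsto[OF assms(3,3) si(1) lim(1) _ lim(2)]) simp
    then show ?thesis unfolding Q_def
      by (intro tendsto_diff tendsto_mult_left L2sq_tendsto[OF si(2) lim(3,4)]) simp
  qed
  have "Q u0 g0 \<le> m"
  proof (rule LIMSEQ_le[OF Q_lim])
    show "(\<lambda>n. m + 1 / real (Suc n)) \<longlonglongrightarrow> m"
      using tendsto_add[OF tendsto_const[of m] LIMSEQ_Suc[OF lim_1_over_n]] by simp
    show "\<exists>N. \<forall>n\<ge>N. Q (u n) (g n) \<le> m + 1 / real (Suc n)" using ug(2) less_imp_le by blast
  qed
  have "weak_solution \<Omega> h u0 g0"
    unfolding weak_solution_def
  proof (intro conjI allI impI zt0)
    fix v k assume vk: "zero_trace \<Omega> v k"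
    note siv = zero_trace_square_integrable[OF vk]
    define B where "B = (LINT x|?M. g0 x \<bullet> k x) - (LINT x|?M. h x * v x)"
    have "0 \<le> 0 + 2 * t * B + t\<^sup>2 * L2sq ?M k" for t
    proof -
      have "Q u0 g0 \<le> Q (\<lambda>x. u0 x + t * v x) (\<lambda>x. g0 x + t *\<^sub>R k x)"
        using \<open>Q u0 g0 \<le> m\<close> m_le[OF zero_trace_add_scaled[OF assms(1) zt0 vk]] by (rule order_trans)
      also have "\<dots> = Q u0 g0 + 2 * t * B + t\<^sup>2 * L2sq ?M k"
      proof -
        have "(LINT x|?M. h x * (u0 x + t * v x)) = (LINT x|?M. h x * u0 x + t * (h x * v x))"
          by (intro Bochner_Integration.integral_cong) (auto simp: algebra_simps)
        also have "\<dots> = (LINT x|?M. h x * u0 x) + t * (LINT x|?M. h x * v x)"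
          using integrable_mult_square[OF assms(3) lim(1)] integrable_mult_square[OF assms(3) siv(1)] by simp
        finally show ?thesis unfolding Q_def B_def L2sq_expand[OF lim(3) siv(2)] by (simp add: algebra_simps)
      qed
      finally show ?thesis by simp
    qed
    from quadratic_nonneg_discriminant[OF this] have "B = 0" by simp
    then show "(LINT x|?M. g0 x \<bullet> k x) = (LINT x|?M. h x * v x)" by (simp add: B_def)
  qed
  then show ?thesis by blast
qed

section \<open>Positive solutions of a regularised sublinear equation\<close>

lemma smooth_abs_deriv:
  assumes "e > 0"
  shows "((\<lambda>s. sqrt (s\<^sup>2 + e\<^sup>2) - e) has_real_derivative (s / sqrt (s\<^sup>2 + e\<^sup>2))) (at s)"
proof -
  have "s\<^sup>2 + e\<^sup>2 > 0" using assms by (simp add: add_nonneg_pos)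
  then show ?thesis by (auto intro!: derivative_eq_intros simp: field_simps)
qed

lemma smooth_abs_error:
  fixes s e :: real
  assumes "e > 0"
  shows "\<bar>(sqrt (s\<^sup>2 + e\<^sup>2) - e) - \<bar>s\<bar>\<bar> \<le> e"
proof -
  have "sqrt (s\<^sup>2 + e\<^sup>2) \<le> \<bar>s\<bar> + e" using assms sqrt_sum_squares_le_sum[of "\<bar>s\<bar>" e] by simp
  moreover have "\<bar>s\<bar> \<le> sqrt (s\<^sup>2 + e\<^sup>2)" by (simp add: real_le_rsqrt)
  ultimately show ?thesis using assms by linarith
qed

text \<open>The excess of the quadratic functional over its minimum is the squared distance of the gradients,
  so that every minimising sequence converges to the solution.\<close>

lemma weak_solution_defect:
  fixes u v :: "'a::euclidean_space \<Rightarrow> real"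
  assumes "weak_solution \<Omega> h u g" "zero_trace \<Omega> v k"
  shows "L2sq (lebesgue_on \<Omega>) (\<lambda>x. k x - g x)
    = L2sq (lebesgue_on \<Omega>) k - 2 * (LINT x|lebesgue_on \<Omega>. h x * v x) + L2sq (lebesgue_on \<Omega>) g"
proof -
  have zt: "zero_trace \<Omega> u g" using assms(1) by (simp add: weak_solution_def)
  note si = zero_trace_square_integrable(2)[OF assms(2)] zero_trace_square_integrable(2)[OF zt]
  have "(LINT x|lebesgue_on \<Omega>. g x \<bullet> k x) = (LINT x|lebesgue_on \<Omega>. h x * v x)"
    using assms by (simp add: weak_solution_def)
  then show ?thesis
    using L2sq_expand[OF si, of "-1"] by (simp add: inner_commute)
qed

text \<open>The weak maximum principle: smooth approximations of the absolute value of the solution have no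
  more energy than approximations of the solution itself, so they form a minimising sequence, and
  minimising sequences converge to the solution.\<close>

lemma weak_solution_nonneg:
  fixes u :: "'a::euclidean_space \<Rightarrow> real"
  assumes "open \<Omega>" "emeasure lebesgue \<Omega> < \<infinity>" "weak_solution \<Omega> h u g"
    and h: "square_integrable (lebesgue_on \<Omega>) h" "AE x in lebesgue_on \<Omega>. 0 \<le> h x"
  shows "AE x in lebesgue_on \<Omega>. 0 \<le> u x"
proof -
  let ?M = "lebesgue_on \<Omega>"
  interpret finite_measure ?M by (rule finite_measure_lebesgue_on_open[OF assms(1,2)])
  obtain P where P: "P > 0" "\<And>u g. zero_trace \<Omega> u g \<Longrightarrow> L2sq ?M u \<le> P * L2sq ?M g"
    using poincare_constant_exists[OF assms(1,2)] unfolding poincare_constant_def by blast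
  have zt: "zero_trace \<Omega> u g" using assms(3) by (simp add: weak_solution_def)
  note si = zero_trace_square_integrable[OF zt]
  obtain \<psi> where \<psi>: "\<And>n. \<psi> n \<in> Cinf_0 \<Omega>" "(\<lambda>n. L2sq ?M (\<lambda>x. \<psi> n x - u x)) \<longlonglongrightarrow> 0"
    "(\<lambda>n. L2sq ?M (\<lambda>x. grad (\<psi> n) x - g x)) \<longlonglongrightarrow> 0"
    using zero_trace_approximation[OF assms(1) zt] by blast
  note si\<psi> = Cinf_0_square_integrable[OF assms(1) \<psi>(1)]
  have \<psi>C: "\<psi> n \<in> C1_0 \<Omega>" for n using \<psi>(1) Cinf_0_subset_C1_0 by blast
  define e where "e n = 1 / real (Suc n)" for n
  have e: "e n > 0" for n by (simp add: e_def)
  have e_lim: "e \<longlonglongrightarrow> 0" unfolding e_def using LIMSEQ_Suc[OF lim_1_over_n] by simp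
  define a where "a n s = sqrt (s\<^sup>2 + (e n)\<^sup>2) - e n" for n s
  define a' where "a' n s = s / sqrt (s\<^sup>2 + (e n)\<^sup>2)" for n s
  define v where "v n x = a n (\<psi> n x)" for n x
  have a_deriv: "(a n has_real_derivative a' n s) (at s)" for n s
    unfolding a_def a'_def using smooth_abs_deriv[OF e] .
  have pos: "s\<^sup>2 + (e n)\<^sup>2 > 0" for s n using e[of n] by (simp add: add_nonneg_pos)
  have a'_cont: "continuous_on UNIV (a' n)" for n
    unfolding a'_def using pos[of _ n] by (intro continuous_intros) (auto simp: less_le)
  have a'_bound: "\<bar>a' n s\<bar> \<le> 1" for n s
  proof -
    have "\<bar>s\<bar> \<le> sqrt (s\<^sup>2 + (e n)\<^sup>2)" by (simp add: real_le_rsqrt)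
    then show ?thesis using pos[of s n] by (simp add: a'_def)
  qed
  have vC: "v n \<in> C1_0 \<Omega>" for n
    unfolding v_def using e[of n] by (intro C1_0_compose[OF \<psi>C a_deriv a'_cont]) (simp add: a_def)
  have grad_v: "grad (v n) x = a' n (\<psi> n x) *\<^sub>R grad (\<psi> n) x" for n x
    unfolding v_def Ck_1_compose(2)[OF C1_0_Ck[OF \<psi>C] a_deriv a'_cont] ..
  note siv = C1_0_square_integrable[OF assms(1) vC]
  have v_zt: "zero_trace \<Omega> (v n) (grad (v n))" for n
    by (rule C1_0_zero_trace[OF assms(1,2) vC])
  have energy_v: "L2sq ?M (grad (v n)) \<le> L2sq ?M (grad (\<psi> n))" for n
  proof (rule L2sq_mono[OF siv(2) si\<psi>(2)])
    show "AE x in ?M. norm (grad (v n) x) \<le> norm (grad (\<psi> n) x)"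
      unfolding grad_v using a'_bound[of n] by (intro AE_I2) (auto intro!: mult_left_le_one_le)
  qed
  have si_abs: "square_integrable ?M (\<lambda>x. \<bar>u x\<bar>)"
    using square_integrable_norm[OF si(1)] by simp
  have v_lim: "(\<lambda>n. L2sq ?M (\<lambda>x. v n x - \<bar>u x\<bar>)) \<longlonglongrightarrow> 0"
  proof (rule tendsto_sandwich[OF _ _ tendsto_const])
    let ?b = "\<lambda>n. 2 * ((e n)\<^sup>2 * measure ?M (space ?M)) + 2 * L2sq ?M (\<lambda>x. \<psi> n x - u x)"
    have "?b \<longlonglongrightarrow> 2 * (0\<^sup>2 * measure ?M (space ?M)) + 2 * 0"
      by (intro tendsto_intros e_lim \<psi>(2))
    then show "?b \<longlonglongrightarrow> 0" by simp
    show "\<forall>\<^sub>F n in sequentially. L2sq ?M (\<lambda>x. v n x - \<bar>u x\<bar>) \<le> ?b n"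
    proof (intro always_eventually allI)
      fix n
      have abs_\<psi>: "square_integrable ?M (\<lambda>x. \<bar>\<psi> n x\<bar>)" using square_integrable_norm[OF si\<psi>(1)] by simp
      have "L2sq ?M (\<lambda>x. v n x - \<bar>u x\<bar>) \<le> 2 * L2sq ?M (\<lambda>x. v n x - \<bar>\<psi> n x\<bar>) + 2 * L2sq ?M (\<lambda>x. \<bar>\<psi> n x\<bar> - \<bar>u x\<bar>)"
        by (rule L2sq_diff_triangle[OF siv(1) abs_\<psi> si_abs])
      also have "L2sq ?M (\<lambda>x. v n x - \<bar>\<psi> n x\<bar>) \<le> L2sq ?M (\<lambda>x. e n)"
      proof (rule L2sq_mono[OF square_integrable_diff[OF siv(1) abs_\<psi>] square_integrable_const])
        show "AE x in ?M. norm (v n x - \<bar>\<psi> n x\<bar>) \<le> norm (e n)"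
          using smooth_abs_error[OF e[of n]] e[of n] by (intro AE_I2) (simp add: v_def a_def)
      qed
      also have "L2sq ?M (\<lambda>x. e n) = (e n)\<^sup>2 * measure ?M (space ?M)" by simp
      also have "L2sq ?M (\<lambda>x. \<bar>\<psi> n x\<bar> - \<bar>u x\<bar>) \<le> L2sq ?M (\<lambda>x. \<psi> n x - u x)"
        by (rule L2sq_mono[OF square_integrable_diff[OF abs_\<psi> si_abs] square_integrable_diff[OF si\<psi>(1) si(1)]])
          (auto intro: abs_triangle_ineq3)
      finally show "L2sq ?M (\<lambda>x. v n x - \<bar>u x\<bar>) \<le> ?b n" by simp
    qed
  qed (intro always_eventually allI L2sq_nonneg)
  \<comment> \<open>Passing to the limit in the defect identity along the comparison sequence.\<close>
  have "L2sq ?M (\<lambda>x. \<bar>u x\<bar> - u x) \<le> 2 * 0 + 2 * (P * (L2sq ?M g - 2 * (LINT x|?M. h x \<bullet> \<bar>u x\<bar>) + L2sq ?M g))"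
  proof (rule LIMSEQ_le_const)
    show "(\<lambda>n. 2 * L2sq ?M (\<lambda>x. v n x - \<bar>u x\<bar>) + 2 * (P * (L2sq ?M (grad (\<psi> n)) - 2 * (LINT x|?M. h x \<bullet> v n x) + L2sq ?M g)))
      \<longlonglongrightarrow> 2 * 0 + 2 * (P * (L2sq ?M g - 2 * (LINT x|?M. h x \<bullet> \<bar>u x\<bar>) + L2sq ?M g))"
    proof (intro tendsto_add tendsto_mult_left tendsto_diff tendsto_const v_lim)
      show "(\<lambda>n. L2sq ?M (grad (\<psi> n))) \<longlonglongrightarrow> L2sq ?M g" by (rule L2sq_tendsto[OF si\<psi>(2) si(2) \<psi>(3)])
      show "(\<lambda>n. LINT x|?M. h x \<bullet> v n x) \<longlonglongrightarrow> (LINT x|?M. h x \<bullet> \<bar>u x\<bar>)"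
        by (rule L2_inner_tendsto[OF h(1) h(1) siv(1) si_abs _ v_lim]) simp
    qed
    show "\<exists>N. \<forall>n\<ge>N. L2sq ?M (\<lambda>x. \<bar>u x\<bar> - u x)
      \<le> 2 * L2sq ?M (\<lambda>x. v n x - \<bar>u x\<bar>) + 2 * (P * (L2sq ?M (grad (\<psi> n)) - 2 * (LINT x|?M. h x \<bullet> v n x) + L2sq ?M g))"
    proof (intro exI allI impI)
      fix n
      have "L2sq ?M (\<lambda>x. \<bar>u x\<bar> - u x) \<le> 2 * L2sq ?M (\<lambda>x. \<bar>u x\<bar> - v n x) + 2 * L2sq ?M (\<lambda>x. v n x - u x)"
        by (rule L2sq_diff_triangle[OF si_abs siv(1) si(1)])
      also have "L2sq ?M (\<lambda>x. v n x - u x) \<le> P * L2sq ?M (\<lambda>x. grad (v n) x - g x)"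
        by (rule P(2)[OF zero_trace_diff[OF assms(1) v_zt zt]])
      also have "L2sq ?M (\<lambda>x. grad (v n) x - g x) = L2sq ?M (grad (v n)) - 2 * (LINT x|?M. h x * v n x) + L2sq ?M g"
        by (rule weak_solution_defect[OF assms(3) v_zt])
      also have "\<dots> \<le> L2sq ?M (grad (\<psi> n)) - 2 * (LINT x|?M. h x * v n x) + L2sq ?M g"
        using energy_v[of n] by simp
      also have "L2sq ?M (\<lambda>x. \<bar>u x\<bar> - v n x) = L2sq ?M (\<lambda>x. v n x - \<bar>u x\<bar>)" by (rule L2sq_minus_commute)
      finally show "L2sq ?M (\<lambda>x. \<bar>u x\<bar> - u x)
        \<le> 2 * L2sq ?M (\<lambda>x. v n x - \<bar>u x\<bar>) + 2 * (P * (L2sq ?M (grad (\<psi> n)) - 2 * (LINT x|?M. h x \<bullet> v n x) + L2sq ?M g))"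
        using P(1) by (simp add: mult_left_mono)
    qed
  qed
  moreover have "L2sq ?M g \<le> (LINT x|?M. h x \<bullet> \<bar>u x\<bar>)"
  proof -
    have "(LINT x|?M. h x * u x) \<le> (LINT x|?M. h x * \<bar>u x\<bar>)"
      using integrable_mult_square[OF h(1) si(1)] integrable_mult_square[OF h(1) si_abs] h(2)
      by (intro integral_mono_AE) (auto elim!: eventually_mono intro!: mult_left_mono)
    then show ?thesis using weak_solution_energy[OF assms(3)] by simp
  qed
  ultimately have "L2sq ?M (\<lambda>x. \<bar>u x\<bar> - u x) \<le> 0"
    using P(1) by (smt (verit, best) mult_nonneg_nonpos)
  then have "L2sq ?M (\<lambda>x. \<bar>u x\<bar> - u x) = 0" using L2sq_nonneg[of ?M "\<lambda>x. \<bar>u x\<bar> - u x"] by linarith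
  from L2sq_eq_0_AE[OF square_integrable_diff[OF si_abs si(1)] this]
  show ?thesis by eventually_elim linarith
qed

text \<open>The nonlinearity of the regularised equation. With the absolute value it is Lipschitz continuous
  on the whole line if \<open>\<delta> > 0\<close>, whatever the sign of the argument.\<close>

definition reg :: "real \<Rightarrow> real \<Rightarrow> real \<Rightarrow> real" where
  "reg p \<delta> s = (\<bar>s\<bar> + \<delta>) powr p"

lemma powr_shift_Lipschitz:
  fixes \<delta> p s t :: real
  assumes "\<delta> > 0" "p \<le> 1" "0 \<le> s" "s \<le> t" "0 \<le> p"
  shows "0 \<le> (t + \<delta>) powr p - (s + \<delta>) powr p" "(t + \<delta>) powr p - (s + \<delta>) powr p \<le> p * \<delta> powr (p - 1) * (t - s)"
proof -
  show "0 \<le> (t + \<delta>) powr p - (s + \<delta>) powr p"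
    using powr_mono2[of p "s + \<delta>" "t + \<delta>"] assms by simp
  show "(t + \<delta>) powr p - (s + \<delta>) powr p \<le> p * \<delta> powr (p - 1) * (t - s)"
  proof (cases "s = t")
    case False
    then have st: "s < t" using assms by simp
    have "\<exists>z. s < z \<and> z < t \<and> (t + \<delta>) powr p - (s + \<delta>) powr p = (t - s) * (p * (z + \<delta>) powr (p - 1))"
      by (rule MVT2[OF st]) (use assms in \<open>auto intro!: derivative_eq_intros\<close>)
    then obtain z where z: "s < z" "(t + \<delta>) powr p - (s + \<delta>) powr p = (t - s) * (p * (z + \<delta>) powr (p - 1))"
      by blast
    have "(z + \<delta>) powr (p - 1) \<le> \<delta> powr (p - 1)"
      using assms z(1) by (intro powr_mono2') auto
    then show ?thesis unfolding z(2) using assms st by (simp add: mult_left_mono mult.assoc mult.commute)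
  qed simp
qed

lemma reg_Lipschitz:
  assumes "\<delta> > 0" "0 \<le> p" "p \<le> 1"
  shows "\<bar>reg p \<delta> s - reg p \<delta> t\<bar> \<le> p * \<delta> powr (p - 1) * \<bar>s - t\<bar>"
proof -
  have *: "\<bar>reg p \<delta> s - reg p \<delta> t\<bar> \<le> p * \<delta> powr (p - 1) * \<bar>s - t\<bar>" if "\<bar>s\<bar> \<le> \<bar>t\<bar>" for s t
  proof -
    have "\<bar>reg p \<delta> s - reg p \<delta> t\<bar> \<le> p * \<delta> powr (p - 1) * (\<bar>t\<bar> - \<bar>s\<bar>)"
      unfolding reg_def using powr_shift_Lipschitz[of \<delta> p "\<bar>s\<bar>" "\<bar>t\<bar>"] assms that by (simp add: abs_le_iff)
    also have "\<dots> \<le> p * \<delta> powr (p - 1) * \<bar>s - t\<bar>"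
      using assms by (intro mult_left_mono) auto
    finally show ?thesis .
  qed
  show ?thesis using *[of s t] *[of t s] by (cases "\<bar>s\<bar> \<le> \<bar>t\<bar>") (auto simp: abs_minus_commute)
qed

lemma reg_mono: "0 \<le> s \<Longrightarrow> s \<le> t \<Longrightarrow> 0 \<le> p \<Longrightarrow> 0 \<le> \<delta> \<Longrightarrow> reg p \<delta> s \<le> reg p \<delta> t"
  by (simp add: reg_def powr_mono2)

lemma reg_nonneg: "0 \<le> reg p \<delta> s" by (simp add: reg_def)

lemma powr_le_one_plus:
  fixes t :: real
  assumes "0 \<le> p" "p \<le> 1" "0 \<le> t"
  shows "t powr p \<le> 1 + t"
proof (cases "t \<le> 1")
  case True
  then have "t powr p \<le> 1" using assms by (intro powr_le1) auto
  then show ?thesis using assms by simp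
next
  case False
  then have "t powr p \<le> t powr 1" using assms by (intro powr_mono) auto
  then show ?thesis using False by simp
qed

lemma (in finite_measure) square_integrable_reg:
  assumes "square_integrable M u" "0 \<le> \<delta>" "0 \<le> p" "p \<le> 1"
  shows "square_integrable M (\<lambda>x. reg p \<delta> (u x))"
proof (rule square_integrable_bound)
  have si: "square_integrable M (\<lambda>x. (1 + \<delta>) + \<bar>u x\<bar>)"
    using square_integrable_add[OF square_integrable_const[of "1 + \<delta>"] square_integrable_norm[OF assms(1)]] by simp
  then show "integrable M (\<lambda>x. (norm ((1 + \<delta>) + \<bar>u x\<bar>))\<^sup>2)" by (simp add: square_integrable_def)
  show "(\<lambda>x. reg p \<delta> (u x)) \<in> borel_measurable M" unfolding reg_def using assms(1) by measurable
  show "AE x in M. (norm (reg p \<delta> (u x)))\<^sup>2 \<le> (norm ((1 + \<delta>) + \<bar>u x\<bar>))\<^sup>2"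
  proof (intro AE_I2 power_mono)
    fix x
    show "norm (reg p \<delta> (u x)) \<le> norm ((1 + \<delta>) + \<bar>u x\<bar>)"
      using powr_le_one_plus[of p "\<bar>u x\<bar> + \<delta>"] assms by (simp add: reg_def)
  qed simp
qed

text \<open>This bounds the energy of the iterates: the quadratic term, with a small factor, is absorbed by
  the Poincare inequality.\<close>

lemma sublinear_growth:
  fixes \<epsilon> \<delta> p :: real
  assumes "0 < \<epsilon>" "0 \<le> \<delta>" "0 \<le> p" "p < 1"
  shows "\<exists>C. \<forall>s\<ge>0. (s + \<delta>) powr p * s \<le> \<epsilon> * s\<^sup>2 + C"
proof -
  have "((\<lambda>s. (s + \<delta>) powr p / s) \<longlongrightarrow> 0) at_top"
    using assms by real_asymp
  then have "\<forall>\<^sub>F s in at_top. (s + \<delta>) powr p / s < \<epsilon>" using assms(1) by (rule order_tendstoD)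
  then obtain S where S: "\<And>s. s \<ge> S \<Longrightarrow> (s + \<delta>) powr p / s < \<epsilon>" by (auto simp: eventually_at_top_linorder)
  define S' where "S' = max S 1"
  have "(s + \<delta>) powr p * s \<le> \<epsilon> * s\<^sup>2 + (S' + \<delta>) powr p * S'" if "s \<ge> 0" for s
  proof (cases "s \<ge> S'")
    case True
    then have s: "s > 0" "(s + \<delta>) powr p < \<epsilon> * s" using S[of s] by (auto simp: S'_def field_simps)
    then have "(s + \<delta>) powr p * s \<le> \<epsilon> * s * s" by (intro mult_right_mono) auto
    then show ?thesis by (simp add: power2_eq_square S'_def add_increasing2)
  next
    case False
    then have "(s + \<delta>) powr p * s \<le> (S' + \<delta>) powr p * S'"
      using assms that by (intro mult_mono powr_mono2) auto
    then show ?thesis using assms(1) by (simp add: add_increasing)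
  qed
  then show ?thesis by blast
qed

text \<open>Monotone iteration, started at zero. Increasing bounded sequences of nonnegative functions are
  Cauchy in the mean square because \<open>(t - s)\<^sup>2 \<le> t\<^sup>2 - s\<^sup>2\<close> for \<open>0 \<le> s \<le> t\<close>; the
  gradients then converge by the stability estimate for the Poisson equation.\<close>

lemma regularised_solution_exists:
  fixes \<Omega> :: "'a::euclidean_space set"
  assumes "open \<Omega>" "emeasure lebesgue \<Omega> < \<infinity>" "0 < \<delta>" "0 < p" "p < 1"
  shows "\<exists>u g. weak_solution \<Omega> (\<lambda>x. reg p \<delta> (u x)) u g \<and> (AE x in lebesgue_on \<Omega>. 0 \<le> u x)"
proof -
  let ?M = "lebesgue_on \<Omega>"
  interpret finite_measure ?M by (rule finite_measure_lebesgue_on_open[OF assms(1,2)])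
  obtain P where P: "poincare_constant \<Omega> P"
    using poincare_constant_exists[OF assms(1,2)] by blast
  have P0: "P > 0" and P1: "\<And>u g. zero_trace \<Omega> u g \<Longrightarrow> L2sq ?M u \<le> P * L2sq ?M g"
    using P unfolding poincare_constant_def by blast+
  define L where "L = p * \<delta> powr (p - 1)"
  have L: "L \<ge> 0" using assms by (simp add: L_def)
  define step where "step u = (SOME v. \<exists>k. weak_solution \<Omega> (\<lambda>x. reg p \<delta> (u x)) v k)" for u :: "'a \<Rightarrow> real"
  define u where "u = rec_nat (\<lambda>x. 0) (\<lambda>_. step)"
  have u_0: "u 0 = (\<lambda>x. 0)" and u_Suc: "u (Suc n) = step (u n)" for n by (simp_all add: u_def)
  have step: "\<exists>k. weak_solution \<Omega> (\<lambda>x. reg p \<delta> (v x)) (step v) k" if "square_integrable ?M v" for v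
  proof -
    have "square_integrable ?M (\<lambda>x. reg p \<delta> (v x))" using assms that by (intro square_integrable_reg) auto
    from weak_solution_exists[OF assms(1,2) this]
    show ?thesis unfolding step_def by (rule someI_ex)
  qed
  have si_u: "square_integrable ?M (u n)" for n
  proof (induction n)
    case (Suc n)
    then show ?case using step[OF Suc] zero_trace_square_integrable(1) unfolding u_Suc weak_solution_def by blast
  qed (simp add: u_0)
  have si_reg: "square_integrable ?M (\<lambda>x. reg p \<delta> (u n x))" for n
    using assms si_u by (intro square_integrable_reg) auto
  have "\<forall>n. \<exists>k. weak_solution \<Omega> (\<lambda>x. reg p \<delta> (u n x)) (u (Suc n)) k"
    using step[OF si_u] by (simp add: u_Suc)
  then obtain g where g: "\<And>n. weak_solution \<Omega> (\<lambda>x. reg p \<delta> (u n x)) (u (Suc n)) (g n)" by metis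
  have zt: "zero_trace \<Omega> (u (Suc n)) (g n)" for n using g[of n] by (simp add: weak_solution_def)
  note si_g = zero_trace_square_integrable(2)[OF zt]
  have nonneg: "AE x in ?M. 0 \<le> u n x" for n
  proof (cases n)
    case (Suc k)
    show ?thesis unfolding Suc by (rule weak_solution_nonneg[OF assms(1,2) g si_reg]) (simp add: reg_nonneg)
  qed (simp add: u_0)
  have mono: "AE x in ?M. u n x \<le> u (Suc n) x" for n
  proof (induction n)
    case 0
    then show ?case using nonneg[of 1] by (simp add: u_0)
  next
    case (Suc n)
    have "AE x in ?M. 0 \<le> u (Suc (Suc n)) x - u (Suc n) x"
    proof (rule weak_solution_nonneg[OF assms(1,2) weak_solution_diff[OF assms(1) g g si_reg si_reg]])
      show "square_integrable ?M (\<lambda>x. reg p \<delta> (u (Suc n) x) - reg p \<delta> (u n x))"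
        by (intro square_integrable_diff si_reg)
      show "AE x in ?M. 0 \<le> reg p \<delta> (u (Suc n) x) - reg p \<delta> (u n x)"
        using Suc nonneg[of n] by eventually_elim (use assms in \<open>simp add: reg_mono\<close>)
    qed
    then show ?case by eventually_elim simp
  qed
  have mono': "AE x in ?M. u n x \<le> u m x" if "n \<le> m" for n m
    using that
  proof (induction m rule: dec_induct)
    case (step m)
    show ?case using step.IH mono[of m] by eventually_elim linarith
  qed simp
  obtain C where C: "\<And>s. s \<ge> 0 \<Longrightarrow> (s + \<delta>) powr p * s \<le> 1 / (2 * P) * s\<^sup>2 + C"
    using sublinear_growth[of "1 / (2 * P)" \<delta> p] P0 assms by auto
  define m where "m = measure ?M (space ?M)"
  have energy: "L2sq ?M (g n) \<le> 2 * (C * m)" for n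
  proof -
    have "L2sq ?M (g n) = (LINT x|?M. reg p \<delta> (u n x) * u (Suc n) x)"
      by (rule weak_solution_energy[OF g])
    also have "\<dots> \<le> (LINT x|?M. 1 / (2 * P) * (norm (u (Suc n) x))\<^sup>2 + C)"
    proof (rule integral_mono_AE)
      show "integrable ?M (\<lambda>x. reg p \<delta> (u n x) * u (Suc n) x)" by (rule integrable_mult_square[OF si_reg si_u])
      show "integrable ?M (\<lambda>x. 1 / (2 * P) * (norm (u (Suc n) x))\<^sup>2 + C)"
        using si_u[of "Suc n"] by (simp add: square_integrable_def)
      show "AE x in ?M. reg p \<delta> (u n x) * u (Suc n) x \<le> 1 / (2 * P) * (norm (u (Suc n) x))\<^sup>2 + C"
        using nonneg[of n] nonneg[of "Suc n"] mono[of n]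
      proof eventually_elim
        case (elim x)
        have "reg p \<delta> (u n x) * u (Suc n) x \<le> (u (Suc n) x + \<delta>) powr p * u (Suc n) x"
          unfolding reg_def using elim assms by (intro mult_right_mono powr_mono2) auto
        also have "\<dots> \<le> 1 / (2 * P) * (norm (u (Suc n) x))\<^sup>2 + C" using C[of "u (Suc n) x"] elim by simp
        finally show ?case .
      qed
    qed
    also have "\<dots> = 1 / (2 * P) * L2sq ?M (u (Suc n)) + C * m"
      using si_u[of "Suc n"] by (simp add: square_integrable_def m_def)
    also have "\<dots> \<le> 1 / (2 * P) * (P * L2sq ?M (g n)) + C * m"
      using P0 P1[OF zt] by (intro add_right_mono mult_left_mono) auto
    finally show ?thesis using P0 by (simp add: field_simps)
  qed
  have bounded: "L2sq ?M (u n) \<le> P * (2 * (C * m))" for n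
  proof -
    have Suc_bound: "L2sq ?M (u (Suc k)) \<le> P * (2 * (C * m))" for k
      using P1[OF zt, of k] mult_left_mono[OF energy[of k], of P] P0 by linarith
    show ?thesis
    proof (cases n)
      case 0
      have "0 \<le> L2sq ?M (u (Suc 0))" by (rule L2sq_nonneg)
      then have "0 \<le> P * (2 * (C * m))" using Suc_bound[of 0] by linarith
      then show ?thesis unfolding 0 u_0 by simp
    qed (use Suc_bound in simp)
  qed
  have diff: "L2sq ?M (\<lambda>x. u j x - u i x) \<le> L2sq ?M (u j) - L2sq ?M (u i)" if "i \<le> j" for i j
  proof -
    have "L2sq ?M (\<lambda>x. u j x - u i x) \<le> (LINT x|?M. (norm (u j x))\<^sup>2 - (norm (u i x))\<^sup>2)"
    proof (rule integral_mono_AE)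
      show "integrable ?M (\<lambda>x. (norm (u j x - u i x))\<^sup>2)"
        using square_integrable_diff[OF si_u[of j] si_u[of i]] by (simp add: square_integrable_def)
      show "integrable ?M (\<lambda>x. (norm (u j x))\<^sup>2 - (norm (u i x))\<^sup>2)"
        using si_u[of j] si_u[of i] by (simp add: square_integrable_def)
      show "AE x in ?M. (norm (u j x - u i x))\<^sup>2 \<le> (norm (u j x))\<^sup>2 - (norm (u i x))\<^sup>2"
        using mono'[OF that] nonneg[of i]
      proof eventually_elim
        case (elim x)
        have "0 \<le> 2 * u i x * (u j x - u i x)" using elim by simp
        then show ?case by (simp add: power2_eq_square algebra_simps)
      qed
    qed
    then show ?thesis using si_u[of j] si_u[of i] by (simp add: square_integrable_def)
  qed
  have "incseq (\<lambda>n. L2sq ?M (u n))"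
  proof (rule incseq_SucI)
    fix n
    have "0 \<le> L2sq ?M (\<lambda>x. u (Suc n) x - u n x)" by (rule L2sq_nonneg)
    then show "L2sq ?M (u n) \<le> L2sq ?M (u (Suc n))" using diff[of n "Suc n"] by linarith
  qed
  then have "Cauchy (\<lambda>n. L2sq ?M (u n))"
    using bounded by (meson incseq_convergent LIMSEQ_imp_Cauchy)
  have u_Cauchy: "L2_Cauchy ?M u"
    unfolding L2_Cauchy_def
  proof (intro allI impI)
    fix e :: real assume "e > 0"
    then obtain N where N: "\<And>i j. i \<ge> N \<Longrightarrow> j \<ge> N \<Longrightarrow> \<bar>L2sq ?M (u i) - L2sq ?M (u j)\<bar> < e"
      using \<open>Cauchy (\<lambda>n. L2sq ?M (u n))\<close> unfolding Cauchy_def dist_real_def by blast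
    have "L2sq ?M (\<lambda>x. u i x - u j x) \<le> e" if "i \<ge> N" "j \<ge> N" for i j
    proof (cases "i \<le> j")
      case True
      then show ?thesis using diff[OF True] N[OF that] L2sq_minus_commute[of ?M "u i" "u j"] by linarith
    next
      case False
      then have "j \<le> i" by simp
      then show ?thesis using diff[of j i] N[OF that] by linarith
    qed
    then show "\<exists>N. \<forall>i\<ge>N. \<forall>j\<ge>N. L2sq ?M (\<lambda>x. u i x - u j x) \<le> e" by blast
  qed
  have reg_diff: "L2sq ?M (\<lambda>x. reg p \<delta> (a x) - reg p \<delta> (b x)) \<le> L\<^sup>2 * L2sq ?M (\<lambda>x. a x - b x)"
    if "square_integrable ?M a" "square_integrable ?M b" for a b
  proof -
    have "L2sq ?M (\<lambda>x. reg p \<delta> (a x) - reg p \<delta> (b x)) \<le> L2sq ?M (\<lambda>x. L *\<^sub>R (a x - b x))"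
    proof (rule L2sq_mono)
      show "square_integrable ?M (\<lambda>x. reg p \<delta> (a x) - reg p \<delta> (b x))"
        using that assms by (intro square_integrable_diff square_integrable_reg) auto
      show "square_integrable ?M (\<lambda>x. L *\<^sub>R (a x - b x))"
        by (intro square_integrable_scaleR square_integrable_diff that)
      show "AE x in ?M. norm (reg p \<delta> (a x) - reg p \<delta> (b x)) \<le> norm (L *\<^sub>R (a x - b x))"
        using reg_Lipschitz[of \<delta> p] assms L by (intro AE_I2) (simp add: L_def abs_mult)
    qed
    then show ?thesis by (simp only: L2sq_scaleR)
  qed
  have g_Cauchy: "L2_Cauchy ?M g"
  proof (rule L2_Cauchy_dominated[OF u_Cauchy])
    fix i j
    have "L2sq ?M (\<lambda>x. g i x - g j x) \<le> P * L2sq ?M (\<lambda>x. reg p \<delta> (u i x) - reg p \<delta> (u j x))"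
      by (rule weak_solution_energy_bound[OF P weak_solution_diff[OF assms(1) g g si_reg si_reg] square_integrable_diff[OF si_reg si_reg]])
    also have "\<dots> \<le> P * (L\<^sup>2 * L2sq ?M (\<lambda>x. u i x - u j x))"
      using P0 by (intro mult_left_mono reg_diff si_u) auto
    finally show "L2sq ?M (\<lambda>x. g i x - g j x) \<le> (P * L\<^sup>2) * L2sq ?M (\<lambda>x. u i x - u j x)" by (simp add: mult.assoc)
  qed (use P0 in simp)
  obtain u0 where u0: "square_integrable ?M u0" "(\<lambda>n. L2sq ?M (\<lambda>x. u n x - u0 x)) \<longlonglongrightarrow> 0"
    using L2_complete[OF si_u u_Cauchy] by blast
  obtain g0 where g0: "square_integrable ?M g0" "(\<lambda>n. L2sq ?M (\<lambda>x. g n x - g0 x)) \<longlonglongrightarrow> 0"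
    using L2_complete[OF si_g g_Cauchy] by blast
  have zt0: "zero_trace \<Omega> u0 g0"
    by (rule zero_trace_limit[OF assms(1) u0(1) g0(1) zt LIMSEQ_Suc[OF u0(2)] g0(2)])
  have si_reg0: "square_integrable ?M (\<lambda>x. reg p \<delta> (u0 x))" using assms u0 by (intro square_integrable_reg) auto
  have reg_lim: "(\<lambda>n. L2sq ?M (\<lambda>x. reg p \<delta> (u n x) - reg p \<delta> (u0 x))) \<longlonglongrightarrow> 0"
  proof (rule tendsto_sandwich[OF _ _ tendsto_const])
    show "(\<lambda>n. L\<^sup>2 * L2sq ?M (\<lambda>x. u n x - u0 x)) \<longlonglongrightarrow> 0" using tendsto_mult_left[OF u0(2), of "L\<^sup>2"] by simp
    show "\<forall>\<^sub>F n in sequentially. L2sq ?M (\<lambda>x. reg p \<delta> (u n x) - reg p \<delta> (u0 x)) \<le> L\<^sup>2 * L2sq ?M (\<lambda>x. u n x - u0 x)"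
      by (intro always_eventually allI reg_diff si_u u0)
  qed (intro always_eventually allI L2sq_nonneg)
  have "weak_solution \<Omega> (\<lambda>x. reg p \<delta> (u0 x)) u0 g0"
    unfolding weak_solution_def
  proof (intro conjI allI impI zt0)
    fix v k assume vk: "zero_trace \<Omega> v k"
    note siv = zero_trace_square_integrable[OF vk]
    have "(\<lambda>n. LINT x|?M. g n x \<bullet> k x) \<longlonglongrightarrow> (LINT x|?M. g0 x \<bullet> k x)"
      by (rule L2_inner_tendsto[OF si_g g0(1) siv(2) siv(2) g0(2)]) simp
    moreover have "(\<lambda>n. LINT x|?M. reg p \<delta> (u n x) \<bullet> v x) \<longlonglongrightarrow> (LINT x|?M. reg p \<delta> (u0 x) \<bullet> v x)"
      by (rule L2_inner_tendsto[OF si_reg si_reg0 siv(1) siv(1) reg_lim]) simp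
    moreover have "(LINT x|?M. g n x \<bullet> k x) = (LINT x|?M. reg p \<delta> (u n x) \<bullet> v x)" for n
      using g[of n] vk by (simp add: weak_solution_def)
    ultimately show "(LINT x|?M. g0 x \<bullet> k x) = (LINT x|?M. reg p \<delta> (u0 x) * v x)"
      using LIMSEQ_unique by simp
  qed
  moreover have "AE x in ?M. 0 \<le> u0 x"
    by (rule weak_solution_nonneg[OF assms(1,2) \<open>weak_solution \<Omega> (\<lambda>x. reg p \<delta> (u0 x)) u0 g0\<close> si_reg0])
      (simp add: reg_nonneg)
  ultimately show ?thesis by blast
qed

section \<open>From solutions to dual pairs\<close>

lemma Lipschitz_L2_tendsto:
  fixes f :: "nat \<Rightarrow> 'a \<Rightarrow> real" and h :: "real \<Rightarrow> real"
  assumes f: "\<And>n. square_integrable M (f n)" "square_integrable M f0"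
    and lim: "(\<lambda>n. L2sq M (\<lambda>x. f n x - f0 x)) \<longlonglongrightarrow> 0"
    and h: "\<And>s t. \<bar>h s - h t\<bar> \<le> B * \<bar>s - t\<bar>"
    and si: "\<And>n. square_integrable M (\<lambda>x. h (f n x))" "square_integrable M (\<lambda>x. h (f0 x))"
  shows "(\<lambda>n. L2sq M (\<lambda>x. h (f n x) - h (f0 x))) \<longlonglongrightarrow> 0"
proof (rule tendsto_sandwich[OF _ _ tendsto_const])
  show "(\<lambda>n. B\<^sup>2 * L2sq M (\<lambda>x. f n x - f0 x)) \<longlonglongrightarrow> 0" using tendsto_mult_left[OF lim, of "B\<^sup>2"] by simp
  have "L2sq M (\<lambda>x. h (f n x) - h (f0 x)) \<le> B\<^sup>2 * L2sq M (\<lambda>x. f n x - f0 x)" for n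
  proof -
    have "L2sq M (\<lambda>x. h (f n x) - h (f0 x)) \<le> L2sq M (\<lambda>x. B *\<^sub>R (f n x - f0 x))"
    proof (rule L2sq_mono[OF square_integrable_diff[OF si] square_integrable_scaleR[OF square_integrable_diff[OF f]]])
      show "AE x in M. norm (h (f n x) - h (f0 x)) \<le> norm (B *\<^sub>R (f n x - f0 x))"
      proof (rule AE_I2)
        fix x
        have "\<bar>h (f n x) - h (f0 x)\<bar> \<le> B * \<bar>f n x - f0 x\<bar>" by (rule h)
        also have "\<dots> \<le> \<bar>B\<bar> * \<bar>f n x - f0 x\<bar>" by (intro mult_right_mono) auto
        finally show "norm (h (f n x) - h (f0 x)) \<le> norm (B *\<^sub>R (f n x - f0 x))" by (simp add: abs_mult)
      qed
    qed
    then show ?thesis by (simp only: L2sq_scaleR)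
  qed
  then show "\<forall>\<^sub>F n in sequentially. L2sq M (\<lambda>x. h (f n x) - h (f0 x)) \<le> B\<^sup>2 * L2sq M (\<lambda>x. f n x - f0 x)"
    by (intro always_eventually allI)
qed (intro always_eventually allI L2sq_nonneg)

lemma (in finite_measure) square_integrable_Lipschitz:
  fixes h :: "real \<Rightarrow> real"
  assumes "square_integrable M f" "\<And>s t. \<bar>h s - h t\<bar> \<le> B * \<bar>s - t\<bar>" "continuous_on UNIV h"
  shows "square_integrable M (\<lambda>x. h (f x))"
proof (rule square_integrable_bound)
  have "square_integrable M (\<lambda>x. \<bar>h 0\<bar> + B *\<^sub>R \<bar>f x\<bar>)"
    using square_integrable_add[OF square_integrable_const square_integrable_scaleR[OF square_integrable_norm[OF assms(1)]]]
    by simp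
  then show "integrable M (\<lambda>x. (norm (\<bar>h 0\<bar> + B *\<^sub>R \<bar>f x\<bar>))\<^sup>2)" by (simp add: square_integrable_def)
  have "h \<in> borel_measurable borel" using assms(3) by (rule borel_measurable_continuous_onI)
  then show "(\<lambda>x. h (f x)) \<in> borel_measurable M" using assms(1) by measurable
  show "AE x in M. (norm (h (f x)))\<^sup>2 \<le> (norm (\<bar>h 0\<bar> + B *\<^sub>R \<bar>f x\<bar>))\<^sup>2"
  proof (intro AE_I2 power_mono)
    fix x
    show "norm (h (f x)) \<le> norm (\<bar>h 0\<bar> + B *\<^sub>R \<bar>f x\<bar>)" using assms(2)[of "f x" 0] by simp
  qed simp
qed

lemma bounded_derivative_Lipschitz:
  fixes h :: "real \<Rightarrow> real"
  assumes "\<And>s. (h has_real_derivative h' s) (at s)" "\<And>s. \<bar>h' s\<bar> \<le> B"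
  shows "\<bar>h s - h t\<bar> \<le> B * \<bar>s - t\<bar>"
  using field_differentiable_bound[of UNIV h h' B s t] assms
  by (simp add: has_field_derivative_at_within)

text \<open>The equation may be tested with \<open>\<psi> h(u)\<close>, with the gradient given by the chain and product rules.
  This is seen along smooth approximations of \<open>u\<close>, where the classical rules hold.\<close>

lemma weak_solution_test_composition:
  fixes u :: "'a::euclidean_space \<Rightarrow> real" and h h' :: "real \<Rightarrow> real"
  assumes \<Omega>: "open \<Omega>" "emeasure lebesgue \<Omega> < \<infinity>"
    and sol: "weak_solution \<Omega> H u g" and H: "square_integrable (lebesgue_on \<Omega>) H"
    and \<psi>: "\<psi> \<in> C1_0 \<Omega>"
    and h: "\<And>s. (h has_real_derivative h' s) (at s)" "continuous_on UNIV h'" "\<And>s. \<bar>h' s\<bar> \<le> B"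
  shows "(LINT x|lebesgue_on \<Omega>. (g x \<bullet> grad \<psi> x) * h (u x)) + (LINT x|lebesgue_on \<Omega>. \<psi> x * h' (u x) * (norm (g x))\<^sup>2)
    = (LINT x|lebesgue_on \<Omega>. H x * \<psi> x * h (u x))"
proof -
  let ?M = "lebesgue_on \<Omega>"
  interpret finite_measure ?M by (rule finite_measure_lebesgue_on_open[OF \<Omega>])
  have zt: "zero_trace \<Omega> u g" using sol by (simp add: weak_solution_def)
  note si = zero_trace_square_integrable[OF zt]
  obtain \<phi> where \<phi>: "\<And>n. \<phi> n \<in> Cinf_0 \<Omega>" "(\<lambda>n. L2sq ?M (\<lambda>x. \<phi> n x - u x)) \<longlonglongrightarrow> 0"
    "(\<lambda>n. L2sq ?M (\<lambda>x. grad (\<phi> n) x - g x)) \<longlonglongrightarrow> 0" "AE x in ?M. (\<lambda>n. \<phi> n x) \<longlonglongrightarrow> u x"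
    using zero_trace_approximation[OF \<Omega>(1) zt] by blast
  note si\<phi> = Cinf_0_square_integrable[OF \<Omega>(1) \<phi>(1)]
  have \<phi>C: "Ck 1 (\<phi> n)" for n using \<phi>(1)[of n] by (simp add: Cinf_0_def)
  have h_cont: "continuous_on UNIV h"
    using h(1) DERIV_isCont by (auto simp: continuous_on_eq_continuous_at)
  have h_meas[measurable]: "h \<in> borel_measurable borel" "h' \<in> borel_measurable borel"
    using h_cont h(2) by (auto intro: borel_measurable_continuous_onI)
  have lip: "\<bar>h s - h t\<bar> \<le> B * \<bar>s - t\<bar>" for s t by (rule bounded_derivative_Lipschitz[OF h(1,3)])
  have si_h: "square_integrable ?M (\<lambda>x. h (v x))" if "square_integrable ?M v" for v :: "'a \<Rightarrow> real"
    by (rule square_integrable_Lipschitz[OF that lip h_cont])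
  obtain K where K: "K > 0" "\<forall>x. \<bar>\<psi> x\<bar> \<le> K \<and> norm (grad \<psi> x) \<le> K" using C1_0_bounded[OF \<psi>] by blast
  note \<psi>_meas[measurable] = C1_0_measurable(1,2)[OF \<psi>, of \<Omega>]
  note u_meas[measurable] = square_integrable_measurable[OF si(1)] square_integrable_measurable[OF si(2)] square_integrable_measurable[OF H]
  have \<phi>_meas[measurable]: "\<phi> n \<in> borel_measurable ?M" "grad (\<phi> n) \<in> borel_measurable ?M" for n
    using si\<phi>[of n] by (auto simp: square_integrable_def)
  define \<zeta> where "\<zeta> n x = \<psi> x * h (\<phi> n x)" for n x
  have \<zeta>C: "\<zeta> n \<in> C1_0 \<Omega>" for n
    unfolding \<zeta>_def by (rule C1_0_mult[OF \<psi> Ck_1_compose(1)[OF \<phi>C h(1,2)]])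
  have grad_\<zeta>: "grad (\<zeta> n) x = h (\<phi> n x) *\<^sub>R grad \<psi> x + \<psi> x *\<^sub>R (h' (\<phi> n x) *\<^sub>R grad (\<phi> n) x)" for n x
    unfolding \<zeta>_def Ck_1_mult(2)[OF C1_0_Ck[OF \<psi>] Ck_1_compose(1)[OF \<phi>C h(1,2)]]
      Ck_1_compose(2)[OF \<phi>C h(1,2)] ..
  have si_g\<psi>: "square_integrable ?M (\<lambda>x. g x \<bullet> grad \<psi> x)"
  proof (rule square_integrable_bound)
    show "integrable ?M (\<lambda>x. K\<^sup>2 * (norm (g x))\<^sup>2)" using si(2) by (simp add: square_integrable_def)
    show "AE x in ?M. (norm (g x \<bullet> grad \<psi> x))\<^sup>2 \<le> K\<^sup>2 * (norm (g x))\<^sup>2"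
    proof (rule AE_I2)
      fix x
      have "\<bar>g x \<bullet> grad \<psi> x\<bar> \<le> norm (g x) * norm (grad \<psi> x)" by (rule Cauchy_Schwarz_ineq2)
      also have "\<dots> \<le> norm (g x) * K" using K by (intro mult_left_mono) auto
      finally have "\<bar>g x \<bullet> grad \<psi> x\<bar>\<^sup>2 \<le> (norm (g x) * K)\<^sup>2" by (intro power_mono) auto
      then show "(norm (g x \<bullet> grad \<psi> x))\<^sup>2 \<le> K\<^sup>2 * (norm (g x))\<^sup>2" by (simp add: power_mult_distrib mult.commute)
    qed
  qed measurable
  have si_H\<psi>: "square_integrable ?M (\<lambda>x. H x * \<psi> x)"
    using square_integrable_bounded_mult[OF H \<psi>_meas(1), of K] K by (simp add: mult.commute)
  have si_F: "square_integrable ?M (\<lambda>x. (\<psi> x * h' (v x)) *\<^sub>R g x)" if "v \<in> borel_measurable ?M" for v :: "'a \<Rightarrow> real"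
  proof (rule square_integrable_bounded_mult[OF si(2)])
    show "(\<lambda>x. \<psi> x * h' (v x)) \<in> borel_measurable ?M" using that by measurable
    show "AE x in ?M. \<bar>\<psi> x * h' (v x)\<bar> \<le> K * B"
      using K h(3) by (intro AE_I2) (auto simp: abs_mult intro!: mult_mono)
  qed
  have h_lim: "(\<lambda>n. L2sq ?M (\<lambda>x. h (\<phi> n x) - h (u x))) \<longlonglongrightarrow> 0"
    by (rule Lipschitz_L2_tendsto[OF si\<phi>(1) si(1) \<phi>(2) lip si_h si_h]) (intro si\<phi>(1) si(1))+
  have lim1: "(\<lambda>n. LINT x|?M. (g x \<bullet> grad \<psi> x) \<bullet> h (\<phi> n x)) \<longlonglongrightarrow> (LINT x|?M. (g x \<bullet> grad \<psi> x) \<bullet> h (u x))"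
    by (rule L2_inner_tendsto[OF si_g\<psi> si_g\<psi> si_h si_h _ h_lim]) (simp_all add: si\<phi>(1) si(1))
  have lim2: "(\<lambda>n. LINT x|?M. (H x * \<psi> x) \<bullet> h (\<phi> n x)) \<longlonglongrightarrow> (LINT x|?M. (H x * \<psi> x) \<bullet> h (u x))"
    by (rule L2_inner_tendsto[OF si_H\<psi> si_H\<psi> si_h si_h _ h_lim]) (simp_all add: si\<phi>(1) si(1))
  have F_lim: "(\<lambda>n. L2sq ?M (\<lambda>x. (\<psi> x * h' (\<phi> n x)) *\<^sub>R g x - (\<psi> x * h' (u x)) *\<^sub>R g x)) \<longlonglongrightarrow> (LINT x|?M. 0)"
  proof (rule integral_dominated_convergence[where w = "\<lambda>x. (K * (2 * B))\<^sup>2 * (norm (g x))\<^sup>2"])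
    show "integrable ?M (\<lambda>x. (K * (2 * B))\<^sup>2 * (norm (g x))\<^sup>2)" using si(2) by (simp add: square_integrable_def)
    show "AE x in ?M. (\<lambda>n. (norm ((\<psi> x * h' (\<phi> n x)) *\<^sub>R g x - (\<psi> x * h' (u x)) *\<^sub>R g x))\<^sup>2) \<longlonglongrightarrow> 0"
      using \<phi>(4)
    proof eventually_elim
      case (elim x)
      have "(\<lambda>n. h' (\<phi> n x)) \<longlonglongrightarrow> h' (u x)"
        using continuous_on_tendsto_compose[OF h(2) elim] by simp
      then have "(\<lambda>n. (norm ((\<psi> x * h' (\<phi> n x)) *\<^sub>R g x - (\<psi> x * h' (u x)) *\<^sub>R g x))\<^sup>2)
          \<longlonglongrightarrow> (norm ((\<psi> x * h' (u x)) *\<^sub>R g x - (\<psi> x * h' (u x)) *\<^sub>R g x))\<^sup>2"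
        by (intro tendsto_intros)
      then show ?case by simp
    qed
    show "AE x in ?M. norm ((norm ((\<psi> x * h' (\<phi> n x)) *\<^sub>R g x - (\<psi> x * h' (u x)) *\<^sub>R g x))\<^sup>2) \<le> (K * (2 * B))\<^sup>2 * (norm (g x))\<^sup>2" for n
    proof (rule AE_I2)
      fix x
      have "\<bar>\<psi> x\<bar> * \<bar>h' (\<phi> n x) - h' (u x)\<bar> \<le> K * (2 * B)"
        using K h(3)[of "\<phi> n x"] h(3)[of "u x"] by (intro mult_mono) auto
      then have "(\<bar>\<psi> x\<bar> * \<bar>h' (\<phi> n x) - h' (u x)\<bar> * norm (g x))\<^sup>2 \<le> (K * (2 * B) * norm (g x))\<^sup>2"
        by (intro power_mono mult_right_mono) auto
      moreover have "norm ((\<psi> x * h' (\<phi> n x)) *\<^sub>R g x - (\<psi> x * h' (u x)) *\<^sub>R g x) = \<bar>\<psi> x\<bar> * \<bar>h' (\<phi> n x) - h' (u x)\<bar> * norm (g x)"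
        by (simp add: scaleR_diff_left[symmetric] right_diff_distrib[symmetric] abs_mult)
      ultimately show "norm ((norm ((\<psi> x * h' (\<phi> n x)) *\<^sub>R g x - (\<psi> x * h' (u x)) *\<^sub>R g x))\<^sup>2) \<le> (K * (2 * B))\<^sup>2 * (norm (g x))\<^sup>2"
        by (simp add: power_mult_distrib)
    qed
  qed measurable
  have lim3: "(\<lambda>n. LINT x|?M. ((\<psi> x * h' (\<phi> n x)) *\<^sub>R g x) \<bullet> grad (\<phi> n) x) \<longlonglongrightarrow> (LINT x|?M. ((\<psi> x * h' (u x)) *\<^sub>R g x) \<bullet> g x)"
    by (rule L2_inner_tendsto[OF si_F si_F si\<phi>(2) si(2) _ \<phi>(3)]) (use F_lim in simp_all)
  have eq: "(LINT x|?M. (g x \<bullet> grad \<psi> x) \<bullet> h (\<phi> n x)) + (LINT x|?M. ((\<psi> x * h' (\<phi> n x)) *\<^sub>R g x) \<bullet> grad (\<phi> n) x)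
      = (LINT x|?M. (H x * \<psi> x) \<bullet> h (\<phi> n x))" for n
  proof -
    have e1: "(LINT x|?M. g x \<bullet> grad (\<zeta> n) x) = (LINT x|?M. H x * \<zeta> n x)"
      using sol C1_0_zero_trace[OF \<Omega> \<zeta>C, of n] by (simp add: weak_solution_def)
    have e2: "(LINT x|?M. H x * \<zeta> n x) = (LINT x|?M. (H x * \<psi> x) \<bullet> h (\<phi> n x))"
      by (simp add: \<zeta>_def mult.assoc)
    have e3: "(LINT x|?M. g x \<bullet> grad (\<zeta> n) x)
        = (LINT x|?M. (g x \<bullet> grad \<psi> x) \<bullet> h (\<phi> n x) + ((\<psi> x * h' (\<phi> n x)) *\<^sub>R g x) \<bullet> grad (\<phi> n) x)"
      by (intro Bochner_Integration.integral_cong) (auto simp: grad_\<zeta> inner_add_right mult.commute mult.left_commute)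
    also have "(LINT x|?M. (g x \<bullet> grad \<psi> x) \<bullet> h (\<phi> n x) + ((\<psi> x * h' (\<phi> n x)) *\<^sub>R g x) \<bullet> grad (\<phi> n) x)
      = (LINT x|?M. (g x \<bullet> grad \<psi> x) \<bullet> h (\<phi> n x)) + (LINT x|?M. ((\<psi> x * h' (\<phi> n x)) *\<^sub>R g x) \<bullet> grad (\<phi> n) x)"
      by (intro Bochner_Integration.integral_add integrable_inner si_g\<psi> si_h si\<phi> si_F) measurable
    finally show ?thesis using e1 e2 by (simp only:)
  qed
  have "(LINT x|?M. (g x \<bullet> grad \<psi> x) \<bullet> h (u x)) + (LINT x|?M. ((\<psi> x * h' (u x)) *\<^sub>R g x) \<bullet> g x) = (LINT x|?M. (H x * \<psi> x) \<bullet> h (u x))"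
    using tendsto_add[OF lim1 lim3] lim2 unfolding eq by (rule LIMSEQ_unique)
  then show ?thesis by (simp add: power2_norm_eq_inner mult.assoc)
qed

text \<open>The negative power \<open>(s + a)\<^bsup>-p\<^esup>\<close>, continued for negative \<open>s\<close> by its tangent at zero.\<close>

definition neg_power :: "real \<Rightarrow> real \<Rightarrow> real \<Rightarrow> real" where
  "neg_power p a s = (if 0 \<le> s then (s + a) powr (- p) else a powr (- p) - p * a powr (- p - 1) * s)"

lemma neg_power_deriv:
  assumes "a > 0"
  shows "(neg_power p a has_real_derivative (- p * (max s 0 + a) powr (- p - 1))) (at s)"
proof -
  have d1: "((\<lambda>s. (s + a) powr (- p)) has_real_derivative (- p * (s + a) powr (- p - 1))) (at s)" if "s \<ge> 0" for s
    using assms that by (auto intro!: derivative_eq_intros)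
  have d2: "((\<lambda>s. a powr (- p) - p * a powr (- p - 1) * s) has_real_derivative (- p * a powr (- p - 1))) (at s)" for s
    by (auto intro!: derivative_eq_intros)
  consider "s > 0" | "s < 0" | "s = 0" by linarith
  then show ?thesis
  proof cases
    case 1
    have "(neg_power p a has_real_derivative (- p * (s + a) powr (- p - 1))) (at s)"
      by (rule has_field_derivative_transform_within_open[OF d1[OF less_imp_le[OF 1]], of "{0<..}"])
        (use 1 in \<open>auto simp: neg_power_def\<close>)
    then show ?thesis using 1 by simp
  next
    case 2
    have "(neg_power p a has_real_derivative (- p * a powr (- p - 1))) (at s)"
      by (rule has_field_derivative_transform_within_open[OF d2, of "{..<0}"])
        (use 2 in \<open>auto simp: neg_power_def\<close>)
    then show ?thesis using 2 by simp
  next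
    case 3
    have d10: "((\<lambda>s. (s + a) powr (- p)) has_real_derivative (- p * a powr (- p - 1))) (at 0)"
      using d1[of 0] by simp
    have "(neg_power p a has_real_derivative (- p * a powr (- p - 1))) (at 0 within {0..})"
      by (rule has_field_derivative_transform_within[OF has_field_derivative_at_within[OF d10] zero_less_one])
        (auto simp: neg_power_def)
    then have r: "(neg_power p a has_real_derivative (- p * a powr (- p - 1))) (at_right 0)"
      by (rule DERIV_subset) auto
    have "(neg_power p a has_real_derivative (- p * a powr (- p - 1))) (at 0 within {..0})"
      by (rule has_field_derivative_transform_within[OF has_field_derivative_at_within[OF d2] zero_less_one])
        (auto simp: neg_power_def)
    then have l: "(neg_power p a has_real_derivative (- p * a powr (- p - 1))) (at_left 0)"
      by (rule DERIV_subset) auto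
    show ?thesis using r l 3 by (simp add: has_field_derivative_iff filterlim_split_at)
  qed
qed

lemma weighted_young:
  fixes b c p :: real
  assumes "p > 0"
  shows "2 * b * c \<le> p / 2 * b\<^sup>2 + 2 / p * c\<^sup>2"
proof -
  have "0 \<le> (p * b - 2 * c)\<^sup>2 / (2 * p)" using assms by simp
  also have "\<dots> = p / 2 * b\<^sup>2 + 2 / p * c\<^sup>2 - 2 * b * c"
    using assms by (simp add: power2_eq_square field_simps)
  finally show ?thesis by simp
qed

text \<open>The common situation of the approximating solutions (\<open>\<delta> > 0\<close>) and of the positive maximiser
  (\<open>\<delta> = 0\<close>). With \<open>U\<close> standing for \<open>u + \<delta>\<close>, the equation is \<open>- \<Delta> U = U\<^bsup>q-1\<^esup>\<close> in the weak sense.\<close>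

locale singular_solution =
  fixes \<Omega> :: "'a::euclidean_space set" and q \<delta> :: real and u :: "'a \<Rightarrow> real" and g :: "'a \<Rightarrow> 'a"
  assumes open_\<Omega>: "open \<Omega>" and finite_\<Omega>: "emeasure lebesgue \<Omega> < \<infinity>"
    and q: "1 < q" "q < 2" and \<delta>: "0 \<le> \<delta>"
    and sol: "weak_solution \<Omega> (\<lambda>x. reg (q - 1) \<delta> (u x)) u g"
    and u_nonneg: "AE x in lebesgue_on \<Omega>. 0 \<le> u x"
    and u_pos: "AE x in lebesgue_on \<Omega>. 0 < u x + \<delta>"
begin

abbreviation "M \<equiv> lebesgue_on \<Omega>"

text \<open>The absolute value changes \<open>u + \<delta>\<close> on a null set and makes the function nonnegative everywhere.\<close>

definition "U x = \<bar>u x\<bar> + \<delta>"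
definition "f\<^sub>0 x = - (q - 1) * ((norm (g x))\<^sup>2 / U x powr q)"
definition "\<phi>\<^sub>0 x = g x /\<^sub>R (U x powr (q - 1))"

lemma finite_M: "finite_measure M"
  by (rule finite_measure_lebesgue_on_open[OF open_\<Omega> finite_\<Omega>])

sublocale finite_measure M by (rule finite_M)

lemma u_zero_trace: "zero_trace \<Omega> u g" using sol by (simp add: weak_solution_def)

lemma u_g_square_integrable: "square_integrable M u" "square_integrable M g"
  using zero_trace_square_integrable[OF u_zero_trace] .

lemma u_measurable [measurable]: "u \<in> borel_measurable M" "g \<in> borel_measurable M"
  using u_g_square_integrable by (simp_all add: square_integrable_def)

lemma U_measurable [measurable]: "U \<in> borel_measurable M"
  unfolding U_def[abs_def] by measurable

lemma U_nonneg: "0 \<le> U x" using \<delta> by (simp add: U_def)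

lemma U_pos: "AE x in M. 0 < U x \<and> 0 \<le> u x"
  using u_nonneg u_pos by eventually_elim (simp add: U_def)

lemma U_integrable: "integrable M U"
proof -
  have "integrable M (\<lambda>x. \<bar>u x\<bar>)" using square_integrable_integrable[OF u_g_square_integrable(1)] by simp
  then show ?thesis unfolding U_def[abs_def] by simp
qed

lemma g_sq_integrable: "integrable M (\<lambda>x. (norm (g x))\<^sup>2)"
  using u_g_square_integrable(2) by (simp add: square_integrable_def)

text \<open>This is the equation tested with \<open>\<psi> (U + \<epsilon>)\<^bsup>-(q-1)\<^esup>\<close>. For \<open>\<epsilon> > 0\<close> the negative power is a
  \<open>C\<^sup>1\<close> function of \<open>u\<close> with bounded derivative, even when \<open>\<delta> = 0\<close>.\<close>

lemma tested_equation:
  assumes \<psi>: "\<psi> \<in> C1_0 \<Omega>" and \<epsilon>: "\<epsilon> > 0"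
  shows "(LINT x|M. (g x \<bullet> grad \<psi> x) * (U x + \<epsilon>) powr (- (q - 1)))
      - (q - 1) * (LINT x|M. \<psi> x * (norm (g x))\<^sup>2 * (U x + \<epsilon>) powr (- q))
    = (LINT x|M. U x powr (q - 1) * \<psi> x * (U x + \<epsilon>) powr (- (q - 1)))"
proof -
  define p where "p = q - 1"
  have p: "0 < p" "p < 1" "- p - 1 = - q" using q by (auto simp: p_def)
  define a where "a = \<delta> + \<epsilon>"
  have a: "a > 0" using \<delta> \<epsilon> by (simp add: a_def)
  let ?h' = "\<lambda>s. - p * (max s 0 + a) powr (- p - 1)"
  note [measurable] = C1_0_measurable(1,2)[OF \<psi>, of \<Omega>]
  have cont: "continuous_on UNIV ?h'"
    using a by (intro continuous_intros) (auto simp: max_def)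
  have bound: "\<bar>?h' s\<bar> \<le> p * a powr (- p - 1)" for s
    using a p by (auto simp: abs_mult intro!: mult_left_mono powr_mono2')
  have h_meas[measurable]: "neg_power p a \<in> borel_measurable borel"
    using DERIV_isCont[OF neg_power_deriv[OF a]] by (intro borel_measurable_continuous_onI continuous_at_imp_continuous_on) blast
  have H: "square_integrable M (\<lambda>x. reg p \<delta> (u x))"
    using p \<delta> by (intro square_integrable_reg u_g_square_integrable) auto
  note [measurable] = square_integrable_measurable[OF H]
  have rew: "AE x in M. neg_power p a (u x) = (U x + \<epsilon>) powr (- p) \<and> max (u x) 0 + a = U x + \<epsilon> \<and> reg p \<delta> (u x) = U x powr p"
    using U_pos by eventually_elim (auto simp: neg_power_def U_def a_def reg_def add.assoc)
  have "(LINT x|M. (g x \<bullet> grad \<psi> x) * neg_power p a (u x)) + (LINT x|M. \<psi> x * ?h' (u x) * (norm (g x))\<^sup>2)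
    = (LINT x|M. reg p \<delta> (u x) * \<psi> x * neg_power p a (u x))"
    by (rule weak_solution_test_composition[OF open_\<Omega> finite_\<Omega> sol[folded p_def] H \<psi> neg_power_deriv[OF a] cont bound])
  also have "(LINT x|M. (g x \<bullet> grad \<psi> x) * neg_power p a (u x)) = (LINT x|M. (g x \<bullet> grad \<psi> x) * (U x + \<epsilon>) powr (- p))"
  proof (rule integral_cong_AE)
    show "AE x in M. (g x \<bullet> grad \<psi> x) * neg_power p a (u x) = (g x \<bullet> grad \<psi> x) * (U x + \<epsilon>) powr (- p)"
      using rew by eventually_elim (simp add: p(3))
  qed measurable
  also have "(LINT x|M. \<psi> x * ?h' (u x) * (norm (g x))\<^sup>2) = (LINT x|M. - p * (\<psi> x * (norm (g x))\<^sup>2 * (U x + \<epsilon>) powr (- q)))"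
  proof (rule integral_cong_AE)
    show "AE x in M. \<psi> x * ?h' (u x) * (norm (g x))\<^sup>2 = - p * (\<psi> x * (norm (g x))\<^sup>2 * (U x + \<epsilon>) powr (- q))"
      using rew by eventually_elim (simp add: p(3))
  qed measurable
  also have "\<dots> = - p * (LINT x|M. \<psi> x * (norm (g x))\<^sup>2 * (U x + \<epsilon>) powr (- q))" by simp
  also have "(LINT x|M. reg p \<delta> (u x) * \<psi> x * neg_power p a (u x)) = (LINT x|M. U x powr p * \<psi> x * (U x + \<epsilon>) powr (- p))"
  proof (rule integral_cong_AE)
    show "AE x in M. reg p \<delta> (u x) * \<psi> x * neg_power p a (u x) = U x powr p * \<psi> x * (U x + \<epsilon>) powr (- p)"
      using rew by eventually_elim (simp add: p(3))
  qed measurable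
  finally show ?thesis
    unfolding p_def[symmetric] by (simp only: mult_minus_left diff_conv_add_uminus)
qed

text \<open>A Caccioppoli argument with \<open>\<psi> = \<eta>\<^sup>2\<close>. The right-hand side of the tested equation is
  nonnegative, so the weighted energy is at most the mixed term, half of which is absorbed by
  Young's inequality. What remains is \<open>|\<nabla>\<eta>|\<^sup>2 (U + \<epsilon>)\<^bsup>2-q\<^esup>\<close>, whose exponent is positive because
  \<open>q < 2\<close>; it is therefore bounded independently of \<open>\<epsilon>\<close>.\<close>

lemma weighted_energy_bound:
  assumes \<eta>: "\<eta> \<in> C1_0 \<Omega>"
  shows "\<exists>C. \<forall>\<epsilon>. 0 < \<epsilon> \<and> \<epsilon> \<le> 1 \<longrightarrow> integrable M (\<lambda>x. (\<eta> x)\<^sup>2 * (norm (g x))\<^sup>2 * (U x + \<epsilon>) powr (- q))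
    \<and> (LINT x|M. (\<eta> x)\<^sup>2 * (norm (g x))\<^sup>2 * (U x + \<epsilon>) powr (- q)) \<le> C"
proof -
  define p where "p = q - 1"
  have p: "0 < p" "p < 1" using q by (auto simp: p_def)
  obtain K where K: "K > 0" "\<forall>x. \<bar>\<eta> x\<bar> \<le> K \<and> norm (grad \<eta> x) \<le> K" using C1_0_bounded[OF \<eta>] by blast
  note [measurable] = C1_0_measurable(1,2)[OF \<eta>, of \<Omega>]
  define W where "W x = K\<^sup>2 * (U x + 2)" for x
  have W: "integrable M W" unfolding W_def[abs_def] using U_integrable by simp
  show ?thesis
  proof (intro exI[of _ "4 / p\<^sup>2 * (LINT x|M. W x)"] allI impI)
    fix \<epsilon> :: real assume \<epsilon>: "0 < \<epsilon> \<and> \<epsilon> \<le> 1"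
    let ?Y = "\<lambda>x. (\<eta> x)\<^sup>2 * (norm (g x))\<^sup>2 * (U x + \<epsilon>) powr (- q)"
    have Y: "integrable M ?Y"
    proof (rule Bochner_Integration.integrable_bound)
      show "integrable M (\<lambda>x. K\<^sup>2 * \<epsilon> powr (- q) * (norm (g x))\<^sup>2)" using g_sq_integrable by simp
      show "AE x in M. norm (?Y x) \<le> norm (K\<^sup>2 * \<epsilon> powr (- q) * (norm (g x))\<^sup>2)"
      proof (rule AE_I2)
        fix x
        have "(\<eta> x)\<^sup>2 \<le> K\<^sup>2" using K by (simp add: power2_le_iff_abs_le)
        moreover have "(U x + \<epsilon>) powr (- q) \<le> \<epsilon> powr (- q)" using U_nonneg[of x] \<epsilon> q by (intro powr_mono2') auto
        ultimately have "(\<eta> x)\<^sup>2 * (U x + \<epsilon>) powr (- q) * (norm (g x))\<^sup>2 \<le> K\<^sup>2 * \<epsilon> powr (- q) * (norm (g x))\<^sup>2"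
          by (intro mult_right_mono mult_mono) auto
        then show "norm (?Y x) \<le> norm (K\<^sup>2 * \<epsilon> powr (- q) * (norm (g x))\<^sup>2)"
          by (simp add: abs_mult mult_ac)
      qed
    qed measurable
    have pw: "\<bar>(g x \<bullet> (2 * \<eta> x) *\<^sub>R grad \<eta> x) * (U x + \<epsilon>) powr (- p)\<bar> \<le> p / 2 * ?Y x + 2 / p * W x" for x
    proof -
      define t where "t = U x + \<epsilon>"
      have t: "t > 0" "t \<le> U x + 1" using U_nonneg[of x] \<epsilon> by (auto simp: t_def)
      define b where "b = \<bar>\<eta> x\<bar> * norm (g x) * t powr (- q / 2)"
      define c where "c = norm (grad \<eta> x) * t powr (1 - q / 2)"
      have b2: "b\<^sup>2 = ?Y x"
        using t by (simp add: b_def t_def power_mult_distrib powr_power)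
      have "c\<^sup>2 = (norm (grad \<eta> x))\<^sup>2 * t powr (2 - q)"
        using t by (simp add: c_def power_mult_distrib powr_power algebra_simps)
      also have "\<dots> \<le> K\<^sup>2 * (1 + t)"
        using K powr_le_one_plus[of "2 - q" t] t q by (intro mult_mono power_mono) auto
      also have "\<dots> \<le> W x" unfolding W_def using t K by (intro mult_left_mono) auto
      finally have c2: "c\<^sup>2 \<le> W x" .
      have "\<bar>(g x \<bullet> (2 * \<eta> x) *\<^sub>R grad \<eta> x) * t powr (- p)\<bar> = 2 * \<bar>\<eta> x\<bar> * \<bar>g x \<bullet> grad \<eta> x\<bar> * t powr (- p)"
        by (simp add: abs_mult)
      also have "\<dots> \<le> 2 * \<bar>\<eta> x\<bar> * (norm (g x) * norm (grad \<eta> x)) * t powr (- p)"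
        by (intro mult_right_mono mult_left_mono Cauchy_Schwarz_ineq2) auto
      also have "\<dots> = 2 * b * c"
      proof -
        have "t powr (- p) = t powr (- q / 2) * t powr (1 - q / 2)"
          by (simp add: powr_add[symmetric] p_def)
        then show ?thesis by (simp add: b_def c_def)
      qed
      also have "\<dots> \<le> p / 2 * b\<^sup>2 + 2 / p * c\<^sup>2" by (rule weighted_young[OF p(1)])
      also have "\<dots> \<le> p / 2 * ?Y x + 2 / p * W x" using c2 b2 p by (simp add: mult_left_mono divide_right_mono)
      finally show ?thesis by (simp add: t_def)
    qed
    have int_R: "integrable M (\<lambda>x. p / 2 * ?Y x + 2 / p * W x)" using Y W by simp
    have int_L: "integrable M (\<lambda>x. (g x \<bullet> (2 * \<eta> x) *\<^sub>R grad \<eta> x) * (U x + \<epsilon>) powr (- p))"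
    proof (rule Bochner_Integration.integrable_bound[OF int_R])
      show "AE x in M. norm ((g x \<bullet> (2 * \<eta> x) *\<^sub>R grad \<eta> x) * (U x + \<epsilon>) powr (- p)) \<le> norm (p / 2 * ?Y x + 2 / p * W x)"
        using pw order_trans[OF pw abs_ge_self] by (intro AE_I2) (simp only: real_norm_def)
    qed measurable
    have \<eta>\<eta>: "(\<lambda>x. \<eta> x * \<eta> x) \<in> C1_0 \<Omega>" by (rule C1_0_mult[OF \<eta> C1_0_Ck[OF \<eta>]])
    have grad_\<eta>\<eta>: "grad (\<lambda>x. \<eta> x * \<eta> x) x = (2 * \<eta> x) *\<^sub>R grad \<eta> x" for x
      unfolding Ck_1_mult(2)[OF C1_0_Ck[OF \<eta>] C1_0_Ck[OF \<eta>]] by (simp add: scaleR_add_left[symmetric])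
    have "0 \<le> (LINT x|M. U x powr (q - 1) * (\<eta> x * \<eta> x) * (U x + \<epsilon>) powr (- (q - 1)))"
      by (intro integral_nonneg_AE AE_I2) simp
    also have "\<dots> = (LINT x|M. (g x \<bullet> (2 * \<eta> x) *\<^sub>R grad \<eta> x) * (U x + \<epsilon>) powr (- p)) - p * (LINT x|M. ?Y x)"
      using tested_equation[OF \<eta>\<eta>, of \<epsilon>] \<epsilon> unfolding grad_\<eta>\<eta> by (simp add: p_def power2_eq_square)
    finally have "p * (LINT x|M. ?Y x) \<le> (LINT x|M. (g x \<bullet> (2 * \<eta> x) *\<^sub>R grad \<eta> x) * (U x + \<epsilon>) powr (- p))" by simp
    also have "\<dots> \<le> (LINT x|M. p / 2 * ?Y x + 2 / p * W x)"
      using pw by (intro integral_mono[OF int_L int_R]) (meson abs_le_D1)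
    also have "\<dots> = p / 2 * (LINT x|M. ?Y x) + 2 / p * (LINT x|M. W x)" using Y W by simp
    finally have "(p / 2) * (LINT x|M. ?Y x) \<le> 2 / p * (LINT x|M. W x)" by simp
    then have "(LINT x|M. ?Y x) \<le> 4 / p\<^sup>2 * (LINT x|M. W x)"
      using p by (simp add: field_simps power2_eq_square)
    with Y show "integrable M ?Y \<and> (LINT x|M. ?Y x) \<le> 4 / p\<^sup>2 * (LINT x|M. W x)" by blast
  qed
qed

definition "E \<eta> x = (\<eta> x)\<^sup>2 * (norm (g x))\<^sup>2 * U x powr (- q)"

lemma E_nonneg: "0 \<le> E \<eta> x" by (simp add: E_def)

text \<open>The weighted energy bound survives the removal of the regularisation by Fatou's lemma.\<close>

lemma weighted_energy_integrable:
  assumes \<eta>: "\<eta> \<in> C1_0 \<Omega>"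
  shows "integrable M (E \<eta>)"
proof -
  obtain C where C: "\<And>\<epsilon>. 0 < \<epsilon> \<and> \<epsilon> \<le> 1 \<Longrightarrow> integrable M (\<lambda>x. (\<eta> x)\<^sup>2 * (norm (g x))\<^sup>2 * (U x + \<epsilon>) powr (- q))
    \<and> (LINT x|M. (\<eta> x)\<^sup>2 * (norm (g x))\<^sup>2 * (U x + \<epsilon>) powr (- q)) \<le> C"
    using weighted_energy_bound[OF \<eta>] by blast
  note [measurable] = C1_0_measurable(1,2)[OF \<eta>, of \<Omega>]
  define e where "e n = 1 / real (Suc n)" for n
  have e: "0 < e n \<and> e n \<le> 1" for n by (simp add: e_def)
  have e_lim: "e \<longlonglongrightarrow> 0" unfolding e_def using LIMSEQ_Suc[OF lim_1_over_n] by simp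
  let ?Y = "\<lambda>n x. (\<eta> x)\<^sup>2 * (norm (g x))\<^sup>2 * (U x + e n) powr (- q)"
  have "(\<integral>\<^sup>+x. ennreal (E \<eta> x) \<partial>M) = (\<integral>\<^sup>+x. liminf (\<lambda>n. ennreal (?Y n x)) \<partial>M)"
  proof (rule nn_integral_cong_AE)
    show "AE x in M. ennreal (E \<eta> x) = liminf (\<lambda>n. ennreal (?Y n x))"
      using U_pos
    proof eventually_elim
      case (elim x)
      have "(\<lambda>n. U x + e n) \<longlonglongrightarrow> U x + 0" by (intro tendsto_add tendsto_const e_lim)
      then have "(\<lambda>n. ?Y n x) \<longlonglongrightarrow> (\<eta> x)\<^sup>2 * (norm (g x))\<^sup>2 * (U x + 0) powr (- q)"
        using elim by (intro tendsto_mult tendsto_const tendsto_powr) auto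
      then have "(\<lambda>n. ennreal (?Y n x)) \<longlonglongrightarrow> ennreal (E \<eta> x)" by (intro tendsto_ennrealI) (simp add: E_def)
      then show ?case by (rule lim_imp_Liminf[OF trivial_limit_sequentially, symmetric])
    qed
  qed
  also have "\<dots> \<le> liminf (\<lambda>n. \<integral>\<^sup>+x. ennreal (?Y n x) \<partial>M)"
    by (intro nn_integral_liminf) measurable
  also have "\<dots> \<le> liminf (\<lambda>n. ennreal C)"
  proof (intro Liminf_mono always_eventually allI)
    fix n
    have "(\<integral>\<^sup>+x. ennreal (?Y n x) \<partial>M) = ennreal (LINT x|M. ?Y n x)"
      using C[OF e] by (intro nn_integral_eq_integral) auto
    then show "(\<integral>\<^sup>+x. ennreal (?Y n x) \<partial>M) \<le> ennreal C" using C[OF e[of n]] by (simp add: ennreal_leI)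
  qed
  also have "\<dots> = ennreal C" by (simp add: Liminf_const)
  finally have "(\<integral>\<^sup>+x. ennreal (E \<eta> x) \<partial>M) < \<infinity>" by (simp add: le_less_trans)
  moreover have "E \<eta> \<in> borel_measurable M" unfolding E_def[abs_def] by measurable
  ultimately show ?thesis by (intro integrableI_bounded) (simp_all add: E_nonneg)
qed

text \<open>The majorants, uniform in \<open>\<epsilon>\<close>, for the terms of the tested equation where the cutoff is at least
  one.\<close>

lemma dual_integrand_bound:
  assumes "0 < U x" "1 \<le> \<eta> x" "0 \<le> \<epsilon>"
  shows "norm (g x) * (U x + \<epsilon>) powr (- (q - 1)) \<le> E \<eta> x + (1 + U x)"
    and "(norm (g x))\<^sup>2 * (U x + \<epsilon>) powr (- q) \<le> E \<eta> x"
proof -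
  have "(U x + \<epsilon>) powr (- q) \<le> U x powr (- q)" using assms q by (intro powr_mono2') auto
  then have "(norm (g x))\<^sup>2 * (U x + \<epsilon>) powr (- q) \<le> 1 * ((norm (g x))\<^sup>2 * U x powr (- q))"
    by (simp add: mult_left_mono)
  also have "\<dots> \<le> (\<eta> x)\<^sup>2 * ((norm (g x))\<^sup>2 * U x powr (- q))"
    using assms by (intro mult_right_mono) (auto simp: one_le_power)
  finally show "(norm (g x))\<^sup>2 * (U x + \<epsilon>) powr (- q) \<le> E \<eta> x" by (simp add: E_def mult.assoc)
  have E: "(norm (g x))\<^sup>2 * U x powr (- q) \<le> E \<eta> x"
    using assms \<open>1 * ((norm (g x))\<^sup>2 * U x powr (- q)) \<le> _\<close> by (simp add: E_def mult.assoc)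
  define b where "b = norm (g x) * U x powr (- q / 2)"
  define c where "c = U x powr (1 - q / 2)"
  have "(U x + \<epsilon>) powr (- (q - 1)) \<le> U x powr (- (q - 1))" using assms q by (intro powr_mono2') auto
  then have "norm (g x) * (U x + \<epsilon>) powr (- (q - 1)) \<le> norm (g x) * U x powr (- (q - 1))" by (intro mult_left_mono) auto
  also have "U x powr (- (q - 1)) = U x powr (- q / 2) * U x powr (1 - q / 2)" by (simp add: powr_add[symmetric])
  also have "norm (g x) * \<dots> = b * c" by (simp add: b_def c_def)
  also have "\<dots> \<le> b\<^sup>2 + c\<^sup>2"
    using sum_squares_bound[of b c] zero_le_power2[of b] zero_le_power2[of c] by linarith
  also have "b\<^sup>2 = (norm (g x))\<^sup>2 * U x powr (- q)"
    using assms by (simp add: b_def power_mult_distrib powr_power)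
  also have "c\<^sup>2 = U x powr (2 - q)"
    using assms by (simp add: c_def powr_power algebra_simps)
  also have "U x powr (2 - q) \<le> 1 + U x" using q assms by (intro powr_le_one_plus) auto
  finally show "norm (g x) * (U x + \<epsilon>) powr (- (q - 1)) \<le> E \<eta> x + (1 + U x)" using E by simp
qed

text \<open>The limit \<open>\<epsilon> \<rightarrow> 0\<close> of the tested equation. On the right \<open>U\<^bsup>q-1\<^esup> (U + \<epsilon>)\<^bsup>-(q-1)\<^esup>\<close> increases to one,
  and the terms on the left become those of the dual pair. The constraint thus holds with equality.\<close>

lemma dual_constraint:
  assumes \<psi>: "\<psi> \<in> C1_0 \<Omega>"
  shows "(LINT x|M. grad \<psi> x \<bullet> \<phi>\<^sub>0 x + f\<^sub>0 x * \<psi> x) = (LINT x|M. \<psi> x)"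
proof -
  define p where "p = q - 1"
  have p: "0 < p" "p < 1" using q by (auto simp: p_def)
  obtain K where K: "K > 0" "\<forall>x. \<bar>\<psi> x\<bar> \<le> K \<and> norm (grad \<psi> x) \<le> K" using C1_0_bounded[OF \<psi>] by blast
  obtain \<eta> where \<eta>: "\<eta> \<in> Cinf_0 \<Omega>" "\<forall>x. 0 \<le> \<eta> x" "\<forall>x\<in>support \<psi>. 1 \<le> \<eta> x"
    using cutoff_exists[OF C1_0_support(1)[OF \<psi>] open_\<Omega> C1_0_support(2)[OF \<psi>]] by blast
  have \<eta>C: "\<eta> \<in> C1_0 \<Omega>" using \<eta>(1) Cinf_0_subset_C1_0 by blast
  note E_int = weighted_energy_integrable[OF \<eta>C]
  note [measurable] = C1_0_measurable(1,2)[OF \<psi>, of \<Omega>]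
  define e where "e n = 1 / real (Suc n)" for n
  have e: "0 < e n" for n by (simp add: e_def)
  have e_lim: "e \<longlonglongrightarrow> 0" unfolding e_def using LIMSEQ_Suc[OF lim_1_over_n] by simp
  have U_lim: "(\<lambda>n. (U x + e n) powr r) \<longlonglongrightarrow> U x powr r" if "0 < U x" for x r
  proof -
    have "(\<lambda>n. U x + e n) \<longlonglongrightarrow> U x + 0" by (intro tendsto_add tendsto_const e_lim)
    then have "(\<lambda>n. (U x + e n) powr r) \<longlonglongrightarrow> (U x + 0) powr r"
      using that by (intro tendsto_powr tendsto_const) auto
    then show ?thesis by simp
  qed
  let ?T1 = "\<lambda>x. (g x \<bullet> grad \<psi> x) * U x powr (- p)"
  let ?T2 = "\<lambda>x. \<psi> x * (norm (g x))\<^sup>2 * U x powr (- q)"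
  have w1: "integrable M (\<lambda>x. K * (E \<eta> x + (1 + U x)))" using E_int U_integrable by simp
  have b1: "AE x in M. norm ((g x \<bullet> grad \<psi> x) * (U x + \<epsilon>) powr (- p)) \<le> K * (E \<eta> x + (1 + U x))" if "0 \<le> \<epsilon>" for \<epsilon>
    using U_pos
  proof eventually_elim
    case (elim x)
    show ?case
    proof (cases "x \<in> support \<psi>")
      case True
      have "norm ((g x \<bullet> grad \<psi> x) * (U x + \<epsilon>) powr (- p)) = \<bar>g x \<bullet> grad \<psi> x\<bar> * (U x + \<epsilon>) powr (- p)" by (simp add: abs_mult)
      also have "\<dots> \<le> (norm (g x) * K) * (U x + \<epsilon>) powr (- p)"
        using K by (intro mult_right_mono order_trans[OF Cauchy_Schwarz_ineq2] mult_left_mono) auto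
      also have "\<dots> = K * (norm (g x) * (U x + \<epsilon>) powr (- p))" by simp
      also have "\<dots> \<le> K * (E \<eta> x + (1 + U x))"
        using dual_integrand_bound(1)[of x \<eta> \<epsilon>] elim \<eta>(3) True K that by (intro mult_left_mono) (auto simp: p_def)
      finally show ?thesis .
    next
      case False
      then have "grad \<psi> x = 0" by (rule grad_outside_support)
      then show ?thesis using K E_nonneg[of \<eta> x] elim by simp
    qed
  qed
  have lim1: "(\<lambda>n. LINT x|M. (g x \<bullet> grad \<psi> x) * (U x + e n) powr (- p)) \<longlonglongrightarrow> (LINT x|M. ?T1 x)"
  proof (rule integral_dominated_convergence[OF _ _ w1])
    show "AE x in M. (\<lambda>n. (g x \<bullet> grad \<psi> x) * (U x + e n) powr (- p)) \<longlonglongrightarrow> ?T1 x"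
      using U_pos by eventually_elim (intro tendsto_mult tendsto_const U_lim, simp)
    show "AE x in M. norm ((g x \<bullet> grad \<psi> x) * (U x + e n) powr (- p)) \<le> K * (E \<eta> x + (1 + U x))" for n
      using e[of n] by (intro b1) simp
  qed measurable
  have int1: "integrable M ?T1"
    by (rule Bochner_Integration.integrable_bound[OF w1])
      (use b1[of 0] in \<open>auto elim!: eventually_mono intro: order_trans[OF _ abs_ge_self]\<close>)
  have w2: "integrable M (\<lambda>x. K * E \<eta> x)" using E_int by simp
  have b2: "AE x in M. norm (\<psi> x * (norm (g x))\<^sup>2 * (U x + \<epsilon>) powr (- q)) \<le> K * E \<eta> x" if "0 \<le> \<epsilon>" for \<epsilon>
    using U_pos
  proof eventually_elim
    case (elim x)
    show ?case
    proof (cases "x \<in> support \<psi>")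
      case True
      have "norm (\<psi> x * (norm (g x))\<^sup>2 * (U x + \<epsilon>) powr (- q)) = \<bar>\<psi> x\<bar> * ((norm (g x))\<^sup>2 * (U x + \<epsilon>) powr (- q))" by (simp add: abs_mult)
      also have "\<dots> \<le> K * E \<eta> x"
        using dual_integrand_bound(2)[of x \<eta> \<epsilon>] elim \<eta>(3) True K that by (intro mult_mono) auto
      finally show ?thesis .
    next
      case False
      then have "\<psi> x = 0" by (rule outside_support)
      then show ?thesis using K E_nonneg[of \<eta> x] by simp
    qed
  qed
  have lim2: "(\<lambda>n. LINT x|M. \<psi> x * (norm (g x))\<^sup>2 * (U x + e n) powr (- q)) \<longlonglongrightarrow> (LINT x|M. ?T2 x)"
  proof (rule integral_dominated_convergence[OF _ _ w2])
    show "AE x in M. (\<lambda>n. \<psi> x * (norm (g x))\<^sup>2 * (U x + e n) powr (- q)) \<longlonglongrightarrow> ?T2 x"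
      using U_pos by eventually_elim (intro tendsto_mult tendsto_const U_lim, simp)
    show "AE x in M. norm (\<psi> x * (norm (g x))\<^sup>2 * (U x + e n) powr (- q)) \<le> K * E \<eta> x" for n
      using e[of n] by (intro b2) simp
  qed measurable
  have int2: "integrable M ?T2"
    by (rule Bochner_Integration.integrable_bound[OF w2])
      (use b2[of 0] in \<open>auto elim!: eventually_mono intro: order_trans[OF _ abs_ge_self]\<close>)
  have lim3: "(\<lambda>n. LINT x|M. U x powr p * \<psi> x * (U x + e n) powr (- p)) \<longlonglongrightarrow> (LINT x|M. \<psi> x)"
  proof (rule integral_dominated_convergence[where w = "\<lambda>x. \<bar>\<psi> x\<bar>"])
    show "integrable M (\<lambda>x. \<bar>\<psi> x\<bar>)"
      using square_integrable_integrable[OF C1_0_square_integrable(1)[OF open_\<Omega> \<psi>]] by simp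
    show "AE x in M. (\<lambda>n. U x powr p * \<psi> x * (U x + e n) powr (- p)) \<longlonglongrightarrow> \<psi> x"
      using U_pos
    proof eventually_elim
      case (elim x)
      have "(\<lambda>n. U x powr p * \<psi> x * (U x + e n) powr (- p)) \<longlonglongrightarrow> U x powr p * \<psi> x * U x powr (- p)"
        using elim by (intro tendsto_mult tendsto_const U_lim) simp
      also have "U x powr p * \<psi> x * U x powr (- p) = \<psi> x" using elim by (simp add: powr_minus)
      finally show ?case .
    qed
    show "AE x in M. norm (U x powr p * \<psi> x * (U x + e n) powr (- p)) \<le> \<bar>\<psi> x\<bar>" for n
      using U_pos
    proof eventually_elim
      case (elim x)
      have "(U x + e n) powr (- p) \<le> U x powr (- p)" using elim e[of n] p by (intro powr_mono2') auto
      then have "U x powr p * (U x + e n) powr (- p) \<le> U x powr p * U x powr (- p)" by (intro mult_left_mono) auto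
      also have "\<dots> = 1" using elim by (simp add: powr_minus)
      finally have "U x powr p * (U x + e n) powr (- p) * \<bar>\<psi> x\<bar> \<le> 1 * \<bar>\<psi> x\<bar>" by (intro mult_right_mono) auto
      then show ?case by (simp add: abs_mult mult_ac)
    qed
  qed measurable
  have "(\<lambda>n. LINT x|M. U x powr p * \<psi> x * (U x + e n) powr (- p)) \<longlonglongrightarrow> (LINT x|M. ?T1 x) - p * (LINT x|M. ?T2 x)"
    using tendsto_diff[OF lim1 tendsto_mult_left[OF lim2, of p]] tested_equation[OF \<psi> e] by (simp add: p_def)
  then have "(LINT x|M. ?T1 x) - p * (LINT x|M. ?T2 x) = (LINT x|M. \<psi> x)"
    using lim3 by (rule LIMSEQ_unique)
  moreover have "(LINT x|M. grad \<psi> x \<bullet> \<phi>\<^sub>0 x + f\<^sub>0 x * \<psi> x) = (LINT x|M. ?T1 x - p * ?T2 x)"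
  proof (intro Bochner_Integration.integral_cong refl)
    fix x
    have e1: "\<phi>\<^sub>0 x = inverse (U x powr p) *\<^sub>R g x" by (simp add: \<phi>\<^sub>0_def p_def)
    have e2: "f\<^sub>0 x = - p * ((norm (g x))\<^sup>2 * inverse (U x powr q))" by (simp add: f\<^sub>0_def p_def divide_inverse)
    show "grad \<psi> x \<bullet> \<phi>\<^sub>0 x + f\<^sub>0 x * \<psi> x = ?T1 x - p * ?T2 x"
      unfolding e1 e2 powr_minus by (simp add: inner_commute mult_ac)
  qed
  ultimately show ?thesis using int1 int2 by simp
qed

lemma f\<^sub>0_measurable [measurable]: "f\<^sub>0 \<in> borel_measurable M" "\<phi>\<^sub>0 \<in> borel_measurable M"
  unfolding f\<^sub>0_def[abs_def] \<phi>\<^sub>0_def[abs_def] by measurable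

text \<open>On a compact set both functions are controlled by the weighted energy density of a cutoff that is
  at least one there. For the square of \<open>\<phi>\<^sub>0\<close> this uses \<open>t\<^bsup>-2(q-1)\<^esup> \<le> 1 + t\<^bsup>-q\<^esup>\<close>, valid as \<open>2(q-1) \<le> q\<close>.\<close>

lemma dual_pair_local:
  assumes K: "compact K" "K \<subseteq> \<Omega>"
  shows "integrable (lebesgue_on K) f\<^sub>0" "square_integrable (lebesgue_on K) \<phi>\<^sub>0"
proof -
  have K_sets: "K \<in> sets lebesgue" "\<Omega> \<in> sets lebesgue" using K(1) open_\<Omega> by (auto simp: compact_imp_closed)
  obtain \<eta> where \<eta>: "\<eta> \<in> Cinf_0 \<Omega>" "\<forall>x. 0 \<le> \<eta> x" "\<forall>x\<in>K. 1 \<le> \<eta> x"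
    using cutoff_exists[OF K(1) open_\<Omega> K(2)] by blast
  have \<eta>C: "\<eta> \<in> C1_0 \<Omega>" using \<eta>(1) Cinf_0_subset_C1_0 by blast
  have restrict: "AE x in lebesgue_on K. Q x" if "AE x in M. Q x" for Q
  proof -
    have "AE x in lebesgue. x \<in> \<Omega> \<longrightarrow> Q x" using that K_sets by (simp add: AE_restrict_space_iff)
    then have "AE x in lebesgue. x \<in> K \<longrightarrow> Q x" by eventually_elim (use K(2) in blast)
    then show ?thesis using K_sets by (simp add: AE_restrict_space_iff)
  qed
  have sub: "integrable (lebesgue_on K) h" if "integrable M h" for h :: "'a \<Rightarrow> real"
    by (rule integrable_lebesgue_on_subset[OF that K_sets K(2)])
  have meas: "f\<^sub>0 \<in> borel_measurable (lebesgue_on K)" "\<phi>\<^sub>0 \<in> borel_measurable (lebesgue_on K)"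
    using measurable_restrict_mono[OF f\<^sub>0_measurable(1) K(2)] measurable_restrict_mono[OF f\<^sub>0_measurable(2) K(2)] .
  have in_K: "AE x in lebesgue_on K. x \<in> K" using AE_space[of "lebesgue_on K"] by simp
  note E_int = weighted_energy_integrable[OF \<eta>C]
  show "integrable (lebesgue_on K) f\<^sub>0"
  proof (rule Bochner_Integration.integrable_bound[OF sub meas(1)])
    show "integrable M (\<lambda>x. (q - 1) * E \<eta> x)" using E_int by simp
    show "AE x in lebesgue_on K. norm (f\<^sub>0 x) \<le> norm ((q - 1) * E \<eta> x)"
      using restrict[OF U_pos] in_K
    proof eventually_elim
      case (elim x)
      have "(norm (g x))\<^sup>2 * U x powr (- q) \<le> E \<eta> x"
        using dual_integrand_bound(2)[of x \<eta> 0] elim \<eta>(3) by simp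
      then show ?case using q E_nonneg[of \<eta> x]
        by (simp add: f\<^sub>0_def abs_mult powr_minus divide_inverse)
    qed
  qed
  show "square_integrable (lebesgue_on K) \<phi>\<^sub>0"
  proof (rule square_integrable_bound[OF meas(2) sub])
    show "integrable M (\<lambda>x. (norm (g x))\<^sup>2 + E \<eta> x)" using E_int g_sq_integrable by simp
    show "AE x in lebesgue_on K. (norm (\<phi>\<^sub>0 x))\<^sup>2 \<le> (norm (g x))\<^sup>2 + E \<eta> x"
      using restrict[OF U_pos] in_K
    proof eventually_elim
      case (elim x)
      have E: "(norm (g x))\<^sup>2 * U x powr (- q) \<le> E \<eta> x"
        using dual_integrand_bound(2)[of x \<eta> 0] elim \<eta>(3) by simp
      have "U x powr (- 2 * (q - 1)) \<le> 1 + U x powr (- q)"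
      proof (cases "U x \<le> 1")
        case True
        then have "U x powr (- 2 * (q - 1)) \<le> U x powr (- q)" using q elim by (intro powr_mono') auto
        then show ?thesis by simp
      next
        case False
        then have "U x powr (- 2 * (q - 1)) \<le> U x powr 0" using q by (intro powr_mono) auto
        then show ?thesis using False by (simp add: add_increasing2)
      qed
      then have "(norm (g x))\<^sup>2 * U x powr (- 2 * (q - 1)) \<le> (norm (g x))\<^sup>2 * (1 + U x powr (- q))"
        by (intro mult_left_mono) auto
      also have "\<dots> \<le> (norm (g x))\<^sup>2 + E \<eta> x" using E by (simp add: distrib_left)
      finally have "(norm (g x))\<^sup>2 * U x powr (- 2 * (q - 1)) \<le> (norm (g x))\<^sup>2 + E \<eta> x" .
      moreover have "(norm (\<phi>\<^sub>0 x))\<^sup>2 = (norm (g x))\<^sup>2 * U x powr (- 2 * (q - 1))"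
      proof -
        have "(U x powr (- (q - 1)))\<^sup>2 = U x powr (- 2 * (q - 1))" using elim by (simp add: powr_power)
        then show ?thesis by (simp add: \<phi>\<^sub>0_def power_mult_distrib powr_minus[symmetric] mult.commute)
      qed
      ultimately show ?case by simp
    qed
  qed
qed

lemma dual_pair_admissible: "(f\<^sub>0, \<phi>\<^sub>0) \<in> admissible \<Omega>"
proof -
  have "f\<^sub>0 \<in> Lp_loc \<Omega> 1"
    by (rule integrable_Lp_loc_1[OF open_\<Omega> f\<^sub>0_measurable(1) dual_pair_local(1)])
  moreover have "\<phi>\<^sub>0 \<in> Lp_loc \<Omega> 2"
    using dual_pair_local(2) f\<^sub>0_measurable by (simp add: Lp_loc_def Lp_space_2_iff)
  moreover have "dist_ineq \<Omega> f\<^sub>0 \<phi>\<^sub>0"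
    unfolding dist_ineq_def using dual_constraint by simp
  ultimately show ?thesis by (simp add: admissible_def)
qed

text \<open>All powers of \<open>U\<close> cancel. Where the gradient vanishes, both components of the pair do, and the
  case \<open>G\<^sub>q(0, 0) = 0\<close> applies.\<close>

lemma G_dual_pair:
  assumes "0 < U x"
  shows "G q (f\<^sub>0 x) (\<phi>\<^sub>0 x) = ennreal ((q - 1) powr (- (q - 1)) * norm (g x) powr (2 - q))"
proof (cases "g x = 0")
  case True
  then show ?thesis using q by (simp add: G_def f\<^sub>0_def \<phi>\<^sub>0_def)
next
  case False
  define p where "p = q - 1"
  have p: "0 < p" "p < 1" "q = p + 1" using q by (auto simp: p_def)
  define n where "n = norm (g x)"
  have n: "n > 0" using False by (simp add: n_def)
  define t where "t = U x"
  have t: "t > 0" using assms by (simp add: t_def)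
  have f_eq: "f\<^sub>0 x = - p * (n\<^sup>2 / t powr q)" by (simp only: f\<^sub>0_def p_def n_def t_def)
  have neg: "f\<^sub>0 x < 0" unfolding f_eq using n t p(1) by simp
  have abs_f: "\<bar>f\<^sub>0 x\<bar> = p * (n powr 2 * t powr (- q))"
    unfolding f_eq using n t p(1) by (simp add: abs_mult powr_minus divide_inverse)
  have norm_\<phi>: "norm (\<phi>\<^sub>0 x) = n * t powr (- p)"
    using t unfolding \<phi>\<^sub>0_def n_def t_def p_def by (simp add: powr_minus[of _ "q - 1", symmetric])
  have "norm (\<phi>\<^sub>0 x) powr q / \<bar>f\<^sub>0 x\<bar> powr p = (n powr q * t powr (- p * q)) * (p powr (- p) * (n powr (- 2 * p) * t powr (q * p)))"
  proof -
    have A: "norm (\<phi>\<^sub>0 x) powr q = n powr q * t powr (- p * q)"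
      unfolding norm_\<phi> by (simp only: powr_mult powr_powr)
    have B: "\<bar>f\<^sub>0 x\<bar> powr p = p powr p * (n powr (2 * p) * t powr (- q * p))"
      unfolding abs_f by (simp only: powr_mult powr_powr)
    show ?thesis
      unfolding A B divide_inverse inverse_mult_distrib powr_minus[symmetric] by simp
  qed
  also have "\<dots> = p powr (- p) * (n powr q * n powr (- 2 * p)) * (t powr (- p * q) * t powr (q * p))" by (simp only: mult_ac)
  also have "\<dots> = p powr (- p) * n powr (2 - q)"
    using n t by (simp add: powr_add[symmetric] p(3))
  finally show ?thesis using neg by (simp add: G_def p_def n_def)
qed

lemma dual_value:
  "ennreal ((q - 1) powr ((q - 1) * (2 / q))) * dual_functional \<Omega> q (f\<^sub>0, \<phi>\<^sub>0) = ennreal (L2sq M g powr ((2 - q) / q))"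
proof -
  define p where "p = q - 1"
  have p: "0 < p" "p < 1" using q by (auto simp: p_def)
  define r where "r = 2 / (2 - q)"
  have r: "r > 0" "(2 - q) * r = 2" using q by (auto simp: r_def field_simps)
  define X where "X = L2sq M g"
  have X: "X \<ge> 0" by (simp add: X_def)
  have "(\<integral>\<^sup>+x. ennpowr (G q (f\<^sub>0 x) (\<phi>\<^sub>0 x)) r \<partial>M) = (\<integral>\<^sup>+x. ennreal (p powr (- p * r) * (norm (g x))\<^sup>2) \<partial>M)"
  proof (rule nn_integral_cong_AE)
    show "AE x in M. ennpowr (G q (f\<^sub>0 x) (\<phi>\<^sub>0 x)) r = ennreal (p powr (- p * r) * (norm (g x))\<^sup>2)"
      using U_pos
    proof eventually_elim
      case (elim x)
      have "(p powr (- p) * norm (g x) powr (2 - q)) powr r = p powr (- p * r) * (norm (g x))\<^sup>2"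
        using p r by (simp add: powr_mult powr_powr)
      then show ?case using G_dual_pair[of x] elim by (simp add: ennpowr_def p_def)
    qed
  qed
  also have "\<dots> = ennreal (p powr (- p * r) * X)"
    unfolding X_def using g_sq_integrable by (subst nn_integral_eq_integral) auto
  finally have "dual_functional \<Omega> q (f\<^sub>0, \<phi>\<^sub>0) = ennreal (((p powr (- p * r) * X) powr (1 / r)) powr (2 / q))"
    using X by (simp add: dual_functional_def eLp_norm_def r_def[symmetric] ennpowr_def)
  also have "((p powr (- p * r) * X) powr (1 / r)) powr (2 / q) = p powr (- p * (2 / q)) * X powr ((2 - q) / q)"
  proof -
    have "1 / r * (2 / q) = (2 - q) / q" using q by (simp add: r_def field_simps)
    then show ?thesis using r X p by (simp add: powr_mult powr_powr)
  qed
  finally have "ennreal (p powr (p * (2 / q))) * dual_functional \<Omega> q (f\<^sub>0, \<phi>\<^sub>0)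
      = ennreal (p powr (p * (2 / q)) * (p powr (- p * (2 / q)) * X powr ((2 - q) / q)))"
    by (simp add: ennreal_mult)
  also have "p powr (p * (2 / q)) * (p powr (- p * (2 / q)) * X powr ((2 - q) / q)) = X powr ((2 - q) / q)"
    using p by (simp add: mult.assoc[symmetric] powr_add[symmetric])
  finally show ?thesis by (simp add: p_def X_def)
qed

end

section \<open>Weak duality\<close>

lemma abs_powr_deriv:
  fixes q :: real
  assumes "1 < q"
  shows "((\<lambda>s. \<bar>s\<bar> powr q) has_real_derivative q * sgn s * \<bar>s\<bar> powr (q - 1)) (at s)"
proof -
  consider "s > 0" | "s < 0" | "s = 0" by linarith
  then show ?thesis
  proof cases
    case 1
    have "((\<lambda>s. s powr q) has_real_derivative q * sgn s * \<bar>s\<bar> powr (q - 1)) (at s)"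
      using 1 by (auto intro!: derivative_eq_intros)
    then show ?thesis
      by (rule has_field_derivative_transform_within_open[of _ _ _ "{0<..}"]) (use 1 in auto)
  next
    case 2
    have "((\<lambda>s. (- s) powr q) has_real_derivative q * (- s) powr (q - 1) * (- 1)) (at s)"
      by (rule DERIV_chain'[of uminus "-1" s UNIV "\<lambda>s. s powr q"])
        (use 2 in \<open>auto intro!: derivative_eq_intros\<close>)
    then have "((\<lambda>s. (- s) powr q) has_real_derivative q * sgn s * \<bar>s\<bar> powr (q - 1)) (at s)"
      using 2 by simp
    then show ?thesis
      by (rule has_field_derivative_transform_within_open[of _ _ _ "{..<0}"]) (use 2 in auto)
  next
    case 3
    have "((\<lambda>y. \<bar>y\<bar> powr q / y) \<longlongrightarrow> 0) (at (0::real))"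
    proof (rule Lim_null_comparison)
      show "\<forall>\<^sub>F y in at 0. norm (\<bar>y\<bar> powr q / y) \<le> \<bar>y\<bar> powr (q - 1)"
        by (rule always_eventually) (auto simp: powr_diff)
      have "((\<lambda>y::real. \<bar>y\<bar> powr (q - 1)) \<longlongrightarrow> \<bar>0\<bar> powr (q - 1)) (at 0)"
        using assms by (intro tendsto_powr' tendsto_rabs tendsto_ident_at tendsto_const) auto
      then show "((\<lambda>y::real. \<bar>y\<bar> powr (q - 1)) \<longlongrightarrow> 0) (at 0)" by simp
    qed
    then show ?thesis using 3 by (simp add: has_field_derivative_iff)
  qed
qed

lemma abs_powr_deriv_continuous:
  fixes q :: real
  assumes "1 < q"
  shows "continuous_on UNIV (\<lambda>s. q * sgn s * \<bar>s\<bar> powr (q - 1))"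
proof -
  have "isCont (\<lambda>s. q * sgn s * \<bar>s\<bar> powr (q - 1)) s" for s
  proof (cases "s = 0")
    case False
    then show ?thesis by (intro continuous_intros isCont_sgn) auto
  next
    case True
    have "((\<lambda>s. q * sgn s * \<bar>s\<bar> powr (q - 1)) \<longlongrightarrow> 0) (at 0)"
    proof (rule Lim_null_comparison)
      show "\<forall>\<^sub>F y in at 0. norm (q * sgn y * \<bar>y\<bar> powr (q - 1)) \<le> q * \<bar>y\<bar> powr (q - 1)"
        using assms by (intro always_eventually) (auto simp: abs_mult sgn_if)
      have "((\<lambda>y::real. \<bar>y\<bar> powr (q - 1)) \<longlongrightarrow> \<bar>0\<bar> powr (q - 1)) (at 0)"
        using assms by (intro tendsto_powr' tendsto_rabs tendsto_ident_at tendsto_const) auto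
      then have "((\<lambda>y::real. q * \<bar>y\<bar> powr (q - 1)) \<longlongrightarrow> q * 0) (at 0)" by (intro tendsto_mult_left) simp
      then show "((\<lambda>y::real. q * \<bar>y\<bar> powr (q - 1)) \<longlongrightarrow> 0) (at 0)" by simp
    qed
    then show ?thesis using True by (simp add: isCont_def)
  qed
  then show ?thesis by (simp add: continuous_on_eq_continuous_at)
qed

text \<open>Young's inequality with exponents \<open>q/(q-1)\<close> and \<open>q\<close>. Equivalently, the graph of the convex
  function \<open>b\<^sup>q\<close> lies above its tangent at \<open>a\<close>; this second reading gives the Euler--Lagrange equation
  of the maximiser.\<close>

lemma young_tangent:
  fixes a b q :: real
  assumes "1 < q" "0 \<le> a" "0 \<le> b"
  shows "q * a powr (q - 1) * b \<le> (q - 1) * a powr q + b powr q"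
proof (cases "a = 0 \<or> b = 0")
  case False
  then have ab: "a > 0" "b > 0" using assms by auto
  have "(a powr q) powr ((q - 1) / q) * (b powr q) powr (1 / q) \<le> (q - 1) / q * a powr q + 1 / q * b powr q"
    using assms ab by (intro Youngs_inequality_0) (auto simp: field_simps)
  then have "a powr (q - 1) * b \<le> (q - 1) / q * a powr q + 1 / q * b powr q"
    using assms ab by (simp add: powr_powr)
  then have "q * (a powr (q - 1) * b) \<le> q * ((q - 1) / q * a powr q + 1 / q * b powr q)"
    using assms by (intro mult_left_mono) auto
  also have "\<dots> = (q - 1) * a powr q + b powr q" using assms by (simp add: field_simps)
  finally show ?thesis by (simp add: mult.assoc)
qed (use assms in auto)

text \<open>The pointwise form of weak duality, with \<open>s = |f|\<close>, \<open>y = |\<psi>|\<close>, \<open>n = |\<nabla>\<psi>|\<close> and \<open>m = |\<phi>|\<close>: the last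
  factor is \<open>G\<^sub>q\<close>, and its constant \<open>(q-1)\<^bsup>q-1\<^esup>\<close> is the one that enters the theorem.\<close>

lemma dual_young:
  fixes q s y n m :: real
  assumes "1 < q" "0 < s" "0 \<le> y" "0 \<le> n" "0 \<le> m"
  shows "q * y powr (q - 1) * (n * m) \<le> s * y powr q + (q - 1) powr (q - 1) * (n powr q * (m powr q / s powr (q - 1)))"
proof -
  define p where "p = q - 1"
  have p: "0 < p" "q = p + 1" using assms by (auto simp: p_def)
  \<comment> \<open>The scaling is chosen such that the first term of Young's inequality becomes \<open>s y\<^sup>q\<close>.\<close>
  define a where "a = (s / p) powr (1 / q) * y"
  define b where "b = n * m * (s / p) powr (- p / q)"
  have a: "a \<ge> 0" "b \<ge> 0" using assms by (auto simp: a_def b_def)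
  have sp: "s / p > 0" using assms p by simp
  have aq: "a powr q = (s / p) * y powr q" using sp assms p(1) by (simp add: a_def powr_mult powr_powr)
  have ap: "a powr p = (s / p) powr (p / q) * y powr p" using sp by (simp add: a_def powr_mult powr_powr)
  have bq: "b powr q = n powr q * (m powr q * (s / p) powr (- p))"
    using sp assms by (simp add: b_def powr_mult powr_powr)
  have "(s / p) powr (p / q) * (s / p) powr (- p / q) = 1" using sp assms p by (simp add: powr_add[symmetric])
  then have "q * y powr p * (n * m) = q * a powr p * b" unfolding ap b_def by (simp add: mult_ac)
  also have "\<dots> \<le> p * a powr q + b powr q" using young_tangent[of q a b] assms a by (simp add: p_def)
  also have "p * a powr q = s * y powr q" unfolding aq using p(1) by simp
  also have "b powr q = p powr p * (n powr q * (m powr q / s powr p))"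
    unfolding bq powr_minus powr_divide using p(1) by (simp add: field_simps)
  finally show ?thesis by (simp add: p_def)
qed

lemma Holder_powr_nn_integral:
  fixes A B :: "'a \<Rightarrow> real"
  assumes [measurable]: "A \<in> borel_measurable M" "B \<in> borel_measurable M"
    and pos: "\<And>x. 0 \<le> A x" "\<And>x. 0 \<le> B x" and ab: "0 \<le> a" "0 \<le> b" "0 < \<alpha>" "0 < \<beta>" "\<alpha> + \<beta> = 1"
    and int: "(\<integral>\<^sup>+x. ennreal (A x) \<partial>M) = ennreal a" "(\<integral>\<^sup>+x. ennreal (B x) \<partial>M) = ennreal b"
  shows "(\<integral>\<^sup>+x. ennreal (A x powr \<alpha> * B x powr \<beta>) \<partial>M) \<le> ennreal (a powr \<alpha> * b powr \<beta>)"
proof (cases "a = 0 \<or> b = 0")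
  case True
  then have "AE x in M. A x = 0 \<or> B x = 0"
  proof
    assume "a = 0"
    then have "AE x in M. ennreal (A x) = 0" using int(1) by (simp add: nn_integral_0_iff_AE)
    then show ?thesis by eventually_elim (use pos in \<open>auto simp: ennreal_eq_0_iff intro: antisym\<close>)
  next
    assume "b = 0"
    then have "AE x in M. ennreal (B x) = 0" using int(2) by (simp add: nn_integral_0_iff_AE)
    then show ?thesis by eventually_elim (use pos in \<open>auto simp: ennreal_eq_0_iff intro: antisym\<close>)
  qed
  then have "AE x in M. ennreal (A x powr \<alpha> * B x powr \<beta>) = 0" by eventually_elim auto
  then have "(\<integral>\<^sup>+x. ennreal (A x powr \<alpha> * B x powr \<beta>) \<partial>M) = 0" by (simp add: nn_integral_0_iff_AE)
  then show ?thesis by simp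
next
  case False
  then have a: "a > 0" and b: "b > 0" using ab by auto
  define c where "c = a powr \<alpha> * b powr \<beta>"
  have c: "c \<ge> 0" by (simp add: c_def)
  have "A x powr \<alpha> * B x powr \<beta> \<le> c * (\<alpha> / a) * A x + c * (\<beta> / b) * B x" for x
  proof (cases "A x = 0 \<or> B x = 0")
    case True
    then show ?thesis using pos[of x] a b ab c by auto
  next
    case False
    then have AB: "A x > 0" "B x > 0" using pos[of x] by (auto simp: less_le)
    have "A x powr \<alpha> * B x powr \<beta> = c * ((A x / a) powr \<alpha> * (B x / b) powr \<beta>)"
      using a b by (simp add: c_def powr_divide)
    also have "\<dots> \<le> c * (\<alpha> * (A x / a) + \<beta> * (B x / b))"
      using ab a b AB c by (intro mult_left_mono Youngs_inequality_0) auto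
    finally show ?thesis by (simp add: algebra_simps)
  qed
  then have "(\<integral>\<^sup>+x. ennreal (A x powr \<alpha> * B x powr \<beta>) \<partial>M)
      \<le> (\<integral>\<^sup>+x. ennreal (c * (\<alpha> / a)) * ennreal (A x) + ennreal (c * (\<beta> / b)) * ennreal (B x) \<partial>M)"
    using pos a b ab c by (intro nn_integral_mono) (simp add: ennreal_mult[symmetric] ennreal_plus[symmetric] ennreal_leI del: ennreal_plus)
  also have "\<dots> = ennreal (c * (\<alpha> / a)) * ennreal a + ennreal (c * (\<beta> / b)) * ennreal b"
    by (simp add: nn_integral_add nn_integral_cmult int)
  also have "\<dots> = ennreal (c * (\<alpha> / a) * a + c * (\<beta> / b) * b)"
    using a b ab c by (simp add: ennreal_mult[symmetric] ennreal_plus[symmetric] del: ennreal_plus)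
  also have "c * (\<alpha> / a) * a + c * (\<beta> / b) * b = c"
    using a b ab(5) by (simp add: distrib_left[symmetric])
  finally show ?thesis by (simp add: c_def)
qed

text \<open>If \<open>h\<close> is not integrable, its Bochner integral is zero by convention and the bound holds
  trivially. It can therefore be applied to the integrand of the dual constraint directly.\<close>

lemma ennreal_integral_le_nn_integral:
  fixes h R :: "'a \<Rightarrow> real"
  assumes "AE x in M. h x \<le> R x"
  shows "ennreal (LINT x|M. h x) \<le> (\<integral>\<^sup>+x. ennreal (R x) \<partial>M)"
proof -
  have "ennreal (LINT x|M. h x) \<le> (\<integral>\<^sup>+x. ennreal (h x) \<partial>M)"
  proof (cases "integrable M h")
    case True
    have fin: "(\<integral>\<^sup>+x. ennreal (h x) \<partial>M) < \<infinity>" using True by (simp add: real_integrable_def top.not_eq_extremum)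
    have "(LINT x|M. h x) \<le> enn2real (\<integral>\<^sup>+x. ennreal (h x) \<partial>M)"
      using real_lebesgue_integral_def[OF True] by simp
    then have "ennreal (LINT x|M. h x) \<le> ennreal (enn2real (\<integral>\<^sup>+x. ennreal (h x) \<partial>M))" by (rule ennreal_leI)
    then show ?thesis unfolding ennreal_enn2real[OF fin[unfolded infinity_ennreal_def]] .
  qed (simp add: not_integrable_integral_eq)
  also have "\<dots> \<le> (\<integral>\<^sup>+x. ennreal (R x) \<partial>M)"
    by (rule nn_integral_mono_AE) (use assms in \<open>auto elim!: eventually_mono intro: ennreal_leI\<close>)
  finally show ?thesis .
qed

text \<open>If the dual functional is finite, then almost everywhere only the two finite branches in the
  definition of \<open>G\<^sub>q\<close> occur; on both the quotient formula is correct, as \<open>0 / 0 = 0\<close>.\<close>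

lemma AE_finite_ennpowr:
  assumes "f \<in> borel_measurable M" "\<phi> \<in> borel_measurable M" "(\<integral>\<^sup>+x. ennpowr (G q (f x) (\<phi> x :: 'a::euclidean_space)) r \<partial>M) < \<infinity>"
  shows "AE x in M. G q (f x) (\<phi> x) = ennreal (norm (\<phi> x) powr q / \<bar>f x\<bar> powr (q - 1)) \<and> (f x < 0 \<or> f x = 0 \<and> \<phi> x = 0)"
proof -
  note [measurable] = assms(1,2)
  have [measurable]: "(\<lambda>x. ennpowr (G q (f x) (\<phi> x)) r) \<in> borel_measurable M"
    unfolding ennpowr_def G_def by measurable
  have "AE x in M. ennpowr (G q (f x) (\<phi> x)) r \<noteq> \<infinity>"
    using assms(3) by (intro nn_integral_PInf_AE) auto
  then show ?thesis
    by eventually_elim (auto simp: G_def ennpowr_def split: if_splits)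
qed

text \<open>The power \<open>|\<psi>|\<^sup>q\<close> of a test function is itself an admissible test function, because \<open>q > 1\<close>.\<close>

lemma dual_test_inequality:
  fixes \<Omega> :: "'a::euclidean_space set"
  assumes \<Omega>: "open \<Omega>" "emeasure lebesgue \<Omega> < \<infinity>" and q: "1 < q" "q < 2"
    and adm: "(f, \<phi>) \<in> admissible \<Omega>" and \<psi>: "\<psi> \<in> C1_0 \<Omega>"
    and N: "(\<integral>\<^sup>+x. ennpowr (G q (f x) (\<phi> x)) (2 / (2 - q)) \<partial>lebesgue_on \<Omega>) = ennreal N" "0 \<le> N"
  shows "(\<integral>\<^sup>+x. ennreal (\<bar>\<psi> x\<bar> powr q) \<partial>lebesgue_on \<Omega>)
    \<le> ennreal ((q - 1) powr (q - 1) * (L2sq (lebesgue_on \<Omega>) (grad \<psi>) powr (q / 2) * N powr ((2 - q) / 2)))"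
proof -
  let ?M = "lebesgue_on \<Omega>"
  define r where "r = 2 / (2 - q)"
  have r: "r > 0" "r * ((2 - q) / 2) = 1" using q by (auto simp: r_def field_simps)
  have meas[measurable]: "f \<in> borel_measurable ?M" "\<phi> \<in> borel_measurable ?M"
    using adm by (auto simp: admissible_def Lp_loc_def)
  note [measurable] = C1_0_measurable(1,2)[OF \<psi>, of \<Omega>]
  define W where "W x = norm (\<phi> x) powr q / \<bar>f x\<bar> powr (q - 1)" for x
  have W_nonneg: "0 \<le> W x" for x by (simp add: W_def)
  have [measurable]: "W \<in> borel_measurable ?M" unfolding W_def[abs_def] by measurable
  have AE: "AE x in ?M. G q (f x) (\<phi> x) = ennreal (W x) \<and> (f x < 0 \<or> f x = 0 \<and> \<phi> x = 0)"
    unfolding W_def using N by (intro AE_finite_ennpowr[of f _ \<phi> q "2 / (2 - q)"]) simp_all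
  have N': "(\<integral>\<^sup>+x. ennreal (W x powr r) \<partial>?M) = ennreal N"
    unfolding N(1)[symmetric] r_def
    by (rule nn_integral_cong_AE) (use AE W_nonneg in \<open>auto elim!: eventually_mono simp: ennpowr_def\<close>)
  define \<zeta> where "\<zeta> x = \<bar>\<psi> x\<bar> powr q" for x
  note C = abs_powr_deriv[OF q(1)] abs_powr_deriv_continuous[OF q(1)]
  have \<zeta>: "\<zeta> \<in> C1_0 \<Omega>" unfolding \<zeta>_def by (rule C1_0_compose[OF \<psi> C]) simp
  have grad_\<zeta>: "grad \<zeta> x = (q * sgn (\<psi> x) * \<bar>\<psi> x\<bar> powr (q - 1)) *\<^sub>R grad \<psi> x" for x
    unfolding \<zeta>_def Ck_1_compose(2)[OF C1_0_Ck[OF \<psi>] C] ..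
  have X: "(\<integral>\<^sup>+x. ennreal ((norm (grad \<psi> x))\<^sup>2) \<partial>?M) = ennreal (L2sq ?M (grad \<psi>))"
    using C1_0_square_integrable(2)[OF \<Omega>(1) \<psi>] by (intro nn_integral_eq_integral) (auto simp: square_integrable_def)
  have "(\<integral>\<^sup>+x. ennreal (\<zeta> x) \<partial>?M) = ennreal (LINT x|?M. \<zeta> x)"
    using finite_measure.square_integrable_integrable[OF finite_measure_lebesgue_on_open[OF \<Omega>] C1_0_square_integrable(1)[OF \<Omega>(1) \<zeta>]]
    by (intro nn_integral_eq_integral) (auto simp: \<zeta>_def[abs_def])
  also have "\<dots> \<le> ennreal (LINT x|?M. grad \<zeta> x \<bullet> \<phi> x + f x * \<zeta> x)"
  proof (rule ennreal_leI)
    have "\<forall>x. 0 \<le> \<zeta> x" by (simp add: \<zeta>_def)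
    then show "(LINT x|?M. \<zeta> x) \<le> (LINT x|?M. grad \<zeta> x \<bullet> \<phi> x + f x * \<zeta> x)"
      using adm \<zeta> by (simp add: admissible_def dist_ineq_def)
  qed
  also have "\<dots> \<le> (\<integral>\<^sup>+x. ennreal ((q - 1) powr (q - 1) * (norm (grad \<psi> x) powr q * W x)) \<partial>?M)"
  proof (rule ennreal_integral_le_nn_integral)
    show "AE x in ?M. grad \<zeta> x \<bullet> \<phi> x + f x * \<zeta> x \<le> (q - 1) powr (q - 1) * (norm (grad \<psi> x) powr q * W x)"
      using AE
    proof eventually_elim
      case (elim x)
      show ?case
      proof (cases "f x = 0")
        case True
        then show ?thesis using elim W_nonneg[of x] by simp
      next
        case False
        then have f: "\<bar>f x\<bar> = - f x" "\<bar>f x\<bar> > 0" using elim by auto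
        have "grad \<zeta> x \<bullet> \<phi> x \<le> \<bar>grad \<zeta> x \<bullet> \<phi> x\<bar>" by (rule abs_ge_self)
        also have "\<dots> = q * \<bar>sgn (\<psi> x)\<bar> * \<bar>\<psi> x\<bar> powr (q - 1) * \<bar>grad \<psi> x \<bullet> \<phi> x\<bar>"
          using q by (simp add: grad_\<zeta> abs_mult)
        also have "\<dots> \<le> q * 1 * \<bar>\<psi> x\<bar> powr (q - 1) * (norm (grad \<psi> x) * norm (\<phi> x))"
          using q by (intro mult_mono Cauchy_Schwarz_ineq2) (auto simp: abs_sgn_eq)
        also have "\<dots> \<le> \<bar>f x\<bar> * \<bar>\<psi> x\<bar> powr q + (q - 1) powr (q - 1) * (norm (grad \<psi> x) powr q * W x)"
          unfolding W_def using dual_young[of q "\<bar>f x\<bar>" "\<bar>\<psi> x\<bar>" "norm (grad \<psi> x)" "norm (\<phi> x)"] q f by simp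
        finally show ?thesis using f by (simp add: \<zeta>_def)
      qed
    qed
  qed
  also have "\<dots> = ennreal ((q - 1) powr (q - 1)) * (\<integral>\<^sup>+x. ennreal (norm (grad \<psi> x) powr q * W x) \<partial>?M)"
    using W_nonneg by (simp add: ennreal_mult nn_integral_cmult)
  also have "(\<integral>\<^sup>+x. ennreal (norm (grad \<psi> x) powr q * W x) \<partial>?M)
      = (\<integral>\<^sup>+x. ennreal (((norm (grad \<psi> x))\<^sup>2) powr (q / 2) * (W x powr r) powr ((2 - q) / 2)) \<partial>?M)"
  proof (intro nn_integral_cong)
    fix x
    have "((norm (grad \<psi> x))\<^sup>2) powr (q / 2) = norm (grad \<psi> x) powr q"
      using powr_powr[of "norm (grad \<psi> x)" 2 "q / 2"] by simp
    moreover have "(W x powr r) powr ((2 - q) / 2) = W x"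
      using W_nonneg[of x] unfolding powr_powr r(2) by simp
    ultimately show "ennreal (norm (grad \<psi> x) powr q * W x)
      = ennreal (((norm (grad \<psi> x))\<^sup>2) powr (q / 2) * (W x powr r) powr ((2 - q) / 2))" by simp
  qed
  also have "\<dots> \<le> ennreal (L2sq ?M (grad \<psi>) powr (q / 2) * N powr ((2 - q) / 2))"
    by (rule Holder_powr_nn_integral[OF _ _ _ _ _ _ _ _ _ X N']) (use q N(2) in \<open>auto simp: field_simps\<close>)
  finally show ?thesis by (simp add: \<zeta>_def ennreal_mult mult_left_mono)
qed

lemma powr_le_one_plus_sq:
  fixes t q :: real
  assumes "0 \<le> q" "q \<le> 2"
  shows "\<bar>t\<bar> powr q \<le> 1 + t\<^sup>2"
proof (cases "\<bar>t\<bar> \<le> 1")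
  case True
  then have "\<bar>t\<bar> powr q \<le> 1" using assms by (intro powr_le1) auto
  then show ?thesis by (simp add: add_increasing2)
next
  case False
  then have "\<bar>t\<bar> powr q \<le> \<bar>t\<bar> powr 2" using assms by (intro powr_mono) auto
  then show ?thesis using False by simp
qed

lemma (in finite_measure) abs_powr_integrable:
  fixes u :: "'a \<Rightarrow> real"
  assumes "square_integrable M u" "0 \<le> q" "q \<le> 2"
  shows "integrable M (\<lambda>x. \<bar>u x\<bar> powr q)"
proof (rule Bochner_Integration.integrable_bound)
  show "integrable M (\<lambda>x. 1 + (u x)\<^sup>2)" using assms(1) by (simp add: square_integrable_def)
  show "(\<lambda>x. \<bar>u x\<bar> powr q) \<in> borel_measurable M" using assms(1) by measurable
  show "AE x in M. norm (\<bar>u x\<bar> powr q) \<le> norm (1 + (u x)\<^sup>2)"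
    using powr_le_one_plus_sq[OF assms(2,3)] by (intro AE_I2) (simp add: abs_of_nonneg add_nonneg_nonneg)
qed

text \<open>Extension from test functions to the Sobolev space, by Fatou's lemma on the left and convergence
  of the energies on the right.\<close>

lemma dual_inequality:
  fixes \<Omega> :: "'a::euclidean_space set"
  assumes \<Omega>: "open \<Omega>" "emeasure lebesgue \<Omega> < \<infinity>" and q: "1 < q" "q < 2"
    and adm: "(f, \<phi>) \<in> admissible \<Omega>" and zt: "zero_trace \<Omega> u g"
    and N: "(\<integral>\<^sup>+x. ennpowr (G q (f x) (\<phi> x)) (2 / (2 - q)) \<partial>lebesgue_on \<Omega>) = ennreal N" "0 \<le> N"
  shows "(LINT x|lebesgue_on \<Omega>. \<bar>u x\<bar> powr q)
    \<le> (q - 1) powr (q - 1) * (L2sq (lebesgue_on \<Omega>) g powr (q / 2) * N powr ((2 - q) / 2))"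
proof -
  let ?M = "lebesgue_on \<Omega>"
  interpret finite_measure ?M by (rule finite_measure_lebesgue_on_open[OF \<Omega>])
  define c where "c = (q - 1) powr (q - 1)"
  note si = zero_trace_square_integrable[OF zt]
  obtain \<psi> where \<psi>: "\<And>n. \<psi> n \<in> Cinf_0 \<Omega>" "(\<lambda>n. L2sq ?M (\<lambda>x. \<psi> n x - u x)) \<longlonglongrightarrow> 0"
    "(\<lambda>n. L2sq ?M (\<lambda>x. grad (\<psi> n) x - g x)) \<longlonglongrightarrow> 0" "AE x in ?M. (\<lambda>n. \<psi> n x) \<longlonglongrightarrow> u x"
    using zero_trace_approximation[OF \<Omega>(1) zt] by blast
  note si\<psi> = Cinf_0_square_integrable[OF \<Omega>(1) \<psi>(1)]
  have [measurable]: "\<psi> n \<in> borel_measurable ?M" for n using si\<psi>(1)[of n] by (simp add: square_integrable_def)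
  have \<psi>C: "\<psi> n \<in> C1_0 \<Omega>" for n using \<psi>(1) Cinf_0_subset_C1_0 by blast
  let ?R = "\<lambda>X. c * (X powr (q / 2) * N powr ((2 - q) / 2))"
  have "(\<integral>\<^sup>+x. ennreal (\<bar>u x\<bar> powr q) \<partial>?M) = (\<integral>\<^sup>+x. liminf (\<lambda>n. ennreal (\<bar>\<psi> n x\<bar> powr q)) \<partial>?M)"
  proof (rule nn_integral_cong_AE)
    show "AE x in ?M. ennreal (\<bar>u x\<bar> powr q) = liminf (\<lambda>n. ennreal (\<bar>\<psi> n x\<bar> powr q))"
      using \<psi>(4)
    proof eventually_elim
      case (elim x)
      have "(\<lambda>n. ennreal (\<bar>\<psi> n x\<bar> powr q)) \<longlonglongrightarrow> ennreal (\<bar>u x\<bar> powr q)"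
        using q by (intro tendsto_ennrealI tendsto_powr' tendsto_rabs tendsto_const elim) auto
      then show ?case by (rule lim_imp_Liminf[OF trivial_limit_sequentially, symmetric])
    qed
  qed
  also have "\<dots> \<le> liminf (\<lambda>n. \<integral>\<^sup>+x. ennreal (\<bar>\<psi> n x\<bar> powr q) \<partial>?M)"
    by (intro nn_integral_liminf) measurable
  also have "\<dots> \<le> liminf (\<lambda>n. ennreal (?R (L2sq ?M (grad (\<psi> n)))))"
    using dual_test_inequality[OF \<Omega> q adm \<psi>C N] unfolding c_def by (intro Liminf_mono always_eventually allI)
  also have "\<dots> = ennreal (?R (L2sq ?M g))"
  proof (rule lim_imp_Liminf[OF trivial_limit_sequentially])
    have "(\<lambda>n. L2sq ?M (grad (\<psi> n))) \<longlonglongrightarrow> L2sq ?M g" by (rule L2sq_tendsto[OF si\<psi>(2) si(2) \<psi>(3)])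
    then show "(\<lambda>n. ennreal (?R (L2sq ?M (grad (\<psi> n))))) \<longlonglongrightarrow> ennreal (?R (L2sq ?M g))"
      using q by (intro tendsto_ennrealI tendsto_mult tendsto_const tendsto_powr') auto
  qed
  also have "(\<integral>\<^sup>+x. ennreal (\<bar>u x\<bar> powr q) \<partial>?M) = ennreal (LINT x|?M. \<bar>u x\<bar> powr q)"
    using abs_powr_integrable[OF si(1), of q] q by (intro nn_integral_eq_integral) auto
  finally have "ennreal (LINT x|?M. \<bar>u x\<bar> powr q) \<le> ennreal (?R (L2sq ?M g))" .
  moreover have "0 \<le> ?R (L2sq ?M g)" by (simp add: c_def)
  ultimately show ?thesis by (simp add: ennreal_le_iff c_def)
qed

section \<open>The principal frequency\<close>

lemma ennreal_inverse_antimono: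
  fixes a b :: ennreal
  assumes "a \<le> b"
  shows "inverse b \<le> inverse a"
proof (cases a)
  case (real x)
  show ?thesis
  proof (cases b)
    case (real y)
    show ?thesis
    proof (cases "x = 0")
      case False
      then have "0 < x" "x \<le> y" using assms \<open>a = ennreal x\<close> \<open>0 \<le> x\<close> real by auto
      then show ?thesis
        using \<open>a = ennreal x\<close> real by (simp add: inverse_ennreal ennreal_leI le_imp_inverse_le)
    qed (simp add: \<open>a = ennreal x\<close>)
  qed simp
qed (use assms in \<open>simp add: top_unique\<close>)

lemma W12_0_quotient:
  fixes \<Omega> :: "'a::euclidean_space set"
  assumes \<Omega>: "open \<Omega>" "emeasure lebesgue \<Omega> < \<infinity>" and q: "1 < q" "q < 2" and zt: "zero_trace \<Omega> u g"
  shows "(\<integral>\<^sup>+x. ennreal ((norm (weak_gradient \<Omega> u x))\<^sup>2) \<partial>lebesgue_on \<Omega>) = ennreal (L2sq (lebesgue_on \<Omega>) g)"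
    and "ennpowr (\<integral>\<^sup>+x. ennreal (\<bar>u x\<bar> powr q) \<partial>lebesgue_on \<Omega>) (2 / q) = ennreal ((LINT x|lebesgue_on \<Omega>. \<bar>u x\<bar> powr q) powr (2 / q))"
proof -
  let ?M = "lebesgue_on \<Omega>"
  interpret finite_measure ?M by (rule finite_measure_lebesgue_on_open[OF \<Omega>])
  note si = zero_trace_square_integrable[OF zt]
  have "(\<integral>\<^sup>+x. ennreal ((norm (weak_gradient \<Omega> u x))\<^sup>2) \<partial>?M) = (\<integral>\<^sup>+x. ennreal ((norm (g x))\<^sup>2) \<partial>?M)"
    by (rule nn_integral_cong_AE) (use zero_trace_weak_gradient(1)[OF \<Omega> zt] in \<open>auto elim!: eventually_mono\<close>)
  also have "\<dots> = ennreal (L2sq ?M g)"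
    using si(2) by (intro nn_integral_eq_integral) (auto simp: square_integrable_def)
  finally show "(\<integral>\<^sup>+x. ennreal ((norm (weak_gradient \<Omega> u x))\<^sup>2) \<partial>?M) = ennreal (L2sq ?M g)" .
  have "(\<integral>\<^sup>+x. ennreal (\<bar>u x\<bar> powr q) \<partial>?M) = ennreal (LINT x|?M. \<bar>u x\<bar> powr q)"
    using abs_powr_integrable[OF si(1), of q] q by (intro nn_integral_eq_integral) auto
  moreover have "0 \<le> (LINT x|?M. \<bar>u x\<bar> powr q)" by (intro integral_nonneg_AE) auto
  ultimately show "ennpowr (\<integral>\<^sup>+x. ennreal (\<bar>u x\<bar> powr q) \<partial>?M) (2 / q) = ennreal ((LINT x|?M. \<bar>u x\<bar> powr q) powr (2 / q))"
    by (simp add: ennpowr_def)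
qed

lemma abs_powr_integral_pos:
  fixes \<Omega> :: "'a::euclidean_space set" and u :: "'a \<Rightarrow> real"
  assumes \<Omega>: "open \<Omega>" "emeasure lebesgue \<Omega> < \<infinity>" and q: "1 < q" "q < 2"
    and si: "square_integrable (lebesgue_on \<Omega>) u" and nz: "\<not> (AE x in lebesgue_on \<Omega>. u x = 0)"
  shows "0 < (LINT x|lebesgue_on \<Omega>. \<bar>u x\<bar> powr q)"
proof -
  let ?M = "lebesgue_on \<Omega>"
  interpret finite_measure ?M by (rule finite_measure_lebesgue_on_open[OF \<Omega>])
  have int: "integrable ?M (\<lambda>x. \<bar>u x\<bar> powr q)" using abs_powr_integrable[OF si, of q] q by auto
  have ne: "0 \<noteq> (LINT x|?M. \<bar>u x\<bar> powr q)"
    using nz integral_nonneg_eq_0_iff_AE[OF int] by auto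
  have "0 \<le> (LINT x|?M. \<bar>u x\<bar> powr q)" by (intro integral_nonneg_AE) auto
  then show ?thesis using ne by (rule le_neq_trans)
qed

text \<open>If the bound \<open>K\<close> is zero, every function with zero trace vanishes almost everywhere; then there
  are no competitors, the principal frequency is infinite, and its reciprocal is zero.\<close>

lemma weak_duality:
  fixes \<Omega> :: "'a::euclidean_space set"
  assumes \<Omega>: "open \<Omega>" "emeasure lebesgue \<Omega> < \<infinity>" and q: "1 < q" "q < 2"
    and adm: "d \<in> admissible \<Omega>"
  shows "1 / principal_frequency \<Omega> q \<le> ennreal ((q - 1) powr ((q - 1) * (2 / q))) * dual_functional \<Omega> q d"
proof -
  let ?M = "lebesgue_on \<Omega>"
  obtain f \<phi> where d: "d = (f, \<phi>)" by (cases d)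
  define p where "p = q - 1"
  have p: "0 < p" using q by (simp add: p_def)
  define r where "r = 2 / (2 - q)"
  have r: "r > 0" "1 / r = (2 - q) / 2" using q by (auto simp: r_def)
  show ?thesis
  proof (cases "(\<integral>\<^sup>+x. ennpowr (G q (f x) (\<phi> x)) r \<partial>?M)")
    case top
    then have "dual_functional \<Omega> q d = \<infinity>"
      by (simp add: d dual_functional_def eLp_norm_def r_def[symmetric] ennpowr_def)
    then show ?thesis using p by (simp add: p_def[symmetric] ennreal_mult_top)
  next
    case (real N)
    define K where "K = p powr (p * (2 / q)) * N powr ((2 - q) / q)"
    have K: "K \<ge> 0" by (simp add: K_def)
    have "dual_functional \<Omega> q d = ennreal ((N powr (1 / r)) powr (2 / q))"
      using real by (simp add: d dual_functional_def eLp_norm_def r_def[symmetric] ennpowr_def)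
    also have "(N powr (1 / r)) powr (2 / q) = N powr ((2 - q) / q)"
    proof -
      have "(2 - q) / 2 * (2 / q) = (2 - q) / q" using q by (simp add: field_simps)
      then show ?thesis unfolding r(2) powr_powr by (simp only:)
    qed
    finally have eq: "ennreal (p powr (p * (2 / q))) * dual_functional \<Omega> q d = ennreal K"
      by (simp add: K_def ennreal_mult)
    have main: "S powr (2 / q) \<le> K * X"
      if "S = (LINT x|?M. \<bar>u x\<bar> powr q)" "X = L2sq ?M g" "zero_trace \<Omega> u g" for u g S X
    proof -
      have S: "0 \<le> S" unfolding that(1) by (intro integral_nonneg_AE) auto
      have "S \<le> p powr p * (X powr (q / 2) * N powr ((2 - q) / 2))"
        unfolding that(1,2) p_def by (rule dual_inequality[OF \<Omega> q adm[unfolded d] that(3) real(2)[unfolded r_def] real(1)])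
      then have "S powr (2 / q) \<le> (p powr p * (X powr (q / 2) * N powr ((2 - q) / 2))) powr (2 / q)"
        using S q by (intro powr_mono2) auto
      also have "\<dots> = K * X"
      proof -
        have e: "q / 2 * (2 / q) = 1" "(2 - q) / 2 * (2 / q) = (2 - q) / q" using q by (auto simp: field_simps)
        show ?thesis unfolding K_def powr_mult powr_powr e using that(2) by simp
      qed
      finally show ?thesis .
    qed
    have "ennreal (1 / K) \<le> principal_frequency \<Omega> q" if "K > 0"
      unfolding principal_frequency_def
    proof (rule INF_greatest)
      fix u assume u: "u \<in> {\<phi> \<in> W12_0 \<Omega>. \<not> (AE x in ?M. \<phi> x = 0)}"
      then have zt: "zero_trace \<Omega> u (weak_gradient \<Omega> u)" using W12_0_imp_zero_trace[OF \<Omega>(1)] by blast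
      define S where "S = (LINT x|?M. \<bar>u x\<bar> powr q)"
      define X where "X = L2sq ?M (weak_gradient \<Omega> u)"
      have S: "S > 0" unfolding S_def using u abs_powr_integral_pos[OF \<Omega> q zero_trace_square_integrable(1)[OF zt]] by blast
      have "1 / K \<le> X / S powr (2 / q)"
        using main[OF S_def X_def zt] S that by (simp add: field_simps)
      then have "ennreal (1 / K) \<le> ennreal X / ennreal (S powr (2 / q))"
        using S by (simp add: divide_ennreal X_def ennreal_leI)
      then show "ennreal (1 / K) \<le> (\<integral>\<^sup>+ x. ennreal ((norm (weak_gradient \<Omega> u x))\<^sup>2) \<partial>?M) /
          ennpowr (\<integral>\<^sup>+ x. ennreal (\<bar>u x\<bar> powr q) \<partial>?M) (2 / q)"
        unfolding W12_0_quotient[OF \<Omega> q zt] S_def X_def .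
    qed
    moreover have "principal_frequency \<Omega> q = \<infinity>" if "K = 0"
    proof -
      have no: "\<not> (u \<in> W12_0 \<Omega> \<and> \<not> (AE x in ?M. u x = 0))" for u
      proof
        assume u: "u \<in> W12_0 \<Omega> \<and> \<not> (AE x in ?M. u x = 0)"
        then have zt: "zero_trace \<Omega> u (weak_gradient \<Omega> u)" using W12_0_imp_zero_trace[OF \<Omega>(1)] by blast
        have "0 < (LINT x|?M. \<bar>u x\<bar> powr q)" using u abs_powr_integral_pos[OF \<Omega> q zero_trace_square_integrable(1)[OF zt]] by blast
        then show False using main[OF refl refl zt] that by simp
      qed
      then have empty: "{\<phi> \<in> W12_0 \<Omega>. \<not> (AE x in ?M. \<phi> x = 0)} = {}" by blast
      show ?thesis unfolding principal_frequency_def empty by simp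
    qed
    ultimately have "1 / principal_frequency \<Omega> q \<le> ennreal K"
    proof (cases "K = 0")
      case False
      then have K': "K > 0" using K by simp
      have "1 / principal_frequency \<Omega> q \<le> 1 / ennreal (1 / K)"
        using \<open>K > 0 \<Longrightarrow> _\<close>[OF K'] by (simp add: divide_ennreal_def ennreal_inverse_antimono)
      also have "\<dots> = ennreal K" using K' by (simp add: divide_ennreal_def inverse_ennreal)
      finally show ?thesis .
    qed simp
    then show ?thesis unfolding eq[symmetric] p_def .
  qed
qed

text \<open>The defining inequality of the principal frequency without division, so that it holds for the
  zero function as well.\<close>

lemma competitor_inequality:
  fixes \<Omega> :: "'a::euclidean_space set"
  assumes \<Omega>: "open \<Omega>" "emeasure lebesgue \<Omega> < \<infinity>" and q: "1 < q" "q < 2"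
    and m: "1 / principal_frequency \<Omega> q \<le> ennreal m" "0 \<le> m" and zt: "zero_trace \<Omega> u g"
  shows "(LINT x|lebesgue_on \<Omega>. \<bar>u x\<bar> powr q) \<le> m powr (q / 2) * L2sq (lebesgue_on \<Omega>) g powr (q / 2)"
proof (cases "AE x in lebesgue_on \<Omega>. u x = 0")
  case True
  have "(LINT x|lebesgue_on \<Omega>. \<bar>u x\<bar> powr q) = (LINT x|lebesgue_on \<Omega>. 0)"
    using square_integrable_measurable[OF zero_trace_square_integrable(1)[OF zt]]
    by (intro integral_cong_AE) (use True in \<open>auto elim!: eventually_mono\<close>)
  then show ?thesis by simp
next
  case False
  let ?M = "lebesgue_on \<Omega>"
  define S where "S = (LINT x|?M. \<bar>u x\<bar> powr q)"
  define X where "X = L2sq ?M g"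
  have S: "S > 0" unfolding S_def by (rule abs_powr_integral_pos[OF \<Omega> q zero_trace_square_integrable(1)[OF zt] False])
  have X: "X \<ge> 0" by (simp add: X_def)
  have "principal_frequency \<Omega> q \<le> ennreal X / ennreal (S powr (2 / q))"
    unfolding principal_frequency_def S_def X_def W12_0_quotient[OF \<Omega> q zt, symmetric]
    by (rule INF_lower) (use False zero_trace_imp_W12_0[OF \<Omega> zt] in simp)
  then have pf: "principal_frequency \<Omega> q \<le> ennreal (X / S powr (2 / q))"
    using S X by (simp add: divide_ennreal)
  have "1 / ennreal (X / S powr (2 / q)) \<le> 1 / principal_frequency \<Omega> q"
    using pf by (simp add: divide_ennreal_def ennreal_inverse_antimono)
  also note m(1)
  finally have le: "1 / ennreal (X / S powr (2 / q)) \<le> ennreal m" .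
  have X_pos: "X > 0"
  proof (rule ccontr)
    assume "\<not> X > 0"
    then have "X = 0" using X by simp
    then show False using le by (simp add: top_unique)
  qed
  have "1 / ennreal (X / S powr (2 / q)) = ennreal (S powr (2 / q) / X)"
    using X_pos S by (simp add: divide_ennreal_def inverse_ennreal)
  then have "S powr (2 / q) / X \<le> m" using le m(2) by (simp add: ennreal_le_iff)
  then have "S powr (2 / q) \<le> m * X" using X_pos by (simp add: field_simps)
  then have "(S powr (2 / q)) powr (q / 2) \<le> (m * X) powr (q / 2)" using q by (intro powr_mono2) auto
  then show ?thesis using S q by (simp add: powr_powr powr_mult S_def X_def)
qed

section \<open>Absence of a duality gap\<close>

lemma powr_subadditive:
  fixes a b p :: real
  assumes "0 \<le> a" "0 \<le> b" "0 \<le> p" "p \<le> 1"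
  shows "(a + b) powr p \<le> a powr p + b powr p"
proof (cases "a + b = 0")
  case False
  then have ab: "a + b > 0" using assms by simp
  have le: "t \<le> t powr p" if "0 \<le> t" "t \<le> 1" for t :: real
    using powr_mono'[of p 1 t] assms that by simp
  have "1 = a / (a + b) + b / (a + b)" using ab by (simp add: add_divide_distrib[symmetric])
  also have "\<dots> \<le> (a / (a + b)) powr p + (b / (a + b)) powr p"
    using ab assms by (intro add_mono le) auto
  also have "\<dots> = (a powr p + b powr p) / (a + b) powr p"
    using ab assms by (simp add: powr_divide add_divide_distrib)
  finally show ?thesis using ab by (simp add: field_simps)
qed (use assms in auto)

text \<open>Test the equation with its own solution and split \<open>(u + \<delta>)\<^bsup>q-1\<^esup> \<le> u\<^bsup>q-1\<^esup> + \<delta>\<^bsup>q-1\<^esup>\<close>; the second part is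
  estimated by the Cauchy--Schwarz and Poincare inequalities.\<close>

lemma (in singular_solution) energy_estimate:
  assumes "poincare_constant \<Omega> P"
  shows "L2sq M g \<le> (LINT x|M. \<bar>u x\<bar> powr q) + \<delta> powr (q - 1) * sqrt (measure M (space M) * P) * sqrt (L2sq M g)"
proof -
  have int_q: "integrable M (\<lambda>x. \<bar>u x\<bar> powr q)" using abs_powr_integrable[OF u_g_square_integrable(1), of q] q by simp
  have int_1: "integrable M (\<lambda>x. \<bar>u x\<bar>)" using square_integrable_integrable[OF u_g_square_integrable(1)] by simp
  have "L2sq M g = (LINT x|M. reg (q - 1) \<delta> (u x) * u x)" by (rule weak_solution_energy[OF sol])
  also have "\<dots> \<le> (LINT x|M. \<bar>u x\<bar> powr q + \<delta> powr (q - 1) * \<bar>u x\<bar>)"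
  proof (rule integral_mono_AE)
    show "integrable M (\<lambda>x. reg (q - 1) \<delta> (u x) * u x)"
      using q \<delta> by (intro integrable_mult_square square_integrable_reg u_g_square_integrable) auto
    show "integrable M (\<lambda>x. \<bar>u x\<bar> powr q + \<delta> powr (q - 1) * \<bar>u x\<bar>)" using int_q int_1 by simp
    show "AE x in M. reg (q - 1) \<delta> (u x) * u x \<le> \<bar>u x\<bar> powr q + \<delta> powr (q - 1) * \<bar>u x\<bar>"
      using u_nonneg
    proof eventually_elim
      case (elim x)
      have "reg (q - 1) \<delta> (u x) * u x \<le> (\<bar>u x\<bar> powr (q - 1) + \<delta> powr (q - 1)) * \<bar>u x\<bar>"
        unfolding reg_def using elim q \<delta> by (intro mult_mono powr_subadditive) auto
      also have "\<dots> = \<bar>u x\<bar> powr q + \<delta> powr (q - 1) * \<bar>u x\<bar>"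
        using powr_mult_base[of "\<bar>u x\<bar>" "q - 1"] by (simp add: algebra_simps)
      finally show ?case .
    qed
  qed
  also have "\<dots> = (LINT x|M. \<bar>u x\<bar> powr q) + \<delta> powr (q - 1) * (LINT x|M. \<bar>u x\<bar>)"
    using int_q int_1 by simp
  also have "(LINT x|M. \<bar>u x\<bar>) \<le> sqrt (measure M (space M) * P) * sqrt (L2sq M g)"
  proof -
    have "(LINT x|M. \<bar>u x\<bar> \<bullet> 1)\<^sup>2 \<le> L2sq M (\<lambda>x. \<bar>u x\<bar>) * L2sq M (\<lambda>x. 1::real)"
      using square_integrable_norm[OF u_g_square_integrable(1)] by (intro L2_Cauchy_Schwarz square_integrable_const) simp
    also have "\<dots> = L2sq M u * measure M (space M)" by simp
    also have "\<dots> \<le> (P * L2sq M g) * measure M (space M)"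
      using assms u_zero_trace by (intro mult_right_mono) (auto simp: poincare_constant_def)
    finally have "(LINT x|M. \<bar>u x\<bar>) \<le> sqrt ((P * L2sq M g) * measure M (space M))"
      by (intro real_le_rsqrt) simp
    then show ?thesis by (simp add: real_sqrt_mult mult_ac)
  qed
  finally show ?thesis using \<delta> by (simp add: mult_left_mono mult.assoc)
qed

text \<open>If there were a gap, choose numbers \<open>\<mu> < m\<close> in it. The pair built from the solution for \<open>\<delta>\<close> has a
  value above \<open>m\<close>, which keeps its energy \<open>X\<close> above \<open>X0 = m\<^bsup>q/(2-q)\<^esup>\<close>. After division by \<open>X\<^bsup>q/2\<^esup>\<close> the
  energy estimate therefore has an error that is uniformly of order \<open>\<delta>\<^bsup>q-1\<^esup>\<close>, and
  \<open>m\<^bsup>q/2\<^esup> \<le> \<mu>\<^bsup>q/2\<^esup>\<close> follows in the limit, a contradiction.\<close>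

lemma no_duality_gap:
  fixes \<Omega> :: "'a::euclidean_space set"
  assumes \<Omega>: "open \<Omega>" "emeasure lebesgue \<Omega> < \<infinity>" and q: "1 < q" "q < 2"
  shows "ennreal ((q - 1) powr ((q - 1) * (2 / q))) * (INF d\<in>admissible \<Omega>. dual_functional \<Omega> q d)
    \<le> 1 / principal_frequency \<Omega> q"
proof (rule ccontr)
  let ?M = "lebesgue_on \<Omega>"
  interpret finite_measure ?M by (rule finite_measure_lebesgue_on_open[OF \<Omega>])
  define c where "c = ennreal ((q - 1) powr ((q - 1) * (2 / q)))"
  define I where "I = (INF d\<in>admissible \<Omega>. dual_functional \<Omega> q d)"
  assume "\<not> ennreal ((q - 1) powr ((q - 1) * (2 / q))) * (INF d\<in>admissible \<Omega>. dual_functional \<Omega> q d) \<le> 1 / principal_frequency \<Omega> q"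
  then have gap: "1 / principal_frequency \<Omega> q < c * I" by (simp add: c_def I_def not_le)
  then obtain e1 where e1: "1 / principal_frequency \<Omega> q < e1" "e1 < c * I" using dense by blast
  then obtain e2 where e2: "e1 < e2" "e2 < c * I" using dense by blast
  have "e1 < top" "e2 < top" using e1 e2 by (auto intro: less_le_trans order.strict_trans)
  then obtain \<mu> m where \<mu>: "e1 = ennreal \<mu>" "0 \<le> \<mu>" and m: "e2 = ennreal m" "0 \<le> m"
    by (metis ennreal_cases less_irrefl)
  have \<mu>m: "\<mu> < m" using e2(1) \<mu> m by (simp add: ennreal_less_iff)
  have m_pos: "m > 0" using \<mu>m \<mu>(2) by simp
  have pf: "1 / principal_frequency \<Omega> q \<le> ennreal \<mu>" using e1(1) \<mu>(1) by simp
  obtain P where P: "poincare_constant \<Omega> P" using poincare_constant_exists[OF \<Omega>] by blast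
  define K where "K = sqrt (measure ?M (space ?M) * P)"
  have K: "K \<ge> 0" using P by (simp add: K_def poincare_constant_def)
  define X0 where "X0 = m powr (q / (2 - q))"
  have X0: "X0 > 0" using m_pos by (simp add: X0_def)
  have X0_powr: "X0 powr ((2 - q) / 2) = m powr (q / 2)" "X0 powr ((2 - q) / q) = m"
    using q m_pos by (simp_all add: X0_def powr_powr)
  define b where "b = m powr (q / 2) - \<mu> powr (q / 2)"
  have b: "b > 0" unfolding b_def using powr_less_mono2[of "q / 2" \<mu> m] q \<mu>(2) \<mu>m by simp
  have bound: "b \<le> \<delta> powr (q - 1) * K * X0 powr ((1 - q) / 2)" if \<delta>: "\<delta> > 0" for \<delta>
  proof -
    obtain u g where ug: "weak_solution \<Omega> (\<lambda>x. reg (q - 1) \<delta> (u x)) u g" "AE x in ?M. 0 \<le> u x"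
      using regularised_solution_exists[OF \<Omega> \<delta>, of "q - 1"] q by auto
    interpret s: singular_solution \<Omega> q \<delta> u g
    proof
      show "AE x in ?M. 0 < u x + \<delta>" using ug(2) by eventually_elim (use \<delta> in simp)
    qed (use \<Omega> q \<delta> ug in auto)
    define X where "X = L2sq ?M g"
    have "ennreal m < c * I" using e2(2) m(1) by simp
    also have "\<dots> \<le> c * dual_functional \<Omega> q (s.f\<^sub>0, s.\<phi>\<^sub>0)"
      unfolding I_def by (intro mult_left_mono INF_lower s.dual_pair_admissible) auto
    also have "\<dots> = ennreal (X powr ((2 - q) / q))" unfolding c_def X_def by (rule s.dual_value)
    finally have "m < X powr ((2 - q) / q)" using m(2) by (simp add: ennreal_less_iff)
    have X_nonneg: "X \<ge> 0" by (simp add: X_def)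
    have XX0: "X0 < X"
    proof (rule ccontr)
      assume "\<not> X0 < X"
      then have "X powr ((2 - q) / q) \<le> X0 powr ((2 - q) / q)" using q X_nonneg by (intro powr_mono2) auto
      then show False using \<open>m < X powr ((2 - q) / q)\<close> X0_powr(2) by simp
    qed
    then have X: "X > 0" using X0 by simp
    have "X \<le> (LINT x|?M. \<bar>u x\<bar> powr q) + \<delta> powr (q - 1) * K * sqrt X"
      unfolding X_def K_def by (rule s.energy_estimate[OF P])
    also have "(LINT x|?M. \<bar>u x\<bar> powr q) \<le> \<mu> powr (q / 2) * X powr (q / 2)"
      unfolding X_def by (rule competitor_inequality[OF \<Omega> q pf \<mu>(2) s.u_zero_trace])
    finally have "X / X powr (q / 2) \<le> (\<mu> powr (q / 2) * X powr (q / 2) + \<delta> powr (q - 1) * K * sqrt X) / X powr (q / 2)"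
      by (intro divide_right_mono) auto
    also have "\<dots> = \<mu> powr (q / 2) + \<delta> powr (q - 1) * K * (sqrt X / X powr (q / 2))"
      using X by (simp add: add_divide_distrib)
    also have "sqrt X / X powr (q / 2) = X powr ((1 - q) / 2)"
    proof -
      have "sqrt X / X powr (q / 2) = X powr (1 / 2 - q / 2)"
        using X by (simp only: powr_half_sqrt[symmetric, OF X_nonneg] powr_diff)
      then show ?thesis by (simp add: diff_divide_distrib)
    qed
    also have "X powr ((1 - q) / 2) \<le> X0 powr ((1 - q) / 2)"
      using q X0 XX0 by (intro powr_mono2') auto
    finally have le: "X / X powr (q / 2) \<le> \<mu> powr (q / 2) + \<delta> powr (q - 1) * K * X0 powr ((1 - q) / 2)"
      using K by (simp add: mult_left_mono)
    have "m powr (q / 2) \<le> X powr ((2 - q) / 2)"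
      unfolding X0_powr(1)[symmetric] using q X0 XX0 by (intro powr_mono2) auto
    also have "X powr ((2 - q) / 2) = X / X powr (q / 2)"
      using X powr_diff[of X 1 "q / 2"] by (simp add: diff_divide_distrib)
    finally show ?thesis using le by (simp add: b_def)
  qed
  have "((\<lambda>\<delta>. \<delta> powr (q - 1) * K * X0 powr ((1 - q) / 2)) \<longlongrightarrow> 0 * K * X0 powr ((1 - q) / 2)) (at_right 0)"
  proof (intro tendsto_mult tendsto_const)
    have "((\<lambda>\<delta>::real. \<delta> powr (q - 1)) \<longlongrightarrow> 0 powr (q - 1)) (at_right 0)"
      using q by (intro tendsto_powr' tendsto_ident_at tendsto_const) (auto simp: eventually_at_right_field intro: exI[of _ 1])
    then show "((\<lambda>\<delta>::real. \<delta> powr (q - 1)) \<longlongrightarrow> 0) (at_right 0)" by simp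
  qed
  moreover have "\<forall>\<^sub>F \<delta> in at_right 0. b \<le> \<delta> powr (q - 1) * K * X0 powr ((1 - q) / 2)"
    using bound by (auto simp: eventually_at_right_field intro: exI[of _ 1])
  ultimately have "b \<le> 0 * K * X0 powr ((1 - q) / 2)"
    by (intro tendsto_lowerbound) auto
  then show False using b by simp
qed

section \<open>The positive maximiser\<close>

text \<open>For real arguments \<open>powr\<close> is even in its base, because the real logarithm is.\<close>

lemma powr_abs_eq: "\<bar>t\<bar> powr r = (t::real) powr r"
  using uminus_powr_eq[of t r] by (cases "t \<ge> 0") auto

lemma abs_powr_tangent:
  fixes a b q :: real
  assumes "1 < q" "0 \<le> a"
  shows "a powr q + q * a powr (q - 1) * b \<le> \<bar>a + b\<bar> powr q"
proof -
  have "q * a powr (q - 1) * (a + b) \<le> q * a powr (q - 1) * \<bar>a + b\<bar>"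
    using assms by (intro mult_left_mono) auto
  also have "\<dots> \<le> (q - 1) * a powr q + \<bar>a + b\<bar> powr q" by (rule young_tangent) (use assms in auto)
  finally have "q * (a powr (q - 1) * a) + q * a powr (q - 1) * b \<le> (q - 1) * a powr q + \<bar>a + b\<bar> powr q"
    by (simp add: algebra_simps)
  also have "a powr (q - 1) * a = a powr q"
    using powr_mult_base[of a "q - 1"] assms by (simp add: mult.commute)
  finally show ?thesis by (simp add: algebra_simps)
qed

text \<open>The Euler--Lagrange equation. Convexity of \<open>|s|\<^sup>q\<close> bounds the functional from below by a
  quadratic polynomial along every line, and maximality at \<open>w\<close> makes the linear term vanish.\<close>

lemma maximizer_weak_solution:
  fixes \<Omega> :: "'a::euclidean_space set"
  assumes \<Omega>: "open \<Omega>" "emeasure lebesgue \<Omega> < \<infinity>" and q: "1 < q" "q < 2"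
    and w: "is_positive_maximizer \<Omega> q w"
  shows "weak_solution \<Omega> (\<lambda>x. reg (q - 1) 0 (w x)) w (weak_gradient \<Omega> w)"
proof -
  let ?M = "lebesgue_on \<Omega>" and ?g = "weak_gradient \<Omega> w"
  interpret finite_measure ?M by (rule finite_measure_lebesgue_on_open[OF \<Omega>])
  have W: "w \<in> W12_0 \<Omega>" and pos: "AE x in ?M. w x > 0"
    and max: "\<And>v. v \<in> W12_0 \<Omega> \<Longrightarrow>
      2 / q * (LINT x|?M. \<bar>v x\<bar> powr q) - (LINT x|?M. (norm (weak_gradient \<Omega> v x))\<^sup>2)
      \<le> 2 / q * (LINT x|?M. \<bar>w x\<bar> powr q) - (LINT x|?M. (norm (?g x))\<^sup>2)"
    using w unfolding is_positive_maximizer_def is_arg_max_def by (auto simp: not_less)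
  have zt: "zero_trace \<Omega> w ?g" by (rule W12_0_imp_zero_trace[OF \<Omega>(1) W])
  note si = zero_trace_square_integrable[OF zt]
  have H: "square_integrable ?M (\<lambda>x. reg (q - 1) 0 (w x))" using q by (intro square_integrable_reg si) auto
  show ?thesis
  proof (rule weak_solutionI[OF \<Omega>(1) zt H])
    fix \<eta> :: "'a \<Rightarrow> real" assume \<eta>: "\<eta> \<in> Cinf_0 \<Omega>"
    note zt\<eta> = Cinf_0_zero_trace[OF \<eta> \<Omega>(1)] and si\<eta> = Cinf_0_square_integrable[OF \<Omega>(1) \<eta>]
    define B where "B = (LINT x|?M. ?g x \<bullet> grad \<eta> x) - (LINT x|?M. reg (q - 1) 0 (w x) * \<eta> x)"
    have "0 \<le> 0 + 2 * t * B + t\<^sup>2 * L2sq ?M (grad \<eta>)" for t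
    proof -
      let ?v = "\<lambda>x. w x + t * \<eta> x"
      have ztv: "zero_trace \<Omega> ?v (\<lambda>x. ?g x + t *\<^sub>R grad \<eta> x)" by (rule zero_trace_add_scaled[OF \<Omega>(1) zt zt\<eta>])
      note siv = zero_trace_square_integrable[OF ztv]
      have wg_meas: "weak_gradient \<Omega> ?v \<in> borel_measurable ?M"
        using zero_trace_weak_gradient(2)[OF \<Omega> ztv] by (simp add: is_weak_gradient_def Lp_loc_def)
      have grad_v: "(LINT x|?M. (norm (weak_gradient \<Omega> ?v x))\<^sup>2) = L2sq ?M ?g + 2 * t * (LINT x|?M. ?g x \<bullet> grad \<eta> x) + t\<^sup>2 * L2sq ?M (grad \<eta>)"
        using L2sq_cong_AE[OF zero_trace_weak_gradient(1)[OF \<Omega> ztv] wg_meas square_integrable_measurable[OF siv(2)]]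
          L2sq_expand[OF si(2) si\<eta>(2), of t] by simp
      have int_w: "integrable ?M (\<lambda>x. \<bar>w x\<bar> powr q)" "integrable ?M (\<lambda>x. \<bar>?v x\<bar> powr q)"
        using abs_powr_integrable[OF si(1), of q] abs_powr_integrable[OF siv(1), of q] q by auto
      have int_H: "integrable ?M (\<lambda>x. reg (q - 1) 0 (w x) * \<eta> x)" by (rule integrable_mult_square[OF H si\<eta>(1)])
      have "(LINT x|?M. \<bar>w x\<bar> powr q) + q * t * (LINT x|?M. reg (q - 1) 0 (w x) * \<eta> x)
          = (LINT x|?M. \<bar>w x\<bar> powr q + q * t * (reg (q - 1) 0 (w x) * \<eta> x))"
        using int_w int_H by simp
      also have "\<dots> \<le> (LINT x|?M. \<bar>?v x\<bar> powr q)"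
      proof (rule integral_mono_AE)
        show "integrable ?M (\<lambda>x. \<bar>w x\<bar> powr q + q * t * (reg (q - 1) 0 (w x) * \<eta> x))" using int_w int_H by simp
        show "AE x in ?M. \<bar>w x\<bar> powr q + q * t * (reg (q - 1) 0 (w x) * \<eta> x) \<le> \<bar>?v x\<bar> powr q"
          using pos
        proof eventually_elim
          case (elim x)
          then show ?case using abs_powr_tangent[of q "w x" "t * \<eta> x"] q by (simp add: reg_def mult_ac)
        qed
      qed (rule int_w)
      finally have low: "(LINT x|?M. \<bar>w x\<bar> powr q) + q * t * (LINT x|?M. reg (q - 1) 0 (w x) * \<eta> x) \<le> (LINT x|?M. \<bar>?v x\<bar> powr q)" .
      have "2 / q * ((LINT x|?M. \<bar>w x\<bar> powr q) + q * t * (LINT x|?M. reg (q - 1) 0 (w x) * \<eta> x)) \<le> 2 / q * (LINT x|?M. \<bar>?v x\<bar> powr q)"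
        using q low by (intro mult_left_mono) auto
      moreover have "2 / q * ((LINT x|?M. \<bar>w x\<bar> powr q) + q * t * (LINT x|?M. reg (q - 1) 0 (w x) * \<eta> x))
        = 2 / q * (LINT x|?M. \<bar>w x\<bar> powr q) + 2 * t * (LINT x|?M. reg (q - 1) 0 (w x) * \<eta> x)"
        using q by (simp add: distrib_left)
      moreover note max[OF zero_trace_imp_W12_0[OF \<Omega> ztv], unfolded grad_v]
      ultimately show ?thesis by (simp add: B_def right_diff_distrib)
    qed
    from quadratic_nonneg_discriminant[OF this] have "B = 0" by simp
    then show "(LINT x|?M. ?g x \<bullet> grad \<eta> x) = (LINT x|?M. reg (q - 1) 0 (w x) * \<eta> x)" by (simp add: B_def)
  qed
qed

text \<open>Testing the equation with \<open>w\<close> gives \<open>\<integral>|\<nabla>w|\<^sup>2 = \<integral>w\<^sup>q\<close>. Hence the Rayleigh quotient of \<open>w\<close> is a power of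
  its energy, and it is at least the principal frequency.\<close>

lemma maximizer_energy:
  fixes \<Omega> :: "'a::euclidean_space set"
  assumes \<Omega>: "open \<Omega>" "emeasure lebesgue \<Omega> < \<infinity>" and q: "1 < q" "q < 2"
    and sol: "weak_solution \<Omega> (\<lambda>x. reg (q - 1) 0 (w x)) w g" and pos: "AE x in lebesgue_on \<Omega>. w x > 0"
  shows "ennreal (L2sq (lebesgue_on \<Omega>) g powr ((2 - q) / q)) \<le> 1 / principal_frequency \<Omega> q"
proof (rule ccontr)
  let ?M = "lebesgue_on \<Omega>"
  have zt: "zero_trace \<Omega> w g" using sol by (simp add: weak_solution_def)
  note si = zero_trace_square_integrable[OF zt]
  define X where "X = L2sq ?M g"
  have X: "X \<ge> 0" by (simp add: X_def)
  assume "\<not> ennreal (L2sq ?M g powr ((2 - q) / q)) \<le> 1 / principal_frequency \<Omega> q"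
  then have "1 / principal_frequency \<Omega> q < ennreal (X powr ((2 - q) / q))" by (simp add: X_def not_le)
  then obtain e where e: "1 / principal_frequency \<Omega> q < e" "e < ennreal (X powr ((2 - q) / q))" using dense by blast
  then have "e < top" by (auto intro: less_le_trans order.strict_trans)
  then obtain m where m: "e = ennreal m" "0 \<le> m" by (metis ennreal_cases less_irrefl)
  have mX: "m < X powr ((2 - q) / q)" using e(2) m by (simp add: ennreal_less_iff)
  have X_pos: "X > 0" using mX m(2) X by (cases "X = 0") auto
  have "X = (LINT x|?M. reg (q - 1) 0 (w x) * w x)" unfolding X_def by (rule weak_solution_energy[OF sol])
  also have "\<dots> = (LINT x|?M. \<bar>w x\<bar> powr q)"
  proof (rule integral_cong_AE)
    note [measurable] = square_integrable_measurable[OF si(1)]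
    show "(\<lambda>x. reg (q - 1) 0 (w x) * w x) \<in> borel_measurable ?M" unfolding reg_def by measurable
    show "(\<lambda>x. \<bar>w x\<bar> powr q) \<in> borel_measurable ?M" by measurable
    show "AE x in ?M. reg (q - 1) 0 (w x) * w x = \<bar>w x\<bar> powr q"
      using pos
    proof eventually_elim
      case (elim x)
      then show ?case using powr_mult_base[of "w x" "q - 1"] by (simp add: reg_def mult.commute)
    qed
  qed
  also have "\<dots> \<le> m powr (q / 2) * X powr (q / 2)"
    unfolding X_def using e(1) m by (intro competitor_inequality[OF \<Omega> q _ m(2) zt]) simp
  finally have "X / X powr (q / 2) \<le> m powr (q / 2)" using X_pos by (simp add: field_simps)
  moreover have "X powr ((2 - q) / 2) = X / X powr (q / 2)"
    using X_pos powr_diff[of X 1 "q / 2"] by (simp add: diff_divide_distrib)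
  ultimately have "X powr ((2 - q) / 2) \<le> m powr (q / 2)" by simp
  then have "(X powr ((2 - q) / 2)) powr (2 / q) \<le> (m powr (q / 2)) powr (2 / q)"
    using q by (intro powr_mono2) auto
  moreover have "(m powr (q / 2)) powr (2 / q) = m" using q m(2) by (simp add: powr_powr)
  moreover have "(X powr ((2 - q) / 2)) powr (2 / q) = X powr ((2 - q) / q)"
  proof -
    have "(2 - q) / 2 * (2 / q) = (2 - q) / q" using q by (simp add: field_simps)
    then show ?thesis by (simp only: powr_powr)
  qed
  ultimately show False using mX by simp
qed

theorem theorem1p1:
  fixes \<Omega> :: "(real ^ 'n) set" and q :: real
  assumes "1 < q" and "q < 2"
    and "open \<Omega>" and "emeasure lebesgue \<Omega> < \<infinity>"
  shows "1 / principal_frequency \<Omega> q =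
           ennreal ((q - 1) powr ((q - 1) * (2 / q))) *
           (INF p\<in>admissible \<Omega>. dual_functional \<Omega> q p)
         \<and> (\<forall>w. is_positive_maximizer \<Omega> q w \<longrightarrow>
           is_arg_min (dual_functional \<Omega> q) (\<lambda>p. p \<in> admissible \<Omega>)
             (\<lambda>x. - (q - 1) * ((norm (weak_gradient \<Omega> w x))\<^sup>2 / w x powr q),
              \<lambda>x. weak_gradient \<Omega> w x /\<^sub>R (w x powr (q - 1))))"
proof (intro conjI allI impI)
  note q = assms(1,2) and \<Omega> = assms(3,4)
  define c where "c = ennreal ((q - 1) powr ((q - 1) * (2 / q)))"
  have c: "c \<noteq> 0" "c \<noteq> top" using q by (simp_all add: c_def)
  have weak: "1 / principal_frequency \<Omega> q \<le> c * dual_functional \<Omega> q d" if "d \<in> admissible \<Omega>" for d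
    unfolding c_def by (rule weak_duality[OF \<Omega> q that])
  show "1 / principal_frequency \<Omega> q = c * (INF p\<in>admissible \<Omega>. dual_functional \<Omega> q p)" 
  proof (rule antisym)
    show "c * (INF p\<in>admissible \<Omega>. dual_functional \<Omega> q p) \<le> 1 / principal_frequency \<Omega> q"
      unfolding c_def by (rule no_duality_gap[OF \<Omega> q])
    have "1 / principal_frequency \<Omega> q / c \<le> (INF p\<in>admissible \<Omega>. dual_functional \<Omega> q p)"
    proof (rule INF_greatest)
      fix d assume "d \<in> admissible \<Omega>"
      then have "1 / principal_frequency \<Omega> q / c \<le> c * dual_functional \<Omega> q d / c"
        by (intro divide_right_mono_ennreal weak)
      also have "\<dots> = dual_functional \<Omega> q d"
        by (subst mult.commute) (rule ennreal_mult_divide_eq[OF c])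
      finally show "1 / principal_frequency \<Omega> q / c \<le> dual_functional \<Omega> q d" .
    qed
    then have "c * (1 / principal_frequency \<Omega> q / c) \<le> c * (INF p\<in>admissible \<Omega>. dual_functional \<Omega> q p)"
      by (intro mult_left_mono) auto
    moreover have "c * (1 / principal_frequency \<Omega> q / c) = (1 / principal_frequency \<Omega> q) * c / c"
      by (subst ennreal_times_divide) (subst mult.commute[of c], rule refl)
    then have "c * (1 / principal_frequency \<Omega> q / c) = 1 / principal_frequency \<Omega> q"
      by (simp only: ennreal_mult_divide_eq[OF c])
    ultimately show "1 / principal_frequency \<Omega> q \<le> c * (INF p\<in>admissible \<Omega>. dual_functional \<Omega> q p)" by simp
  qed
  fix w assume w: "is_positive_maximizer \<Omega> q w"
  have pos: "AE x in lebesgue_on \<Omega>. w x > 0" using w by (simp add: is_positive_maximizer_def)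
  note sol = maximizer_weak_solution[OF \<Omega> q w]
  interpret s: singular_solution \<Omega> q 0 w "weak_gradient \<Omega> w"
    by unfold_locales (use \<Omega> q sol pos in \<open>auto elim!: eventually_mono\<close>)
  have pair: "(\<lambda>x. - (q - 1) * ((norm (weak_gradient \<Omega> w x))\<^sup>2 / w x powr q),
      \<lambda>x. weak_gradient \<Omega> w x /\<^sub>R (w x powr (q - 1))) = (s.f\<^sub>0, s.\<phi>\<^sub>0)"
    by (simp add: fun_eq_iff s.f\<^sub>0_def s.\<phi>\<^sub>0_def s.U_def powr_abs_eq)
  show "is_arg_min (dual_functional \<Omega> q) (\<lambda>p. p \<in> admissible \<Omega>)
      (\<lambda>x. - (q - 1) * ((norm (weak_gradient \<Omega> w x))\<^sup>2 / w x powr q),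
       \<lambda>x. weak_gradient \<Omega> w x /\<^sub>R (w x powr (q - 1)))"
    unfolding pair is_arg_min_def
  proof (intro conjI notI)
    show "(s.f\<^sub>0, s.\<phi>\<^sub>0) \<in> admissible \<Omega>" by (rule s.dual_pair_admissible)
    assume "\<exists>d. d \<in> admissible \<Omega> \<and> dual_functional \<Omega> q d < dual_functional \<Omega> q (s.f\<^sub>0, s.\<phi>\<^sub>0)"
    then obtain d where d: "d \<in> admissible \<Omega>" "dual_functional \<Omega> q d < dual_functional \<Omega> q (s.f\<^sub>0, s.\<phi>\<^sub>0)" by blast
    have "c * dual_functional \<Omega> q (s.f\<^sub>0, s.\<phi>\<^sub>0) \<le> 1 / principal_frequency \<Omega> q"
      unfolding c_def s.dual_value by (rule maximizer_energy[OF \<Omega> q sol pos])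
    also have "\<dots> \<le> c * dual_functional \<Omega> q d" by (rule weak[OF d(1)])
    finally show False using d(2) c by (simp add: ennreal_mult_le_mult_iff)
  qed
qed

end
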